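(* Let $1<p<\infty$, $\alpha>-1$ and $S\in\mathcal{L}(A^p_\alpha,A^p_\alpha)$. Then $S$ is compact if and only if $S\in\mathcal{T}_{p,\alpha}$ and $\lim_{|z|\to 1}B(S)(z)=0$.
   Context: Let $n\ge 1$, let $\mathbb{B}_n$ be the open unit ball of $\mathbb{C}^n$, and let $q=p/(p-1)$. For $z,w\in\mathbb{C}^n$, $\overline{w}z=z\overline{w}$ denotes $\sum_i z_i\overline{w_i}$. Let $v$ be Lebesgue measure on $\mathbb{B}_n$ normalized by $v(\mathbb{B}_n)=1$, and $dv_\alpha(z)=c_\alpha(1-|z|^2)^\alpha\,dv(z)$ with $c_\alpha=\frac{\Gamma(n+\alpha+1)}{n!\,\Gamma(\alpha+1)}$, so that $v_\alpha$ is a probability measure. $L^p_\alpha=L^p(\mathbb{B}_n,v_\alpha)$, and $A^p_\alpha$ is the closed subspace of holomorphic functions in $L^p_\alpha$, with the same norm. $\mathcal{L}(X,Y)$ is the space of bounded linear operators $X\to Y$. The pairing is $\langle f,g\rangle_{A^2_\alpha}=\int_{\mathbb{B}_n}f\overline{g}\,dv_\alpha$ (used for $f\in A^p_\alpha$, $g\in A^q_\alpha$). $P_\alpha f(z)=\int_{\mathbb{B}_n}\frac{f(w)}{(1-z\overline{w})^{n+1+\alpha}}\,dv_\alpha(w)$ is the Bergman projection, bounded from $L^p_\alpha$ to $A^p_\alpha$. For $a\in L^\infty(\mathbb{B}_n)$ the Toeplitz operator is $T_a f=P_\alpha(af)$. The Toeplitz algebra $\mathcal{T}_{p,\alpha}$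 is the norm-closed subalgebra of $\mathcal{L}(A^p_\alpha,A^p_\alpha)$ generated by $\{T_a:a\in L^\infty(\mathbb{B}_n)\}$. For $\lambda\in\mathbb{B}_n$, $k_\lambda^{(p,\alpha)}(z)=\frac{(1-|\lambda|^2)^{(n+1+\alpha)/q}}{(1-\overline{\lambda}z)^{n+1+\alpha}}$, and $k_\lambda^{(q,\alpha)}$ is defined likewise with the roles of $p$ and $q$ exchanged (exponent $(n+1+\alpha)/p$). The Berezin transform of $S$ is $B(S)(z)=\langle Sk_z^{(p,\alpha)},k_z^{(q,\alpha)}\rangle_{A^2_\alpha}$, $z\in\mathbb{B}_n$. *)

theory Defs
  imports "HOL-Analysis.Analysis"
begin

text \<open>
  The unit ball of complex n-space is \<open>ball 0 1 :: (complex ^ 'n) set\<close>, with \<open>n = CARD('n)\<close>.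
  Functions on the ball are represented by total functions \<open>complex ^ 'n \<Rightarrow> complex\<close>; the measures
  below live on the ball, so values outside it do not enter any integral.
\<close>

definition herm :: "complex ^ 'n \<Rightarrow> complex ^ 'n \<Rightarrow> complex" where
  "herm z w = (\<Sum>i\<in>UNIV. z $ i * cnj (w $ i))"

definition ball_measure :: "(complex ^ 'n) measure" where
  "ball_measure = uniform_measure (lebesgue_on (ball 0 1)) (ball 0 1)"

definition weight_const :: "nat \<Rightarrow> real \<Rightarrow> real" where
  "weight_const n \<alpha> = Gamma (real n + \<alpha> + 1) / (fact n * Gamma (\<alpha> + 1))"

definition weighted_measure :: "real \<Rightarrow> (complex ^ 'n) measure" where
  "weighted_measure \<alpha> =
     density ball_measure (\<lambda>z. ennreal (weight_const CARD('n) \<alpha> * (1 - (norm z)\<^sup>2) powr \<alpha>))"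

definition Lp_norm :: "real \<Rightarrow> real \<Rightarrow> (complex ^ 'n \<Rightarrow> complex) \<Rightarrow> real" where
  "Lp_norm p \<alpha> f = (\<integral>z. norm (f z) powr p \<partial>weighted_measure \<alpha>) powr (1 / p)"

definition Lp :: "real \<Rightarrow> real \<Rightarrow> (complex ^ 'n \<Rightarrow> complex) set" where
  "Lp p \<alpha> = {f. f \<in> borel_measurable (weighted_measure \<alpha>) \<and>
                integrable (weighted_measure \<alpha>) (\<lambda>z. norm (f z) powr p)}"

definition Linfty :: "(complex ^ 'n \<Rightarrow> complex) set" where
  "Linfty = {a. a \<in> borel_measurable ball_measure \<and> (\<exists>C. AE z in ball_measure. norm (a z) \<le> C)}"

text \<open>
  Several-variable holomorphy on an open set: the real Frechet derivative exists at every point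
  and is complex linear. (The library's \<^term>\<open>(holomorphic_on)\<close> is for one variable only.)
\<close>

definition holomorphic_several :: "(complex ^ 'n \<Rightarrow> complex) \<Rightarrow> (complex ^ 'n) set \<Rightarrow> bool" where
  "holomorphic_several f U \<longleftrightarrow>
     (\<forall>z\<in>U. \<exists>D. (f has_derivative D) (at z) \<and> (\<forall>c v. D (c *s v) = c * D v))"

text \<open>
  Elements of the Bergman space are normalized to vanish outside the ball. As a holomorphic function
  is determined by its almost-everywhere class, equality in the Bergman space is equality of
  functions.
\<close>

definition Ap :: "real \<Rightarrow> real \<Rightarrow> (complex ^ 'n \<Rightarrow> complex) set" where
  "Ap p \<alpha> = {f \<in> Lp p \<alpha>. holomorphic_several f (ball 0 1) \<and> (\<forall>z. z \<notin> ball 0 1 \<longrightarrow> f z = 0)}"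

definition Ap_topology :: "real \<Rightarrow> real \<Rightarrow> (complex ^ 'n \<Rightarrow> complex) topology" where
  "Ap_topology p \<alpha> = Metric_space.mtopology (Ap p \<alpha>) (\<lambda>f g. Lp_norm p \<alpha> (\<lambda>z. f z - g z))"

definition pairing ::
  "real \<Rightarrow> (complex ^ 'n \<Rightarrow> complex) \<Rightarrow> (complex ^ 'n \<Rightarrow> complex) \<Rightarrow> complex" where
  "pairing \<alpha> f g = (\<integral>z. f z * cnj (g z) \<partial>weighted_measure \<alpha>)"

text \<open>
  Operators on the Bergman space are normalized to send everything outside that space to 0, so that
  equality of operators is equality of functions and the operators form a set.
\<close>

type_synonym 'n operator = "(complex ^ 'n \<Rightarrow> complex) \<Rightarrow> (complex ^ 'n \<Rightarrow> complex)"

definition bounded_operators :: "real \<Rightarrow> real \<Rightarrow> 'n::finite operator set" where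
  "bounded_operators p \<alpha> = {S.
     (\<forall>f. f \<notin> Ap p \<alpha> \<longrightarrow> S f = (\<lambda>z. 0)) \<and>
     (\<forall>f\<in>Ap p \<alpha>. S f \<in> Ap p \<alpha>) \<and>
     (\<forall>f\<in>Ap p \<alpha>. \<forall>g\<in>Ap p \<alpha>. S (\<lambda>z. f z + g z) = (\<lambda>z. S f z + S g z)) \<and>
     (\<forall>c. \<forall>f\<in>Ap p \<alpha>. S (\<lambda>z. c * f z) = (\<lambda>z. c * S f z)) \<and>
     (\<exists>C. \<forall>f\<in>Ap p \<alpha>. Lp_norm p \<alpha> (S f) \<le> C * Lp_norm p \<alpha> f)}"

definition op_norm :: "real \<Rightarrow> real \<Rightarrow> 'n::finite operator \<Rightarrow> real" where
  "op_norm p \<alpha> S = (SUP f\<in>{f \<in> Ap p \<alpha>. Lp_norm p \<alpha> f \<le> 1}. Lp_norm p \<alpha> (S f))"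

definition compact_operator :: "real \<Rightarrow> real \<Rightarrow> 'n::finite operator \<Rightarrow> bool" where
  "compact_operator p \<alpha> S \<longleftrightarrow> S \<in> bounded_operators p \<alpha> \<and>
     compactin (Ap_topology p \<alpha>)
       (Ap_topology p \<alpha> closure_of (S ` {f \<in> Ap p \<alpha>. Lp_norm p \<alpha> f \<le> 1}))"

text \<open>
  Complex \<^term>\<open>(powr)\<close> is the principal branch, which is the intended power because
  \<open>1 - herm z w\<close> has positive real part for \<open>z, w\<close> in the ball.
\<close>

definition bergman_projection ::
  "real \<Rightarrow> (complex ^ 'n \<Rightarrow> complex) \<Rightarrow> (complex ^ 'n \<Rightarrow> complex)" where
  "bergman_projection \<alpha> f = (\<lambda>z. if z \<in> ball 0 1
     then \<integral>w. f w / (1 - herm z w) powr of_real (real CARD('n) + 1 + \<alpha>) \<partial>weighted_measure \<alpha>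
     else 0)"

definition toeplitz :: "real \<Rightarrow> real \<Rightarrow> (complex ^ 'n \<Rightarrow> complex) \<Rightarrow> 'n::finite operator" where
  "toeplitz p \<alpha> a = (\<lambda>f. if f \<in> Ap p \<alpha> then bergman_projection \<alpha> (\<lambda>z. a z * f z) else (\<lambda>z. 0))"

definition closed_subalgebra :: "real \<Rightarrow> real \<Rightarrow> 'n::finite operator set \<Rightarrow> bool" where
  "closed_subalgebra p \<alpha> A \<longleftrightarrow>
     A \<subseteq> bounded_operators p \<alpha> \<and>
     (\<lambda>f z. 0) \<in> A \<and>
     (\<forall>R\<in>A. \<forall>S\<in>A. (\<lambda>f z. R f z + S f z) \<in> A) \<and>
     (\<forall>c. \<forall>R\<in>A. (\<lambda>f z. c * R f z) \<in> A) \<and>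
     (\<forall>R\<in>A. \<forall>S\<in>A. R \<circ> S \<in> A) \<and>
     (\<forall>R. \<forall>S\<in>bounded_operators p \<alpha>.
        (\<forall>k::nat. R k \<in> A) \<and> (\<lambda>k. op_norm p \<alpha> (\<lambda>f z. R k f z - S f z)) \<longlonglongrightarrow> 0 \<longrightarrow> S \<in> A)"

definition toeplitz_algebra :: "real \<Rightarrow> real \<Rightarrow> 'n::finite operator set" where
  "toeplitz_algebra p \<alpha> = closed_subalgebra p \<alpha> hull (toeplitz p \<alpha> ` Linfty)"

definition conj_exponent :: "real \<Rightarrow> real" where
  "conj_exponent p = p / (p - 1)"

definition normalized_kernel ::
  "real \<Rightarrow> real \<Rightarrow> complex ^ 'n \<Rightarrow> (complex ^ 'n \<Rightarrow> complex)" where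
  "normalized_kernel p \<alpha> \<zeta> = (\<lambda>z. if z \<in> ball 0 1
     then of_real ((1 - (norm \<zeta>)\<^sup>2) powr ((real CARD('n) + 1 + \<alpha>) / conj_exponent p)) /
          (1 - herm z \<zeta>) powr of_real (real CARD('n) + 1 + \<alpha>)
     else 0)"

definition berezin :: "real \<Rightarrow> real \<Rightarrow> 'n::finite operator \<Rightarrow> complex ^ 'n \<Rightarrow> complex" where
  "berezin p \<alpha> S z =
     pairing \<alpha> (S (normalized_kernel p \<alpha> z)) (normalized_kernel (conj_exponent p) \<alpha> z)"

text \<open>
  The filter of \<open>|z| \<rightarrow> 1\<close> inside the ball, generated by the shells \<open>{z. 1 - \<delta> < norm z < 1}\<close>.
\<close>

definition to_boundary :: "(complex ^ 'n) filter" where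
  "to_boundary = filtercomap norm (at_left 1)"

end

theory Submission
 imports Defs "HOL-Complex_Analysis.Complex_Analysis" "HOL-Probability.Probability"
begin

text \<open>If \<open>S\<close> is compact, then its image is uniformly small near the sphere, and so is its action on functions
 living near the sphere (otherwise a sum of functions with disjoint supports would be mapped to something too large).
 Hence \<open>S\<close> is a norm limit of finite sums of rank one operators \<open>f \<mapsto> f(w) K\<^sub>u\<close>, and these are limits of products of
 Toeplitz operators with symbols supported on small balls; their Berezin transforms vanish at the boundary.

 Conversely, multiplications by slowly varying functions almost commute with Toeplitz operators, uniformly for
 \<open>\<ell>\<^sup>p\<close>-normalised families, hence with every \<open>S\<close> in the algebra. Such a family with pieces of bounded
 hyperbolic diameter reduces \<open>S\<close> near the sphere to its kernel near the diagonal. There \<open>(S K\<^sub>w)(z) / K\<^sub>w(z)\<close> tends to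
 zero, because its diagonal values are the Berezin transform and it is holomorphic in \<open>z\<close> and antiholomorphic in \<open>w\<close>.
 The Schur test then makes the part of \<open>S\<close> near the sphere small in norm, so \<open>S\<close> is a limit of compact operators.\<close>

text \<open>Both directions pass through one condition on \<open>S\<close>: the norm of
  \<open>f\<close> \<mapsto> \<open>ct r (S f)\<close> tends to 0 as \<open>r\<close> tends to 1.
  Total boundedness of the image of the unit ball gives it, and it returns compactness through a
  finite rank approximation. The obstacle is that the number of pieces needed to localise up to the
  sphere is unbounded. Smallness of each single commutator is therefore useless; the sum over all
  pieces of the \<open>p\<close>-th powers must be small, with a bound that does not depend on the
  family. This forces \<open>slow\<close> families to be normalised by \<open>p\<close>-th powers
  and Schur's test to carry a whole family of weights. For such a test to apply, the pieces need two
  properties that compete: they vary little between close points, yet each has bounded diameter.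
  Among the automorphisms of the ball only unitary maps act on integrals. Changes of variables are
  replaced by exact moments, and Moebius maps appear only on one-dimensional slices, where
  compactness of normal families replaces explicit constants.\<close>

notation LIMSEQ ("((_)/ ----> (_))" [60, 60] 60)
abbreviation "UB \<equiv> ball 0 1"
abbreviation "msk A f \<equiv> %w. indicator A w * f w"
abbreviation "ct r f \<equiv> msk (- cball 0 r) f"
abbreviation "mul u f \<equiv> %w. of_real (u w) * f w"
abbreviation "comm X u f \<equiv> %z. X (mul u f) z - of_real (u z) * X f z"

section \<open>Invariance of Lebesgue measure under translations and linear isometries\<close>

lemma nn_integral_lborel_translate:
 fixes f :: "'a::euclidean_space => ennreal"
 assumes [measurable]: "f \<in> borel_measurable borel"
 shows "(\<integral>\<^sup>+x. f (c + x) \<partial>lborel) = (\<integral>\<^sup>+x. f x \<partial>lborel)"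
proof -
 have "(\<integral>\<^sup>+x. f x \<partial>lborel) = (\<integral>\<^sup>+x. f x \<partial>(distr lborel borel ((+) c)))"
  by (simp add: lborel_distr_plus)
 also have "... = (\<integral>\<^sup>+x. f (c + x) \<partial>lborel)" by (subst nn_integral_distr) auto
 finally show ?thesis by simp
qed

text \<open>Translation invariance is the only input. The double integral of
  \<open>f (T x) * g (- T x + y)\<close> is computed in both orders, with \<open>g\<close> the
  indicator of the unit ball, which is even and invariant under \<open>T\<close>. Cancelling the
  finite positive volume \<open>G\<close> leaves the claim; no determinant occurs.\<close>

lemma nn_integral_lborel_isometry:
 fixes f :: "'a::euclidean_space => ennreal"
 assumes [measurable]: "f \<in> borel_measurable borel" and T: "orthogonal_transformation (T :: 'a => 'a)"
 shows "(\<integral>\<^sup>+x. f (T x) \<partial>lborel) = (\<integral>\<^sup>+x. f x \<partial>lborel)"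
proof -
 have lin: "linear T" and nrm: "!!x. norm (T x) = norm x" using T by (auto simp: orthogonal_transformation)
 have [measurable]: "T \<in> borel_measurable borel"
  using lin by (intro borel_measurable_continuous_onI linear_continuous_on) (simp add: linear_conv_bounded_linear)
 define g :: "'a => ennreal" where "g = indicator UB"
 have [measurable]: "g \<in> borel_measurable borel" unfolding g_def by (intro borel_measurable_indicator) simp
 define G where "G = (\<integral>\<^sup>+x. g x \<partial>lborel)"
 have G: "G = emeasure lborel (ball (0::'a) 1)" unfolding G_def g_def by simp
 have "0 < G" unfolding G by (rule ccontr) (auto simp: emeasure_lborel_ball_finite emeasure_ball unit_ball_vol_pos ennreal_eq_0_iff not_le)
 have "G < \<infinity>" unfolding G by (simp add: emeasure_ball)
 have gm: "g (- x) = g x" "g (T x) = g x" for x by (auto simp: g_def indicator_def nrm)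
 have "(\<integral>\<^sup>+x. f (T x) \<partial>lborel) * G = (\<integral>\<^sup>+x. f (T x) * G \<partial>lborel)"
  by (rule nn_integral_multc[symmetric]) simp
 also have "... = (\<integral>\<^sup>+x. \<integral>\<^sup>+y. f (T x) * g (- T x + y) \<partial>lborel \<partial>lborel)"
  by (rule nn_integral_cong) (simp add: nn_integral_cmult nn_integral_lborel_translate G_def del: add_uminus_conv_diff uminus_add_conv_diff)
 also have "... = (\<integral>\<^sup>+y. \<integral>\<^sup>+x. f (T x) * g (- T x + y) \<partial>lborel \<partial>lborel)"
  by (rule lborel_pair.Fubini') simp
 also have "... = (\<integral>\<^sup>+y. \<integral>\<^sup>+x. f (T x + y) * g x \<partial>lborel \<partial>lborel)"
 proof (rule nn_integral_cong)
  fix y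
  \<comment> \<open>Shifting \<open>x\<close> by a preimage of \<open>y\<close> moves
    \<open>y\<close> from the argument of \<open>g\<close> to that of \<open>f\<close>.\<close>
  obtain c where c: "T c = y" using orthogonal_transformation_surj[OF T] by (metis surjD)
  have "(\<integral>\<^sup>+x. f (T x) * g (- T x + y) \<partial>lborel) = (\<integral>\<^sup>+x. f (T (c + x)) * g (- T (c + x) + y) \<partial>lborel)"
   by (rule nn_integral_lborel_translate[symmetric]) simp
  also have "... = (\<integral>\<^sup>+x. f (T x + y) * g x \<partial>lborel)" using gm by (simp add: linear_add[OF lin] c add.commute)
  finally show "(\<integral>\<^sup>+x. f (T x) * g (- T x + y) \<partial>lborel) = (\<integral>\<^sup>+x. f (T x + y) * g x \<partial>lborel)" .
 qed
 also have "... = (\<integral>\<^sup>+x. \<integral>\<^sup>+y. f (T x + y) * g x \<partial>lborel \<partial>lborel)"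
  by (rule lborel_pair.Fubini'[symmetric]) simp
 also have "... = (\<integral>\<^sup>+x. (\<integral>\<^sup>+x. f x \<partial>lborel) * g x \<partial>lborel)"
  by (intro nn_integral_cong) (simp add: nn_integral_multc nn_integral_lborel_translate)
 also have "... = (\<integral>\<^sup>+x. f x \<partial>lborel) * G" unfolding G_def by (rule nn_integral_cmult) simp
 finally have "G * (\<integral>\<^sup>+x. f (T x) \<partial>lborel) = G * (\<integral>\<^sup>+x. f x \<partial>lborel)" by (simp only: mult.commute)
 thus ?thesis using `0 < G` `G < \<infinity>` by (auto simp: ennreal_mult_cancel_left)
qed

section \<open>The Hermitian form and unitary maps that fix a direction\<close>

lemma herm_add_left: "herm (z + z') w = herm z w + herm z' w" by (simp add: herm_def algebra_simps sum.distrib)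
lemma herm_diff_left: "herm (z - z') w = herm z w - herm z' w" by (simp add: herm_def algebra_simps sum_subtractf)
lemma herm_smult_left: "herm (c *s z) w = c * herm z w" by (simp add: herm_def sum_distrib_left mult.assoc)
lemma herm_commute: "herm w z = cnj (herm z w)" by (simp add: herm_def mult.commute)
lemma herm_add_right: "herm z (w + w') = herm z w + herm z w'" by (simp add: herm_def algebra_simps sum.distrib)
lemma herm_diff_right: "herm z (w - w') = herm z w - herm z w'" by (simp add: herm_def algebra_simps sum_subtractf)
lemma herm_smult_right: "herm z (c *s w) = cnj c * herm z w" by (simp add: herm_def sum_distrib_left mult_ac)
lemma herm_zero_left [simp]: "herm 0 w = 0" and herm_zero_right [simp]: "herm w 0 = 0" by (simp_all add: herm_def)

lemma scaleR_eq_smult: "(r::real) *\<^sub>R (z :: complex ^ 'n) = complex_of_real r *s z"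
 unfolding vec_eq_iff vector_scaleR_component vector_smult_component by (simp add: scaleR_conv_of_real)

lemma herm_scaleR_left: "herm (r *\<^sub>R z) w = of_real r * herm z w" by (simp add: scaleR_eq_smult herm_smult_left)
lemma herm_scaleR_right: "herm z (r *\<^sub>R w) = of_real r * herm z w" by (simp add: scaleR_eq_smult herm_smult_right)

lemma inner_eq_Re_herm: "z \<bullet> w = Re (herm z w)" by (simp add: inner_vec_def herm_def inner_complex_def)

lemma herm_self: "herm z z = of_real ((norm z)\<^sup>2)"
proof -
 have "Im (herm z z) = 0" by (simp add: herm_def)
 moreover have "Re (herm z z) = (norm z)\<^sup>2" using inner_eq_Re_herm[of z z] by (simp add: power2_norm_eq_inner)
 ultimately show ?thesis by (simp add: complex_eq_iff)
qed

lemma norm_smult: "norm (c *s (z :: complex ^ 'n)) = norm c * norm z"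
proof -
 have "(of_real ((norm (c *s z))\<^sup>2) :: complex) = of_real ((norm c * norm z)\<^sup>2)"
  unfolding herm_self[symmetric] herm_smult_left herm_smult_right
  by (simp add: herm_self power_mult_distrib mult.assoc[symmetric] mult.commute[of "cnj c"] complex_norm_square[symmetric, simplified])
 hence "(norm (c *s z))\<^sup>2 = (norm c * norm z)\<^sup>2" using of_real_eq_iff by blast
 thus ?thesis by (simp add: power2_eq_iff_nonneg)
qed

text \<open>A unimodular factor on \<open>z\<close> makes the Hermitian product real and
  nonnegative. It is then the real inner product, and the real Cauchy-Schwarz inequality
  applies.\<close>

lemma norm_herm_le: "norm (herm z w) <= norm z * norm w"
proof (cases "herm z w = 0")
 case False
 define c where "c = cnj (herm z w) / norm (herm z w)"
 have c: "norm c = 1" using False by (simp add: c_def norm_divide)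
 have "norm (herm z w) = Re (herm (c *s z) w)"
  using False by (simp add: herm_smult_left c_def mult.commute[of _ "herm z w"] complex_norm_square[symmetric] power2_eq_square)
 also have "... = (c *s z) \<bullet> w" by (simp add: inner_eq_Re_herm)
 also have "... <= norm (c *s z) * norm w" by (rule norm_cauchy_schwarz)
 finally show ?thesis by (simp add: norm_smult c)
qed simp

lemma bounded_linear_herm_left: "bounded_linear (%z. herm z w)" by (rule bounded_linear_intro[of _ "norm w"])
   (auto simp: herm_add_left herm_scaleR_left norm_herm_le scaleR_conv_of_real[where 'a=complex])

lemma continuous_on_herm [continuous_intros]:
 assumes "continuous_on S f" "continuous_on S g"
 shows "continuous_on S (%x. herm (f x) (g x))" unfolding herm_def using assms by (intro continuous_intros) auto

lemma borel_measurable_herm [measurable]: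
 assumes [measurable]: "f \<in> borel_measurable M" "g \<in> borel_measurable M"
 shows "(%x. herm (f x) (g x)) \<in> borel_measurable M"
proof -
 have "(%z :: (complex^'n) \<times> (complex^'n). herm (fst z) (snd z)) \<in> borel_measurable borel"
  by (intro borel_measurable_continuous_onI continuous_intros)
 hence "(%x. herm (fst (f x, g x)) (snd (f x, g x))) \<in> borel_measurable M"
  by (rule measurable_compose_rev) (simp add: borel_measurable_Pair)
 thus ?thesis by simp
qed

lemma one_minus_herm_self: "1 - herm z z = of_real (1 - (norm z)\<^sup>2)" by (simp add: herm_self)

lemma norm_herm_less_1: "norm z < 1 ==> norm w <= 1 ==> norm (herm z w) < 1" using norm_herm_le[of z w] mult_left_le[of "norm w" "norm z"] by simp

lemma norm_one_minus_herm_ge: "norm w <= 1 ==> 1 - norm z <= norm (1 - herm z w)"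
 using norm_triangle_ineq2[of 1 "herm z w"] norm_herm_le[of z w] mult_left_le[of "norm w" "norm z"] by simp

lemma Re_one_minus_herm_pos: "norm z < 1 ==> norm w <= 1 ==> 0 < Re (1 - herm z w)"
 using norm_herm_less_1[of z w] complex_Re_le_cmod[of "herm z w"] by simp

lemma norm_one_minus_herm_pos: "norm z < 1 ==> norm w <= 1 ==> 0 < norm (1 - herm z w)" using norm_one_minus_herm_ge[of w z] by linarith

text \<open>This comparison with the Euclidean distance is what gives
  \<open>norm (1 - herm z w)\<close> a triangle inequality up to constants, in
  \<open>quasi_triangle\<close>.\<close>

lemma norm_diff_sqr_le:
 assumes "norm z <= 1" "norm w <= 1"
 shows "(norm (z - w))\<^sup>2 <= 2 * norm (1 - herm z w)"
proof -
 have "(norm (z - w))\<^sup>2 = (norm z)\<^sup>2 + (norm w)\<^sup>2 - 2 * Re (herm z w)"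
  by (simp add: power2_norm_eq_inner inner_diff_left inner_diff_right inner_commute inner_eq_Re_herm[of z w, symmetric])
 also have "... <= 2 * Re (1 - herm z w)" using assms abs_square_le_1[of "norm z"] abs_square_le_1[of "norm w"] by simp
 also have "... <= 2 * norm (1 - herm z w)" using complex_Re_le_cmod[of "1 - herm z w"] by simp
 finally show ?thesis .
qed

text \<open>For a unit vector \<open>e\<close> this fixes the complex line of \<open>e\<close> and
  multiplies the orthogonal complement by \<open>c\<close>: unitary if \<open>norm c = 1\<close>,
  the projection onto the line for \<open>c = 0\<close>, an involution for
  \<open>c = -1\<close>.\<close>

definition unit_rot :: "complex ^ 'n => complex => complex ^ 'n => complex ^ 'n" where
 "unit_rot e c w = herm w e *s e + c *s (w - herm w e *s e)"

lemma herm_unit_rot: "norm e = 1 ==> herm (unit_rot e c w) e = herm w e"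
 by (simp add: unit_rot_def herm_add_left herm_smult_left herm_diff_left herm_self)

lemma norm_unit_rot_sqr:
 assumes "norm e = 1"
 shows "(norm (unit_rot e c w))\<^sup>2 = (norm (herm w e))\<^sup>2 + (norm c)\<^sup>2 * ((norm w)\<^sup>2 - (norm (herm w e))\<^sup>2)"
proof -
 have ee: "herm e e = 1" using assms by (simp add: herm_self)
 have "herm (unit_rot e c w) (unit_rot e c w) = herm w e * cnj (herm w e) + c * cnj c * (herm w w - herm w e * cnj (herm w e))"
  unfolding unit_rot_def herm_add_left herm_add_right herm_smult_left herm_smult_right herm_diff_left herm_diff_right
  by (simp add: ee herm_commute[of e w] algebra_simps)
 also have "... = of_real ((norm (herm w e))\<^sup>2 + (norm c)\<^sup>2 * ((norm w)\<^sup>2 - (norm (herm w e))\<^sup>2))"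
  by (simp add: herm_self complex_norm_square[symmetric, simplified])
 finally show ?thesis unfolding herm_self using of_real_eq_iff by blast
qed

lemma norm_unit_rot: "norm e = 1 ==> norm c = 1 ==> norm (unit_rot e c w) = norm w"
 using norm_unit_rot_sqr[of e c w] by (simp add: power2_eq_iff_nonneg)

lemma norm_unit_rot_le:
 assumes "norm e = 1" "norm c <= 1"
 shows "norm (unit_rot e c w) <= norm w"
proof -
 have "(norm (herm w e))\<^sup>2 <= (norm w)\<^sup>2" using norm_herm_le[of w e] assms by (simp add: power_mono)
 moreover have "(norm c)\<^sup>2 <= 1" using assms by (simp add: power_le_one)
 ultimately have "(norm c)\<^sup>2 * ((norm w)\<^sup>2 - (norm (herm w e))\<^sup>2) <= 1 * ((norm w)\<^sup>2 - (norm (herm w e))\<^sup>2)"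
  by (intro mult_right_mono) auto
 hence "(norm (unit_rot e c w))\<^sup>2 <= (norm w)\<^sup>2" unfolding norm_unit_rot_sqr[OF assms(1)] by simp
 thus ?thesis by (rule power2_le_imp_le[OF _ norm_ge_zero])
qed

lemma linear_unit_rot: "linear (unit_rot e c)"
proof (rule linearI)
 show "unit_rot e c (x + y) = unit_rot e c x + unit_rot e c y" for x y
  unfolding unit_rot_def herm_add_left vec_eq_iff by (simp add: distrib_left distrib_right right_diff_distrib)
 show "unit_rot e c (r *\<^sub>R x) = r *\<^sub>R unit_rot e c x" for r x
  unfolding unit_rot_def scaleR_eq_smult herm_smult_left vec_eq_iff by (simp add: distrib_left right_diff_distrib)
qed

lemma orthogonal_transformation_unit_rot:
 "norm e = 1 ==> norm c = 1 ==> orthogonal_transformation (unit_rot e c)" by (simp add: orthogonal_transformation linear_unit_rot norm_unit_rot)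

lemma unit_rot_0: "unit_rot e 0 w = herm w e *s e" by (simp add: unit_rot_def)

lemma linear_smult: "linear (%w. c *s (w :: complex ^ 'n))" by (rule linearI) (simp_all add: vec_eq_iff algebra_simps)

lemma orthogonal_transformation_smult:
 "norm c = 1 ==> orthogonal_transformation (%w. c *s (w :: complex ^ 'n))" by (simp add: orthogonal_transformation norm_smult linear_smult)

text \<open>The unitary involution that fixes the direction of \<open>e - e1\<close> and negates its
  complement takes \<open>e\<close> to \<open>- e1\<close>. It preserves \<open>norm w\<close> and
  exchanges the two Hermitian products up to sign, so invariance of Lebesgue measure gives the
  equality.\<close>

lemma nn_integral_herm_unit_eq:
 fixes e e' :: "complex ^ 'n" and G :: "real => real => ennreal"
 assumes e: "norm e = 1" "norm e' = 1"
  and G[measurable]: "case_prod G \<in> borel_measurable (borel \<Otimes>\<^sub>M borel)"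
 shows "(\<integral>\<^sup>+w. G (norm w) (norm (herm w e)) \<partial>lborel) = (\<integral>\<^sup>+w. G (norm w) (norm (herm w e')) \<partial>lborel)"
proof -
 have Gm: "(%w. G (norm w) (norm (herm w e))) \<in> borel_measurable borel" for e :: "complex ^ 'n"
 proof -
  have "(%w. (norm w, norm (herm w e))) \<in> borel \<rightarrow>\<^sub>M borel \<Otimes>\<^sub>M borel" by measurable
  from measurable_compose[OF this G] show ?thesis unfolding prod.case .
 qed
 \<comment> \<open>The involution carries \<open>e\<close> to a multiple of the second vector only
   if their Hermitian product is real, which the phase arranges.\<close>
 obtain \<gamma> where \<gamma>: "norm \<gamma> = 1" "herm e (\<gamma> *s e') = of_real (norm (herm e e'))"
 proof (cases "herm e e' = 0")
  case True thus ?thesis using that[of 1] by (simp add: herm_smult_right)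
 next
  case False
  thus ?thesis using that[of "herm e e' / norm (herm e e')"]
   by (simp add: herm_smult_right norm_divide mult.commute[of "cnj _"] complex_norm_square[symmetric] power2_eq_square)
 qed
 define e1 where "e1 = \<gamma> *s e'"
 have e1: "norm e1 = 1" using \<gamma> e by (simp add: e1_def norm_smult)
 have he1: "norm (herm w e1) = norm (herm w e')" for w using \<gamma>(1) by (simp add: e1_def herm_smult_right norm_mult)
 define s where "s = norm (herm e e')"
 have s: "herm e e1 = of_real s" "herm e1 e = of_real s" using \<gamma>(2) herm_commute[of e1 e] by (auto simp: e1_def s_def)
 show ?thesis
 proof (cases "e = e1")
  case True thus ?thesis by (simp add: he1)
 next
  case False
  define d where "d = norm (e - e1)"
  have d: "d > 0" using False by (simp add: d_def)
  define v where "v = (1 / d) *\<^sub>R (e - e1)"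
  have v: "norm v = 1" using d by (simp add: v_def d_def)
  have "of_real (d\<^sup>2) = herm (e - e1) (e - e1)" unfolding d_def herm_self ..
  also have "... = of_real (2 - 2 * s)" unfolding herm_diff_left herm_diff_right s herm_self[of e] herm_self[of e1] e e1 by simp
  finally have d2: "d\<^sup>2 = 2 - 2 * s" using of_real_eq_iff by blast
  have ws: "norm (herm (unit_rot v (-1) w) e) = norm (herm w e1)" for w
  proof -
   have vv: "herm w v *s v = (herm w (e - e1) / of_real (d\<^sup>2)) *s (e - e1)" unfolding v_def scaleR_eq_smult herm_smult_right
    by (simp add: power2_eq_square vec_eq_iff)
   have "herm (unit_rot v (-1) w) e = 2 * herm (herm w v *s v) e - herm w e"
    unfolding unit_rot_def herm_add_left herm_smult_left herm_diff_left by simp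
   also have "herm (herm w v *s v) e = herm w (e - e1) * (1 - of_real s) / of_real (d\<^sup>2)"
    unfolding vv herm_smult_left herm_diff_left s herm_self e by simp
   also have "... = herm w (e - e1) * (1 - of_real s) / (2 * (1 - of_real s))" by (simp add: d2 right_diff_distrib)
   also have "... = (herm w e - herm w e1) / 2"
   proof -
    have "s ~= 1" using d d2 by auto
    hence "(1::complex) - of_real s ~= 0" by (metis eq_iff_diff_eq_0 of_real_1 of_real_eq_iff)
    thus ?thesis unfolding herm_diff_right by (simp add: field_simps)
   qed
   finally have "herm (unit_rot v (-1) w) e = - herm w e1" by (simp add: field_simps)
   thus ?thesis by simp
  qed
  have "(\<integral>\<^sup>+w. G (norm w) (norm (herm w e)) \<partial>lborel)
    = (\<integral>\<^sup>+w. G (norm (unit_rot v (-1) w)) (norm (herm (unit_rot v (-1) w) e)) \<partial>lborel)"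
   by (rule nn_integral_lborel_isometry[symmetric, where f = "%w. G (norm w) (norm (herm w e))"
      and T = "unit_rot v (-1)"])
     (rule Gm, rule orthogonal_transformation_unit_rot, simp_all add: v)
  also have "... = (\<integral>\<^sup>+w. G (norm w) (norm (herm w e1)) \<partial>lborel)" by (simp add: norm_unit_rot v ws)
  finally show ?thesis by (simp add: he1)
 qed
qed

section \<open>Moments of the Gaussian and of the ball\<close>

no_notation fps_nth (infixl \<open>$\<close> 75)

lemma borel_measurable_vec_nth [measurable]:
 "(%x :: 'a::euclidean_space ^ 'n. x $ i) \<in> borel_measurable borel" by (intro borel_measurable_continuous_onI continuous_intros)

text \<open>The centred normal density of variance \<open>1 / (2 * a)\<close> has total mass
  one.\<close>

lemma nn_integral_gauss:
 assumes "a > 0"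
 shows "(\<integral>\<^sup>+x. ennreal (exp (- (a * x\<^sup>2))) \<partial>lborel) = ennreal (sqrt (pi / a))"
proof -
 define \<sigma> where "\<sigma> = 1 / sqrt (2 * a)"
 have \<sigma>: "\<sigma> > 0" "\<sigma>\<^sup>2 = 1 / (2 * a)" using assms by (auto simp: \<sigma>_def power_divide)
 interpret prob_space "density lborel (normal_density 0 \<sigma>)" using \<sigma> by (rule_tac prob_space_normal_density)
 have nd: "normal_density 0 \<sigma> x = sqrt (a / pi) * exp (- (a * x\<^sup>2))" for x
  using assms by (simp add: normal_density_def \<sigma> real_sqrt_divide field_simps)
 have "1 = (\<integral>\<^sup>+x. normal_density 0 \<sigma> x \<partial>lborel)" using emeasure_space_1 by (simp add: emeasure_density)
 also have "... = ennreal (sqrt (a / pi)) * (\<integral>\<^sup>+x. ennreal (exp (- (a * x\<^sup>2))) \<partial>lborel)"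
  unfolding nd using assms by (subst ennreal_mult') (auto simp: nn_integral_cmult)
 finally have "ennreal (sqrt (pi / a)) * 1 = ennreal (sqrt (pi / a)) * ennreal (sqrt (a / pi)) *
   (\<integral>\<^sup>+x. ennreal (exp (- (a * x\<^sup>2))) \<partial>lborel)" by (simp add: mult.assoc)
 also have "ennreal (sqrt (pi / a)) * ennreal (sqrt (a / pi)) = 1" using assms by (simp add: ennreal_mult[symmetric] real_sqrt_divide)
 finally show ?thesis by simp
qed

text \<open>Expanded in \<open>s\<close>, this is the exponential generating function of the
  Gaussian moments of one coordinate. The integral factors over the real coordinates; the two that
  belong to coordinate \<open>i\<close> have weight \<open>1 - s\<close> in place of
  \<open>1\<close>, and their square roots multiply to \<open>1 / (1 - s)\<close>.\<close>

lemma gauss_generating: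
 fixes i :: "'n::finite" and s :: real
 assumes s: "s < 1"
 shows "(\<integral>\<^sup>+w. ennreal (exp (s * (norm (w $ i))\<^sup>2 - (norm w)\<^sup>2)) \<partial>(lborel :: (complex ^ 'n) measure))
   = ennreal (pi ^ CARD('n) / (1 - s))"
proof -
 let ?B = "Basis :: (complex ^ 'n) set"
 define A :: "(complex ^ 'n) set" where "A = {axis i 1, axis i \<i>}"
 have A: "A \<subseteq> ?B" "finite A" by (auto simp: A_def axis_in_Basis_iff Basis_complex_def)
 have "axis i 1 ~= (axis i \<i> :: complex ^ 'n)" by (simp add: axis_eq_axis)
 hence cA: "card A = 2" by (simp add: A_def)
 define c where "c b = (if b \<in> A then 1 - s else 1)" for b
 have c: "c b > 0" for b using s by (simp add: c_def)
 have nA: "(norm (w $ i))\<^sup>2 = (\<Sum>b\<in>A. (w \<bullet> b)\<^sup>2)" for w :: "complex ^ 'n"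
  using `axis i 1 ~= (axis i \<i> :: complex ^ 'n)` by (simp add: A_def inner_axis cmod_power2)
 have nB: "(norm w)\<^sup>2 = (\<Sum>b\<in>?B. (w \<bullet> b)\<^sup>2)" for w :: "complex ^ 'n"
  unfolding power2_norm_eq_inner by (subst euclidean_inner) (simp add: power2_eq_square)
 have e: "s * (norm (w $ i))\<^sup>2 - (norm w)\<^sup>2 = (\<Sum>b\<in>?B. - (c b * (w \<bullet> b)\<^sup>2))" for w :: "complex ^ 'n"
 proof -
  have "(\<Sum>b\<in>?B. - (c b * (w \<bullet> b)\<^sup>2)) = (\<Sum>b\<in>?B. (if b \<in> A then s * (w \<bullet> b)\<^sup>2 else 0) - (w \<bullet> b)\<^sup>2)"
   by (rule sum.cong) (auto simp: c_def algebra_simps)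
  also have "... = (\<Sum>b\<in>A. s * (w \<bullet> b)\<^sup>2) - (\<Sum>b\<in>?B. (w \<bullet> b)\<^sup>2)"
   using A by (simp add: sum_subtractf sum.inter_restrict[symmetric] inf_absorb2)
  finally show ?thesis by (simp add: nA nB sum_distrib_left)
 qed
 have "(\<integral>\<^sup>+w. ennreal (exp (s * (norm (w $ i))\<^sup>2 - (norm w)\<^sup>2)) \<partial>(lborel :: (complex ^ 'n) measure))
   = (\<integral>\<^sup>+w. (\<Prod>b\<in>?B. ennreal (exp (- (c b * (w \<bullet> b)\<^sup>2)))) \<partial>lborel)"
  by (intro nn_integral_cong) (simp add: e exp_sum prod_ennreal)
 also have "... = (\<Prod>b\<in>?B. (\<integral>\<^sup>+x. ennreal (exp (- (c b * x\<^sup>2))) \<partial>lborel))"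
  by (rule nn_integral_lborel_prod) auto
 also have "... = (\<Prod>b\<in>?B. ennreal (sqrt (pi / c b)))" by (simp add: nn_integral_gauss c)
 also have "... = ennreal (\<Prod>b\<in>?B. sqrt (pi / c b))" by (rule prod_ennreal) (simp add: less_imp_le c)
 also have "(\<Prod>b\<in>?B. sqrt (pi / c b)) = (\<Prod>b\<in>?B. sqrt pi * (if b \<in> A then 1 / sqrt (1 - s) else 1))"
  by (intro prod.cong) (auto simp: c_def real_sqrt_divide)
 also have "... = sqrt pi ^ card ?B * (\<Prod>b\<in>A. 1 / sqrt (1 - s))"
  using A by (simp add: prod.distrib prod.inter_restrict[symmetric] inf_absorb2)
 also have "... = pi ^ CARD('n) / (1 - s)" using s by (simp add: cA mult.commute[of _ 2] power_mult power_divide)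
 finally show ?thesis .
qed

text \<open>Identities obtained from \<open>ennreal\<close> integrals hold for nonnegative arguments
  only. Since the zeros of a nonzero power series are isolated, this is enough to compare
  coefficients.\<close>

lemma powser_eq_0_on_nonneg:
 fixes d :: "nat => real"
 assumes sm: "!!x. norm x < 1 ==> summable (%k. d k * x ^ k)"
  and z: "!!x. 0 <= x ==> x < 1 ==> (\<Sum>k. d k * x ^ k) = 0"
 shows "d k = 0"
proof (rule ccontr)
 assume k: "d k ~= 0"
 have "d 0 = 0" using z[of 0] powser_zero[of d] by simp
 hence "k > 0" using k by (cases k) auto
 define f where "f x = (\<Sum>k. d k * x ^ k)" for x
 obtain s where "0 < s" "!!z. z \<in> cball 0 s - {0} ==> f z ~= 0"
 proof (rule powser_0_nonzero[of 1 0 d f k])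
  show "(%n. d n * (x - 0) ^ n) sums f x" if "norm (x - 0) < 1" for x using sm[of x] that unfolding f_def by (simp add: summable_sums)
 qed (use z[of 0] k `k > 0` in \<open>auto simp: f_def\<close>)
 from this(2)[of "min (s/2) (1/2)"] `0 < s` z[of "min (s/2) (1/2)"]
 show False unfolding f_def by (cases "s <= 1") (simp_all add: min_def)
qed

text \<open>Comparing the coefficients of the generating function with those of the geometric series
  gives all moments at once, without polar coordinates.\<close>

lemma gauss_moment_coord:
 fixes i :: "'n::finite"
 shows "(\<integral>\<^sup>+w. ennreal ((norm (w $ i)) ^ (2 * k) * exp (- (norm w)\<^sup>2)) \<partial>(lborel :: (complex ^ 'n) measure))
   = ennreal (pi ^ CARD('n) * fact k)"
proof -
 let ?L = "lborel :: (complex ^ 'n) measure"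
 define M where "M k = (\<integral>\<^sup>+w. ennreal ((norm (w $ i)) ^ (2 * k) * exp (- (norm w)\<^sup>2)) \<partial>?L)" for k
 have sum: "(\<Sum>k. ennreal (s ^ k / fact k) * M k) = ennreal (pi ^ CARD('n) / (1 - s))" if s: "0 <= s" "s < 1" for s
 proof -
  have "(\<Sum>k. ennreal (s ^ k / fact k) * M k)
    = (\<Sum>k. \<integral>\<^sup>+w. ennreal (s ^ k / fact k * ((norm (w $ i)) ^ (2 * k) * exp (- (norm w)\<^sup>2))) \<partial>?L)"
  proof (rule suminf_cong)
   fix k
   have "ennreal (s ^ k / fact k * ((norm (w $ i)) ^ (2 * k) * exp (- (norm w)\<^sup>2)))
     = ennreal (s ^ k / fact k) * ennreal ((norm (w $ i)) ^ (2 * k) * exp (- (norm w)\<^sup>2))" for w :: "complex ^ 'n"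
    using s by (intro ennreal_mult) auto
   thus "ennreal (s ^ k / fact k) * M k
     = (\<integral>\<^sup>+w. ennreal (s ^ k / fact k * ((norm (w $ i)) ^ (2 * k) * exp (- (norm w)\<^sup>2))) \<partial>?L)"
    unfolding M_def by (simp only:) (rule nn_integral_cmult[symmetric], measurable)
  qed
  also have "... = (\<integral>\<^sup>+w. (\<Sum>k. ennreal (s ^ k / fact k * ((norm (w $ i)) ^ (2 * k) * exp (- (norm w)\<^sup>2)))) \<partial>?L)"
   by (rule nn_integral_suminf[symmetric]) measurable
  also have "... = (\<integral>\<^sup>+w. ennreal (exp (s * (norm (w $ i))\<^sup>2 - (norm w)\<^sup>2)) \<partial>?L)"
  proof (intro nn_integral_cong)
   fix w :: "complex ^ 'n"
   have "(%k. exp (- (norm w)\<^sup>2) * ((s * (norm (w $ i))\<^sup>2) ^ k /\<^sub>R fact k)) sums (exp (- (norm w)\<^sup>2) * exp (s * (norm (w $ i))\<^sup>2))"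
    by (intro sums_mult exp_converges)
   moreover have "exp (- (norm w)\<^sup>2) * ((s * (norm (w $ i))\<^sup>2) ^ k /\<^sub>R fact k)
     = s ^ k / fact k * ((norm (w $ i)) ^ (2 * k) * exp (- (norm w)\<^sup>2))" for k
    by (simp add: power_mult_distrib power_mult[symmetric] field_simps)
   moreover have "exp (- (norm w)\<^sup>2) * exp (s * (norm (w $ i))\<^sup>2) = exp (s * (norm (w $ i))\<^sup>2 - (norm w)\<^sup>2)"
    by (simp add: exp_add[symmetric])
   ultimately have "(%k. s ^ k / fact k * ((norm (w $ i)) ^ (2 * k) * exp (- (norm w)\<^sup>2))) sums exp (s * (norm (w $ i))\<^sup>2 - (norm w)\<^sup>2)"
    by (simp only:)
   thus "(\<Sum>k. ennreal (s ^ k / fact k * ((norm (w $ i)) ^ (2 * k) * exp (- (norm w)\<^sup>2)))) = ennreal (exp (s * (norm (w $ i))\<^sup>2 - (norm w)\<^sup>2))"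
    using s by (subst suminf_ennreal2) (auto simp: sums_iff)
  qed
  also have "... = ennreal (pi ^ CARD('n) / (1 - s))" by (rule gauss_generating) (use s in auto)
  finally show ?thesis .
 qed
 \<comment> \<open>Finiteness of each moment is read off from the finite sum at one positive value
   of \<open>s\<close>.\<close>
 have fin: "M k < \<infinity>" for k
 proof -
  have "ennreal ((1/2) ^ k / fact k) * M k <= (\<Sum>k. ennreal ((1/2) ^ k / fact k) * M k)"
   using sum_le_suminf[of "%k. ennreal ((1/2) ^ k / fact k) * M k" "{k}"] by (simp add: summableI)
  also have "... < \<infinity>" using sum[of "1/2"] by simp
  finally show ?thesis by (auto simp: ennreal_mult_less_top)
 qed
 define m where "m k = enn2real (M k)" for k
 have m: "M k = ennreal (m k)" "m k >= 0" for k using fin[of k] by (auto simp: m_def)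
 have sm: "(%k. s ^ k / fact k * m k) sums (pi ^ CARD('n) / (1 - s))" if s: "0 <= s" "s < 1" for s
 proof -
  have eq: "ennreal (s ^ k / fact k * m k) = ennreal (s ^ k / fact k) * M k" for k unfolding m(1) using s m(2) by (intro ennreal_mult) auto
  have "(%k. ennreal (s ^ k / fact k * m k)) sums ennreal (pi ^ CARD('n) / (1 - s))"
   unfolding eq using summable_sums[OF summableI, of "%k. ennreal (s ^ k / fact k) * M k"] sum[OF s] by simp
  thus ?thesis using s m(2) by (subst (asm) sums_ennreal) auto
 qed
 define d where "d k = m k / fact k - pi ^ CARD('n)" for k
 have ds: "(%k. d k * s ^ k) sums 0" if s: "0 <= s" "s < 1" for s
  using sums_diff[OF sm[OF s] sums_mult[OF geometric_sums[of s], of "pi ^ CARD('n)"]] s by (simp add: d_def algebra_simps)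
 have "d k = 0" for k
 proof (rule powser_eq_0_on_nonneg[of d])
  fix x :: real assume x: "norm x < 1"
  define y where "y = (1 + norm x) / 2"
  have "summable (%k. d k * y ^ k)" using ds[of y] x by (auto simp: y_def sums_iff)
  thus "summable (%k. d k * x ^ k)" by (rule powser_inside) (use x in \<open>auto simp: y_def\<close>)
 next
  show "(\<Sum>k. d k * x ^ k) = 0" if "0 <= x" "x < 1" for x using ds[OF that] by (simp add: sums_iff)
 qed
 hence "m k = pi ^ CARD('n) * fact k" for k by (simp add: d_def field_simps)
 thus ?thesis using m(1)[of k] unfolding M_def by simp
qed

lemma gauss_moment:
 fixes e :: "complex ^ 'n"
 assumes "norm e = 1"
 shows "(\<integral>\<^sup>+w. ennreal ((norm (herm w e)) ^ (2 * k) * exp (- (norm w)\<^sup>2)) \<partial>lborel) = ennreal (pi ^ CARD('n) * fact k)"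
proof -
 define i where "i = (undefined :: 'n)"
 define e1 :: "complex ^ 'n" where "e1 = axis i 1"
 have e1: "norm e1 = 1" by (simp add: e1_def)
 have h: "herm w e1 = w $ i" for w by (simp add: herm_def e1_def axis_def if_distrib[of "%x. _ * x"] if_distrib[of cnj] cong: if_cong)
 have "(\<integral>\<^sup>+w. ennreal ((norm (herm w e)) ^ (2 * k) * exp (- (norm w)\<^sup>2)) \<partial>lborel)
  = (\<integral>\<^sup>+w. ennreal ((norm (herm w e1)) ^ (2 * k) * exp (- (norm w)\<^sup>2)) \<partial>lborel)"
  by (rule nn_integral_herm_unit_eq[where G = "%x y. ennreal (y ^ (2 * k) * exp (- x\<^sup>2))", OF assms e1]) measurable
 thus ?thesis by (simp add: h gauss_moment_coord)
qed

lemma nn_integral_lborel_scale: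
 fixes f :: "'a::euclidean_space => ennreal"
 assumes [measurable]: "f \<in> borel_measurable borel" and c: "c > 0"
 shows "(\<integral>\<^sup>+x. f x \<partial>lborel) = ennreal (c ^ DIM('a)) * (\<integral>\<^sup>+x. f (c *\<^sub>R x) \<partial>lborel)"
proof -
 have T: "(%x::'a. 0 + (\<Sum>j\<in>Basis. (c * (x \<bullet> j)) *\<^sub>R j)) = (%x. c *\<^sub>R x)"
  by (auto simp: scaleR_sum_right[symmetric] euclidean_representation simp flip: scaleR_scaleR)
 have "(\<integral>\<^sup>+x. f x \<partial>lborel) = (\<integral>\<^sup>+x. f x \<partial>(density (distr lborel borel (%x. c *\<^sub>R x)) (%_. ennreal (c ^ DIM('a)))))"
  using lborel_affine_euclidean[of "%_. c" "0::'a"] c unfolding T by simp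
 also have "... = ennreal (c ^ DIM('a)) * (\<integral>\<^sup>+x. f (c *\<^sub>R x) \<partial>lborel)"
  by (simp add: nn_integral_density nn_integral_distr nn_integral_cmult)
 finally show ?thesis .
qed

lemma Gamma_nn_integral_shift:
 assumes a: "a > -1" and r: "r >= 0"
 shows "(\<integral>\<^sup>+t. ennreal (indicator {r<..} t * (t - r) powr a * exp (- t)) \<partial>lborel) = ennreal (exp (- r) * Gamma (a + 1))"
proof -
 have "(\<integral>\<^sup>+t. ennreal (indicator {r<..} t * (t - r) powr a * exp (- t)) \<partial>lborel)
   = (\<integral>\<^sup>+t. ennreal (indicator {r<..} (r + t) * ((r + t) - r) powr a * exp (- (r + t))) \<partial>lborel)"
  by (rule nn_integral_lborel_translate[symmetric]) measurable
 also have "... = (\<integral>\<^sup>+t. ennreal (exp (- r)) * ennreal (indicator {0..} t * t powr (a + 1 - 1) / exp t) \<partial>lborel)"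
  by (intro nn_integral_cong)
    (auto simp: ennreal_mult[symmetric] indicator_def exp_diff exp_minus field_simps)
 also have "... = ennreal (exp (- r)) * ennreal (Gamma (a + 1))" using a by (subst Gamma_conv_nn_integral_real) (auto simp: nn_integral_cmult)
 finally show ?thesis by (simp add: ennreal_mult')
qed

lemma borel_measurable_indicator_ball [measurable]:
 "(indicator (ball (x :: 'a::metric_space) r) :: 'a => 'b::{real_normed_algebra_1}) \<in> borel_measurable borel"
 by (rule borel_measurable_indicator) simp

text \<open>Integrating \<open>\<integral> |w\<^sub>e|\<^sup>2\<^sup>k (t - |w|\<^sup>2)\<^sup>a dw\<close> against \<open>e\<^sup>-\<^sup>t dt\<close> in both orders reduces the moments
 of the ball to Gaussian ones.\<close>

lemma ball_moment:
 fixes e :: "complex ^ 'n"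
 assumes e: "norm e = 1" and a: "a > -1"
 shows "(\<integral>\<^sup>+w. ennreal (indicator UB w * (norm (herm w e)) ^ (2 * k) * (1 - (norm w)\<^sup>2) powr a) \<partial>lborel)
   = ennreal (pi ^ CARD('n) * fact k * Gamma (a + 1) / Gamma (real CARD('n) + real k + a + 1))"
proof -
 let ?L = "lborel :: (complex ^ 'n) measure"
 define I where "I = (\<integral>\<^sup>+w. ennreal (indicator UB w * (norm (herm w e)) ^ (2 * k) * (1 - (norm w)\<^sup>2) powr a) \<partial>?L)"
 define F where "F t w = ennreal ((norm (herm w e)) ^ (2 * k) * (indicator {(norm w)\<^sup>2<..} t * (t - (norm w)\<^sup>2) powr a * exp (- t)))" for t w
 have ind: "indicator {(norm w)\<^sup>2<..} t = (if (norm w)\<^sup>2 < t then 1 else 0 :: real)" for t and w :: "complex ^ 'n" by simp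
 have Fm[measurable]: "case_prod F \<in> borel_measurable (borel \<Otimes>\<^sub>M borel)" unfolding F_def ind by measurable
 have n: "real CARD('n) + real k + a > -1" using a zero_less_card_finite[where 'a='n] by linarith
 have "(\<integral>\<^sup>+w. \<integral>\<^sup>+t. F t w \<partial>lborel \<partial>?L) = (\<integral>\<^sup>+w. ennreal ((norm (herm w e)) ^ (2 * k)) * (ennreal (exp (- (norm w)\<^sup>2) * Gamma (a + 1))) \<partial>?L)"
 proof (rule nn_integral_cong)
  fix w :: "complex ^ 'n"
  have "F t w = ennreal ((norm (herm w e)) ^ (2 * k)) * ennreal (indicator {(norm w)\<^sup>2<..} t * (t - (norm w)\<^sup>2) powr a * exp (- t))" for t
   unfolding F_def by (rule ennreal_mult') simp
  thus "(\<integral>\<^sup>+t. F t w \<partial>lborel) = ennreal ((norm (herm w e)) ^ (2 * k)) * (ennreal (exp (- (norm w)\<^sup>2) * Gamma (a + 1)))"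
   using Gamma_nn_integral_shift[OF a, of "(norm w)\<^sup>2"] by (simp only:) (subst nn_integral_cmult, auto)
 qed
 also have "... = (\<integral>\<^sup>+w. ennreal (Gamma (a + 1)) * ennreal ((norm (herm w e)) ^ (2 * k) * exp (- (norm w)\<^sup>2)) \<partial>?L)"
  using a Gamma_real_pos[of "a + 1"] by (intro nn_integral_cong) (simp add: ennreal_mult[symmetric] mult_ac)
 also have "... = ennreal (Gamma (a + 1)) * ennreal (pi ^ CARD('n) * fact k)" by (simp add: nn_integral_cmult gauss_moment[OF e])
 finally have 1: "(\<integral>\<^sup>+w. \<integral>\<^sup>+t. F t w \<partial>lborel \<partial>?L) = ennreal (Gamma (a + 1)) * ennreal (pi ^ CARD('n) * fact k)" .
 have "(\<integral>\<^sup>+w. \<integral>\<^sup>+t. F t w \<partial>lborel \<partial>?L) = (\<integral>\<^sup>+t. \<integral>\<^sup>+w. F t w \<partial>?L \<partial>lborel)"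
  by (rule lborel_pair.Fubini') simp
 also have "... = (\<integral>\<^sup>+t. I * ennreal (indicator {0..} t * t powr (real CARD('n) + real k + a + 1 - 1) / exp t) \<partial>lborel)"
 proof (rule nn_integral_cong)
  fix t :: real
  show "(\<integral>\<^sup>+w. F t w \<partial>?L) = I * ennreal (indicator {0..} t * t powr (real CARD('n) + real k + a + 1 - 1) / exp t)"
  \<comment> \<open>For positive \<open>t\<close> the substitution of
    \<open>sqrt t *\<^sub>R w\<close> for \<open>w\<close> turns the inner integral into
    \<open>I\<close> times a power of \<open>t\<close>. The exponent collects the dimension, the
    factor \<open>2 * k\<close> and \<open>a\<close>, and leaves a Gamma integral in
    \<open>t\<close>.\<close>
  proof (cases "t > 0")
   case True
   have "(\<integral>\<^sup>+w. F t w \<partial>?L) = ennreal (sqrt t ^ DIM(complex ^ 'n)) * (\<integral>\<^sup>+w. F t (sqrt t *\<^sub>R w) \<partial>?L)"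
    by (rule nn_integral_lborel_scale) (use True in auto)
   also have "(\<integral>\<^sup>+w. F t (sqrt t *\<^sub>R w) \<partial>?L) = (\<integral>\<^sup>+w. ennreal (t powr (real k + a) * exp (- t)) * ennreal (indicator UB w * (norm (herm w e)) ^ (2 * k) * (1 - (norm w)\<^sup>2) powr a) \<partial>?L)"
   proof (rule nn_integral_cong)
    fix w :: "complex ^ 'n"
    have n: "(norm (sqrt t *\<^sub>R w))\<^sup>2 = t * (norm w)\<^sup>2" using True by (simp add: power_mult_distrib)
    have h: "norm (herm (sqrt t *\<^sub>R w) e) ^ (2 * k) = t ^ k * norm (herm w e) ^ (2 * k)"
     using True by (simp add: herm_scaleR_left norm_mult power_mult_distrib power_mult[of "sqrt t"])
    have b: "t * (norm w)\<^sup>2 < t \<longleftrightarrow> w \<in> UB" using True by (simp add: abs_square_less_1)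
    show "F t (sqrt t *\<^sub>R w) = ennreal (t powr (real k + a) * exp (- t)) * ennreal (indicator UB w * (norm (herm w e)) ^ (2 * k) * (1 - (norm w)\<^sup>2) powr a)"
    proof (cases "w \<in> UB")
     case w: True
     have "(t - t * (norm w)\<^sup>2) powr a = t powr a * (1 - (norm w)\<^sup>2) powr a"
      using True w powr_mult[of t "1 - (norm w)\<^sup>2" a] by (simp add: right_diff_distrib abs_square_le_1)
     thus ?thesis using w b True unfolding F_def n h by (simp add: ennreal_mult[symmetric] powr_add powr_realpow mult_ac)
    next
     case False
     thus ?thesis unfolding F_def n h using b by simp
    qed
   qed
   also have "... = ennreal (t powr (real k + a) * exp (- t)) * I" unfolding I_def by (rule nn_integral_cmult) simp
   also have "sqrt t ^ DIM(complex ^ 'n) = t powr real CARD('n)" using True by (simp add: mult.commute[of _ 2] power_mult powr_realpow)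
   finally have "(\<integral>\<^sup>+w. F t w \<partial>?L) = (ennreal (t powr real CARD('n)) * ennreal (t powr (real k + a) * exp (- t))) * I"
    by (simp add: mult.assoc)
   also have "ennreal (t powr real CARD('n)) * ennreal (t powr (real k + a) * exp (- t)) = ennreal (indicator {0..} t * t powr (real CARD('n) + real k + a + 1 - 1) / exp t)"
    using True by (simp add: ennreal_mult[symmetric] powr_add exp_minus field_simps)
   finally show ?thesis by (simp add: mult.commute)
  next
   case False
   hence "\<not> (norm w)\<^sup>2 < t" for w :: "complex ^ 'n" using zero_le_power2[of "norm w"] by linarith
   hence "F t w = 0" for w unfolding F_def by simp
   thus ?thesis using False by (cases "t = 0") auto
  qed
 qed
 also have "... = I * ennreal (Gamma (real CARD('n) + real k + a + 1))" using n by (subst Gamma_conv_nn_integral_real) (auto simp: nn_integral_cmult)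
 finally have 2: "I * ennreal (Gamma (real CARD('n) + real k + a + 1)) = ennreal (Gamma (a + 1)) * ennreal (pi ^ CARD('n) * fact k)" using 1 by simp
 have Gp: "Gamma (real CARD('n) + real k + a + 1) > 0" using n by (intro Gamma_real_pos) linarith
 have "I = I * ennreal (Gamma (real CARD('n) + real k + a + 1)) / ennreal (Gamma (real CARD('n) + real k + a + 1))"
  using Gp by (simp add: ennreal_mult_divide_eq)
 also have "... = ennreal (pi ^ CARD('n) * fact k * Gamma (a + 1) / Gamma (real CARD('n) + real k + a + 1))"
  unfolding 2 using Gp a Gamma_real_pos[of "a + 1"] by (simp add: ennreal_mult[symmetric] divide_ennreal mult_ac)
 finally show ?thesis unfolding I_def .
qed

section \<open>The weighted measure: density, moments, total mass and unitary invariance\<close>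

definition tau :: "complex ^ 'n => real" where "tau z = 1 - (norm z)\<^sup>2"

lemma tau_pos [simp]: "norm z < 1 ==> 0 < tau z" by (simp add: tau_def abs_square_less_1)
lemma tau_pos' [simp]: "z \<in> UB ==> 0 < tau z" by simp
lemma tau_le_1 [simp]: "tau z <= 1" by (simp add: tau_def)
lemma continuous_on_tau [continuous_intros]: "continuous_on S f ==> continuous_on S (%x. tau (f x))"
 unfolding tau_def by (intro continuous_intros)
lemma borel_measurable_tau [measurable]: "tau \<in> borel_measurable borel" unfolding tau_def by measurable

lemma emeasure_unit_ball: "emeasure lborel (UB :: (complex ^ 'n) set) = ennreal (pi ^ CARD('n) / fact CARD('n))"
proof -
 obtain e :: "complex ^ 'n" where e: "norm e = 1" using vector_choose_size[of 1] by auto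
 have "emeasure lborel (UB :: (complex ^ 'n) set) = (\<integral>\<^sup>+w. indicator (UB :: (complex ^ 'n) set) w \<partial>lborel)" by simp
 also have "... = (\<integral>\<^sup>+w. ennreal (indicator UB w * (norm (herm w e)) ^ (2 * 0) * (1 - (norm w)\<^sup>2) powr 0) \<partial>lborel)"
 proof (rule nn_integral_cong)
  fix w :: "complex ^ 'n"
  show "indicator UB w = ennreal (indicator UB w * (norm (herm w e)) ^ (2 * 0) * (1 - (norm w)\<^sup>2) powr 0)"
   using tau_pos[of w] by (cases "w \<in> UB") (auto simp: tau_def)
 qed
 also have "... = ennreal (pi ^ CARD('n) / fact CARD('n))" using Gamma_fact[of "CARD('n)", where 'a = real]
  by (subst ball_moment[OF e]) (simp_all add: add.commute)
 finally show ?thesis .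
qed

lemma space_weighted_measure [simp]: "space (weighted_measure \<alpha>) = UB" by (simp add: weighted_measure_def ball_measure_def)

lemma sets_weighted_measure: "sets (weighted_measure \<alpha>) = sets (lebesgue_on UB)" by (simp add: weighted_measure_def ball_measure_def)

lemma sets_weighted_measure_eq_ball_measure: "sets (weighted_measure \<alpha>) = sets ball_measure" by (simp add: weighted_measure_def)

lemma borel_measurable_weighted_measure [measurable (raw)]:
 "f \<in> borel_measurable borel ==> f \<in> borel_measurable (weighted_measure \<alpha>)"
proof -
 assume f: "f \<in> borel_measurable borel"
 have "f \<in> borel_measurable (lebesgue_on UB)" using f by (intro measurable_restrict_space1 measurable_completion) simp
 thus ?thesis by (simp cong: measurable_cong_sets add: sets_weighted_measure)
qed

lemma measurable_weighted_measure_id [measurable]: "(%x. x) \<in> weighted_measure \<alpha> \<rightarrow>\<^sub>M borel"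
 using borel_measurable_weighted_measure[of "%x. x"] by simp

lemma sets_weighted_measureI [measurable]: "A \<in> sets borel ==> A \<inter> UB \<in> sets (weighted_measure \<alpha>)"
 using measurable_sets[OF measurable_weighted_measure_id, of A \<alpha>] by simp

lemma weight_const_pos: "\<alpha> > -1 ==> weight_const n \<alpha> > 0"
 unfolding weight_const_def by (intro divide_pos_pos mult_pos_pos Gamma_real_pos) auto

text \<open>For Borel functions the completion, the restriction to the ball and the normalisation
  collapse to one density over \<open>lborel\<close>. The factorial in \<open>weight_const\<close>
  cancels against the one in the volume of the ball.\<close>

lemma nn_integral_weighted_measure:
 fixes f :: "complex ^ 'n => ennreal"
 assumes \<alpha>: "\<alpha> > -1" and f: "f \<in> borel_measurable borel"
 shows "(\<integral>\<^sup>+w. f w \<partial>weighted_measure \<alpha>) =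
  ennreal (Gamma (real CARD('n) + \<alpha> + 1) / (Gamma (\<alpha> + 1) * pi ^ CARD('n))) *
   (\<integral>\<^sup>+w. ennreal (indicator UB w * tau w powr \<alpha>) * f w \<partial>lborel)"
proof -
 let ?B = "UB :: (complex ^ 'n) set"
 let ?w = "weight_const CARD('n) \<alpha>"
 define g :: "complex ^ 'n => ennreal" where "g = (%z. ennreal (?w * (1 - (norm z)\<^sup>2) powr \<alpha>))"
 have g[measurable]: "g \<in> borel_measurable borel" unfolding g_def by measurable
 have L: "h \<in> borel_measurable borel ==> h \<in> borel_measurable (lebesgue_on ?B)" for h :: "complex ^ 'n => ennreal"
  by (intro measurable_restrict_space1 measurable_completion) simp
 have U: "h \<in> borel_measurable borel ==> h \<in> borel_measurable ball_measure" for h :: "complex ^ 'n => ennreal"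
  unfolding ball_measure_def by (subst measurable_cong_sets[OF sets_uniform_measure refl]) (rule L)
 have eB: "emeasure (lebesgue_on ?B) ?B = ennreal (pi ^ CARD('n) / fact CARD('n))" by (simp add: emeasure_restrict_space emeasure_unit_ball)
 have "(\<integral>\<^sup>+w. f w \<partial>weighted_measure \<alpha>) = (\<integral>\<^sup>+w. g w * f w \<partial>ball_measure)"
  unfolding weighted_measure_def g_def[symmetric] by (intro nn_integral_density U f g)
 also have "... = (\<integral>\<^sup>+w. g w * f w * indicator ?B w \<partial>lebesgue_on ?B) / ennreal (pi ^ CARD('n) / fact CARD('n))"
  unfolding ball_measure_def eB[symmetric]
  by (intro nn_integral_uniform_measure L borel_measurable_times_ennreal f g) (simp add: sets_restrict_space_iff)
 also have "(\<integral>\<^sup>+w. g w * f w * indicator ?B w \<partial>lebesgue_on ?B) = (\<integral>\<^sup>+w. g w * f w * indicator ?B w * indicator ?B w \<partial>lebesgue)"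
  by (rule nn_integral_restrict_space) simp
 also have "... = (\<integral>\<^sup>+w. g w * f w * indicator ?B w * indicator ?B w \<partial>lborel)" by (rule nn_integral_completion)
 also have "... = (\<integral>\<^sup>+w. ennreal ?w * (ennreal (indicator ?B w * tau w powr \<alpha>) * f w) \<partial>lborel)"
  using weight_const_pos[OF \<alpha>, of "CARD('n)"] by (intro nn_integral_cong) (auto simp: g_def indicator_def tau_def ennreal_mult' mult_ac)
 also have "... = ennreal ?w * (\<integral>\<^sup>+w. (ennreal (indicator ?B w * tau w powr \<alpha>) * f w) \<partial>lborel)"
  using f by (intro nn_integral_cmult) simp
 also have "... / ennreal (pi ^ CARD('n) / fact CARD('n)) = (ennreal ?w / ennreal (pi ^ CARD('n) / fact CARD('n))) *
   (\<integral>\<^sup>+w. (ennreal (indicator ?B w * tau w powr \<alpha>) * f w) \<partial>lborel)"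
  unfolding divide_ennreal_def by (simp only: mult_ac)
 also have "ennreal ?w / ennreal (pi ^ CARD('n) / fact CARD('n)) = ennreal (Gamma (real CARD('n) + \<alpha> + 1) / (Gamma (\<alpha> + 1) * pi ^ CARD('n)))"
  using weight_const_pos[OF \<alpha>, of "CARD('n)"] by (subst divide_ennreal) (auto simp: weight_const_def field_simps)
 finally show ?thesis .
qed

lemma weighted_moment:
 fixes e :: "complex ^ 'n"
 assumes \<alpha>: "\<alpha> > -1" and b: "\<alpha> + b > -1" and e: "norm e = 1"
 shows "(\<integral>\<^sup>+w. ennreal (norm (herm w e) ^ (2 * k) * tau w powr b) \<partial>weighted_measure \<alpha>)
  = ennreal (Gamma (real CARD('n) + \<alpha> + 1) * fact k * Gamma (\<alpha> + b + 1) / (Gamma (\<alpha> + 1) * Gamma (real CARD('n) + real k + \<alpha> + b + 1)))"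
proof -
 have g: "Gamma (\<alpha> + 1) > 0" "Gamma (real CARD('n) + \<alpha> + 1) > 0" "Gamma (\<alpha> + b + 1) > 0"
  "Gamma (real CARD('n) + real k + \<alpha> + b + 1) > 0" using \<alpha> b by (intro Gamma_real_pos; simp)+
 have "(\<integral>\<^sup>+w. ennreal (norm (herm w e) ^ (2 * k) * tau w powr b) \<partial>weighted_measure \<alpha>) =
  ennreal (Gamma (real CARD('n) + \<alpha> + 1) / (Gamma (\<alpha> + 1) * pi ^ CARD('n))) *
   (\<integral>\<^sup>+w. ennreal (indicator UB w * tau w powr \<alpha>) * ennreal (norm (herm w e) ^ (2 * k) * tau w powr b) \<partial>lborel)"
  by (rule nn_integral_weighted_measure[OF \<alpha>]) measurable
 also have "(\<integral>\<^sup>+w. ennreal (indicator UB w * tau w powr \<alpha>) * ennreal (norm (herm w e) ^ (2 * k) * tau w powr b) \<partial>lborel)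
  = (\<integral>\<^sup>+w. ennreal (indicator UB w * norm (herm w e) ^ (2 * k) * (1 - (norm w)\<^sup>2) powr (\<alpha> + b)) \<partial>lborel)"
  by (intro nn_integral_cong) (auto simp: ennreal_mult[symmetric] tau_def powr_add mult_ac)
 also have "... = ennreal (pi ^ CARD('n) * fact k * Gamma (\<alpha> + b + 1) / Gamma (real CARD('n) + real k + (\<alpha> + b) + 1))"
  by (rule ball_moment[OF e b])
 also have "ennreal (Gamma (real CARD('n) + \<alpha> + 1) / (Gamma (\<alpha> + 1) * pi ^ CARD('n))) * ...
  = ennreal (Gamma (real CARD('n) + \<alpha> + 1) * fact k * Gamma (\<alpha> + b + 1) / (Gamma (\<alpha> + 1) * Gamma (real CARD('n) + real k + \<alpha> + b + 1)))"
  using g by (subst ennreal_mult[symmetric]) (auto simp: add.assoc)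
 finally show ?thesis .
qed

text \<open>The total mass is the moment with \<open>k = 0\<close> and \<open>b = 0\<close>, where
  the Gamma values cancel.\<close>

lemma prob_space_weighted_measure:
 assumes "\<alpha> > -1" shows "prob_space (weighted_measure \<alpha> :: (complex ^ 'n) measure)"
proof
 obtain e :: "complex ^ 'n" where e: "norm e = 1" using vector_choose_size[of 1] by auto
 have g: "Gamma (\<alpha> + 1) > 0" "Gamma (real CARD('n) + \<alpha> + 1) > 0" using assms by (intro Gamma_real_pos; simp)+
 have "emeasure (weighted_measure \<alpha>) (space (weighted_measure \<alpha> :: (complex ^ 'n) measure)) = (\<integral>\<^sup>+w. 1 \<partial>(weighted_measure \<alpha> :: (complex ^ 'n) measure))"
  by (subst nn_integral_const) (simp only: mult_1)
 also have "... = (\<integral>\<^sup>+w. ennreal (norm (herm w e) ^ (2 * 0) * tau w powr 0) \<partial>weighted_measure \<alpha>)"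
 proof (rule nn_integral_cong)
  fix w assume "w \<in> space (weighted_measure \<alpha> :: (complex ^ 'n) measure)"
  thus "1 = ennreal (norm (herm w e) ^ (2 * 0) * tau w powr 0)" using tau_pos[of w] by (simp add: less_imp_neq[symmetric])
 qed
 also have "... = 1" using assms g[THEN less_imp_neq] by (subst weighted_moment[OF _ _ e]) auto
 finally show "emeasure (weighted_measure \<alpha>) (space (weighted_measure \<alpha> :: (complex ^ 'n) measure)) = 1" .
qed

text \<open>The measure itself lives on Lebesgue measurable sets. Comparing the images on
  \<open>borel\<close> allows the Borel version of the isometry lemma to be used.\<close>

lemma distr_weighted_measure_isometry:
 fixes T :: "complex ^ 'n => complex ^ 'n"
 assumes \<alpha>: "\<alpha> > -1" and T: "orthogonal_transformation T"
 shows "distr (weighted_measure \<alpha>) borel T = distr (weighted_measure \<alpha>) borel (%x. x)"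
proof (rule measure_eqI)
 have nrm: "norm (T x) = norm x" for x using T by (auto simp: orthogonal_transformation)
 have "linear T" using T by (auto simp: orthogonal_transformation)
 hence [measurable]: "T \<in> borel_measurable borel"
  by (intro borel_measurable_continuous_onI linear_continuous_on) (simp add: linear_conv_bounded_linear)
 have TM[measurable]: "T \<in> weighted_measure \<alpha> \<rightarrow>\<^sub>M borel" by (rule borel_measurable_weighted_measure) simp
 fix A assume "A \<in> sets (distr (weighted_measure \<alpha>) borel T)"
 hence A[measurable]: "A \<in> sets borel" by simp
 have "emeasure (distr (weighted_measure \<alpha>) borel T) A = (\<integral>\<^sup>+w. indicator A w \<partial>(distr (weighted_measure \<alpha>) borel T))" by simp
 also have "... = (\<integral>\<^sup>+w. indicator A (T w) \<partial>weighted_measure \<alpha>)" by (rule nn_integral_distr) auto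
 also have "... = ennreal (Gamma (real CARD('n) + \<alpha> + 1) / (Gamma (\<alpha> + 1) * pi ^ CARD('n))) *
   (\<integral>\<^sup>+w. ennreal (indicator UB (T w) * tau (T w) powr \<alpha>) * indicator A (T w) \<partial>lborel)"
  by (subst nn_integral_weighted_measure[OF \<alpha>]) (auto simp: tau_def nrm indicator_def)
 also have "(\<integral>\<^sup>+w. ennreal (indicator UB (T w) * tau (T w) powr \<alpha>) * indicator A (T w) \<partial>lborel)
   = (\<integral>\<^sup>+w. ennreal (indicator UB w * tau w powr \<alpha>) * indicator A w \<partial>lborel)"
  by (rule nn_integral_lborel_isometry[OF _ T]) measurable
 also have "ennreal (Gamma (real CARD('n) + \<alpha> + 1) / (Gamma (\<alpha> + 1) * pi ^ CARD('n))) * ...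
   = (\<integral>\<^sup>+w. indicator A w \<partial>weighted_measure \<alpha>)" by (subst nn_integral_weighted_measure[OF \<alpha>]) auto
 also have "... = (\<integral>\<^sup>+w. indicator A w \<partial>(distr (weighted_measure \<alpha>) borel (%x. x)))"
  by (rule nn_integral_distr[symmetric]) auto
 also have "... = emeasure (distr (weighted_measure \<alpha>) borel (%x. x)) A" by simp
 finally show "emeasure (distr (weighted_measure \<alpha>) borel T) A = emeasure (distr (weighted_measure \<alpha>) borel (%x. x)) A" .
qed simp

lemma integral_weighted_measure_isometry:
 fixes f :: "complex ^ 'n => 'b::{banach, second_countable_topology}" and T :: "complex ^ 'n => complex ^ 'n"
 assumes \<alpha>: "\<alpha> > -1" and T: "orthogonal_transformation T" and f: "f \<in> borel_measurable borel"
 shows "(\<integral>w. f (T w) \<partial>weighted_measure \<alpha>) = (\<integral>w. f w \<partial>weighted_measure \<alpha>)"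
proof -
 have "linear T" using T by (auto simp: orthogonal_transformation)
 hence "T \<in> borel_measurable borel" by (intro borel_measurable_continuous_onI linear_continuous_on) (simp add: linear_conv_bounded_linear)
 hence TM[measurable]: "T \<in> weighted_measure \<alpha> \<rightarrow>\<^sub>M borel" by (rule borel_measurable_weighted_measure)
 have "(\<integral>w. f (T w) \<partial>weighted_measure \<alpha>) = (\<integral>w. f w \<partial>(distr (weighted_measure \<alpha>) borel T))"
  by (rule integral_distr[symmetric]) (use f in auto)
 also have "... = (\<integral>w. f w \<partial>weighted_measure \<alpha>)"
  unfolding distr_weighted_measure_isometry[OF \<alpha> T] by (rule integral_distr) (use f in auto)
 finally show ?thesis .
qed

lemma borel_measurable_cnj [measurable (raw)]:
 "f \<in> borel_measurable M ==> (%x. cnj (f x)) \<in> borel_measurable M"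
 using measurable_compose[of f M borel cnj] borel_measurable_continuous_onI[OF continuous_on_cnj[OF continuous_on_id]] by simp

section \<open>Moments and orthogonality of powers of a coordinate\<close>

locale bergman =
 fixes \<alpha> :: real and M :: "(complex ^ 'n::finite) measure" and N :: real
 assumes alpha: "\<alpha> > -1" and M_def: "M = weighted_measure \<alpha>" and N_def: "N = real CARD('n) + 1 + \<alpha>"
begin

abbreviation "bmM \<equiv> borel_measurable M"
abbreviation "bmMM \<equiv> borel_measurable (M \<Otimes>\<^sub>M M)"
abbreviation nnE (binder "NN " 10) where "nnE f \<equiv> \<integral>\<^sup>+w. ennreal (f w) \<partial>M"

lemma N_pos: "N > 0" using alpha zero_less_card_finite[where 'a='n] by (simp add: N_def)

lemma N_gt: "N > 1 + \<alpha>" using zero_less_card_finite[where 'a='n] by (simp add: N_def)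

sublocale prob_space M unfolding M_def by (rule prob_space_weighted_measure[OF alpha])

lemma space_M [simp]: "space M = UB" by (simp add: M_def)

lemma borel_measurable_M [measurable (raw)]:
 "f \<in> borel_measurable borel ==> f \<in> bmM" unfolding M_def by (rule borel_measurable_weighted_measure)

lemma measurable_M_id [measurable]: "(%x. x) \<in> M \<rightarrow>\<^sub>M borel" by (simp add: M_def)

definition mom :: "real => nat => real" where
 "mom b k = Gamma N * fact k * Gamma (\<alpha> + b + 1) / (Gamma (\<alpha> + 1) * Gamma (N + real k + b))"

lemma nn_moment:
 assumes b: "\<alpha> + b > -1" and e: "norm (e :: complex ^ 'n) = 1"
 shows "(NN w. norm (herm w e) ^ (2 * k) * tau w powr b) = ennreal (mom b k)"
proof -
 have "N + real k + b = real CARD('n) + real k + \<alpha> + b + 1" "N = real CARD('n) + \<alpha> + 1" by (simp_all add: N_def)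
 thus ?thesis unfolding M_def mom_def using weighted_moment[OF alpha b e, of k] by (simp only:)
qed

lemma mom_pos: assumes "\<alpha> + b > -1" shows "mom b k > 0"
proof -
 have "N + real k + b > 0" using assms N_gt by linarith
 thus ?thesis unfolding mom_def using assms alpha N_pos by (intro divide_pos_pos mult_pos_pos Gamma_real_pos) auto
qed

lemma integrable_moment:
 assumes b: "\<alpha> + b > -1" and e: "norm (e :: complex ^ 'n) = 1"
 shows "integrable M (%w. norm (herm w e) ^ (2 * k) * tau w powr b)"
  and "(LINT w|M. norm (herm w e) ^ (2 * k) * tau w powr b) = mom b k"
proof -
 have "((NN w. norm (herm w e) ^ (2 * k) * tau w powr b) = ennreal (mom b k)) \<longleftrightarrow>
   integrable M (%w. norm (herm w e) ^ (2 * k) * tau w powr b) & (LINT w|M. norm (herm w e) ^ (2 * k) * tau w powr b) = mom b k"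
  using mom_pos[OF b, of k] by (intro nn_integral_eq_integrable) auto
 thus "integrable M (%w. norm (herm w e) ^ (2 * k) * tau w powr b)"
  and "(LINT w|M. norm (herm w e) ^ (2 * k) * tau w powr b) = mom b k" using nn_moment[OF b e, of k] by auto
qed

lemma integrable_tau_powr:
 assumes b: "\<alpha> + b > -1"
 shows "integrable M (%w. tau w powr b)"
proof -
 obtain e :: "complex ^ 'n" where e: "norm e = 1" using vector_choose_size[of 1] by auto
 show ?thesis using integrable_moment(1)[OF b e, of 0] by simp
qed

text \<open>Multiplication by the unimodular scalar \<open>cis (pi / (k - l))\<close> preserves the
  measure and \<open>norm w\<close> but multiplies the integrand by \<open>-1\<close>.\<close>

lemma orthogonal_monomials:
 fixes t :: "real => real"
 assumes e: "norm (e :: complex ^ 'n) = 1" and kl: "k ~= l" and [measurable]: "t \<in> borel_measurable borel"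
 shows "(LINT w|M. of_real (t (norm w)) * (herm w e ^ k * cnj (herm w e) ^ l)) = 0"
proof -
 define c where "c = cis (pi / (real k - real l))"
 have c: "norm c = 1" by (simp add: c_def)
 have "c ^ k * cnj c ^ l = cis (real k * (pi / (real k - real l)) + real l * (- (pi / (real k - real l))))"
  unfolding c_def cis_cnj Complex.DeMoivre cis_mult ..
 also have "real k * (pi / (real k - real l)) + real l * (- (pi / (real k - real l))) = pi * (real k - real l) / (real k - real l)"
  by (simp add: right_diff_distrib diff_divide_distrib mult.commute)
 also have "... = pi" using kl by simp
 finally have ck: "c ^ k * cnj c ^ l = -1" by simp
 define F where "F w = of_real (t (norm w)) * (herm w e ^ k * cnj (herm w e) ^ l)" for w
 have Fm: "F \<in> borel_measurable borel" unfolding F_def by measurable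
 have "F (c *s w) = (c ^ k * cnj c ^ l) * F w" for w unfolding F_def norm_smult herm_smult_left c by (simp add: power_mult_distrib mult_ac)
 hence Fc: "F (c *s w) = - F w" for w by (simp add: ck)
 have "(LINT w|M. F w) = (LINT w|M. F (c *s w))"
  unfolding M_def by (rule integral_weighted_measure_isometry[OF alpha orthogonal_transformation_smult[OF c] Fm, symmetric])
 also have "... = - (LINT w|M. F w)" unfolding Fc by simp
 finally show ?thesis unfolding F_def by simp
qed

text \<open>Parseval's identity for the partial sums, followed by Fatou's lemma. Only the inequality
  is claimed, since upper bounds are all that the estimate of the kernel integrals asks for.\<close>

lemma nn_integral_power_series_le:
 fixes a :: "nat => real"
 assumes e: "norm (e :: complex ^ 'n) = 1" and b: "\<alpha> + b > -1"
  and F: "!!w. w \<in> UB ==> (%k. of_real (a k) * herm w e ^ k) sums F w"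
 shows "(NN w. tau w powr b * (norm (F w))\<^sup>2) <= (\<Sum>k. ennreal ((a k)\<^sup>2 * mom b k))"
proof -
 define P where "P n w = (\<Sum>k<n. of_real (a k) * herm w e ^ k)" for n w
 have Pm[measurable]: "P n \<in> borel_measurable borel" for n unfolding P_def by measurable
 have hb: "norm (herm w e) <= 1" if "w \<in> UB" for w using norm_herm_le[of w e] that e by simp
 have int: "integrable M (%w. complex_of_real (tau w powr b) * (herm w e ^ k * cnj (herm w e) ^ l))" for k l
 proof (rule Bochner_Integration.integrable_bound[OF integrable_tau_powr[OF b]])
  show "AE w in M. norm (complex_of_real (tau w powr b) * (herm w e ^ k * cnj (herm w e) ^ l)) <= norm (tau w powr b)"
   using hb by (intro AE_I2) (auto simp: norm_mult norm_power intro!: mult_left_le mult_le_one power_le_one)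
 qed measurable
 have norms: "(norm (P n w))\<^sup>2 = Re (\<Sum>k<n. \<Sum>l<n. of_real (a k * a l) * (herm w e ^ k * cnj (herm w e) ^ l))" for n w
 proof -
  have "complex_of_real ((norm (P n w))\<^sup>2) = P n w * cnj (P n w)" by (rule complex_norm_square)
  also have "... = (\<Sum>k<n. \<Sum>l<n. of_real (a k * a l) * (herm w e ^ k * cnj (herm w e) ^ l))"
   unfolding P_def cnj_sum sum_product by (intro sum.cong refl) simp
  finally show ?thesis using Re_complex_of_real[of "(norm (P n w))\<^sup>2"] by simp
 qed
 have val: "(LINT w|M. complex_of_real (tau w powr b) * (herm w e ^ k * cnj (herm w e) ^ l)) = (if k = l then of_real (mom b k) else 0)" for k l
 proof (cases "k = l")
  case True
  have "complex_of_real (tau w powr b) * (herm w e ^ k * cnj (herm w e) ^ k) = of_real (norm (herm w e) ^ (2 * k) * tau w powr b)" for w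
  proof -
   have "herm w e ^ k * cnj (herm w e) ^ k = of_real (norm (herm w e) ^ (2 * k))"
    by (simp only: power_mult_distrib[symmetric] complex_norm_square[symmetric] power_mult of_real_power)
   thus ?thesis by simp
  qed
  hence "(LINT w|M. complex_of_real (tau w powr b) * (herm w e ^ k * cnj (herm w e) ^ k)) = of_real (mom b k)"
   by (simp only: integral_complex_of_real integrable_moment(2)[OF b e, of k])
  thus ?thesis using True by simp
 next
  case False
  have "(%r. (1 - r\<^sup>2) powr b) \<in> borel_measurable borel" by measurable
  from orthogonal_monomials[OF e False this] False show ?thesis unfolding tau_def by simp
 qed
 have Pint: "(NN w. tau w powr b * (norm (P n w))\<^sup>2) = (\<Sum>k<n. ennreal ((a k)\<^sup>2 * mom b k))" for n
 proof -
  define G where "G w = (\<Sum>k<n. \<Sum>l<n. of_real (a k * a l) * (complex_of_real (tau w powr b) * (herm w e ^ k * cnj (herm w e) ^ l)))" for w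
  have GRe: "tau w powr b * (norm (P n w))\<^sup>2 = Re (G w)" for w
  proof -
   have "G w = of_real (tau w powr b) * (\<Sum>k<n. \<Sum>l<n. of_real (a k * a l) * (herm w e ^ k * cnj (herm w e) ^ l))"
    unfolding G_def sum_distrib_left by (intro sum.cong refl) (simp add: mult_ac)
   thus ?thesis unfolding norms by simp
  qed
  have iG: "integrable M G" unfolding G_def by (intro Bochner_Integration.integrable_sum integrable_mult_right int)
  have "(LINT w|M. G w) = (\<Sum>k<n. \<Sum>l<n. of_real (a k * a l) * (if k = l then of_real (mom b k) else 0))"
   unfolding G_def by (simp add: Bochner_Integration.integral_sum Bochner_Integration.integrable_sum int val)
  also have "... = (\<Sum>k<n. of_real ((a k)\<^sup>2 * mom b k))"
   by (intro sum.cong refl) (simp add: if_distrib[of "%x. _ * x"] power2_eq_square cong: if_cong)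
  finally have "(LINT w|M. Re (G w)) = (\<Sum>k<n. (a k)\<^sup>2 * mom b k)" using integral_Re[OF iG] by simp
  moreover have "(NN w. Re (G w)) = ennreal (LINT w|M. Re (G w))"
  proof (rule nn_integral_eq_integral)
   show "integrable M (%w. Re (G w))" using iG by (rule integrable_Re)
   show "AE w in M. 0 <= Re (G w)" unfolding GRe[symmetric] by simp
  qed
  ultimately show ?thesis unfolding GRe using mom_pos[OF b] by (simp add: sum_ennreal less_imp_le)
 qed
 have "(NN w. tau w powr b * (norm (F w))\<^sup>2) = (\<integral>\<^sup>+w. liminf (%n. ennreal (tau w powr b * (norm (P n w))\<^sup>2)) \<partial>M)"
 proof (rule nn_integral_cong)
  fix w assume "w \<in> space M"
  hence "(%n. P n w) ----> F w" using F[of w] unfolding sums_def P_def by simp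
  hence "(%n. ennreal (tau w powr b * (norm (P n w))\<^sup>2)) ----> ennreal (tau w powr b * (norm (F w))\<^sup>2)"
   by (intro tendsto_intros)
  thus "ennreal (tau w powr b * (norm (F w))\<^sup>2) = liminf (%n. ennreal (tau w powr b * (norm (P n w))\<^sup>2))"
   by (rule lim_imp_Liminf[OF trivial_limit_sequentially, symmetric])
 qed
 also have "... <= liminf (%n. \<integral>\<^sup>+w. ennreal (tau w powr b * (norm (P n w))\<^sup>2) \<partial>M)"
  by (rule nn_integral_liminf) measurable
 also have "... <= (\<Sum>k. ennreal ((a k)\<^sup>2 * mom b k))"
 proof -
  have "(%n. \<Sum>k<n. ennreal ((a k)\<^sup>2 * mom b k)) ----> (\<Sum>k. ennreal ((a k)\<^sup>2 * mom b k))"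
   by (rule summable_LIMSEQ) (rule summableI)
  thus ?thesis unfolding Pint by (rule eq_refl[OF lim_imp_Liminf[OF trivial_limit_sequentially]])
 qed
 finally show ?thesis .
qed

end

section \<open>Binomial series and the Forelli-Rudin estimate\<close>

lemma binomial_series_complex:
 fixes b :: real and x :: complex
 assumes "norm x < 1"
 shows "(%k. of_real (pochhammer b k / fact k) * x ^ k) sums ((1 - x) powr (- of_real b))"
proof -
 have "((- of_real b :: complex) gchoose k) * (- x) ^ k = of_real (pochhammer b k / fact k) * x ^ k" for k
  unfolding gbinomial_pochhammer by (simp add: power_mult_distrib[symmetric] pochhammer_of_real mult_ac)
 thus ?thesis using gen_binomial_complex[of "- x" "- of_real b"] assms by simp
qed

lemma binomial_series_real:
 fixes b x :: real
 assumes "0 <= x" "x < 1"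
 shows "(%k. pochhammer b k / fact k * x ^ k) sums ((1 - x) powr (- b))"
proof -
 have "(%k. complex_of_real (pochhammer b k / fact k * x ^ k)) sums (complex_of_real ((1 - x) powr (- b)))"
  using binomial_series_complex[of "of_real x" b] assms by (simp add: powr_of_real[of "1 - x" "- b", simplified])
 thus ?thesis by (simp only: sums_of_real_iff)
qed

text \<open>Because \<open>B\<close> is the mean of \<open>A\<close> and \<open>c\<close>, the
  powers of \<open>n\<close> in the product formulas for the reciprocal Gamma function cancel. The
  quotient therefore converges, and a convergent sequence is bounded.\<close>

lemma pochhammer_ratio_bounded:
 fixes A c :: real
 assumes A: "A > 0" and c: "c > 0"
 shows "\<exists>C. \<forall>k. (pochhammer ((A + c) / 2) k)\<^sup>2 <= C * (pochhammer A k * pochhammer c k)"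
proof -
 define B where "B = (A + c) / 2"
 define r where "r n = (rGamma_series B n)\<^sup>2 / (rGamma_series A n * rGamma_series c n)" for n
 have nz: "rGamma A ~= 0" "rGamma c ~= 0" using A c by (simp_all add: rGamma_inverse_Gamma Gamma_eq_zero_iff nonpos_Ints_def)
 hence "r ----> (rGamma B)\<^sup>2 / (rGamma A * rGamma c)"
  unfolding r_def by (intro tendsto_intros rGamma_series_LIMSEQ) auto
 hence "Bseq r" by (rule convergent_imp_Bseq[OF convergentI])
 then obtain C where C: "!!n. norm (r n) <= C" unfolding Bseq_def by auto
 have rr: "r n = (pochhammer B (n + 1))\<^sup>2 / (pochhammer A (n + 1) * pochhammer c (n + 1))" for n
 proof -
  have "exp (B * ln (real n)) * exp (B * ln (real n)) = exp (A * ln (real n)) * exp (c * ln (real n))"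
   by (simp add: exp_add[symmetric] B_def field_simps)
  thus ?thesis unfolding r_def rGamma_series_def by (simp add: power2_eq_square)
 qed
 have pos: "pochhammer A k > 0" "pochhammer c k > 0" for k using A c by (simp_all add: pochhammer_pos)
 have "(pochhammer B k)\<^sup>2 <= max C 1 * (pochhammer A k * pochhammer c k)" for k
 proof (cases k)
  case (Suc n)
  have "(pochhammer B k)\<^sup>2 / (pochhammer A k * pochhammer c k) <= C"
   using C[of n] abs_ge_self[of "r n"] unfolding rr Suc Suc_eq_plus1 real_norm_def by linarith
  also have "C <= max C 1" by simp
  finally show ?thesis using pos by (simp add: divide_le_eq)
 qed simp
 thus ?thesis unfolding B_def by blast
qed

context bergman begin

text \<open>The integrand is the weight times the squared modulus of a binomial series with half the
  exponent, in powers of \<open>herm w e\<close> where \<open>z\<close> has direction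
  \<open>e\<close>. By orthogonality the integral is at most a series in
  \<open>(norm z)\<^sup>2\<close>. The bounded ratio of Pochhammer symbols compares its coefficients
  with those of the binomial series of exponent \<open>c\<close>, which sums to the power of
  \<open>tau z\<close>.\<close>

theorem forelli_rudin:
 assumes b: "\<alpha> + b > -1" and c: "c > 0"
 obtains C where "C > 0"
  "!!z. z \<in> UB ==> (NN w. tau w powr b / norm (1 - herm w z) powr (N + b + c)) <= ennreal (C * tau z powr (- c))"
proof -
 define \<beta> where "\<beta> = (N + b + c) / 2"
 have A: "N + b > 0" using b N_gt by linarith
 obtain C0 where C0: "!!k. (pochhammer \<beta> k)\<^sup>2 <= C0 * (pochhammer (N + b) k * pochhammer c k)"
  using pochhammer_ratio_bounded[OF A c] unfolding \<beta>_def by auto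
 define C where "C = max C0 1 * mom b 0"
 have "C > 0" unfolding C_def using mom_pos[OF b, of 0] by simp
 moreover have "(NN w. tau w powr b / norm (1 - herm w z) powr (N + b + c)) <= ennreal (C * tau z powr (- c))"
  if z: "z \<in> UB" for z
 proof -
  define s where "s = norm z"
  have s: "0 <= s" "s < 1" using z by (auto simp: s_def)
  obtain e :: "complex ^ 'n" where e: "norm e = 1" and ze: "z = s *\<^sub>R e"
  proof (cases "z = 0")
   case True thus ?thesis using that vector_choose_size[of 1] s_def by (metis norm_zero scaleR_zero_left zero_le_one)
  next
   case False thus ?thesis using that[of "z /\<^sub>R norm z"] by (simp add: s_def)
  qed
  define a where "a k = pochhammer \<beta> k / fact k * s ^ k" for k
  define F where "F w = (1 - herm w z) powr (- complex_of_real \<beta>)" for w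
  have hz: "herm w z = of_real s * herm w e" for w by (simp add: ze herm_scaleR_right)
  have "(NN w. tau w powr b / norm (1 - herm w z) powr (N + b + c)) = (NN w. tau w powr b * (norm (F w))\<^sup>2)"
  proof (rule nn_integral_cong)
   fix w assume "w \<in> space M"
   hence "norm (1 - herm w z) > 0" using norm_one_minus_herm_pos[of w z] z by simp
   moreover have "norm (F w) = norm (1 - herm w z) powr (- \<beta>)"
    unfolding F_def using norm_powr_real_powr'[of "- complex_of_real \<beta>" "1 - herm w z"] by simp
   ultimately have "(norm (F w))\<^sup>2 = 1 / norm (1 - herm w z) powr (N + b + c)"
    by (simp add: power2_eq_square \<beta>_def powr_add[symmetric] flip: powr_minus_divide)
   thus "ennreal (tau w powr b / norm (1 - herm w z) powr (N + b + c)) = ennreal (tau w powr b * (norm (F w))\<^sup>2)" by simp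
  qed
  also have "... <= (\<Sum>k. ennreal ((a k)\<^sup>2 * mom b k))"
  proof (rule nn_integral_power_series_le[OF e b])
   fix w :: "complex ^ 'n" assume "w \<in> UB"
   hence "norm (herm w z) < 1" using norm_herm_less_1[of w z] z by simp
   from binomial_series_complex[OF this, of \<beta>]
   show "(%k. complex_of_real (a k) * herm w e ^ k) sums F w" unfolding F_def a_def hz by (simp add: power_mult_distrib mult_ac)
  qed
  also have "... <= (\<Sum>k. ennreal (C * (pochhammer c k / fact k * (s\<^sup>2) ^ k)))"
  proof (rule suminf_le[OF _ summableI summableI])
   fix k
   have Gk: "Gamma (N + real k + b) = pochhammer (N + b) k * Gamma (N + b)"
    using pochhammer_Gamma[of "N + b" k] A by (simp add: nonpos_Ints_def Gamma_eq_zero_iff field_simps add_ac)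
   have mk: "mom b k = mom b 0 * fact k / pochhammer (N + b) k" using A by (simp add: mom_def Gk mult_ac)
   have pp: "pochhammer (N + b) k > 0" using A by (rule pochhammer_pos)
   have cp: "pochhammer c k > 0" using c by (rule pochhammer_pos)
   have "(a k)\<^sup>2 * mom b k = (pochhammer \<beta> k)\<^sup>2 * (mom b 0 / (pochhammer (N + b) k * fact k) * (s\<^sup>2) ^ k)"
    unfolding a_def mk by (simp add: power_mult_distrib power_divide power2_eq_square power_mult[symmetric] mult.commute)
   also have "... <= (max C0 1 * (pochhammer (N + b) k * pochhammer c k)) * (mom b 0 / (pochhammer (N + b) k * fact k) * (s\<^sup>2) ^ k)"
   proof (rule mult_right_mono)
    have "C0 * (pochhammer (N + b) k * pochhammer c k) <= max C0 1 * (pochhammer (N + b) k * pochhammer c k)"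
     using pp cp by (intro mult_right_mono) auto
    thus "(pochhammer \<beta> k)\<^sup>2 <= max C0 1 * (pochhammer (N + b) k * pochhammer c k)" using C0[of k] by linarith
    show "0 <= mom b 0 / (pochhammer (N + b) k * fact k) * (s\<^sup>2) ^ k" using pp mom_pos[OF b, of 0] by simp
   qed
   also have "... = C * (pochhammer c k / fact k * (s\<^sup>2) ^ k)" using pp by (simp add: C_def)
   finally show "ennreal ((a k)\<^sup>2 * mom b k) <= ennreal (C * (pochhammer c k / fact k * (s\<^sup>2) ^ k))" by (rule ennreal_leI)
  qed
  also have "... = ennreal (C * tau z powr (- c))"
  proof -
   have "(%k. C * (pochhammer c k / fact k * (s\<^sup>2) ^ k)) sums (C * (1 - s\<^sup>2) powr (- c))"
    using s by (intro sums_mult binomial_series_real) (auto simp: abs_square_less_1)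
   thus ?thesis using `C > 0` c unfolding tau_def s_def[symmetric]
    by (subst suminf_ennreal2) (auto simp: sums_iff less_imp_le[OF pochhammer_pos])
  qed
  finally show ?thesis .
 qed
 ultimately show ?thesis using that by blast
qed

end

section \<open>Averages over slices and the reproducing formula\<close>

text \<open>A discrete mean value property: the average over the \<open>n\<close>-th roots of unity
  kills the powers from 1 to \<open>n - 1\<close>, and the rest is at most a tail of an absolutely
  convergent series. Finite averages are preferred to circle integrals because each summand is later
  moved by one isometry of the ball.\<close>

lemma roots_of_unity_average:
 fixes h :: "complex => complex"
 assumes hol: "h holomorphic_on ball 0 r" and r: "r > 1"
 shows "(%n. (\<Sum>j<n. h (exp (2 * of_real pi * \<i> * of_nat j / of_nat n))) / of_nat n) ----> h 0"
proof -
 define a where "a k = (deriv ^^ k) h 0 / fact k" for k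
 have h: "(%k. a k * w ^ k) sums h w" if "norm w < r" for w using holomorphic_power_series[OF hol, of w] that by (simp add: a_def)
 have a0: "a 0 = h 0" by (simp add: a_def)
 have sm: "summable (%k. norm (a k))"
 proof -
  define r' where "r' = (1 + r) / 2"
  have r': "1 < r'" "r' < r" using r by (auto simp: r'_def)
  have "summable (%k. a k * of_real r' ^ k)" using sums_summable[OF h[of "of_real r'"]] r' by simp
  hence "summable (%k. norm (a k * 1 ^ k))" by (rule powser_insidea) (use r' in auto)
  thus ?thesis by simp
 qed
 have bound: "norm ((\<Sum>j<n. h (exp (2 * of_real pi * \<i> * of_nat j / of_nat n))) / of_nat n - h 0) <= (\<Sum>k. norm (a (k + n)))"
  if n: "n > 0" for n
 proof -
  define v where "v j = exp (2 * of_real pi * \<i> * of_nat j / of_nat n)" for j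
  have vn: "norm (v j) = 1" for j unfolding v_def by simp
  have p: "(\<Sum>j<n. v j ^ k) = (if k = 0 then of_nat n else 0)" if k: "k < n" for k
  proof (cases "k = 0")
   case False
   have e: "v j ^ k = v k ^ j" for j unfolding v_def by (simp add: exp_of_nat_mult[symmetric] mult_ac)
   have "v k ~= 1" unfolding v_def using complex_root_unity_eq_1[of n k] n False k by (auto dest: dvd_imp_le)
   moreover have "v k ^ n = 1" unfolding v_def by (rule complex_root_unity) (use n in simp)
   ultimately show ?thesis using False by (simp add: e geometric_sum)
  qed simp
  have S: "(\<Sum>j<n. \<Sum>k<n. a k * v j ^ k) = of_nat n * h 0"
  proof -
   have "(\<Sum>j<n. \<Sum>k<n. a k * v j ^ k) = (\<Sum>k<n. a k * (\<Sum>j<n. v j ^ k))" by (subst sum.swap) (simp add: sum_distrib_left)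
   also have "... = (\<Sum>k<n. if k = 0 then of_nat n * h 0 else 0)" by (intro sum.cong) (auto simp: p a0)
   finally show ?thesis using n by simp
  qed
  have tail: "norm (h (v j) - (\<Sum>k<n. a k * v j ^ k)) <= (\<Sum>k. norm (a (k + n)))" for j
  proof -
   have hs: "(%k. a k * v j ^ k) sums h (v j)" using h[of "v j"] vn r by simp
   have "h (v j) - (\<Sum>k<n. a k * v j ^ k) = (\<Sum>k. a (k + n) * v j ^ (k + n))"
    using suminf_split_initial_segment[of "%k. a k * v j ^ k" n] hs by (simp add: sums_iff)
   moreover have "norm (\<Sum>k. a (k + n) * v j ^ (k + n)) <= (\<Sum>k. norm (a (k + n) * v j ^ (k + n)))"
    by (rule summable_norm) (use summable_ignore_initial_segment[OF sm, of n] in \<open>simp add: norm_mult norm_power vn\<close>)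
   ultimately show ?thesis by (simp add: norm_mult norm_power vn)
  qed
  have "(\<Sum>j<n. h (v j)) / of_nat n - h 0 = (\<Sum>j<n. h (v j) - (\<Sum>k<n. a k * v j ^ k)) / of_nat n"
   unfolding sum_subtractf S using n by (simp add: diff_divide_distrib)
  hence "norm ((\<Sum>j<n. h (v j)) / of_nat n - h 0) = norm (\<Sum>j<n. h (v j) - (\<Sum>k<n. a k * v j ^ k)) / real n"
   by (simp add: norm_divide)
  also have "... <= (\<Sum>j<n. \<Sum>k. norm (a (k + n))) / real n" by (intro divide_right_mono order_trans[OF norm_sum] sum_mono tail) simp
  also have "... = (\<Sum>k. norm (a (k + n)))" using n by simp
  finally show ?thesis unfolding v_def .
 qed
 have "(%n. (\<Sum>j<n. h (exp (2 * of_real pi * \<i> * of_nat j / of_nat n))) / of_nat n - h 0) ----> 0"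
 proof (rule Lim_null_comparison)
  show "\<forall>\<^sub>F n in sequentially. norm ((\<Sum>j<n. h (exp (2 * of_real pi * \<i> * of_nat j / of_nat n))) / of_nat n - h 0) <= (\<Sum>k. norm (a (k + n)))"
   using eventually_gt_at_top[of 0] by eventually_elim (rule bound)
  show "(%n. \<Sum>k. norm (a (k + n))) ----> 0" by (rule suminf_exist_split2[OF sm])
 qed
 thus ?thesis by (simp add: LIM_zero_iff)
qed

lemma holomorphic_several_line:
 assumes f: "holomorphic_several f U" and pU: "p + c *s v \<in> U"
 shows "\<exists>d. ((%c. f (p + c *s v)) has_field_derivative d) (at c)"
proof -
 obtain D where D: "(f has_derivative D) (at (p + c *s v))" and Dl: "!!c v. D (c *s v) = c * D v"
  using f pU unfolding holomorphic_several_def by blast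
 have "((%c. p + c *s v) has_derivative (%c. c *s v)) (at c)"
 proof -
  have "bounded_linear (%c :: complex. c *s v)" by (rule bounded_linear_intro[of _ "norm v"])
     (simp_all add: norm_smult vec_eq_iff distrib_right)
  thus ?thesis by (auto intro!: derivative_eq_intros bounded_linear_imp_has_derivative)
 qed
 from has_derivative_compose[OF this D] have "((%c. f (p + c *s v)) has_derivative (%x. D v * x)) (at c)"
  by (simp add: Dl mult.commute)
 thus ?thesis unfolding has_field_derivative_def by blast
qed

lemma holomorphic_several_continuous_on:
 "holomorphic_several f U ==> continuous_on U f" unfolding holomorphic_several_def
 by (meson continuous_at_imp_continuous_on has_derivative_continuous)

context bergman begin

definition ker :: "complex ^ 'n => complex ^ 'n => complex" where
 "ker z w = 1 / (1 - herm z w) powr of_real N"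

lemma ker_measurable [measurable (raw)]:
 "f \<in> borel_measurable X ==> g \<in> borel_measurable X ==> (%x. ker (f x) (g x)) \<in> borel_measurable X" unfolding ker_def
 by (intro borel_measurable_divide powr_complex_measurable borel_measurable_diff borel_measurable_herm borel_measurable_const)

lemma norm_ker: "norm (ker z w) = norm (1 - herm z w) powr (- N)" using norm_powr_real_powr'[of "of_real N" "1 - herm z w"]
 by (simp add: ker_def norm_divide powr_minus_divide)

lemma norm_ker_le: "norm z < 1 ==> norm w <= 1 ==> norm (ker z w) <= (1 - norm z) powr (- N)"
 unfolding norm_ker using norm_one_minus_herm_ge[of w z] N_pos by (intro powr_mono2') auto

lemma ker_cnj: "norm z < 1 ==> norm w <= 1 ==> cnj (ker z w) = ker w z" using Re_one_minus_herm_pos[of z w] unfolding ker_def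
 by (subst complex_cnj_divide, subst cnj_powr) (auto simp: herm_commute[of w z])

lemma ker_series:
 assumes e: "norm e = 1" and s: "0 <= s" "s < 1" and w: "norm w <= 1"
 shows "(%k. of_real (pochhammer N k / fact k * s ^ k) * cnj (herm w e) ^ k) sums ker (s *\<^sub>R e) w"
proof -
 have h: "herm (s *\<^sub>R e) w = of_real s * cnj (herm w e)" by (simp add: herm_scaleR_left herm_commute[of e w])
 have "norm (herm (s *\<^sub>R e) w) < 1" using s e w by (intro norm_herm_less_1) auto
 from binomial_series_complex[OF this, of N] show ?thesis unfolding ker_def h by (simp add: power_mult_distrib powr_minus_divide mult_ac)
qed

lemma summable_pochhammer: "0 <= s ==> s < 1 ==> summable (%k. pochhammer N k / fact k * s ^ k)"
 using binomial_series_real[of s N] by (simp add: sums_iff)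

text \<open>The coefficients of the kernel are the reciprocals of the moments. This is the reason
  why the kernel reproduces.\<close>

lemma pochhammer_mom: "pochhammer N k / fact k * mom 0 k = 1"
proof -
 have "Gamma (N + real k) = pochhammer N k * Gamma N" "Gamma N > 0" "Gamma (\<alpha> + 1) > 0" "pochhammer N k > 0"
  using pochhammer_Gamma[of N k] N_pos alpha by (auto simp: nonpos_Ints_def Gamma_eq_zero_iff field_simps intro: Gamma_real_pos pochhammer_pos)
 thus ?thesis by (simp add: mom_def)
qed

lemma holomorphic_bounded_cball:
 assumes "holomorphic_several f UB" and "R < 1"
 obtains B where "B > 0" "!!w :: complex ^ 'n. norm w <= R ==> norm (f w) <= B"
proof -
 have "compact (f ` cball 0 R)" by (rule compact_continuous_image)
    (use holomorphic_several_continuous_on[OF assms(1)] assms(2) in \<open>auto elim!: continuous_on_subset\<close>)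
 hence "bounded (f ` cball 0 R)" by (rule compact_imp_bounded)
 then obtain B where "B > 0" "!!x. x \<in> f ` cball 0 R ==> norm x <= B" by (auto simp: bounded_pos)
 thus ?thesis by (intro that[of B]) auto
qed

lemma borel_measurable_truncation:
 assumes "holomorphic_several f UB" and "R <= 1"
 shows "(%w :: complex ^ 'n. indicator (ball 0 R) w *\<^sub>R f w) \<in> borel_measurable borel"
 by (rule borel_measurable_continuous_on_indicator)
   (use holomorphic_several_continuous_on[OF assms(1)] assms(2) in \<open>auto elim!: continuous_on_subset\<close>)

lemma integrable_bounded_M:
 fixes g :: "complex ^ 'n => 'b::{banach, second_countable_topology}"
 assumes "g \<in> bmM" "!!w. w \<in> UB ==> norm (g w) <= B"
 shows "integrable M g" by (rule integrable_const_bound[of _ B]) (use assms in auto)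

text \<open>The maps \<open>unit_rot e c\<close> with \<open>c\<close> a root of unity preserve the
  measure and \<open>herm w e\<close>. Averaging over them replaces \<open>f w\<close> in the limit
  by its value at the projection of \<open>w\<close> to the line of \<open>e\<close>, by the
  discrete mean value property. The cutoff at radius \<open>R\<close> keeps \<open>f\<close>
  bounded, so that the limit can be taken under the integral.\<close>

lemma slice_average:
 assumes f: "holomorphic_several f UB" and R: "0 < R" "R < 1" and e: "norm (e :: complex ^ 'n) = 1"
 shows "(LINT w|M. (indicator (ball 0 R) w *\<^sub>R f w) * cnj (herm w e) ^ k)
    = (LINT w|M. indicator (ball 0 R) w *\<^sub>R (f (herm w e *s e) * cnj (herm w e) ^ k))"
proof -
 obtain B where B: "B > 0" "!!w :: complex ^ 'n. norm w <= R ==> norm (f w) <= B" using holomorphic_bounded_cball[OF f R(2)] by blast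
 define G where "G w = (indicator (ball 0 R) w *\<^sub>R f w) * cnj (herm w e) ^ k" for w
 have Gm[measurable]: "G \<in> borel_measurable borel" unfolding G_def using borel_measurable_truncation[OF f less_imp_le[OF R(2)]] by measurable
 have Gb: "norm (G w) <= B" if "w \<in> UB" for w
 proof -
  have "norm (cnj (herm w e) ^ k) <= 1" using norm_herm_le[of w e] that e by (simp add: norm_power power_le_one)
  moreover have "norm (indicator (ball 0 R) w *\<^sub>R f w) <= B" using B(2)[of w] B(1) by (auto simp: indicator_def)
  ultimately show ?thesis unfolding G_def norm_mult using mult_mono[of _ B _ 1] B(1) by auto
 qed
 define v where "v n j = exp (2 * of_real pi * \<i> * of_nat j / of_nat n)" for n j :: nat
 have v: "norm (v n j) = 1" for n j unfolding v_def by simp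
 define A where "A n w = (\<Sum>j<n. G (unit_rot e (v n j) w)) / of_nat n" for n w
 have rot_m[measurable]: "unit_rot e c \<in> borel_measurable borel" for c using linear_unit_rot[of e c]
  by (intro borel_measurable_continuous_onI linear_continuous_on) (simp add: linear_conv_bounded_linear)
 have Gi: "integrable M (%w. G (unit_rot e (v n j) w))" for n j
 proof (rule integrable_bounded_M)
  show "norm (G (unit_rot e (v n j) w)) <= B" if "w \<in> UB" for w using that by (intro Gb) (simp add: norm_unit_rot e v)
 qed measurable
 have Am[measurable]: "A n \<in> borel_measurable borel" for n unfolding A_def by measurable
 have Aint: "(LINT w|M. A n w) = (LINT w|M. G w)" if "n > 0" for n
 proof -
  have "(LINT w|M. G (unit_rot e (v n j) w)) = (LINT w|M. G w)" for j
   unfolding M_def by (rule integral_weighted_measure_isometry[OF alpha orthogonal_transformation_unit_rot[OF e v] Gm])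
  thus ?thesis unfolding A_def using that Gi by (simp add: Bochner_Integration.integral_sum)
 qed
 have lim: "(%n. A n w) ----> indicator (ball 0 R) w *\<^sub>R (f (herm w e *s e) * cnj (herm w e) ^ k)" for w
 proof (cases "norm w < R")
  case True
  define h where "h c = f (unit_rot e c w)" for c
  \<comment> \<open>The radius \<open>1 / R\<close> exceeds 1, as the averaging lemma demands;
    points with \<open>norm w < R\<close> stay inside the ball under these maps.\<close>
  have hol: "h holomorphic_on ball 0 (1 / R)"
  proof (rule holomorphic_onI)
   fix c :: complex assume "c \<in> ball 0 (1 / R)"
   hence c: "norm c * R < 1" using R by (simp add: field_simps)
   have "norm (unit_rot e c w) < 1"
   proof (cases "norm c <= 1")
    case True thus ?thesis using norm_unit_rot_le[OF e True, of w] `norm w < R` R by simp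
   next
    case False
    have "(norm (unit_rot e c w))\<^sup>2 <= (norm c * norm w)\<^sup>2"
    proof -
     have "1 <= (norm c)\<^sup>2" using False by (simp add: one_le_power)
     hence "1 * (norm (herm w e))\<^sup>2 <= (norm c)\<^sup>2 * (norm (herm w e))\<^sup>2" by (intro mult_right_mono) auto
     thus ?thesis unfolding norm_unit_rot_sqr[OF e] by (simp add: right_diff_distrib power_mult_distrib)
    qed
    hence "norm (unit_rot e c w) <= norm c * norm w" by (rule power2_le_imp_le) simp
    also have "... <= norm c * R" using True by (intro mult_left_mono) auto
    finally show ?thesis using c by simp
   qed
   hence "herm w e *s e + c *s (w - herm w e *s e) \<in> UB" by (simp add: unit_rot_def)
   from holomorphic_several_line[OF f this]
   show "h field_differentiable at c within ball 0 (1 / R)"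
    unfolding h_def unit_rot_def field_differentiable_def by (blast intro: has_field_derivative_at_within)
  qed
  have Aeq: "A n w = (\<Sum>j<n. h (v n j)) / of_nat n * cnj (herm w e) ^ k" for n using True unfolding A_def G_def h_def
   by (simp add: norm_unit_rot e v herm_unit_rot sum_distrib_right)
  have "(%n. (\<Sum>j<n. h (v n j)) / of_nat n) ----> h 0"
   unfolding v_def by (rule roots_of_unity_average[OF hol]) (use R in simp)
  hence "(%n. A n w) ----> h 0 * cnj (herm w e) ^ k" unfolding Aeq by (intro tendsto_mult tendsto_const)
  thus ?thesis using True by (simp add: h_def unit_rot_0)
 next
  case False
  hence "A n w = 0" for n unfolding A_def G_def by (simp add: norm_unit_rot e v)
  thus ?thesis using False by simp
 qed
 have "(%n. \<integral>w. A n w \<partial>M) ----> (LINT w|M. indicator (ball 0 R) w *\<^sub>R (f (herm w e *s e) * cnj (herm w e) ^ k))"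
 proof (rule integral_dominated_convergence[where w = "%_. B"])
  show "A n \<in> bmM" for n by measurable
  show "(%w. indicator (ball 0 R) w *\<^sub>R (f (herm w e *s e) * cnj (herm w e) ^ k)) \<in> bmM"
   by (rule borel_measurable_LIMSEQ_metric[of A, OF borel_measurable_M[OF Am] lim])
  show "AE w in M. (%n. A n w) ----> indicator (ball 0 R) w *\<^sub>R (f (herm w e *s e) * cnj (herm w e) ^ k)"
   using lim by simp
  show "AE w in M. norm (A n w) <= B" for n
  proof (rule AE_I2)
   fix w assume "w \<in> space M"
   have "norm (\<Sum>j<n. G (unit_rot e (v n j) w)) <= (\<Sum>j<n. B)"
    by (intro order_trans[OF norm_sum] sum_mono Gb) (use `w \<in> space M` in \<open>simp add: norm_unit_rot e v\<close>)
   thus "norm (A n w) <= B" unfolding A_def using B(1) by (cases "n = 0") (simp_all add: norm_divide divide_le_eq mult.commute)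
  qed
 qed simp
 moreover have "(%n. \<integral>w. A n w \<partial>M) ----> (LINT w|M. G w)"
  by (rule tendsto_eventually) (use Aint in \<open>auto intro: eventually_mono[OF eventually_gt_at_top[of 0]]\<close>)
 ultimately have "(LINT w|M. indicator (ball 0 R) w *\<^sub>R (f (herm w e *s e) * cnj (herm w e) ^ k)) = (LINT w|M. G w)" by (rule LIMSEQ_unique)
 thus ?thesis unfolding G_def by (rule sym)
qed

text \<open>By orthogonality only the \<open>k\<close>-th Taylor term of \<open>g\<close> survives.
  The cutoff is radial, so it does not disturb the orthogonality and enters only through the
  truncated moment.\<close>

lemma slice_coefficient:
 assumes g: "g holomorphic_on UB" and R: "0 < R" "R < 1" and e: "norm (e :: complex ^ 'n) = 1"
 shows "(LINT w|M. indicator (ball 0 R) w *\<^sub>R (g (herm w e) * cnj (herm w e) ^ k))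
    = ((deriv ^^ k) g 0 / fact k) * of_real (LINT w|M. indicator (ball 0 R) w * norm (herm w e) ^ (2 * k))"
proof -
 define a where "a k = (deriv ^^ k) g 0 / fact k" for k
 have ga: "(%k. a k * x ^ k) sums g x" if "norm x < 1" for x using holomorphic_power_series[OF g, of x] that by (simp add: a_def)
 have sm: "summable (%k. norm (a k * of_real R ^ k))"
 proof -
  define R' where "R' = (1 + R) / 2"
  have R': "R < R'" "R' < 1" using R by (auto simp: R'_def)
  have "summable (%k. a k * of_real R' ^ k)" using sums_summable[OF ga[of "of_real R'"]] R' R by simp
  thus ?thesis by (rule powser_insidea) (use R' R in auto)
 qed
 define C where "C = (\<Sum>k. norm (a k * of_real R ^ k))"
 define P where "P n w = indicator (ball 0 R) w *\<^sub>R ((\<Sum>j<n. a j * herm w e ^ j) * cnj (herm w e) ^ k)" for n and w :: "complex ^ 'n"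
 have Pb: "norm (P n w) <= C" for n w
 proof (cases "norm w < R")
  case True
  have h: "norm (herm w e) <= R" using norm_herm_le[of w e] e True by simp
  have "norm (\<Sum>j<n. a j * herm w e ^ j) <= (\<Sum>j<n. norm (a j * of_real R ^ j))"
   by (intro order_trans[OF norm_sum] sum_mono) (use h R in \<open>simp add: norm_mult norm_power mult_left_mono power_mono\<close>)
  also have "... <= C" unfolding C_def by (rule sum_le_suminf[OF sm]) auto
  finally have "norm (\<Sum>j<n. a j * herm w e ^ j) * norm (cnj (herm w e) ^ k) <= C * 1"
   by (intro mult_mono) (use h R in \<open>auto simp: norm_power power_le_one C_def intro!: suminf_nonneg[OF sm]\<close>)
  thus ?thesis using True by (simp add: P_def norm_mult)
 next
  case False thus ?thesis using suminf_nonneg[OF sm] by (simp add: P_def C_def)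
 qed
 have Pm[measurable]: "P n \<in> borel_measurable borel" for n unfolding P_def by measurable
 have lim: "(%n. P n w) ----> indicator (ball 0 R) w *\<^sub>R (g (herm w e) * cnj (herm w e) ^ k)" for w
 proof (cases "norm w < R")
  case True
  have "norm (herm w e) < 1" using norm_herm_le[of w e] e True R by simp
  from ga[OF this] show ?thesis unfolding P_def sums_def by (intro tendsto_intros)
 next
  case False thus ?thesis by (simp add: P_def)
 qed
 have ic: "integrable M (%w. indicator (ball 0 R) w * norm (herm w e) ^ (2 * k))" for k
 proof (rule integrable_bounded_M[of _ 1])
  show "norm (indicator (ball 0 R) w * norm (herm w e) ^ (2 * k)) <= 1" if "w \<in> UB" for w
   using norm_herm_le[of w e] that e by (auto simp: indicator_def power_le_one)
 qed measurable
 have Pint: "(LINT w|M. P n w) = (\<Sum>j<n. if j = k then a k * of_real (LINT w|M. indicator (ball 0 R) w * norm (herm w e) ^ (2 * k)) else 0)" for n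
 proof -
  define Q where "Q j w = complex_of_real (indicator {..<R} (norm w)) * (herm w e ^ j * cnj (herm w e) ^ k)" for j and w :: "complex ^ 'n"
  have i: "(indicator {..<R} (norm w) :: real) = indicator (ball 0 R) w" for w :: "complex ^ 'n" by (simp add: indicator_def)
  have Qi: "integrable M (Q j)" for j
  proof (rule integrable_bounded_M[of _ 1])
   show "norm (Q j w) <= 1" if "w \<in> UB" for w
    using norm_herm_le[of w e] that e by (auto simp: Q_def indicator_def norm_mult norm_power intro!: mult_le_one power_le_one)
  qed (unfold Q_def, measurable)
  have "P n w = (\<Sum>j<n. a j * Q j w)" for w unfolding P_def Q_def i by (simp add: sum_distrib_left sum_distrib_right scaleR_conv_of_real mult_ac)
  hence "(LINT w|M. P n w) = (\<Sum>j<n. a j * (LINT w|M. Q j w))" using Qi by (simp add: Bochner_Integration.integral_sum)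
  also have "... = (\<Sum>j<n. if j = k then a k * of_real (LINT w|M. indicator (ball 0 R) w * norm (herm w e) ^ (2 * k)) else 0)"
  proof (intro sum.cong refl)
   fix j
   show "a j * (LINT w|M. Q j w) = (if j = k then a k * of_real (LINT w|M. indicator (ball 0 R) w * norm (herm w e) ^ (2 * k)) else 0)"
   proof (cases "j = k")
    case True
    have "Q k w = of_real (indicator (ball 0 R) w * norm (herm w e) ^ (2 * k))" for w
    proof -
     have "herm w e ^ k * cnj (herm w e) ^ k = of_real (norm (herm w e) ^ (2 * k))"
      by (simp only: power_mult_distrib[symmetric] complex_norm_square[symmetric] power_mult of_real_power)
     thus ?thesis by (simp add: Q_def i)
    qed
    hence "(LINT w|M. Q k w) = of_real (LINT w|M. indicator (ball 0 R) w * norm (herm w e) ^ (2 * k))" by (simp only: integral_complex_of_real)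
    thus ?thesis using True by simp
   next
    case False
    have "(LINT w|M. Q j w) = 0" unfolding Q_def by (rule orthogonal_monomials[OF e False]) measurable
    thus ?thesis using False by simp
   qed
  qed
  finally show ?thesis .
 qed
 have "(%n. \<integral>w. P n w \<partial>M) ----> (LINT w|M. indicator (ball 0 R) w *\<^sub>R (g (herm w e) * cnj (herm w e) ^ k))"
 proof (rule integral_dominated_convergence[where w = "%_. C"])
  show "(%w. indicator (ball 0 R) w *\<^sub>R (g (herm w e) * cnj (herm w e) ^ k)) \<in> bmM"
   by (rule borel_measurable_LIMSEQ_metric[of P, OF borel_measurable_M[OF Pm] lim])
 qed (use lim Pb in auto)
 moreover have "(%n. \<integral>w. P n w \<partial>M) ----> a k * of_real (LINT w|M. indicator (ball 0 R) w * norm (herm w e) ^ (2 * k))"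
  unfolding Pint by (rule tendsto_eventually, rule eventually_mono[OF eventually_gt_at_top[of k]]) auto
 ultimately show ?thesis unfolding a_def by (rule LIMSEQ_unique)
qed

text \<open>The kernel is expanded in powers of the conjugate of \<open>herm w e\<close>, where
  \<open>z\<close> has direction \<open>e\<close>. On the ball of radius \<open>R\<close> each term
  integrates to a Taylor coefficient of \<open>f\<close> along the line times a truncated moment. As
  \<open>R\<close> tends to 1 the moments become complete and cancel the kernel coefficients, which
  leaves the Taylor series of \<open>f\<close> at \<open>z\<close>. The detour over \<open>R\<close>
  is due to \<open>f\<close> being merely integrable.\<close>

theorem reproducing:
 assumes f: "holomorphic_several f UB" and int: "integrable M f" and z: "z \<in> UB"
 shows "(LINT w|M. f w * ker z w) = f z"
proof -
 define s where "s = norm z"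
 have s: "0 <= s" "s < 1" using z by (auto simp: s_def)
 obtain e :: "complex ^ 'n" where e: "norm e = 1" and ze: "z = s *\<^sub>R e"
 proof (cases "z = 0")
  case True thus ?thesis using that vector_choose_size[of 1] s_def by (metis norm_zero scaleR_zero_left zero_le_one)
 next
  case False thus ?thesis using that[of "z /\<^sub>R norm z"] by (simp add: s_def)
 qed
 define g where "g c = f (c *s e)" for c
 have gh: "g holomorphic_on UB"
 proof (rule holomorphic_onI)
  fix c :: complex assume "c \<in> UB"
  hence "0 + c *s e \<in> UB" by (simp add: norm_smult e)
  from holomorphic_several_line[OF f this]
  show "g field_differentiable at c within UB" unfolding g_def field_differentiable_def by (auto intro: has_field_derivative_at_within)
 qed
 define a where "a k = (deriv ^^ k) g 0 / fact k" for k
 have ga: "(%k. a k * x ^ k) sums g x" if "norm x < 1" for x using holomorphic_power_series[OF gh, of x] that by (simp add: a_def)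
 define c where "c k = pochhammer N k / fact k * s ^ k" for k
 have cpos: "c k >= 0" for k unfolding c_def using s N_pos by (simp add: less_imp_le[OF pochhammer_pos])
 have csm: "summable c" unfolding c_def by (rule summable_pochhammer[OF s])
 define m where "m R k = (LINT w|M. indicator (ball 0 R) w * norm (herm w e) ^ (2 * k))" for R k
 have ic: "integrable M (%w. indicator (ball 0 R) w * norm (herm w e) ^ (2 * k))" for R k
 proof (rule integrable_bounded_M[of _ 1])
  show "norm (indicator (ball 0 R) w * norm (herm w e) ^ (2 * k)) <= 1" if "w \<in> UB" for w
   using norm_herm_le[of w e] that e by (auto simp: indicator_def power_le_one)
 qed measurable
 have mom0: "integrable M (%w. norm (herm w e) ^ (2 * k))" "(LINT w|M. norm (herm w e) ^ (2 * k)) = mom 0 k" for k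
 proof -
  have a0: "\<alpha> + 0 > -1" using alpha by simp
  show "integrable M (%w. norm (herm w e) ^ (2 * k))"
  proof (rule integrable_bounded_M[of _ 1])
   show "norm (norm (herm w e) ^ (2 * k)) <= 1" if "w \<in> UB" for w using norm_herm_le[of w e] that e by (auto simp: power_le_one)
  qed measurable
  have "(LINT w|M. norm (herm w e) ^ (2 * k)) = (LINT w|M. norm (herm w e) ^ (2 * k) * tau w powr 0)"
   by (intro Bochner_Integration.integral_cong) (auto simp: less_imp_neq[OF tau_pos', symmetric])
  thus "(LINT w|M. norm (herm w e) ^ (2 * k)) = mom 0 k" using integrable_moment(2)[OF a0 e, of k] by simp
 qed
 have m_le: "0 <= m R k" "m R k <= mom 0 k" for R k
 proof -
  show "0 <= m R k" unfolding m_def by (rule Bochner_Integration.integral_nonneg) simp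
  show "m R k <= mom 0 k" unfolding m_def mom0(2)[symmetric] by (rule integral_mono[OF ic mom0(1)]) (simp add: indicator_def)
 qed
 have sumR: "(%k. of_real (c k) * (a k * of_real (m R k))) sums (LINT w|M. (indicator (ball 0 R) w *\<^sub>R f w) * ker z w)"
  if R: "0 < R" "R < 1" for R
 proof -
  obtain B where B: "B > 0" "!!w :: complex ^ 'n. norm w <= R ==> norm (f w) <= B" using holomorphic_bounded_cball[OF f R(2)] by blast
  define F where "F w = indicator (ball 0 R) w *\<^sub>R f w" for w :: "complex ^ 'n"
  have Fm[measurable]: "F \<in> borel_measurable borel" unfolding F_def using borel_measurable_truncation[OF f less_imp_le[OF R(2)]] .
  have Fb: "norm (F w) <= B" for w using B(2)[of w] B(1) by (auto simp: F_def indicator_def)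
  define P where "P n w = F w * (\<Sum>k<n. of_real (c k) * cnj (herm w e) ^ k)" for n w
  have hb: "norm (cnj (herm w e) ^ k) <= 1" if "w \<in> UB" for w k using norm_herm_le[of w e] that e by (simp add: norm_power power_le_one)
  have Pb: "norm (P n w) <= B * (\<Sum>k. c k)" if "w \<in> UB" for n w
  proof -
   have "norm (\<Sum>k<n. of_real (c k) * cnj (herm w e) ^ k) <= (\<Sum>k<n. c k)"
    by (intro order_trans[OF norm_sum] sum_mono) (use cpos hb[OF that] in \<open>auto simp: norm_mult intro!: mult_left_le\<close>)
   also have "... <= (\<Sum>k. c k)" by (rule sum_le_suminf[OF csm]) (use cpos in auto)
   finally show ?thesis unfolding P_def norm_mult using Fb[of w] B(1) by (intro mult_mono) auto
  qed
  have Pm[measurable]: "P n \<in> borel_measurable borel" for n unfolding P_def by measurable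
  have lim: "(%n. P n w) ----> F w * ker z w" if "w \<in> UB" for w
   using ker_series[OF e s, of w] that unfolding P_def sums_def c_def ze by (intro tendsto_intros) auto
  have Fi: "integrable M (%w. F w * cnj (herm w e) ^ k)" for k
  proof (rule integrable_bounded_M[of _ B])
   show "norm (F w * cnj (herm w e) ^ k) <= B" if "w \<in> UB" for w unfolding norm_mult using mult_mono[OF Fb[of w] hb[OF that, of k]] B(1) by simp
  qed measurable
  have "(LINT w|M. P n w) = (\<Sum>k<n. of_real (c k) * (a k * of_real (m R k)))" for n
  proof -
   have "P n w = (\<Sum>k<n. of_real (c k) * (F w * cnj (herm w e) ^ k))" for w by (simp add: P_def sum_distrib_left mult_ac)
   hence "(LINT w|M. P n w) = (\<Sum>k<n. of_real (c k) * (LINT w|M. F w * cnj (herm w e) ^ k))"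
    using Fi by (simp add: Bochner_Integration.integral_sum)
   moreover have "(LINT w|M. F w * cnj (herm w e) ^ k) = a k * of_real (m R k)" for k unfolding F_def slice_average[OF f R e]
    using slice_coefficient[OF gh R e, of k] by (simp add: g_def a_def m_def)
   ultimately show ?thesis by simp
  qed
  moreover have "(%n. \<integral>w. P n w \<partial>M) ----> (LINT w|M. F w * ker z w)"
   by (rule integral_dominated_convergence[where w = "%_. B * (\<Sum>k. c k)"]) (use lim Pb in auto)
  ultimately show ?thesis unfolding sums_def F_def by simp
 qed
 define R where "R j = 1 - 1 / (real j + 2)" for j
 have R: "0 < R j" "R j < 1" for j by (auto simp: R_def field_simps)
 have Rlim: "R ----> 1" unfolding R_def by real_asymp
 have ev: "\<forall>\<^sub>F j in sequentially. indicator (ball 0 (R j)) w = (1 :: real)" if "w \<in> UB" for w :: "complex ^ 'n"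
  using order_tendstoD(1)[OF Rlim, of "norm w"] that by (auto elim!: eventually_mono)
 have 1: "(%j. \<integral>w. (indicator (ball 0 (R j)) w *\<^sub>R f w) * ker z w \<partial>M) ----> (LINT w|M. f w * ker z w)"
 proof (rule integral_dominated_convergence[where w = "%w. norm (f w) * (1 - s) powr (- N)"])
  show "AE w in M. (%j. (indicator (ball 0 (R j)) w *\<^sub>R f w) * ker z w) ----> f w * ker z w"
  proof (rule AE_I2)
   fix w assume "w \<in> space M"
   thus "(%j. (indicator (ball 0 (R j)) w *\<^sub>R f w) * ker z w) ----> f w * ker z w"
    using ev[of w] by (auto intro!: tendsto_eventually elim!: eventually_mono)
  qed
  show "AE w in M. norm ((indicator (ball 0 (R j)) w *\<^sub>R f w) * ker z w) <= norm (f w) * (1 - s) powr (- N)" for j using norm_ker_le[of z] z s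
   by (intro AE_I2) (auto simp: s_def norm_mult indicator_def intro!: mult_left_mono)
  have [measurable]: "f \<in> bmM" using int by simp
  show "(%w. (indicator (ball 0 (R j)) w *\<^sub>R f w) * ker z w) \<in> bmM" for j by measurable
  show "(%w. f w * ker z w) \<in> bmM" by measurable
  show "integrable M (%w. norm (f w) * (1 - s) powr (- N))" using int by simp
 qed
 have mlim: "(%j. m (R j) k) ----> mom 0 k" for k unfolding m_def mom0(2)[symmetric]
 proof (rule integral_dominated_convergence[where w = "%w. norm (herm w e) ^ (2 * k)"])
  show "AE w in M. (%j. indicator (ball 0 (R j)) w * norm (herm w e) ^ (2 * k)) ----> norm (herm w e) ^ (2 * k)"
  proof (rule AE_I2)
   fix w assume "w \<in> space M"
   thus "(%j. indicator (ball 0 (R j)) w * norm (herm w e) ^ (2 * k)) ----> norm (herm w e) ^ (2 * k)"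
    using ev[of w] by (auto intro!: tendsto_eventually elim!: eventually_mono)
  qed
 qed (use mom0(1) in \<open>auto simp: indicator_def\<close>)
 have cm: "c k * mom 0 k = s ^ k" for k
 proof -
  have "c k * mom 0 k = (pochhammer N k / fact k * mom 0 k) * s ^ k" unfolding c_def by (simp only: mult_ac)
  thus ?thesis unfolding pochhammer_mom by simp
 qed
 have asm: "summable (%k. norm (a k * of_real s ^ k))"
 proof -
  define s' where "s' = (1 + s) / 2"
  have s': "s < s'" "s' < 1" using s by (auto simp: s'_def)
  have "summable (%k. a k * of_real s' ^ k)" using sums_summable[OF ga[of "of_real s'"]] s' s by simp
  thus ?thesis by (rule powser_insidea) (use s' s in auto)
 qed
 \<comment> \<open>Tannery's theorem: truncated moments are at most the full ones, so every term is
   dominated by the absolutely convergent Taylor series at \<open>s\<close>.\<close>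
 have "(%j. \<Sum>k. of_real (c k) * (a k * of_real (m (R j) k))) ----> (\<Sum>k. of_real (c k) * (a k * of_real (mom 0 k)))"
 proof (rule conjunct2[OF conjunct2[OF tannerys_theorem[where M = "%k. norm (a k * of_real s ^ k)"]]])
  show "(%j. complex_of_real (c k) * (a k * of_real (m (R j) k))) ----> of_real (c k) * (a k * of_real (mom 0 k))" for k
   by (intro tendsto_intros mlim)
  show "\<forall>\<^sub>F (k, n) in sequentially \<times>\<^sub>F sequentially. norm (complex_of_real (c k) * (a k * of_real (m (R n) k))) <= norm (a k * of_real s ^ k)"
  proof (rule always_eventually, safe)
   fix k j
   have "c k * m (R j) k <= c k * mom 0 k" by (intro mult_left_mono m_le cpos)
   hence "norm (a k) * (c k * m (R j) k) <= norm (a k) * s ^ k" unfolding cm by (intro mult_left_mono) auto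
   thus "norm (complex_of_real (c k) * (a k * of_real (m (R j) k))) <= norm (a k * of_real s ^ k)"
    using cpos[of k] m_le(1)[of "R j" k] s by (simp add: norm_mult norm_power mult_ac)
  qed
 qed (use asm in auto)
 moreover have "(\<Sum>k. of_real (c k) * (a k * of_real (m (R j) k))) = (LINT w|M. (indicator (ball 0 (R j)) w *\<^sub>R f w) * ker z w)" for j
  using sumR[OF R] by (simp add: sums_iff)
 moreover have "(\<Sum>k. of_real (c k) * (a k * of_real (mom 0 k))) = f z"
 proof -
  have eq: "of_real (c k) * (a k * of_real (mom 0 k)) = a k * of_real s ^ k" for k
  proof -
   have "of_real (c k) * (a k * of_real (mom 0 k)) = a k * of_real (c k * mom 0 k)" by (simp add: mult_ac)
   thus ?thesis unfolding cm by simp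
  qed
  have "g (of_real s) = f z" by (simp add: g_def ze scaleR_eq_smult)
  thus ?thesis unfolding eq using ga[of "of_real s"] s by (simp add: sums_iff)
 qed
 ultimately have "(%j. \<integral>w. (indicator (ball 0 (R j)) w *\<^sub>R f w) * ker z w \<partial>M) ----> f z" by simp
 with 1 show ?thesis by (rule LIMSEQ_unique)
qed

end

section \<open>Norms of \<open>p\<close>-integrable functions\<close>

text \<open>Convexity of the \<open>p\<close>-th power at the combination of \<open>a / l\<close>
  and \<open>b / (1 - l)\<close> with weights \<open>l\<close> and \<open>1 - l\<close>. The free
  weight is what yields Minkowski's inequality with constant one.\<close>

lemma add_powr_le_weighted:
 fixes a b :: real
 assumes p: "1 < p" and l: "0 < l" "l < 1" and ab: "0 <= a" "0 <= b"
 shows "(a + b) powr p <= l powr (1 - p) * a powr p + (1 - l) powr (1 - p) * b powr p"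
proof -
 have one: "1 <= l powr (1 - p)" "1 <= (1 - l) powr (1 - p)" using powr_mono2'[of "1 - p" l 1] powr_mono2'[of "1 - p" "1 - l" 1] p l by auto
 consider "a = 0" | "b = 0" | "a > 0" "b > 0" using ab by linarith
 thus ?thesis
 proof cases
  case 1 thus ?thesis using mult_right_mono[OF one(2), of "b powr p"] p by simp
 next
  case 2 thus ?thesis using mult_right_mono[OF one(1), of "a powr p"] p by simp
 next
  case 3
  have "(l *\<^sub>R (a / l) + (1 - l) *\<^sub>R (b / (1 - l))) powr p <= l * (a / l) powr p + (1 - l) * (b / (1 - l)) powr p"
   using convex_onD[OF powr_convex[of p], of "1 - l" "a / l" "b / (1 - l)"] p l 3 by simp
  moreover have "l * (a / l) powr p = l powr (1 - p) * a powr p" using l 3 by (simp add: powr_divide powr_diff)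
  moreover have "(1 - l) * (b / (1 - l)) powr p = (1 - l) powr (1 - p) * b powr p" using l 3 by (simp add: powr_divide powr_diff)
  ultimately show ?thesis using l by simp
 qed
qed

lemma add_powr_le:
 fixes a b :: real
 assumes "1 < p" "0 <= a" "0 <= b"
 shows "(a + b) powr p <= 2 powr p * (a powr p + b powr p)"
proof -
 have "(a + b) powr p <= (1/2) powr (1 - p) * a powr p + (1 - 1/2) powr (1 - p) * b powr p" by (rule add_powr_le_weighted) (use assms in auto)
 also have "... = (1/2) powr (1 - p) * (a powr p + b powr p)" by (simp add: distrib_left)
 also have "(1/2 :: real) powr (1 - p) = 2 powr (p - 1)" by (simp add: powr_divide powr_diff)
 also have "2 powr (p - 1) * (a powr p + b powr p) <= 2 powr p * (a powr p + b powr p)" by (intro mult_right_mono powr_mono) auto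
 finally show ?thesis .
qed

text \<open>Young's inequality applied to \<open>f / A\<close> and \<open>g / B\<close>. Bounds
  \<open>A\<close> and \<open>B\<close> stand in place of norms, so that no integral has to be known
  finite beforehand; if one bound is 0, the product vanishes almost everywhere.\<close>

lemma nn_Holder:
 fixes f g :: "'a => real"
 assumes pq: "p > 1" "q > 1" "1/p + 1/q = 1"
  and [measurable]: "f \<in> borel_measurable X" "g \<in> borel_measurable X"
  and pos: "!!x. x \<in> space X ==> 0 <= f x" "!!x. x \<in> space X ==> 0 <= g x"
  and A: "A >= 0" "(\<integral>\<^sup>+x. ennreal (f x powr p) \<partial>X) <= ennreal (A powr p)"
  and B: "B >= 0" "(\<integral>\<^sup>+x. ennreal (g x powr q) \<partial>X) <= ennreal (B powr q)"
 shows "(\<integral>\<^sup>+x. ennreal (f x * g x) \<partial>X) <= ennreal (A * B)"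
proof -
 have ae0: "AE x in X. h x = 0" if "(\<integral>\<^sup>+x. ennreal (h x powr r) \<partial>X) <= ennreal (0 powr r)" "h \<in> borel_measurable X" for h :: "'a => real" and r
 proof -
  have "(\<integral>\<^sup>+x. ennreal (h x powr r) \<partial>X) = 0" using that by simp
  hence "AE x in X. ennreal (h x powr r) = 0" by (subst (asm) nn_integral_0_iff_AE) (use that in auto)
  thus ?thesis by eventually_elim (auto simp: ennreal_eq_0_iff dest: antisym)
 qed
 consider "A = 0" | "B = 0" | "A > 0" "B > 0" using A B by linarith
 thus ?thesis
 proof cases
  case 1
  have "AE x in X. ennreal (f x * g x) = 0" using ae0[of f p] A 1 by auto
  thus ?thesis by (subst nn_integral_cong_AE[where v = "%_. 0"]) auto
 next
  case 2
  have "AE x in X. ennreal (f x * g x) = 0" using ae0[of g q] B 2 by auto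
  thus ?thesis by (subst nn_integral_cong_AE[where v = "%_. 0"]) auto
 next
  case 3
  have "(\<integral>\<^sup>+x. ennreal (f x * g x) \<partial>X) <= (\<integral>\<^sup>+x. ennreal (A * B / (p * A powr p)) * ennreal (f x powr p) + ennreal (A * B / (q * B powr q)) * ennreal (g x powr q) \<partial>X)"
  proof (rule nn_integral_mono)
   fix x assume x: "x \<in> space X"
   have "f x * g x = A * B * ((f x / A) * (g x / B))" using 3 by simp
   also have "... <= A * B * ((f x / A) powr p / p + (g x / B) powr q / q)" using 3 pos[OF x] by (intro mult_left_mono Youngs_inequality[OF pq]) auto
   also have "... = A * B / (p * A powr p) * f x powr p + A * B / (q * B powr q) * g x powr q"
    using 3 pos[OF x] by (simp add: powr_divide distrib_left mult_ac)
   finally have "ennreal (f x * g x) <= ennreal (A * B / (p * A powr p) * f x powr p + A * B / (q * B powr q) * g x powr q)" by (rule ennreal_leI)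
   also have "... = ennreal (A * B / (p * A powr p)) * ennreal (f x powr p) + ennreal (A * B / (q * B powr q)) * ennreal (g x powr q)"
    using 3 pq by (simp add: ennreal_mult[symmetric] ennreal_plus[symmetric] del: ennreal_plus)
   finally show "ennreal (f x * g x) <= ..." .
  qed
  also have "... = ennreal (A * B / (p * A powr p)) * (\<integral>\<^sup>+x. ennreal (f x powr p) \<partial>X) + ennreal (A * B / (q * B powr q)) * (\<integral>\<^sup>+x. ennreal (g x powr q) \<partial>X)"
   by (subst nn_integral_add) (auto simp: nn_integral_cmult)
  also have "... <= ennreal (A * B / (p * A powr p)) * ennreal (A powr p) + ennreal (A * B / (q * B powr q)) * ennreal (B powr q)"
   by (intro add_mono mult_left_mono A B) auto
  also have "... = ennreal (A * B / p + A * B / q)" using 3 pq by (simp add: ennreal_mult[symmetric] ennreal_plus[symmetric] del: ennreal_plus)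
  also have "A * B / p + A * B / q = A * B * (1/p + 1/q)" by (simp add: distrib_left)
  finally show ?thesis using pq by simp
 qed
qed

locale bergman_space = bergman \<alpha> M N
 for \<alpha> :: real and M :: "(complex ^ 'n::finite) measure" and N :: real +
 fixes p q :: real
 assumes p: "1 < p" and q_def: "q = conj_exponent p"
begin

lemma q: "1 < q" using p by (simp add: q_def conj_exponent_def)
lemma pq: "1 / p + 1 / q = 1" using p by (simp add: q_def conj_exponent_def field_simps)
lemma conj_exponent_q: "conj_exponent q = p" using p by (simp add: q_def conj_exponent_def field_simps)
lemma p_div_q: "p / q = p - 1" using p by (simp add: q_def conj_exponent_def)

abbreviation nrm :: "(complex ^ 'n => complex) => real" where "nrm f \<equiv> Lp_norm p \<alpha> f"
abbreviation LP :: "(complex ^ 'n => complex) set" where "LP \<equiv> Lp p \<alpha>"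
abbreviation AP :: "(complex ^ 'n => complex) set" where "AP \<equiv> Ap p \<alpha>"

text \<open>The \<open>p\<close>-th power of the norm as an extended integral. It makes sense before
  membership in \<open>LP\<close> is known, and it adds up over families.\<close>

definition pw :: "(complex ^ 'n => complex) => ennreal" where
 "pw f = (NN z. norm (f z) powr p)"

lemma nrm_nonneg [simp]: "0 <= nrm f" by (simp add: Lp_norm_def)

lemma LP_measurable [measurable_dest]: "f \<in> LP ==> f \<in> bmM" by (simp add: Lp_def M_def)

lemma pw_LP: "f \<in> LP ==> pw f = ennreal (nrm f powr p)"
proof -
 assume f: "f \<in> LP"
 hence "integrable M (%z. norm (f z) powr p)" by (simp add: Lp_def M_def)
 hence "pw f = ennreal (LINT z|M. norm (f z) powr p)" unfolding pw_def by (intro nn_integral_eq_integral) auto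
 moreover have "nrm f powr p = (LINT z|M. norm (f z) powr p)" using p by (simp add: Lp_norm_def M_def[symmetric] powr_powr powr_one)
 ultimately show ?thesis by simp
qed

lemma LP_I:
 assumes "f \<in> bmM" and "c >= 0" and le: "pw f <= ennreal (c powr p)"
 shows "f \<in> LP" "nrm f <= c"
proof -
 have [measurable]: "f \<in> bmM" by fact
 have "integrable M (%z. norm (f z) powr p)"
 proof (rule integrableI_bounded)
  show "(NN z. norm (norm (f z) powr p)) < \<infinity>" using le unfolding pw_def by (simp add: order_le_less_trans[of _ "ennreal (c powr p)"])
 qed measurable
 thus f: "f \<in> LP" using assms(1) by (simp add: Lp_def M_def)
 have "nrm f powr p <= c powr p" using le unfolding pw_LP[OF f] by simp
 thus "nrm f <= c" using p assms(2) powr_less_mono2[of p c "nrm f"] by (meson not_le order_less_trans zero_less_one)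
qed

lemma pw_mono: "(!!z. z \<in> UB ==> norm (f z) <= norm (g z)) ==> pw f <= pw g"
 unfolding pw_def using p by (intro nn_integral_mono ennreal_leI powr_mono2) auto

lemma LP_mono:
 assumes "g \<in> LP" "f \<in> bmM" "!!z. z \<in> UB ==> norm (f z) <= norm (g z)"
 shows "f \<in> LP" "nrm f <= nrm g"
proof -
 have "pw f <= pw g" by (rule pw_mono) (rule assms(3))
 thus "f \<in> LP" "nrm f <= nrm g" using LP_I[OF assms(2), of "nrm g"] pw_LP[OF assms(1)] by auto
qed

lemma pw_cmult: "f \<in> bmM ==> pw (%z. c * f z) = ennreal (norm c powr p) * pw f"
 unfolding pw_def norm_mult by (subst nn_integral_cmult[symmetric]) (auto simp: powr_mult ennreal_mult)

lemma LP_cmult: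
 assumes f: "f \<in> LP" shows "(%z. c * f z) \<in> LP" "nrm (%z. c * f z) = norm c * nrm f"
proof -
 have [measurable]: "f \<in> bmM" using f by (rule LP_measurable)
 have 1: "(%z. c * f z) \<in> LP & nrm (%z. c * f z) <= norm c * nrm f" if f: "f \<in> LP" for c f
 proof -
  have m: "f \<in> bmM" using f by (rule LP_measurable)
  hence m': "(%z. c * f z) \<in> bmM" by measurable
  have "pw (%z. c * f z) <= ennreal ((norm c * nrm f) powr p)" unfolding pw_cmult[OF m] pw_LP[OF f] by (simp add: powr_mult ennreal_mult)
  thus ?thesis using LP_I[OF m', of "norm c * nrm f"] by auto
 qed
 show cf: "(%z. c * f z) \<in> LP" using 1[OF f] by blast
 show "nrm (%z. c * f z) = norm c * nrm f"
 proof (cases "c = 0")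
  case True
  thus ?thesis using p by (simp add: Lp_norm_def)
 next
  case False
  have "nrm f = nrm (%z. inverse c * (c * f z))" using False by (simp add: mult.assoc[symmetric])
  also have "... <= norm (inverse c) * nrm (%z. c * f z)" using 1[OF cf] by blast
  finally have "norm c * nrm f <= nrm (%z. c * f z)" using False by (simp add: norm_inverse norm_divide field_simps)
  thus ?thesis using 1[OF f, of c] by auto
 qed
qed

text \<open>The pointwise convexity bound is integrated with the weight \<open>A / (A + B)\<close>,
  where \<open>A\<close> and \<open>B\<close> are slightly larger than the two norms; the right-hand
  side then equals \<open>(A + B) powr p\<close>.\<close>

lemma LP_add:
 assumes f: "f \<in> LP" and g: "g \<in> LP"
 shows "(%z. f z + g z) \<in> LP" "nrm (%z. f z + g z) <= nrm f + nrm g"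
proof -
 have [measurable]: "f \<in> bmM" "g \<in> bmM" using f g by (auto intro: LP_measurable)
 have *: "pw (%z. f z + g z) <= ennreal ((nrm f + nrm g + e) powr p)" if e: "e > 0" for e
 proof -
  \<comment> \<open>The slack of \<open>e / 2\<close> keeps both weights positive even if a norm is
    0.\<close>
  define A where "A = nrm f + e / 2"
  define B where "B = nrm g + e / 2"
  define l where "l = A / (A + B)"
  have AB: "A > 0" "B > 0" using e by (auto simp: A_def B_def intro: add_nonneg_pos)
  have l: "0 < l" "l < 1" "1 - l = B / (A + B)" using AB by (auto simp: l_def field_simps)
  have "pw (%z. f z + g z) <= (\<integral>\<^sup>+z. ennreal (l powr (1 - p)) * ennreal (norm (f z) powr p) + ennreal ((1 - l) powr (1 - p)) * ennreal (norm (g z) powr p) \<partial>M)"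
   unfolding pw_def
  proof (rule nn_integral_mono)
   fix z
   have "norm (f z + g z) powr p <= (norm (f z) + norm (g z)) powr p" using p by (intro powr_mono2 norm_triangle_ineq) auto
   also have "... <= l powr (1 - p) * norm (f z) powr p + (1 - l) powr (1 - p) * norm (g z) powr p" by (rule add_powr_le_weighted[OF p l(1,2)]) auto
   finally show "ennreal (norm (f z + g z) powr p) <= ennreal (l powr (1 - p)) * ennreal (norm (f z) powr p) + ennreal ((1 - l) powr (1 - p)) * ennreal (norm (g z) powr p)"
    by (simp add: ennreal_mult[symmetric] ennreal_plus[symmetric] del: ennreal_plus)
  qed
  also have "... = ennreal (l powr (1 - p)) * pw f + ennreal ((1 - l) powr (1 - p)) * pw g"
   unfolding pw_def by (subst nn_integral_add) (auto simp: nn_integral_cmult)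
  also have "... = ennreal (l powr (1 - p) * nrm f powr p + (1 - l) powr (1 - p) * nrm g powr p)"
   unfolding pw_LP[OF f] pw_LP[OF g] by (simp add: ennreal_mult[symmetric] ennreal_plus[symmetric] del: ennreal_plus)
  also have "... <= ennreal (l powr (1 - p) * A powr p + (1 - l) powr (1 - p) * B powr p)"
   using e p by (intro ennreal_leI add_mono mult_left_mono powr_mono2) (auto simp: A_def B_def)
  also have "l powr (1 - p) * A powr p + (1 - l) powr (1 - p) * B powr p = (A + B) powr p"
  proof -
   have X: "(x / S) powr (1 - p) * x powr p = x * S powr (p - 1)" if "x > 0" "S > 0" for x S :: real
   proof -
    have "(x / S) powr (1 - p) * x powr p = (x powr (1 - p) * x powr p) * S powr (- (1 - p))"
     using that by (simp add: powr_divide powr_minus_divide del: minus_diff_eq)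
    also have "x powr (1 - p) * x powr p = x" using that by (simp add: powr_add[symmetric])
    finally show ?thesis by simp
   qed
   have "l powr (1 - p) * A powr p = A * (A + B) powr (p - 1)" unfolding l_def using AB by (intro X) auto
   moreover have "(1 - l) powr (1 - p) * B powr p = B * (A + B) powr (p - 1)" unfolding l(3) using AB by (intro X) auto
   ultimately have "l powr (1 - p) * A powr p + (1 - l) powr (1 - p) * B powr p = (A + B) * (A + B) powr (p - 1)" by (simp add: distrib_right)
   thus ?thesis using AB by (simp add: powr_mult_base)
  qed
  also have "A + B = nrm f + nrm g + e" by (simp add: A_def B_def)
  finally show ?thesis .
 qed
 have m: "(%z. f z + g z) \<in> bmM" by measurable
 show "(%z. f z + g z) \<in> LP" using LP_I(1)[OF m _ *[of 1]] by simp
 show "nrm (%z. f z + g z) <= nrm f + nrm g"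
 proof (rule field_le_epsilon)
  fix e :: real assume "e > 0"
  thus "nrm (%z. f z + g z) <= nrm f + nrm g + e" using LP_I(2)[OF m _ *[of e]] by simp
 qed
qed

lemma LP_diff:
 assumes f: "f \<in> LP" and g: "g \<in> LP"
 shows "(%z. f z - g z) \<in> LP" "nrm (%z. f z - g z) <= nrm f + nrm g"
 using LP_add[OF f LP_cmult(1)[OF g, of "-1"]] LP_cmult(2)[OF g, of "-1"] by simp_all

lemma LP_zero [simp]: "(%z. 0) \<in> LP" "nrm (%z. 0) = 0"
 using p LP_I[of "%z. 0" 0] nrm_nonneg[of "%z. 0"] by (auto simp: pw_def)

lemma nrm_minus_commute: "nrm (%z. f z - g z) = nrm (%z. g z - f z)" by (simp add: Lp_norm_def norm_minus_commute)

lemma LP_sum: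
 assumes "finite J" "!!j. j \<in> J ==> f j \<in> LP"
 shows "(%z. \<Sum>j\<in>J. f j z) \<in> LP & nrm (%z. \<Sum>j\<in>J. f j z) <= (\<Sum>j\<in>J. nrm (f j))" using assms
proof (induction J rule: finite_induct)
 case (insert x F)
 thus ?case using LP_add[of "f x" "%z. \<Sum>j\<in>F. f j z"] by (auto intro: order_trans)
qed simp

lemma LP_bounded:
 assumes m: "f \<in> bmM" and b: "!!z. z \<in> UB ==> norm (f z) <= c" and c: "c >= 0"
 shows "f \<in> LP" "nrm f <= c"
proof -
 have "pw f <= (NN z. c powr p)" unfolding pw_def using p b by (intro nn_integral_mono ennreal_leI powr_mono2) auto
 also have "... = ennreal (c powr p)" using emeasure_space_1 by simp
 finally show "f \<in> LP" "nrm f <= c" using LP_I[OF m c] by auto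
qed

lemma LP_bounded_mult:
 assumes f: "f \<in> LP" and a: "a \<in> bmM" and b: "!!z. z \<in> UB ==> norm (a z) <= c" and c: "c >= 0"
 shows "(%z. a z * f z) \<in> LP" "nrm (%z. a z * f z) <= c * nrm f"
proof -
 have m: "(%z. a z * f z) \<in> bmM" using a LP_measurable[OF f] by measurable
 have "norm (a z * f z) <= norm (of_real c * f z)" if "z \<in> UB" for z using b[OF that] c by (simp add: norm_mult mult_right_mono)
 from LP_mono[OF LP_cmult(1)[OF f, of "of_real c"] m this]
 show "(%z. a z * f z) \<in> LP" "nrm (%z. a z * f z) <= c * nrm f" using LP_cmult(2)[OF f, of "of_real c"] c by auto
qed

lemma LP_Holder:
 fixes g :: "complex ^ 'n => real"
 assumes f: "f \<in> LP" and g: "g \<in> bmM" "!!z. z \<in> UB ==> 0 <= g z"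
  and B: "B >= 0" "(NN z. g z powr q) <= ennreal (B powr q)"
 shows "(NN z. norm (f z) * g z) <= ennreal (nrm f * B)"
 by (rule nn_Holder[OF p q pq]) (use assms LP_measurable[OF f] pw_LP[OF f] in \<open>auto simp: pw_def\<close>)

lemma LP_nn_integral_le: "f \<in> LP ==> (NN z. norm (f z)) <= ennreal (nrm f)" using LP_Holder[of f "%_. 1" 1] emeasure_space_1 by simp

lemma LP_integrable: "f \<in> LP ==> integrable M f" using LP_nn_integral_le[of f] LP_measurable[of f]
 by (intro integrableI_bounded) (auto intro: order_le_less_trans)

lemma LP_integral_norm_le:
 assumes "f \<in> LP" shows "(LINT z|M. norm (f z)) <= nrm f"
proof -
 have "ennreal (LINT z|M. norm (f z)) = (NN z. norm (f z))" by (rule nn_integral_eq_integral[symmetric]) (use LP_integrable[OF assms] in auto)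
 also have "... <= ennreal (nrm f)" by (rule LP_nn_integral_le[OF assms])
 finally show ?thesis by simp
qed

end

section \<open>Taylor bounds for the kernel and holomorphy of the projection\<close>

lemma has_derivative_quadratic:
 fixes f :: "'a::real_normed_vector => 'b::real_normed_vector"
 assumes D: "bounded_linear D" and d: "d > 0"
  and le: "!!h. norm h < d ==> norm (f (x + h) - f x - D h) <= C * (norm h)\<^sup>2"
 shows "(f has_derivative D) (at x)" unfolding has_derivative_at
proof (intro conjI D)
 have "((%h::'a. C * norm h) \<longlongrightarrow> C * 0) (at 0)" by (intro tendsto_intros tendsto_norm_zero tendsto_ident_at)
 hence lim: "((%h::'a. C * norm h) \<longlongrightarrow> 0) (at 0)" by simp
 show "((%h. norm (f (x + h) - f x - D h) / norm h) \<longlongrightarrow> 0) (at 0)"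
 proof (rule Lim_null_comparison[OF _ lim])
  have "\<forall>\<^sub>F h in at (0::'a). h \<in> ball 0 d - {0}" using d by (intro eventually_at_in_open) auto
  thus "\<forall>\<^sub>F h in at 0. norm (norm (f (x + h) - f x - D h) / norm h) <= C * norm h"
  proof eventually_elim
   case (elim h)
   thus ?case using le[of h] by (simp add: divide_le_eq power2_eq_square mult.assoc)
  qed
 qed
qed

lemma norm_one_minus_herm_commute: "norm (1 - herm z w) = norm (1 - herm w z)"
proof -
 have "1 - herm z w = cnj (1 - herm w z)" by (simp add: herm_commute[of w z])
 thus ?thesis by (metis complex_mod_cnj)
qed

context bergman begin

definition phi :: "complex => complex" where "phi x = (1 - x) powr (- of_real N)"
definition dphi :: "complex => complex" where "dphi x = of_real N * (1 - x) powr (- of_real N - 1)"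

lemma ker_phi: "ker z w = phi (herm z w)" by (simp add: ker_def phi_def powr_minus_divide)

lemma norm_phi: "norm (phi x) = norm (1 - x) powr (- N)" unfolding phi_def using norm_powr_real_powr'[of "- of_real N" "1 - x"] by simp

lemma norm_dphi: "norm (dphi x) = N * norm (1 - x) powr (- N - 1)"
 unfolding dphi_def using norm_powr_real_powr'[of "- of_real N - 1" "1 - x"] N_pos by (simp add: norm_mult)

lemma measurable_dphi [measurable]: "dphi \<in> borel_measurable borel"
 unfolding dphi_def by (intro borel_measurable_times powr_complex_measurable borel_measurable_diff borel_measurable_const) auto

text \<open>On the disc of radius \<open>r\<close> the point 1 is at distance at least
  \<open>1 - r\<close>, so all derivatives of the power are bounded. One constant serves all the
  bounds; they are uniform in the integration variable and so permit differentiation under the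
  integral.\<close>

lemma phi_Taylor:
 assumes r: "r < 1"
 obtains C where "C >= 0"
  "!!x y. norm x <= r ==> norm y <= r ==> norm (phi y - phi x - dphi x * (y - x)) <= C * (norm (y - x))\<^sup>2"
  "!!x y. norm x <= r ==> norm y <= r ==> norm (phi y - phi x) <= C * norm (y - x)"
  "!!x. norm x <= r ==> norm (dphi x) <= C"
  "!!x. norm x <= r ==> norm (phi x) <= C"
proof -
 define F :: "nat => complex => complex" where
  "F i x = (if i = 0 then phi x else if i = 1 then dphi x else of_real N * (of_real N + 1) * (1 - x) powr (- of_real N - 2))" for i x
 have nz: "1 - x \<notin> \<real>\<^sub>\<le>\<^sub>0" "norm (1 - x) >= 1 - r" if "norm x <= r" for x :: complex
 proof -
  have "Re x <= norm x" by (rule complex_Re_le_cmod)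
  thus "1 - x \<notin> \<real>\<^sub>\<le>\<^sub>0" using that r by (auto simp: complex_nonpos_Reals_iff)
  show "norm (1 - x) >= 1 - r" using norm_triangle_ineq2[of 1 x] that by simp
 qed
 have d: "(F i has_field_derivative F (Suc i) x) (at x within cball 0 r)" if x0: "x \<in> cball 0 r" and i1: "i <= 1" for i x
 proof -
  have x: "1 - x \<notin> \<real>\<^sub>\<le>\<^sub>0" using nz x0 by simp
  have P: "((%x. (1 - x) powr s) has_field_derivative (s * (1 - x) powr (s - 1) * (- 1))) (at x within cball 0 r)" for s
  proof -
   have "((%x. 1 - x) has_field_derivative - 1) (at x within cball 0 r)" by (auto intro!: derivative_eq_intros)
   from DERIV_chain'[where g = "%z. z powr s", OF this has_field_derivative_powr[OF x]]
   show ?thesis .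
  qed
  consider "i = 0" | "i = 1" using i1 by linarith
  thus ?thesis
  proof cases
   case 1
   thus ?thesis unfolding F_def phi_def dphi_def using P[of "- of_real N"] by simp
  next
   case 2
   have "((%x. of_real N * (1 - x) powr (- of_real N - 1)) has_field_derivative
     (of_real N * ((- of_real N - 1) * (1 - x) powr ((- of_real N - 1) - 1) * (- 1)))) (at x within cball 0 r)" by (rule DERIV_cmult[OF P])
   thus ?thesis unfolding F_def phi_def dphi_def using 2 by (simp add: algebra_simps)
  qed
 qed
 have F01: "F 0 = phi" "F (Suc 0) = dphi" by (simp_all add: F_def fun_eq_iff)
 define C2 where "C2 = N * (N + 1) * (1 - r) powr (- N - 2)"
 define C1 where "C1 = N * (1 - r) powr (- N - 1)"
 define C0 where "C0 = (1 - r) powr (- N)"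
 define C where "C = C0 + C1 + C2"
 have C: "0 <= C0" "0 <= C1" "0 <= C2" using N_pos by (auto simp: C0_def C1_def C2_def)
 have b2: "norm (F 2 x) <= C2" if "norm x <= r" for x
 proof -
  have "norm (F 2 x) = N * (N + 1) * norm (1 - x) powr (- N - 2)"
   using norm_powr_real_powr'[of "- of_real N - 2" "1 - x"] N_pos norm_of_real[of "N + 1", where 'a = complex] by (simp add: F_def norm_mult)
  also have "... <= C2" unfolding C2_def using nz(2)[OF that] r N_pos by (intro mult_left_mono powr_mono2') auto
  finally show ?thesis .
 qed
 have b1: "norm (dphi x) <= C1" if "norm x <= r" for x
  unfolding norm_dphi C1_def using nz(2)[OF that] r N_pos by (intro mult_left_mono powr_mono2') auto
 have b0: "norm (phi x) <= C0" if "norm x <= r" for x unfolding norm_phi C0_def using nz(2)[OF that] r N_pos by (intro powr_mono2') auto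
 show ?thesis
 proof (rule that[of C])
  show "C >= 0" using C by (simp add: C_def)
  fix x y :: complex assume xy: "norm x <= r" "norm y <= r"
  have "norm (F 0 y - (\<Sum>i\<le>1. F i x * (y - x) ^ i / fact i)) <= C2 * norm (y - x) ^ Suc 1 / fact 1"
   by (rule field_Taylor[of "cball 0 r"]) (use d b2 xy in \<open>auto simp: numeral_2_eq_2\<close>)
  hence "norm (phi y - phi x - dphi x * (y - x)) <= C2 * (norm (y - x))\<^sup>2" by (simp add: F_def power2_eq_square diff_diff_eq)
  also have "... <= C * (norm (y - x))\<^sup>2" using C by (intro mult_right_mono) (auto simp: C_def)
  finally show "norm (phi y - phi x - dphi x * (y - x)) <= C * (norm (y - x))\<^sup>2" .
  have "norm (F 0 y - (\<Sum>i\<le>0. F i x * (y - x) ^ i / fact i)) <= C1 * norm (y - x) ^ Suc 0 / fact 0"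
   by (rule field_Taylor[of "cball 0 r"]) (use d[of _ 0] b1 xy in \<open>auto simp: F01\<close>)
  hence "norm (phi y - phi x) <= C1 * norm (y - x)" by (simp add: F_def)
  also have "... <= C * norm (y - x)" using C by (intro mult_right_mono) (auto simp: C_def)
  finally show "norm (phi y - phi x) <= C * norm (y - x)" .
 next
  show "norm (dphi x) <= C" "norm (phi x) <= C" if "norm x <= r" for x using b1[OF that] b0[OF that] C by (auto simp: C_def)
 qed
qed

lemma projection_eq:
 "bergman_projection \<alpha> f z = (if z \<in> UB then \<integral>w. f w * ker z w \<partial>M else 0)" for z :: "complex ^ 'n"
proof -
 have "bergman_projection \<alpha> f z = (if z \<in> UB then \<integral>w. f w / (1 - herm z w) powr of_real N \<partial>M else 0)"
  unfolding bergman_projection_def N_def[symmetric] M_def[symmetric] ..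
 thus ?thesis unfolding ker_def by simp
qed

lemma integrable_mult_ker:
 assumes "integrable M f" "z \<in> UB"
 shows "integrable M (%w. f w * ker z w)"
proof (rule Bochner_Integration.integrable_bound)
 show "integrable M (%w. norm (f w) * (1 - norm z) powr (- N))" using assms(1) by simp
 have [measurable]: "f \<in> bmM" using assms(1) by simp
 show "(%w. f w * ker z w) \<in> bmM" by measurable
 show "AE w in M. norm (f w * ker z w) <= norm (norm (f w) * (1 - norm z) powr (- N))"
  using norm_ker_le[of z] assms(2) by (intro AE_I2) (auto simp: norm_mult intro!: mult_left_mono)
qed

lemma norm_projection_le:
 assumes f: "integrable M f" and z: "z \<in> UB"
 shows "norm (bergman_projection \<alpha> f z) <= (1 - norm z) powr (- N) * (LINT w|M. norm (f w))"
proof -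
 have "norm (bergman_projection \<alpha> f z) = norm (LINT w|M. f w * ker z w)" using z by (simp add: projection_eq)
 also have "... <= (LINT w|M. norm (f w * ker z w))" by (rule integral_norm_bound)
 also have "... <= (LINT w|M. (1 - norm z) powr (- N) * norm (f w))"
 proof (rule integral_mono)
  show "integrable M (%w. norm (f w * ker z w))" using integrable_mult_ker[OF f z] by simp
  show "integrable M (%w. (1 - norm z) powr (- N) * norm (f w))" using f by simp
  show "norm (f w * ker z w) <= (1 - norm z) powr (- N) * norm (f w)" if "w \<in> space M" for w
   using norm_ker_le[of z w] that z mult_left_mono[of "norm (ker z w)" "(1 - norm z) powr (- N)" "norm (f w)"] by (simp add: norm_mult mult.commute)
 qed
 finally show ?thesis by simp
qed

text \<open>Differentiation under the integral: the Taylor remainder of the kernel in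
  \<open>h\<close> is at most a constant times \<open>(norm h)\<^sup>2\<close>, uniformly in
  \<open>w\<close>, and the resulting derivative is complex linear because \<open>herm h w\<close>
  is so in \<open>h\<close>.\<close>

lemma holomorphic_projection:
 assumes f: "integrable M f"
 shows "holomorphic_several (bergman_projection \<alpha> f) UB" unfolding holomorphic_several_def
proof
 fix z :: "complex ^ 'n" assume z: "z \<in> UB"
 have [measurable]: "f \<in> bmM" using f by simp
 define d where "d = (1 - norm z) / 2"
 define r where "r = norm z + d"
 have d: "d > 0" "r < 1" using z by (auto simp: d_def r_def field_simps)
 obtain C where C: "C >= 0"
  "!!x y. norm x <= r ==> norm y <= r ==> norm (phi y - phi x - dphi x * (y - x)) <= C * (norm (y - x))\<^sup>2"
  "!!x. norm x <= r ==> norm (dphi x) <= C" using phi_Taylor[OF d(2)] by metis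
 have hb: "norm (herm (z + h) w) <= r" if "norm h < d" "w \<in> UB" for h w
 proof -
  have "norm (herm (z + h) w) <= norm (z + h) * norm w" by (rule norm_herm_le)
  also have "... <= norm (z + h)" using that by (intro mult_left_le) auto
  also have "... <= r" using norm_triangle_ineq[of z h] that by (simp add: r_def)
  finally show ?thesis .
 qed
 have hb0: "norm (herm z w) <= r" if "w \<in> UB" for w using hb[of 0 w] that d by simp
 have hw: "norm (herm h w) <= norm h" if "w \<in> UB" for h w using norm_herm_le[of h w] mult_left_le[of "norm w" "norm h"] that by simp
 define D where "D h = (LINT w|M. f w * (dphi (herm z w) * herm h w))" for h
 have Di: "integrable M (%w. f w * (dphi (herm z w) * herm h w))" for h
 proof (rule Bochner_Integration.integrable_bound)
  show "integrable M (%w. norm (f w) * (C * norm h))" using f by simp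
  show "AE w in M. norm (f w * (dphi (herm z w) * herm h w)) <= norm (norm (f w) * (C * norm h))"
  proof (rule AE_I2)
   fix w assume "w \<in> space M"
   hence "norm (dphi (herm z w)) * norm (herm h w) <= C * norm h" using C(1) C(3)[OF hb0[of w]] hw[of w h] by (intro mult_mono) auto
   thus "norm (f w * (dphi (herm z w) * herm h w)) <= norm (norm (f w) * (C * norm h))" using C(1) by (simp add: norm_mult mult_left_mono)
  qed
 qed measurable
 have Dadd: "D (h + h') = D h + D h'" for h h' unfolding D_def herm_add_left distrib_left by (rule Bochner_Integration.integral_add[OF Di Di])
 have Dsm: "D (c *s h) = c * D h" for c h unfolding D_def herm_smult_left by (simp add: mult.left_commute[of _ c])
 have Db: "norm (D h) <= norm h * (C * (LINT w|M. norm (f w)))" for h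
 proof -
  have "norm (D h) <= (LINT w|M. norm (f w * (dphi (herm z w) * herm h w)))" unfolding D_def by (rule integral_norm_bound)
  also have "... <= (LINT w|M. (C * norm h) * norm (f w))"
  proof (rule integral_mono)
   show "norm (f w * (dphi (herm z w) * herm h w)) <= (C * norm h) * norm (f w)" if "w \<in> space M" for w
   proof -
    have "norm (dphi (herm z w)) * norm (herm h w) <= C * norm h" using C(1) C(3)[OF hb0[of w]] hw[of w h] that by (intro mult_mono) auto
    from mult_left_mono[OF this norm_ge_zero[of "f w"]] show ?thesis by (simp add: norm_mult mult.commute)
   qed
  qed (use f Di in auto)
  finally show ?thesis by (simp add: mult_ac)
 qed
 have "bounded_linear D" by (rule bounded_linear_intro[of _ "C * (LINT w|M. norm (f w))"])
    (use Dadd Dsm Db in \<open>simp_all add: scaleR_eq_smult scaleR_conv_of_real\<close>)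
 have "(bergman_projection \<alpha> f has_derivative D) (at z)"
 proof (rule has_derivative_quadratic[OF `bounded_linear D` d(1)])
  fix h :: "complex ^ 'n" assume h: "norm h < d"
  have zh: "z + h \<in> UB" using norm_triangle_ineq[of z h] h d by (simp add: r_def)
  have E: "f w * ker (z + h) w - f w * ker z w - f w * (dphi (herm z w) * herm h w)
    = f w * (phi (herm (z + h) w) - phi (herm z w) - dphi (herm z w) * (herm (z + h) w - herm z w))" for w
   unfolding ker_phi herm_add_left by (simp add: right_diff_distrib)
  have "bergman_projection \<alpha> f (z + h) - bergman_projection \<alpha> f z - D h
    = (LINT w|M. f w * ker (z + h) w) - (LINT w|M. f w * ker z w) - (LINT w|M. f w * (dphi (herm z w) * herm h w))"
   unfolding projection_eq D_def using zh z by simp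
  also have "... = (LINT w|M. f w * ker (z + h) w - f w * ker z w - f w * (dphi (herm z w) * herm h w))"
   unfolding Bochner_Integration.integral_diff[OF Bochner_Integration.integrable_diff[OF integrable_mult_ker[OF f zh] integrable_mult_ker[OF f z]] Di[of h]]
    Bochner_Integration.integral_diff[OF integrable_mult_ker[OF f zh] integrable_mult_ker[OF f z]] ..
  also have "... = (LINT w|M. f w * (phi (herm (z + h) w) - phi (herm z w) - dphi (herm z w) * (herm (z + h) w - herm z w)))" unfolding E ..
  finally have eq: "bergman_projection \<alpha> f (z + h) - bergman_projection \<alpha> f z - D h
    = (LINT w|M. f w * (phi (herm (z + h) w) - phi (herm z w) - dphi (herm z w) * (herm (z + h) w - herm z w)))" .
  have "norm (bergman_projection \<alpha> f (z + h) - bergman_projection \<alpha> f z - D h)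
   <= (LINT w|M. norm (f w * (phi (herm (z + h) w) - phi (herm z w) - dphi (herm z w) * (herm (z + h) w - herm z w))))"
   unfolding eq by (rule integral_norm_bound)
  also have "... <= (LINT w|M. (C * (norm h)\<^sup>2) * norm (f w))"
  proof (rule integral_mono)
   have "integrable M (%w. f w * ker (z + h) w - f w * ker z w - f w * (dphi (herm z w) * herm h w))"
    by (intro Bochner_Integration.integrable_diff integrable_mult_ker f zh z Di)
   thus "integrable M (%w. norm (f w * (phi (herm (z + h) w) - phi (herm z w) - dphi (herm z w) * (herm (z + h) w - herm z w))))"
    unfolding E by (rule integrable_norm)
   show "integrable M (%w. (C * (norm h)\<^sup>2) * norm (f w))" using f by simp
   fix w assume w: "w \<in> space M"
   have "norm (phi (herm (z + h) w) - phi (herm z w) - dphi (herm z w) * (herm (z + h) w - herm z w)) <= C * (norm (herm (z + h) w - herm z w))\<^sup>2"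
    using hb[OF h] hb0 w by (intro C(2)) auto
   also have "... <= C * (norm h)\<^sup>2" using hw[of w h] w C(1) by (intro mult_left_mono power_mono) (auto simp: herm_add_left)
   finally have "norm (f w) * norm (phi (herm (z + h) w) - phi (herm z w) - dphi (herm z w) * (herm (z + h) w - herm z w)) <= norm (f w) * (C * (norm h)\<^sup>2)"
    by (rule mult_left_mono) simp
   thus "norm (f w * (phi (herm (z + h) w) - phi (herm z w) - dphi (herm z w) * (herm (z + h) w - herm z w))) <= (C * (norm h)\<^sup>2) * norm (f w)"
    unfolding norm_mult by (simp only: mult.commute[of "norm (f w)"])
  qed
  also have "... = (C * (LINT w|M. norm (f w))) * (norm h)\<^sup>2" by simp
  finally show "norm (bergman_projection \<alpha> f (z + h) - bergman_projection \<alpha> f z - D h) <= (C * (LINT w|M. norm (f w))) * (norm h)\<^sup>2" .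
 qed
 thus "\<exists>D. (bergman_projection \<alpha> f has_derivative D) (at z) & (\<forall>c v. D (c *s v) = c * D v)"
  using Dsm by (intro exI[of _ D]) simp
qed

end

section \<open>Schur's test, boundedness of the projection, point evaluations\<close>

context bergman_space begin

text \<open>Schur's test with a family of extra weights. Hoelder's inequality is split so that
  \<open>\<omega> j\<close> stays entirely with the factor that is raised to the power
  \<open>p\<close>. The weights then enter only the second test, summed over \<open>j\<close>, so
  smallness of this sum suffices even if there are arbitrarily many indices.\<close>

lemma schur_family:
 fixes k :: "complex ^ 'n => complex ^ 'n => real" and \<omega> :: "'j => complex ^ 'n => complex ^ 'n => real"
 assumes J: "finite J"
  and km[measurable]: "case_prod k \<in> bmMM"
  and \<omega>m[measurable]: "!!j. j \<in> J ==> case_prod (\<omega> j) \<in> bmMM"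
  and gm[measurable]: "g \<in> bmM" and hm[measurable]: "h \<in> bmM"
  and nn: "!!z w. k z w >= 0" "!!j z w. j \<in> J ==> \<omega> j z w >= 0" "!!w. g w >= 0" "!!z. z \<in> UB ==> h z > 0"
  and C: "C1 > 0" "C2 >= 0"
  and S1: "!!z. z \<in> UB ==> (NN w. k z w * h w powr q) <= ennreal (C1 * h z powr q)"
  and S2: "!!w. w \<in> UB ==> (NN z. k z w * (\<Sum>j\<in>J. \<omega> j z w powr p) * h z powr p) <= ennreal (C2 * h w powr p)"
  and u: "!!j z. j \<in> J ==> z \<in> UB ==> u j z >= 0"
   "!!j z. j \<in> J ==> z \<in> UB ==> ennreal (u j z) <= (NN w. k z w * \<omega> j z w * g w)"
 shows "(\<Sum>j\<in>J. \<integral>\<^sup>+z. ennreal (u j z powr p) \<partial>M) <= ennreal (C1 powr (p - 1) * C2) * (NN w. g w powr p)"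
proof -
 have p0: "p > 0" "q > 0" using p q by auto
 let ?Q = "%j z w. ennreal (C1 powr (p - 1) * h z powr p) * ennreal (k z w * \<omega> j z w powr p * g w powr p * h w powr (- p))"
 define X where "X j z = (NN w. k z w * \<omega> j z w powr p * g w powr p * h w powr (- p))" for j z
 have pt: "ennreal (u j z powr p) <= ennreal (C1 powr (p - 1) * h z powr p) * X j z" if j: "j \<in> J" and z: "z \<in> UB" for j z
 proof (cases "X j z")
  case top
  show ?thesis using top C nn(4)[OF z] by (auto simp: ennreal_mult_top)
 next
  case (real x)
  have mz[measurable]: "(%w. k z w) \<in> bmM" "(%w. \<omega> j z w) \<in> bmM"
   using measurable_compose[OF measurable_Pair1' km] measurable_compose[OF measurable_Pair1' \<omega>m[OF j]] z by auto
  \<comment> \<open>The kernel is split into the powers \<open>1 / p\<close> and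
    \<open>1 / q\<close>, and the test function \<open>h\<close> is divided out of one factor and
    put into the other.\<close>
  define F where "F w = k z w powr (1 / p) * \<omega> j z w * g w * h w powr (- 1)" for w
  define G where "G w = k z w powr (1 / q) * h w" for w
  have "(NN w. F w * G w) <= ennreal (x powr (1 / p) * (C1 * h z powr q) powr (1 / q))"
  proof (rule nn_Holder[OF p q pq])
   show "F \<in> bmM" "G \<in> bmM" unfolding F_def G_def by measurable
   fix w assume "w \<in> space M"
   thus "0 <= F w" "0 <= G w" using nn(1,3) nn(2)[OF j] nn(4)[of w] by (simp_all add: F_def G_def less_imp_le)
  next
   have "(NN w. F w powr p) = X j z" unfolding X_def
   proof (rule nn_integral_cong)
    fix w assume "w \<in> space M"
    hence "F w powr p = k z w * \<omega> j z w powr p * g w powr p * h w powr (- p)"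
     using nn(1)[of z w] nn(2)[OF j, of z w] nn(3)[of w] nn(4)[of w] p0 by (simp add: F_def powr_mult powr_powr powr_divide powr_minus_divide)
    thus "ennreal (F w powr p) = ennreal (k z w * \<omega> j z w powr p * g w powr p * h w powr (- p))" by simp
   qed
   also have "... = ennreal ((x powr (1 / p)) powr p)" using real p0 by (simp add: powr_powr)
   finally show "(NN w. F w powr p) <= ennreal ((x powr (1 / p)) powr p)" by simp
   have "(NN w. G w powr q) = (NN w. k z w * h w powr q)"
   proof (rule nn_integral_cong)
    fix w assume "w \<in> space M"
    hence "G w powr q = k z w * h w powr q" using nn(1)[of z w] nn(4)[of w] p0 by (simp add: G_def powr_mult powr_powr)
    thus "ennreal (G w powr q) = ennreal (k z w * h w powr q)" by simp
   qed
   also have "... <= ennreal (C1 * h z powr q)" by (rule S1[OF z])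
   also have "... = ennreal (((C1 * h z powr q) powr (1 / q)) powr q)" using C p0 by (simp add: powr_powr)
   finally show "(NN w. G w powr q) <= ennreal (((C1 * h z powr q) powr (1 / q)) powr q)" .
  qed auto
  moreover have "(NN w. F w * G w) = (NN w. k z w * \<omega> j z w * g w)"
  proof (rule nn_integral_cong)
   fix w assume "w \<in> space M"
   hence "h w powr (-1) * h w = 1" using nn(4)[of w] by (simp add: powr_minus)
   moreover have "k z w powr (1 / p) * k z w powr (1 / q) = k z w" using nn(1)[of z w] pq by (simp add: powr_add[symmetric])
   moreover have "F w * G w = (k z w powr (1 / p) * k z w powr (1 / q)) * \<omega> j z w * g w * (h w powr (-1) * h w)"
    unfolding F_def G_def by (simp only: mult_ac)
   ultimately show "ennreal (F w * G w) = ennreal (k z w * \<omega> j z w * g w)" by simp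
  qed
  ultimately have "ennreal (u j z) <= ennreal (x powr (1 / p) * (C1 * h z powr q) powr (1 / q))" using order_trans[OF u(2)[OF j z]] by metis
  hence "u j z <= x powr (1 / p) * (C1 * h z powr q) powr (1 / q)" by (subst (asm) ennreal_le_iff) auto
  hence "u j z powr p <= (x powr (1 / p) * (C1 * h z powr q) powr (1 / q)) powr p" using u(1)[OF j z] p0 by (intro powr_mono2) auto
  also have "... = x * (C1 powr (p / q) * h z powr p)" using C nn(4)[OF z] p0 real by (simp add: powr_mult powr_powr)
  also have "... = C1 powr (p - 1) * h z powr p * x" by (simp add: p_div_q)
  finally show ?thesis using real by (simp add: ennreal_mult[symmetric])
 qed
 have Y: "(%(z, w). ?Q j z w) \<in> bmMM" if "j \<in> J" for j
  using \<omega>m[OF that] km by measurable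
 have "(\<Sum>j\<in>J. \<integral>\<^sup>+z. ennreal (u j z powr p) \<partial>M) <= (\<Sum>j\<in>J. \<integral>\<^sup>+z. ennreal (C1 powr (p - 1) * h z powr p) * X j z \<partial>M)"
  by (intro sum_mono nn_integral_mono pt) auto
 also have "... = (\<Sum>j\<in>J. \<integral>\<^sup>+z. \<integral>\<^sup>+w. ?Q j z w \<partial>M \<partial>M)"
 proof (intro sum.cong refl nn_integral_cong)
  fix j z assume j: "j \<in> J" and z: "z \<in> space M"
  have mz[measurable]: "(%w. k z w) \<in> bmM" "(%w. \<omega> j z w) \<in> bmM"
   using measurable_compose[OF measurable_Pair1' km] measurable_compose[OF measurable_Pair1' \<omega>m[OF j]] z by auto
  show "ennreal (C1 powr (p - 1) * h z powr p) * X j z = (\<integral>\<^sup>+w. ?Q j z w \<partial>M)"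
   unfolding X_def by (rule nn_integral_cmult[symmetric]) measurable
 qed
 also have "... = (\<Sum>j\<in>J. \<integral>\<^sup>+w. \<integral>\<^sup>+z. ?Q j z w \<partial>M \<partial>M)"
 proof (intro sum.cong refl)
  fix j assume "j \<in> J"
  interpret PP: pair_sigma_finite M M ..
  show "(\<integral>\<^sup>+z. \<integral>\<^sup>+w. ?Q j z w \<partial>M \<partial>M)
   = (\<integral>\<^sup>+w. \<integral>\<^sup>+z. ?Q j z w \<partial>M \<partial>M)"
   using PP.Fubini'[OF Y[OF `j \<in> J`]] by simp
 qed
 also have "... = (\<integral>\<^sup>+w. (\<Sum>j\<in>J. \<integral>\<^sup>+z. ?Q j z w \<partial>M) \<partial>M)"
 proof (rule nn_integral_sum[symmetric])
  fix j assume j: "j \<in> J"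
  have "(%(w, z). ?Q j z w) \<in> bmMM"
   using measurable_pair_swap[OF Y[OF j]] by (simp only: prod.case)
  thus "(%w. \<integral>\<^sup>+z. ?Q j z w \<partial>M) \<in> bmM"
   by (rule borel_measurable_nn_integral)
 qed
 also have "... <= (\<integral>\<^sup>+w. ennreal (C1 powr (p - 1) * C2) * ennreal (g w powr p) \<partial>M)"
 proof (rule nn_integral_mono)
  fix w assume w: "w \<in> space M"
  have hw: "h w > 0" using nn(4) w by simp
  have mE: "(%z. ennreal (k z w * \<omega> j z w powr p * h z powr p)) \<in> bmM" if "j \<in> J" for j
  proof -
   have [measurable]: "(%z. k z w) \<in> bmM" "(%z. \<omega> j z w) \<in> bmM"
    using measurable_compose[OF measurable_Pair2' km] measurable_compose[OF measurable_Pair2' \<omega>m[OF that]] w by auto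
   show ?thesis by measurable
  qed
  have "(\<Sum>j\<in>J. \<integral>\<^sup>+z. ?Q j z w \<partial>M)
   = (\<Sum>j\<in>J. \<integral>\<^sup>+z. ennreal (C1 powr (p - 1) * (g w powr p * h w powr (- p))) * ennreal (k z w * \<omega> j z w powr p * h z powr p) \<partial>M)"
   using nn C by (intro sum.cong refl nn_integral_cong) (simp add: ennreal_mult[symmetric] mult_ac)
  also have "... = (\<Sum>j\<in>J. ennreal (C1 powr (p - 1) * (g w powr p * h w powr (- p))) * (NN z. k z w * \<omega> j z w powr p * h z powr p))"
   by (intro sum.cong refl nn_integral_cmult mE)
  also have "... = ennreal (C1 powr (p - 1) * (g w powr p * h w powr (- p))) * (\<integral>\<^sup>+z. (\<Sum>j\<in>J. ennreal (k z w * \<omega> j z w powr p * h z powr p)) \<partial>M)"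
   unfolding sum_distrib_left[symmetric] by (subst nn_integral_sum) (auto intro: mE)
  also have "(\<integral>\<^sup>+z. (\<Sum>j\<in>J. ennreal (k z w * \<omega> j z w powr p * h z powr p)) \<partial>M) = (NN z. k z w * (\<Sum>j\<in>J. \<omega> j z w powr p) * h z powr p)"
   using nn by (intro nn_integral_cong) (simp add: sum_ennreal sum_distrib_left sum_distrib_right)
  also have "ennreal (C1 powr (p - 1) * (g w powr p * h w powr (- p))) * ... <= ennreal (C1 powr (p - 1) * (g w powr p * h w powr (- p))) * ennreal (C2 * h w powr p)"
   using S2[of w] w by (intro mult_left_mono) auto
  also have "... = ennreal (C1 powr (p - 1) * C2 * g w powr p * (h w powr (- p) * h w powr p))"
   using C hw by (simp add: ennreal_mult[symmetric] mult_ac)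
  also have "h w powr (- p) * h w powr p = 1" using hw by (simp add: powr_add[symmetric])
  finally show "(\<Sum>j\<in>J. \<integral>\<^sup>+z. ?Q j z w \<partial>M) <= ennreal (C1 powr (p - 1) * C2) * ennreal (g w powr p)"
   using C by (simp add: ennreal_mult)
 qed
 also have "... = ennreal (C1 powr (p - 1) * C2) * (NN w. g w powr p)" by (rule nn_integral_cmult) measurable
 finally show ?thesis .
qed

end

context bergman begin

abbreviation proj :: "(complex ^ 'n => complex) => (complex ^ 'n => complex)" where
 "proj \<equiv> bergman_projection \<alpha>"

text \<open>Extended by zero, as members of the Bergman space are normalised to vanish outside the
  ball.\<close>

definition kf :: "complex ^ 'n => (complex ^ 'n => complex)" where
 "kf w = (%z. if z \<in> UB then ker z w else 0)"

lemma holomorphic_measurable: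
 assumes "holomorphic_several f UB" shows "f \<in> bmM"
proof -
 have "(%w. indicator UB w *\<^sub>R f w) \<in> bmM" by (rule borel_measurable_M[OF borel_measurable_truncation[OF assms]]) simp
 thus ?thesis by (rule measurable_cong[THEN iffD1, rotated]) simp
qed

lemma measurable_pair_norm_ker [measurable]: "(%(z, w). norm (ker z w)) \<in> bmMM"
proof -
 have [measurable]: "fst \<in> bmMM" "snd \<in> bmMM"
  using measurable_compose[OF measurable_fst measurable_M_id] measurable_compose[OF measurable_snd measurable_M_id] by auto
 have "(%x. ker (fst x) (snd x)) \<in> bmMM" by (rule ker_measurable) measurable
 hence "(%x. norm (ker (fst x) (snd x))) \<in> bmMM" by (rule measurable_compose[OF _ borel_measurable_norm])
 thus ?thesis by (simp add: case_prod_beta')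
qed

lemma norm_ker_commute: "norm (ker z w) = norm (ker w z)" unfolding norm_ker by (simp add: norm_one_minus_herm_commute[of z w])

lemma holomorphic_kf:
 assumes w: "w \<in> UB"
 shows "holomorphic_several (kf w) UB" unfolding holomorphic_several_def
proof
 fix z :: "complex ^ 'n" assume z: "z \<in> UB"
 obtain C where C: "C >= 0"
  "!!x y. norm x <= norm w ==> norm y <= norm w ==> norm (phi y - phi x - dphi x * (y - x)) <= C * (norm (y - x))\<^sup>2"
 proof -
  have "norm w < 1" using w by simp
  from phi_Taylor[OF this] show ?thesis using that by metis
 qed
 define D where "D h = dphi (herm z w) * herm h w" for h
 have hb: "norm (herm x w) <= norm w" if "norm x < 1" for x using norm_herm_le[of x w] mult_right_mono[of "norm x" 1 "norm w"] that by simp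
 have "(kf w has_derivative D) (at z)"
 proof (rule has_derivative_quadratic)
  show "bounded_linear D" unfolding D_def by (rule bounded_linear_compose[OF bounded_linear_mult_right bounded_linear_herm_left])
  show "1 - norm z > 0" using z by simp
  fix h :: "complex ^ 'n" assume h: "norm h < 1 - norm z"
  have zh: "norm (z + h) < 1" using norm_triangle_ineq[of z h] h by simp
  have "kf w (z + h) - kf w z - D h = phi (herm (z + h) w) - phi (herm z w) - dphi (herm z w) * (herm (z + h) w - herm z w)"
   using z zh by (simp add: kf_def ker_phi D_def herm_add_left)
  also have "norm ... <= C * (norm (herm (z + h) w - herm z w))\<^sup>2" using z zh by (intro C(2) hb) auto
  also have "norm (herm (z + h) w - herm z w) <= norm h" using norm_herm_le[of h w] mult_left_le[of "norm w" "norm h"] w by (simp add: herm_add_left)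
  hence "C * (norm (herm (z + h) w - herm z w))\<^sup>2 <= C * (norm h)\<^sup>2" using C(1) by (intro mult_left_mono power_mono) auto
  finally show "norm (kf w (z + h) - kf w z - D h) <= C * (norm h)\<^sup>2" .
 qed
 moreover have "D (c *s v) = c * D v" for c v by (simp add: D_def herm_smult_left)
 ultimately show "\<exists>D. (kf w has_derivative D) (at z) & (\<forall>c v. D (c *s v) = c * D v)" by auto
qed

end

context bergman_space begin

lemma AP_D: assumes "f \<in> AP" shows "f \<in> LP" "holomorphic_several f UB" "z \<notin> UB ==> f z = 0" using assms by (auto simp: Ap_def)

lemma AP_I: "f \<in> LP ==> holomorphic_several f UB ==> (!!z. z \<notin> UB ==> f z = 0) ==> f \<in> AP" by (auto simp: Ap_def)

lemma proj_outside: "z \<notin> UB ==> proj f z = 0" for z :: "complex ^ 'n" by (simp add: projection_eq)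

lemma proj_AP_eq:
 assumes "f \<in> AP" shows "proj f = f"
proof
 fix z
 show "proj f z = f z" using reproducing[OF AP_D(2)[OF assms] LP_integrable[OF AP_D(1)[OF assms]], of z] AP_D(3)[OF assms, of z]
  by (simp add: projection_eq)
qed

lemma proj_add:
 assumes "f \<in> LP" "g \<in> LP"
 shows "proj (%z. f z + g z) = (%z. proj f z + proj g z)"
proof
 fix z
 show "proj (%z. f z + g z) z = proj f z + proj g z"
  using integrable_mult_ker[OF LP_integrable[OF assms(1)], of z] integrable_mult_ker[OF LP_integrable[OF assms(2)], of z]
  by (simp add: projection_eq distrib_right)
qed

lemma proj_cmult: "proj (%z. c * f z) = (%z. c * proj f z)" for f :: "complex ^ 'n => complex"
 by (rule ext) (simp add: projection_eq mult.assoc)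

lemma proj_diff:
 assumes "f \<in> LP" "g \<in> LP"
 shows "proj (%z. f z - g z) = (%z. proj f z - proj g z)"
 using proj_add[OF assms(1) LP_cmult(1)[OF assms(2), of "-1"]] proj_cmult[of "-1" g] by simp

text \<open>Exponent of the test function in Schur's test. The test requires \<open>s0 * p\<close>
  and \<open>s0 * q\<close> below \<open>\<alpha> + 1\<close>; the larger denominator leaves room
  for the additional negative power of \<open>tau\<close> in the commutator estimate.\<close>

definition s0 :: real where "s0 = (\<alpha> + 1) / (4 * (p + q))"

lemma s0: "s0 > 0" "s0 * p < (\<alpha> + 1) / 2" "s0 * q < (\<alpha> + 1) / 2"
proof -
 have pq0: "p + q > 0" using p q by simp
 show s: "s0 > 0" using alpha pq0 by (simp add: s0_def)
 have "(\<alpha> + 1) / (4 * x) * x = (\<alpha> + 1) / 4" if "x > 0" for x using that by simp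
 from this[OF pq0] have sum: "s0 * p + s0 * q = (\<alpha> + 1) / 4" unfolding distrib_left[symmetric] s0_def .
 have "s0 * p > 0" "s0 * q > 0" using s p q by auto
 thus "s0 * p < (\<alpha> + 1) / 2" "s0 * q < (\<alpha> + 1) / 2" using sum alpha by linarith+
qed

lemma FR_ker:
 assumes b: "\<alpha> + b > -1" and c: "c > 0" and e: "b + c = a - N"
 obtains C where "C > 0"
  "!!z. z \<in> UB ==> (NN w. tau w powr b * norm (1 - herm z w) powr (- a)) <= ennreal (C * tau z powr (- c))"
proof -
 have a: "N + b + c = a" using e by simp
 obtain C where C: "C > 0"
  "!!z. z \<in> UB ==> (NN w. tau w powr b / norm (1 - herm w z) powr (N + b + c)) <= ennreal (C * tau z powr (- c))"
  using forelli_rudin[OF b c] by blast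
 show ?thesis
 proof (rule that[OF C(1)])
  fix z :: "complex ^ 'n" assume "z \<in> UB"
  thus "(NN w. tau w powr b * norm (1 - herm z w) powr (- a)) <= ennreal (C * tau z powr (- c))"
   using C(2)[of z] unfolding a by (simp add: powr_minus_divide norm_one_minus_herm_commute[of z])
 qed
qed

lemma norm_projection_nn:
 assumes "f \<in> LP" "z \<in> UB"
 shows "ennreal (norm (proj f z)) <= (NN w. norm (ker z w) * norm (f w))"
 using integral_norm_bound_ennreal[OF integrable_mult_ker[OF LP_integrable[OF assms(1)] assms(2)]] assms(2)
 by (simp add: projection_eq norm_mult mult.commute)

text \<open>In the Forelli-Rudin estimate with \<open>c = - b\<close> the power of
  \<open>tau\<close> reproduces itself, so the same test function serves for \<open>p\<close> and
  \<open>q\<close>.\<close>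

lemma schur_weights:
 obtains C1 C2 where "C1 > 0" "C2 > 0"
  "!!z. z \<in> UB ==> (NN w. norm (ker z w) * (tau w powr (- s0)) powr q) <= ennreal (C1 * (tau z powr (- s0)) powr q)"
  "!!z. z \<in> UB ==> (NN w. norm (ker z w) * (tau w powr (- s0)) powr p) <= ennreal (C2 * (tau z powr (- s0)) powr p)"
proof -
 have 1: "\<alpha> + (- (s0 * q)) > -1" "s0 * q > 0" "- (s0 * q) + s0 * q = N - N" using s0 q alpha by auto
 have 2: "\<alpha> + (- (s0 * p)) > -1" "s0 * p > 0" "- (s0 * p) + s0 * p = N - N" using s0 p alpha by auto
 have E: "norm (ker z w) * tau w powr (- (s0 * r)) = tau w powr (- (s0 * r)) * norm (1 - herm z w) powr (- N)"
  "(tau w powr (- s0)) powr r = tau w powr (- (s0 * r))" for z w r by (simp_all add: norm_ker powr_powr)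
 obtain C1 where C1: "C1 > 0"
  "!!z. z \<in> UB ==> (NN w. tau w powr (- (s0 * q)) * norm (1 - herm z w) powr (- N)) <= ennreal (C1 * tau z powr (- (s0 * q)))"
  by (rule FR_ker[OF 1]) (rule that)
 obtain C2 where C2: "C2 > 0"
  "!!z. z \<in> UB ==> (NN w. tau w powr (- (s0 * p)) * norm (1 - herm z w) powr (- N)) <= ennreal (C2 * tau z powr (- (s0 * p)))"
  by (rule FR_ker[OF 2]) (rule that)
 have "(NN w. norm (ker z w) * (tau w powr (- s0)) powr q) <= ennreal (C1 * (tau z powr (- s0)) powr q)"
  "(NN w. norm (ker z w) * (tau w powr (- s0)) powr p) <= ennreal (C2 * (tau z powr (- s0)) powr p)"
  if "z \<in> UB" for z unfolding E using C1(2)[OF that] C2(2)[OF that] by auto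
 with C1(1) C2(1) show ?thesis by (rule that)
qed

text \<open>Boundedness holds for everything dominated by the integral against the modulus of the
  kernel, not only for the projection. The general form is needed again when the kernel of
  \<open>S\<close> near the diagonal is compared with a small multiple of
  \<open>ker\<close>.\<close>

lemma kernel_domination:
 "\<exists>B>0. \<forall>f\<in>LP. \<forall>u. u \<in> bmM -->
   (\<forall>z\<in>UB. ennreal (norm (u z)) <= (NN w. norm (ker z w) * norm (f w))) --> pw u <= ennreal (B powr p) * pw f"
proof -
 obtain C1 C2 where C: "C1 > 0" "C2 > 0"
  "!!z. z \<in> UB ==> (NN w. norm (ker z w) * (tau w powr (- s0)) powr q) <= ennreal (C1 * (tau z powr (- s0)) powr q)"
  "!!z. z \<in> UB ==> (NN w. norm (ker z w) * (tau w powr (- s0)) powr p) <= ennreal (C2 * (tau z powr (- s0)) powr p)"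
  by (rule schur_weights) (rule that)
 define B where "B = (C1 powr (p - 1) * C2) powr (1 / p)"
 have B: "B > 0" "B powr p = C1 powr (p - 1) * C2" using C p by (auto simp: B_def powr_powr)
 have "pw u <= ennreal (B powr p) * pw f" if f: "f \<in> LP"
  and u: "\<forall>z\<in>UB. ennreal (norm (u z)) <= (NN w. norm (ker z w) * norm (f w))" for f u
 proof -
  have fm: "f \<in> bmM" using f by (rule LP_measurable)
  have "(\<Sum>j\<in>{0::nat}. \<integral>\<^sup>+z. ennreal (norm (u z) powr p) \<partial>M) <= ennreal (C1 powr (p - 1) * C2) * (NN w. norm (f w) powr p)"
  proof (rule schur_family[where k = "%z w. norm (ker z w)" and \<omega> = "%_ _ _. 1" and h = "%w. tau w powr (- s0)"])
   show "!!w. w \<in> UB ==> (NN z. norm (ker z w) * (\<Sum>j\<in>{0::nat}. 1 powr p) * (tau z powr (- s0)) powr p) <= ennreal (C2 * (tau w powr (- s0)) powr p)"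
    using C(4) by (simp add: norm_ker_commute)
   show "!!z. z \<in> UB ==> tau z powr (- s0) > 0" by (simp add: less_imp_neq[OF tau_pos', symmetric])
  qed (use C fm u in auto)
  thus ?thesis by (simp add: pw_def B)
 qed
 thus ?thesis using B(1) by blast
qed

lemma proj_bounded_ex: "\<exists>C>0. \<forall>f\<in>LP. proj f \<in> LP & nrm (proj f) <= C * nrm f"
proof -
 obtain B where B: "B > 0"
  "!!f u. f \<in> LP ==> u \<in> bmM ==>
   \<forall>z\<in>UB. ennreal (norm (u z)) <= (NN w. norm (ker z w) * norm (f w)) ==> pw u <= ennreal (B powr p) * pw f"
  using kernel_domination by blast
 have "proj f \<in> LP & nrm (proj f) <= B * nrm f" if f: "f \<in> LP" for f
 proof -
  have pm: "proj f \<in> bmM" by (rule holomorphic_measurable[OF holomorphic_projection[OF LP_integrable[OF f]]])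
  have "pw (proj f) <= ennreal (B powr p) * pw f" using norm_projection_nn[OF f] by (intro B(2)[OF f pm]) auto
  also have "... = ennreal ((B * nrm f) powr p)" using B(1) by (simp add: pw_LP[OF f] powr_mult ennreal_mult)
  finally have le: "pw (proj f) <= ennreal ((B * nrm f) powr p)" .
  show ?thesis using LP_I[OF pm _ le] B(1) by simp
 qed
 thus ?thesis using B(1) by blast
qed

definition CP :: real where "CP = (SOME C. C > 0 & (\<forall>f\<in>LP. proj f \<in> LP & nrm (proj f) <= C * nrm f))"

lemma CP: "CP > 0" "f \<in> LP ==> nrm (proj f) <= CP * nrm f"
proof -
 have "CP > 0 & (\<forall>f\<in>LP. proj f \<in> LP & nrm (proj f) <= CP * nrm f)"
  unfolding CP_def by (rule someI_ex) (use proj_bounded_ex in blast)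
 thus "CP > 0" "f \<in> LP ==> nrm (proj f) <= CP * nrm f" by blast+
qed

lemma proj_LP: "f \<in> LP ==> proj f \<in> LP" using proj_bounded_ex by blast

lemma proj_AP: "f \<in> LP ==> proj f \<in> AP" by (intro AP_I proj_LP holomorphic_projection LP_integrable proj_outside)

text \<open>The projection maps \<open>LP\<close> into the Bergman space and fixes the latter, so
  closure under linear operations follows from linearity of the projection instead of that of
  derivatives.\<close>

lemma AP_add: assumes "f \<in> AP" "g \<in> AP" shows "(%z. f z + g z) \<in> AP"
 using proj_AP[OF LP_add(1)[OF AP_D(1)[OF assms(1)] AP_D(1)[OF assms(2)]]]
 by (simp add: proj_add[OF AP_D(1)[OF assms(1)] AP_D(1)[OF assms(2)]] proj_AP_eq assms)

lemma AP_cmult: assumes "f \<in> AP" shows "(%z. c * f z) \<in> AP"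
 using proj_AP[OF LP_cmult(1)[OF AP_D(1)[OF assms]]] by (simp add: proj_cmult proj_AP_eq assms)

lemma AP_diff: assumes "f \<in> AP" "g \<in> AP" shows "(%z. f z - g z) \<in> AP"
 using AP_add[OF assms(1) AP_cmult[OF assms(2), of "-1"]] by simp

lemma AP_zero: "(%z. 0) \<in> AP" by (rule AP_I) (auto simp: holomorphic_several_def intro!: exI[of _ "%z. 0"])

lemma AP_sum: "finite J ==> (!!j. j \<in> J ==> f j \<in> AP) ==> (%z. \<Sum>j\<in>J. f j z) \<in> AP"
 by (induction J rule: finite_induct) (auto simp: AP_zero AP_add)

lemma AP_norm_le:
 assumes f: "f \<in> AP" and z: "z \<in> UB"
 shows "norm (f z) <= (1 - norm z) powr (- N) * nrm f"
proof -
 have "norm (f z) <= (1 - norm z) powr (- N) * (LINT w|M. norm (f w))"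
  using norm_projection_le[OF LP_integrable[OF AP_D(1)[OF f]] z] unfolding proj_AP_eq[OF f] .
 also have "... <= (1 - norm z) powr (- N) * nrm f" by (intro mult_left_mono LP_integral_norm_le AP_D(1)[OF f]) simp
 finally show ?thesis .
qed

lemma kf_LP: "w \<in> UB ==> kf w \<in> LP" by (rule LP_bounded(1)[OF holomorphic_measurable[OF holomorphic_kf], of w "(1 - norm w) powr (- N)"])
   (auto simp: kf_def norm_ker_commute[of _ w] norm_ker_le)

lemma kf_AP: "w \<in> UB ==> kf w \<in> AP" by (intro AP_I kf_LP holomorphic_kf) (auto simp: kf_def)

text \<open>Hoelder's inequality in the reproducing formula, with the \<open>q\<close>-norm of the
  kernel from the Forelli-Rudin estimate. The exponent refines \<open>AP_norm_le\<close>: combined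
  with \<open>nrm_kf_le\<close> it gives, on the diagonal, exactly the power \<open>- N\<close> of
  \<open>tau\<close>.\<close>

lemma AP_growth:
 obtains C where "C > 0" "!!f z. f \<in> AP ==> z \<in> UB ==> norm (f z) <= C * tau z powr (- N / p) * nrm f"
proof -
 have h: "\<alpha> + 0 > -1" "N * (q - 1) > 0" "0 + N * (q - 1) = N * q - N" using alpha N_pos q by (auto simp: algebra_simps)
 obtain C where C: "C > 0"
  "!!z. z \<in> UB ==> (NN w. tau w powr 0 * norm (1 - herm z w) powr (- (N * q))) <= ennreal (C * tau z powr (- (N * (q - 1))))"
  by (rule FR_ker[OF h]) (rule that)
 have "q / p = q - 1" using p by (simp add: q_def conj_exponent_def field_simps)
 hence qp: "N / p * q = N * (q - 1)" by (metis times_divide_eq_left times_divide_eq_right)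
 show ?thesis
 proof (rule that)
  show "C powr (1 / q) > 0" using C by simp
  fix f :: "complex ^ 'n => complex" and z :: "complex ^ 'n" assume f: "f \<in> AP" and z: "z \<in> UB"
  define B where "B = C powr (1 / q) * tau z powr (- N / p)"
  have Bq: "B powr q = C * tau z powr (- (N * (q - 1)))"
  proof -
   have "(- N / p) * q = - (N * (q - 1))" using qp by simp
   thus ?thesis using C(1) q z by (simp add: B_def powr_mult powr_powr)
  qed
  have "(NN w. norm (f w) * norm (ker z w)) <= ennreal (nrm f * B)"
  proof (rule LP_Holder[OF AP_D(1)[OF f]])
   show "(%w. norm (ker z w)) \<in> bmM" by measurable
   have "(NN w. norm (ker z w) powr q) = (NN w. tau w powr 0 * norm (1 - herm z w) powr (- (N * q)))"
    by (intro nn_integral_cong) (auto simp: norm_ker powr_powr less_imp_neq[OF tau_pos', symmetric])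
   thus "(NN w. norm (ker z w) powr q) <= ennreal (B powr q)" using C(2)[OF z] Bq by simp
  qed (auto simp: B_def)
  hence "ennreal (norm (f z)) <= ennreal (nrm f * B)"
   using norm_projection_nn[OF AP_D(1)[OF f] z] unfolding proj_AP_eq[OF f] by (simp add: mult.commute order_trans)
  thus "norm (f z) <= C powr (1 / q) * tau z powr (- N / p) * nrm f" by (subst (asm) ennreal_le_iff) (auto simp: B_def mult_ac)
 qed
qed

lemma nrm_kf_le:
 obtains C where "C > 0" "!!w. w \<in> UB ==> nrm (kf w) <= C * tau w powr (- N / q)"
proof -
 have h: "\<alpha> + 0 > -1" "N * (p - 1) > 0" "0 + N * (p - 1) = N * p - N" using alpha N_pos p by (auto simp: algebra_simps)
 obtain C where C: "C > 0"
  "!!z. z \<in> UB ==> (NN w. tau w powr 0 * norm (1 - herm z w) powr (- (N * p))) <= ennreal (C * tau z powr (- (N * (p - 1))))"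
  by (rule FR_ker[OF h]) (rule that)
 have qp: "N / q * p = N * (p - 1)" using p_div_q by (metis times_divide_eq_left times_divide_eq_right)
 show ?thesis
 proof (rule that)
  show "C powr (1 / p) > 0" using C by simp
  fix w :: "complex ^ 'n" assume w: "w \<in> UB"
  define B where "B = C powr (1 / p) * tau w powr (- N / q)"
  have Bp: "B powr p = C * tau w powr (- (N * (p - 1)))"
  proof -
   have "(- N / q) * p = - (N * (p - 1))" using qp by simp
   thus ?thesis using C(1) p w by (simp add: B_def powr_mult powr_powr)
  qed
  have "pw (kf w) = (NN z. tau z powr 0 * norm (1 - herm w z) powr (- (N * p)))" unfolding pw_def
   by (intro nn_integral_cong) (auto simp: kf_def norm_one_minus_herm_commute[of _ w] norm_ker powr_powr less_imp_neq[OF tau_pos', symmetric])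
  also have "... <= ennreal (B powr p)" using C(2)[OF w] Bp by simp
  finally show "nrm (kf w) <= C powr (1 / p) * tau w powr (- N / q)" using LP_I(2)[OF LP_measurable[OF kf_LP[OF w]], of B] by (simp add: B_def)
 qed
qed

end

section \<open>Slowly varying families and commutators with the projection\<close>

text \<open>For the pseudohyperbolic distance \<rho> of two points of the ball,
  \<open>tau z * tau w\<close> divided by the square of \<open>norm (1 - herm z w)\<close> is 1
  minus the square of \<rho>. Closeness is thus a bound on \<rho> and becomes weaker as
  \<open>\<delta>\<close> decreases.\<close>

definition close :: "real => complex ^ 'n => complex ^ 'n => bool" where
 "close \<delta> z w \<longleftrightarrow> \<delta> * (norm (1 - herm z w))\<^sup>2 <= tau z * tau w"

context bergman_space begin

text \<open>One parameter plays two roles: as \<open>\<delta>\<close> decreases, more pairs count as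
  close and less variation is tolerated between them. The notion is therefore monotone in
  \<open>\<delta>\<close>.\<close>

definition slow :: "real => nat set => (nat => complex ^ 'n => real) => bool" where
 "slow \<delta> J \<phi> \<longleftrightarrow> finite J & (\<forall>j\<in>J. \<phi> j \<in> bmM & (\<forall>z. 0 <= \<phi> j z)) &
   (\<forall>z\<in>UB. (\<Sum>j\<in>J. \<phi> j z powr p) <= 1) &
   (\<forall>z\<in>UB. \<forall>w\<in>UB. close \<delta> z w --> (\<Sum>j\<in>J. \<bar>\<phi> j z - \<phi> j w\<bar> powr p) <= \<delta>)"

lemma slow_le_1: assumes "slow d J f" "j \<in> J" "z \<in> UB" shows "f j z <= 1"
proof (rule ccontr)
 assume "\<not> f j z <= 1"
 hence "1 < f j z powr p" using p powr_less_mono2[of p 1 "f j z"] by simp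
 also have "... <= (\<Sum>j\<in>J. f j z powr p)" using assms by (intro member_le_sum) (auto simp: slow_def)
 also have "... <= 1" using assms by (auto simp: slow_def)
 finally show False by simp
qed

lemma slow_mult_LP:
 assumes "slow d J g" "j \<in> J" "f \<in> LP"
 shows "(mul (g j) f) \<in> LP" "nrm (mul (g j) f) <= nrm f"
proof -
 have [measurable]: "g j \<in> bmM" using assms by (auto simp: slow_def)
 have m: "(%w. complex_of_real (g j w)) \<in> bmM" by measurable
 have "norm (complex_of_real (g j w)) <= 1" if "w \<in> UB" for w using slow_le_1[OF assms(1,2) that] assms(1,2) by (auto simp: slow_def)
 from LP_bounded_mult[OF assms(3) m this]
 show "(mul (g j) f) \<in> LP" "nrm (mul (g j) f) <= nrm f" by auto
qed

lemma slow_sum_pw: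
 assumes "slow d J g" and fm: "f \<in> bmM"
 shows "(\<Sum>j\<in>J. pw (mul (g j) f)) <= pw f"
proof -
 have m: "g j \<in> bmM" if "j \<in> J" for j using assms that by (auto simp: slow_def)
 have "(\<Sum>j\<in>J. pw (mul (g j) f)) = (\<integral>\<^sup>+w. (\<Sum>j\<in>J. ennreal (norm (of_real (g j w) * f w) powr p)) \<partial>M)"
  unfolding pw_def
 proof (rule nn_integral_sum[symmetric])
  fix j assume "j \<in> J"
  hence [measurable]: "g j \<in> bmM" "f \<in> bmM" using m fm by auto
  show "(%w. ennreal (norm (of_real (g j w) * f w) powr p)) \<in> bmM" by measurable
 qed
 also have "... <= (NN w. norm (f w) powr p)"
 proof (rule nn_integral_mono)
  fix w assume w: "w \<in> space M"
  have "(\<Sum>j\<in>J. norm (of_real (g j w) * f w) powr p) = (\<Sum>j\<in>J. g j w powr p) * norm (f w) powr p"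
   unfolding sum_distrib_right using assms by (intro sum.cong) (auto simp: slow_def norm_mult powr_mult)
  also have "... <= 1 * norm (f w) powr p" using assms w by (intro mult_right_mono) (auto simp: slow_def)
  finally show "(\<Sum>j\<in>J. ennreal (norm (of_real (g j w) * f w) powr p)) <= ennreal (norm (f w) powr p)" by (simp add: sum_ennreal ennreal_leI)
 qed
 finally show ?thesis by (simp add: pw_def)
qed

text \<open>The commutator has the kernel \<open>ker z w\<close> times the difference of
  \<open>g j\<close> at the two points. For close pairs the sum of the \<open>p\<close>-th powers is
  at most \<open>\<delta>\<close>. For the other pairs it is at most 2, and since
  \<open>\<delta>\<close> times the squared \<open>norm (1 - herm w z)\<close> exceeds
  \<open>tau z * tau w\<close>, a \<open>t\<close>-th power of this quotient may be inserted. The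
  inserted powers only shift the exponents in the Forelli-Rudin estimate.\<close>

lemma commutator_projection:
 assumes e: "\<epsilon> > 0"
 shows "\<exists>\<delta>>0. \<forall>J g. slow \<delta> J g --> (\<forall>f\<in>LP.
  (\<Sum>j\<in>J. pw (comm proj (g j) f)) <= ennreal (\<epsilon> * nrm f powr p))"
proof -
 obtain C1 C2 where C: "C1 > 0" "C2 > 0"
  "!!z. z \<in> UB ==> (NN w. norm (ker z w) * (tau w powr (- s0)) powr q) <= ennreal (C1 * (tau z powr (- s0)) powr q)"
  "!!z. z \<in> UB ==> (NN w. norm (ker z w) * (tau w powr (- s0)) powr p) <= ennreal (C2 * (tau z powr (- s0)) powr p)"
  by (rule schur_weights) (rule that)
 \<comment> \<open>Half of \<open>s0 * p\<close>: the power \<open>- t\<close> of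
   \<open>tau w\<close> that comes from far pairs and the one that the integral produces then
   multiply to the \<open>p\<close>-th power of the test function.\<close>
 define t where "t = s0 * p / 2"
 have t: "t > 0" using s0 p by (simp add: t_def)
 have x: "s0 * p = 2 * t" by (simp add: t_def)
 have t4: "4 * t < \<alpha> + 1" using s0(2) unfolding x by (simp add: field_simps)
 have "\<alpha> + (- t - s0 * p) > -1" unfolding x using t4 t by (simp add: algebra_simps)
 moreover have "(- t - s0 * p) + t = (N - 2 * t) - N" unfolding x by simp
 ultimately have h: "\<alpha> + (- t - s0 * p) > -1" "t > 0" "(- t - s0 * p) + t = (N - 2 * t) - N" using t by auto
 obtain C3 where C3: "C3 > 0"
  "!!z. z \<in> UB ==> (NN w. tau w powr (- t - s0 * p) * norm (1 - herm z w) powr (- (N - 2 * t))) <= ennreal (C3 * tau z powr (- t))"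
  by (rule FR_ker[OF h]) (rule that)
 define K where "K = C1 powr (p - 1)"
 have K: "K > 0" using C by (simp add: K_def)
 \<comment> \<open>The first entry controls close pairs and the second one far pairs; each
   contributes at most half of \<open>\<epsilon>\<close> after multiplication with the Schur
   constant \<open>K\<close>.\<close>
 define \<delta> where "\<delta> = min (\<epsilon> / (2 * K * C2)) ((\<epsilon> / (4 * K * C3)) powr (1 / t))"
 have \<delta>: "\<delta> > 0" using e K C C3 by (simp add: \<delta>_def)
 have \<delta>1: "\<delta> * C2 <= \<epsilon> / (2 * K)"
 proof -
  have "\<delta> * C2 <= \<epsilon> / (2 * K * C2) * C2" using C by (intro mult_right_mono) (auto simp: \<delta>_def)
  thus ?thesis using C K by simp
 qed
 have \<delta>2: "2 * \<delta> powr t * C3 <= \<epsilon> / (2 * K)"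
 proof -
  have "\<delta> powr t <= ((\<epsilon> / (4 * K * C3)) powr (1 / t)) powr t" using \<delta> t by (intro powr_mono2) (auto simp: \<delta>_def)
  also have "... = \<epsilon> / (4 * K * C3)" using e K C3 t by (simp add: powr_powr)
  finally have "(2 * C3) * \<delta> powr t <= (2 * C3) * (\<epsilon> / (4 * K * C3))" using C3(1) by (intro mult_left_mono) auto
  also have "... = \<epsilon> / (2 * K)" using C3(1) K by (simp add: field_simps)
  finally show ?thesis by (simp add: mult_ac)
 qed
 show ?thesis
 proof (intro exI[of _ \<delta>] conjI \<delta> allI impI ballI)
  fix J g f assume s: "slow \<delta> J g" and f: "f \<in> LP"
  have J: "finite J" and m: "!!j. j \<in> J ==> g j \<in> bmM" and nn: "!!j z. j \<in> J ==> 0 <= g j z"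
   and le1: "!!z. z \<in> UB ==> (\<Sum>j\<in>J. g j z powr p) <= 1"
   and cl: "!!z w. z \<in> UB ==> w \<in> UB ==> close \<delta> z w ==> (\<Sum>j\<in>J. \<bar>g j z - g j w\<bar> powr p) <= \<delta>"
   using s by (auto simp: slow_def)
  have fm: "f \<in> bmM" using f by (rule LP_measurable)
  define \<omega> where "\<omega> j z w = \<bar>g j z - g j w\<bar>" for j z w
  have \<omega>2: "(\<Sum>j\<in>J. \<omega> j z w powr p) <= 2" if "z \<in> UB" "w \<in> UB" for z w
  proof -
   have "(\<Sum>j\<in>J. \<omega> j z w powr p) <= (\<Sum>j\<in>J. g j z powr p + g j w powr p)"
   proof (rule sum_mono)
    fix j assume j: "j \<in> J"
    have "\<omega> j z w <= g j z \<or> \<omega> j z w <= g j w" unfolding \<omega>_def using nn[OF j, of z] nn[OF j, of w] by linarith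
    hence "\<omega> j z w powr p <= g j z powr p \<or> \<omega> j z w powr p <= g j w powr p"
     using p by (auto simp: \<omega>_def intro: powr_mono2)
    thus "\<omega> j z w powr p <= g j z powr p + g j w powr p" by (auto intro: add_increasing add_increasing2)
   qed
   also have "... <= 2" using le1[OF that(1)] le1[OF that(2)] by (simp add: sum.distrib)
   finally show ?thesis .
  qed
  have \<omega>b: "(\<Sum>j\<in>J. \<omega> j z w powr p) <= \<delta> + 2 * \<delta> powr t * (norm (1 - herm w z) powr (2 * t) * (tau z powr (- t) * tau w powr (- t)))"
   if zw: "z \<in> UB" "w \<in> UB" for z w
  proof (cases "close \<delta> z w")
   case True
   have "(\<Sum>j\<in>J. \<omega> j z w powr p) <= \<delta>" unfolding \<omega>_def by (rule cl[OF zw True])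
   thus ?thesis by (rule order_trans) simp
  next
   case False
   have tt: "tau z > 0" "tau w > 0" "norm (1 - herm w z) > 0" using zw norm_one_minus_herm_pos[of w z] by auto
   have "tau z * tau w < \<delta> * (norm (1 - herm w z))\<^sup>2" using False by (simp add: close_def norm_one_minus_herm_commute[of z w])
   hence "1 <= \<delta> * (norm (1 - herm w z))\<^sup>2 / (tau z * tau w)" using tt by simp
   hence "1 powr t <= (\<delta> * (norm (1 - herm w z))\<^sup>2 / (tau z * tau w)) powr t" using t by (intro powr_mono2) auto
   also have "... = \<delta> powr t * (norm (1 - herm w z) powr (2 * t) * (tau z powr (- t) * tau w powr (- t)))"
    using tt \<delta> by (simp add: powr_mult powr_divide powr_minus_divide powr_powr[symmetric] powr_numeral)
   finally have "2 <= 2 * \<delta> powr t * (norm (1 - herm w z) powr (2 * t) * (tau z powr (- t) * tau w powr (- t)))" by simp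
   thus ?thesis using \<omega>2[OF zw] \<delta> by linarith
  qed
  have "(\<Sum>j\<in>J. \<integral>\<^sup>+z. ennreal (norm (proj (mul (g j) f) z - of_real (g j z) * proj f z) powr p) \<partial>M)
   <= ennreal (C1 powr (p - 1) * (\<delta> * C2 + 2 * \<delta> powr t * C3)) * (NN w. norm (f w) powr p)"
  proof (rule schur_family[where k = "%z w. norm (ker z w)" and \<omega> = \<omega> and h = "%w. tau w powr (- s0)"])
   show "(%(z, w). \<omega> j z w) \<in> bmMM" if "j \<in> J" for j unfolding \<omega>_def using m[OF that] by measurable
   show "!!z. z \<in> UB ==> tau z powr (- s0) > 0" by (simp add: less_imp_neq[OF tau_pos', symmetric])
   show "ennreal (norm (proj (mul (g j) f) z - of_real (g j z) * proj f z)) <= (NN w. norm (ker z w) * \<omega> j z w * norm (f w))"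
    if j: "j \<in> J" and z: "z \<in> UB" for j z
   proof -
    have i: "integrable M (%w. of_real (g j w) * f w * ker z w)"
     by (rule integrable_mult_ker[OF LP_integrable[OF slow_mult_LP(1)[OF s j f]] z])
    have i2: "integrable M (%w. of_real (g j z) * (f w * ker z w))"
     by (intro integrable_mult_right integrable_mult_ker[OF LP_integrable[OF f] z])
    have "proj (mul (g j) f) z - of_real (g j z) * proj f z = (LINT w|M. of_real (g j w) * f w * ker z w - of_real (g j z) * (f w * ker z w))"
     unfolding Bochner_Integration.integral_diff[OF i i2] using z by (simp add: projection_eq)
    hence "ennreal (norm (proj (mul (g j) f) z - of_real (g j z) * proj f z))
      <= (NN w. norm (of_real (g j w) * f w * ker z w - of_real (g j z) * (f w * ker z w)))"
     using integral_norm_bound_ennreal[OF Bochner_Integration.integrable_diff[OF i i2]] by simp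
    also have "... = (NN w. norm (ker z w) * \<omega> j z w * norm (f w))"
    proof (rule nn_integral_cong)
     fix w
     have "of_real (g j w) * f w * ker z w - of_real (g j z) * (f w * ker z w) = of_real (g j w - g j z) * (f w * ker z w)"
      by (simp add: left_diff_distrib mult.assoc)
     hence "norm (of_real (g j w) * f w * ker z w - of_real (g j z) * (f w * ker z w)) = \<bar>g j w - g j z\<bar> * (norm (f w) * norm (ker z w))"
      by (simp only: norm_mult norm_of_real)
     thus "ennreal (norm (of_real (g j w) * f w * ker z w - of_real (g j z) * (f w * ker z w))) = ennreal (norm (ker z w) * \<omega> j z w * norm (f w))"
      by (simp add: \<omega>_def abs_minus_commute mult_ac)
    qed
    finally show ?thesis .
   qed
   show "(NN z. norm (ker z w) * (\<Sum>j\<in>J. \<omega> j z w powr p) * (tau z powr (- s0)) powr p) <= ennreal ((\<delta> * C2 + 2 * \<delta> powr t * C3) * (tau w powr (- s0)) powr p)"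
    if w: "w \<in> UB" for w
   proof -
    let ?A = "%z. norm (ker w z) * (tau z powr (- s0)) powr p"
    let ?B = "%z. tau z powr (- t - s0 * p) * norm (1 - herm w z) powr (- (N - 2 * t))"
    have "(NN z. norm (ker z w) * (\<Sum>j\<in>J. \<omega> j z w powr p) * (tau z powr (- s0)) powr p)
     <= (\<integral>\<^sup>+z. ennreal \<delta> * ennreal (?A z) + ennreal (2 * \<delta> powr t * tau w powr (- t)) * ennreal (?B z) \<partial>M)"
    proof (rule nn_integral_mono)
     fix z assume "z \<in> space M"
     hence z: "z \<in> UB" by simp
     have nz: "norm (1 - herm w z) > 0" using norm_one_minus_herm_pos[of w z] z w by simp
     have "norm (ker z w) * (\<Sum>j\<in>J. \<omega> j z w powr p) * (tau z powr (- s0)) powr p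
       <= norm (ker w z) * (\<delta> + 2 * \<delta> powr t * (norm (1 - herm w z) powr (2 * t) * (tau z powr (- t) * tau w powr (- t)))) * (tau z powr (- s0)) powr p"
      using \<omega>b[OF z w] by (intro mult_right_mono mult_mono) (auto simp: norm_ker_commute[of z w] intro!: sum_nonneg)
     also have "... = \<delta> * ?A z + 2 * \<delta> powr t * tau w powr (- t) * ((norm (1 - herm w z) powr (2 * t) * norm (1 - herm w z) powr (- N)) * (tau z powr (- t) * tau z powr (- (s0 * p))))"
      by (simp add: norm_ker powr_powr distrib_left distrib_right mult_ac)
     also have "norm (1 - herm w z) powr (2 * t) * norm (1 - herm w z) powr (- N) = norm (1 - herm w z) powr (- (N - 2 * t))"
      by (simp add: powr_add[symmetric])
     also have "tau z powr (- t) * tau z powr (- (s0 * p)) = tau z powr (- t - s0 * p)" by (simp add: powr_add[symmetric])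
     finally show "ennreal (norm (ker z w) * (\<Sum>j\<in>J. \<omega> j z w powr p) * (tau z powr (- s0)) powr p)
      <= ennreal \<delta> * ennreal (?A z) + ennreal (2 * \<delta> powr t * tau w powr (- t)) * ennreal (?B z)"
      using \<delta> by (simp add: ennreal_mult[symmetric] ennreal_plus[symmetric] mult_ac del: ennreal_plus)
    qed
    also have "... = ennreal \<delta> * (NN z. ?A z) + ennreal (2 * \<delta> powr t * tau w powr (- t)) * (NN z. ?B z)"
     by (subst nn_integral_add) (auto simp: nn_integral_cmult)
    also have "... <= ennreal \<delta> * ennreal (C2 * (tau w powr (- s0)) powr p) + ennreal (2 * \<delta> powr t * tau w powr (- t)) * ennreal (C3 * tau w powr (- t))"
     by (intro add_mono mult_left_mono C(4)[OF w] C3(2)[OF w]) auto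
    also have "... = ennreal (\<delta> * C2 * (tau w powr (- s0)) powr p + 2 * \<delta> powr t * C3 * (tau w powr (- t) * tau w powr (- t)))"
     using \<delta> C C3 by (simp add: ennreal_mult[symmetric] ennreal_plus[symmetric] mult_ac del: ennreal_plus)
    also have "tau w powr (- t) * tau w powr (- t) = (tau w powr (- s0)) powr p" by (simp add: powr_add[symmetric] powr_powr t_def mult.commute)
    finally show ?thesis by (simp add: distrib_right)
   qed
  qed (use C C3 \<delta> fm J in \<open>auto simp: \<omega>_def\<close>)
  also have "... <= ennreal \<epsilon> * (NN w. norm (f w) powr p)"
  proof (intro mult_right_mono ennreal_leI)
   have "K * (\<delta> * C2 + 2 * \<delta> powr t * C3) <= K * (\<epsilon> / (2 * K) + \<epsilon> / (2 * K))"
    using K \<delta>1 \<delta>2 by (intro mult_left_mono add_mono) auto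
   also have "... = \<epsilon>" using K by simp
   finally show "C1 powr (p - 1) * (\<delta> * C2 + 2 * \<delta> powr t * C3) <= \<epsilon>" by (simp add: K_def)
  qed simp
  finally show "(\<Sum>j\<in>J. pw (comm proj (g j) f)) <= ennreal (\<epsilon> * nrm f powr p)" using pw_LP[OF f] e by (simp add: pw_def ennreal_mult)
 qed
qed

section \<open>Local operators, bounded operators and the Toeplitz algebra\<close>

abbreviation BO :: "'n operator set" where "BO \<equiv> bounded_operators p \<alpha>"
abbreviation TA :: "'n operator set" where "TA \<equiv> toeplitz_algebra p \<alpha>"

lemma pw_add: "f \<in> bmM ==> g \<in> bmM ==> pw (%z. f z + g z) <= ennreal (2 powr p) * (pw f + pw g)"
proof -
 assume [measurable]: "f \<in> bmM" "g \<in> bmM"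
 have "pw (%z. f z + g z) <= (\<integral>\<^sup>+z. ennreal (2 powr p) * (ennreal (norm (f z) powr p) + ennreal (norm (g z) powr p)) \<partial>M)"
  unfolding pw_def
 proof (rule nn_integral_mono)
  fix z
  have "norm (f z + g z) powr p <= (norm (f z) + norm (g z)) powr p" using p by (intro powr_mono2 norm_triangle_ineq) auto
  also have "... <= 2 powr p * (norm (f z) powr p + norm (g z) powr p)" by (rule add_powr_le[OF p]) auto
  finally show "ennreal (norm (f z + g z) powr p) <= ennreal (2 powr p) * (ennreal (norm (f z) powr p) + ennreal (norm (g z) powr p))"
   by (simp add: ennreal_mult[symmetric] ennreal_plus[symmetric] ennreal_leI del: ennreal_plus)
 qed
 also have "... = ennreal (2 powr p) * (pw f + pw g)" unfolding pw_def by (subst nn_integral_cmult) (auto simp: nn_integral_add)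
 finally show ?thesis .
qed

lemma pw_le_nrm: assumes "f \<in> LP" "nrm f <= c" shows "pw f <= ennreal (c powr p)"
 unfolding pw_LP[OF assms(1)] using assms(2) p by (intro ennreal_leI powr_mono2) auto

lemma slow_mono: "slow d J f ==> d <= d' ==> slow d' J f" unfolding slow_def close_def by (meson mult_right_mono order_trans zero_le_power2)

definition comm_le :: "'n operator => real => bool" where
 "comm_le X \<epsilon> \<longleftrightarrow> (\<exists>\<delta>>0. \<forall>J \<phi>. slow \<delta> J \<phi> --> (\<forall>f\<in>LP.
  (\<Sum>j\<in>J. pw (comm X (\<phi> j) f)) <= ennreal (\<epsilon> * nrm f powr p)))"

definition bddL :: "'n operator => bool" where
 "bddL X \<longleftrightarrow> (\<forall>f\<in>LP. X f \<in> LP) & (\<forall>f\<in>LP. \<forall>g\<in>LP. X (%z. f z - g z) = (%z. X f z - X g z)) &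
  (\<exists>C>0. \<forall>f\<in>LP. nrm (X f) <= C * nrm f)"

lemma bddL_I:
 assumes "!!f. f \<in> LP ==> X f \<in> LP" "!!f g. f \<in> LP ==> g \<in> LP ==> X (%z. f z - g z) = (%z. X f z - X g z)"
  "C > 0" "!!f. f \<in> LP ==> nrm (X f) <= C * nrm f"
 shows "bddL X" using assms unfolding bddL_def by blast

text \<open>Operators that commute with slow families up to a small error. They act on
  \<open>LP\<close>, since multiplication by \<open>\<phi> j\<close> leaves the Bergman space; an
  operator \<open>S\<close> of the Bergman space enters as \<open>S\<close> after
  \<open>proj\<close>.\<close>

definition local_op :: "'n operator => bool" where
 "local_op X \<longleftrightarrow> bddL X & (\<forall>\<epsilon>>0. comm_le X \<epsilon>)"

lemma comm_le_scale:
 assumes K: "K > 0" and "!!e. e > 0 ==> comm_le X (K * e)"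
 shows "\<forall>e>0. comm_le X e"
proof (intro allI impI)
 fix e :: real assume "e > 0"
 thus "comm_le X e" using assms(2)[of "e / K"] K by simp
qed

lemma comm_le_joint:
 assumes "comm_le X e1" "comm_le Y e2"
 obtains d where "d > 0"
  "!!J g f. slow d J g ==> f \<in> LP ==> (\<Sum>j\<in>J. pw (comm X (g j) f)) <= ennreal (e1 * nrm f powr p)"
  "!!J g f. slow d J g ==> f \<in> LP ==> (\<Sum>j\<in>J. pw (comm Y (g j) f)) <= ennreal (e2 * nrm f powr p)"
proof -
 obtain d1 where d1: "d1 > 0" "!!J g f. slow d1 J g ==> f \<in> LP ==> (\<Sum>j\<in>J. pw (comm X (g j) f)) <= ennreal (e1 * nrm f powr p)"
  using assms(1) unfolding comm_le_def by auto
 obtain d2 where d2: "d2 > 0" "!!J g f. slow d2 J g ==> f \<in> LP ==> (\<Sum>j\<in>J. pw (comm Y (g j) f)) <= ennreal (e2 * nrm f powr p)"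
  using assms(2) unfolding comm_le_def by auto
 show ?thesis by (rule that[of "min d1 d2"]) (use d1 d2 slow_mono in auto)
qed

lemma local_projection: "local_op proj" unfolding local_op_def bddL_def comm_le_def using proj_LP proj_diff CP commutator_projection by blast

lemma slow_commutator_LP:
 assumes X: "bddL X" and s: "slow d J g" and j: "j \<in> J" and f: "f \<in> LP"
 shows "(comm X (g j) f) \<in> LP" using X s j f by (intro LP_diff(1) slow_mult_LP(1)) (auto simp: bddL_def intro: slow_mult_LP(1))

text \<open>The commutator of the composition is \<open>X\<close> applied to the commutator of
  \<open>Y\<close>, plus the commutator of \<open>X\<close> at \<open>Y f\<close>. The norm of
  \<open>X\<close> multiplies the first part and that of \<open>Y\<close> the second.\<close>

lemma local_comp:
 assumes X: "local_op X" and Y: "local_op Y"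
 shows "local_op (%f. X (Y f))"
proof -
 have bX: "bddL X" and bY: "bddL Y" using X Y by (auto simp: local_op_def)
 obtain CX where CX: "CX > 0" "!!f. f \<in> LP ==> nrm (X f) <= CX * nrm f" using bX by (auto simp: bddL_def)
 obtain CY where CY: "CY > 0" "!!f. f \<in> LP ==> nrm (Y f) <= CY * nrm f" using bY by (auto simp: bddL_def)
 have mem: "f \<in> LP ==> X f \<in> LP" "f \<in> LP ==> Y f \<in> LP" for f using bX bY by (auto simp: bddL_def)
 have dX: "f \<in> LP ==> g \<in> LP ==> X (%z. f z - g z) = (%z. X f z - X g z)" for f g using bX by (auto simp: bddL_def)
 have dY: "f \<in> LP ==> g \<in> LP ==> Y (%z. f z - g z) = (%z. Y f z - Y g z)" for f g using bY by (auto simp: bddL_def)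
 have "bddL (%f. X (Y f))"
 proof (rule bddL_I)
  show "CX * CY > 0" using CX(1) CY(1) by simp
  show "nrm (X (Y f)) <= CX * CY * nrm f" if "f \<in> LP" for f
  proof -
   have "nrm (X (Y f)) <= CX * nrm (Y f)" by (rule CX(2)[OF mem(2)[OF that]])
   also have "... <= CX * (CY * nrm f)" using CX(1) by (intro mult_left_mono CY(2) that) simp
   finally show ?thesis by (simp add: mult.assoc)
  qed
 qed (use mem dX dY in auto)
 moreover have "\<forall>x>0. comm_le (%f. X (Y f)) x"
 proof (rule comm_le_scale)
  show "2 powr p * (CX powr p + CY powr p) > 0" using CX CY by (simp add: add_pos_pos)
  fix x :: real assume e: "x > 0"
  obtain d where d: "d > 0"
   "!!J h f. slow d J h ==> f \<in> LP ==> (\<Sum>j\<in>J. pw (comm X (h j) f)) <= ennreal (x * nrm f powr p)"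
   "!!J h f. slow d J h ==> f \<in> LP ==> (\<Sum>j\<in>J. pw (comm Y (h j) f)) <= ennreal (x * nrm f powr p)"
   by (rule comm_le_joint[of X x Y x]) (use X Y e in \<open>auto simp: local_op_def\<close>)
  show "comm_le (%f. X (Y f)) (2 powr p * (CX powr p + CY powr p) * x)" unfolding comm_le_def
  proof (intro exI[of _ d] conjI d(1) allI impI ballI)
   fix J h f assume s: "slow d J h" and f: "f \<in> LP"
   define A where "A j = (comm Y (h j) f)" for j
   define B where "B j = (%z. X (%w. of_real (h j w) * Y f w) z - of_real (h j z) * X (Y f) z)" for j
   have A: "A j \<in> LP" and B: "B j \<in> LP" if "j \<in> J" for j
    unfolding A_def B_def using slow_commutator_LP[OF bY s that f] slow_commutator_LP[OF bX s that mem(2)[OF f]] by auto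
   have eq: "(%z. X (Y (mul (h j) f)) z - of_real (h j z) * X (Y f) z) = (%z. X (A j) z + B j z)" if "j \<in> J" for j
    using dX[OF mem(2)[OF slow_mult_LP(1)[OF s that f]] slow_mult_LP(1)[OF s that mem(2)[OF f]]] by (simp add: A_def B_def)
   have "(\<Sum>j\<in>J. pw (%z. X (Y (mul (h j) f)) z - of_real (h j z) * X (Y f) z))
     <= (\<Sum>j\<in>J. ennreal (2 powr p) * (ennreal (CX powr p) * pw (A j) + pw (B j)))"
   proof (rule sum_mono)
    fix j assume j: "j \<in> J"
    have "pw (X (A j)) <= ennreal ((CX * nrm (A j)) powr p)" by (rule pw_le_nrm[OF mem(1)[OF A[OF j]] CX(2)[OF A[OF j]]])
    also have "... = ennreal (CX powr p) * pw (A j)" using CX(1) by (simp add: pw_LP[OF A[OF j]] powr_mult ennreal_mult)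
    finally show "pw (%z. X (Y (mul (h j) f)) z - of_real (h j z) * X (Y f) z) <= ennreal (2 powr p) * (ennreal (CX powr p) * pw (A j) + pw (B j))"
     unfolding eq[OF j] using pw_add[OF LP_measurable[OF mem(1)[OF A[OF j]]] LP_measurable[OF B[OF j]]]
     by (meson add_right_mono mult_left_mono order_trans zero_le)
   qed
   also have "... = ennreal (2 powr p) * (ennreal (CX powr p) * (\<Sum>j\<in>J. pw (A j)) + (\<Sum>j\<in>J. pw (B j)))"
    by (simp add: sum_distrib_left sum.distrib distrib_left)
   also have "... <= ennreal (2 powr p) * (ennreal (CX powr p) * ennreal (x * nrm f powr p) + ennreal (x * nrm (Y f) powr p))"
    unfolding A_def B_def by (intro mult_left_mono add_mono d(2)[OF s mem(2)[OF f]] d(3)[OF s f]) auto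
   also have "... <= ennreal (2 powr p) * (ennreal (CX powr p) * ennreal (x * nrm f powr p) + ennreal (x * (CY * nrm f) powr p))"
    using CY(2)[OF f] e p by (intro mult_left_mono add_mono ennreal_leI powr_mono2) auto
   also have "... = ennreal (2 powr p * (CX powr p + CY powr p) * x * nrm f powr p)"
    using e CX(1) CY(1) by (simp add: ennreal_mult[symmetric] ennreal_plus[symmetric] powr_mult distrib_left distrib_right mult_ac del: ennreal_plus)
   finally show "(\<Sum>j\<in>J. pw (%z. X (Y (mul (h j) f)) z - of_real (h j z) * X (Y f) z))
     <= ennreal (2 powr p * (CX powr p + CY powr p) * x * nrm f powr p)" .
  qed
 qed
 ultimately show ?thesis by (simp add: local_op_def)
qed

lemma local_add:
 assumes X: "local_op X" and Y: "local_op Y"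
 shows "local_op (%f z. X f z + Y f z)"
proof -
 have bX: "bddL X" and bY: "bddL Y" using X Y by (auto simp: local_op_def)
 obtain CX where CX: "CX > 0" "!!f. f \<in> LP ==> nrm (X f) <= CX * nrm f" using bX by (auto simp: bddL_def)
 obtain CY where CY: "CY > 0" "!!f. f \<in> LP ==> nrm (Y f) <= CY * nrm f" using bY by (auto simp: bddL_def)
 have mem: "f \<in> LP ==> X f \<in> LP" "f \<in> LP ==> Y f \<in> LP" for f using bX bY by (auto simp: bddL_def)
 have dX: "f \<in> LP ==> g \<in> LP ==> X (%z. f z - g z) = (%z. X f z - X g z)" for f g using bX by (auto simp: bddL_def)
 have dY: "f \<in> LP ==> g \<in> LP ==> Y (%z. f z - g z) = (%z. Y f z - Y g z)" for f g using bY by (auto simp: bddL_def)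
 have "bddL (%f z. X f z + Y f z)"
 proof (rule bddL_I)
  show "CX + CY > 0" using CX(1) CY(1) by simp
  show "nrm (%z. X f z + Y f z) <= (CX + CY) * nrm f" if "f \<in> LP" for f
   using LP_add(2)[OF mem(1)[OF that] mem(2)[OF that]] CX(2)[OF that] CY(2)[OF that] by (simp add: distrib_right)
  show "(%z. X f z + Y f z) \<in> LP" if "f \<in> LP" for f by (rule LP_add(1)[OF mem(1)[OF that] mem(2)[OF that]])
  show "(%z. X (%z. f z - g z) z + Y (%z. f z - g z) z) = (%z. X f z + Y f z - (X g z + Y g z))" if "f \<in> LP" "g \<in> LP" for f g
   unfolding dX[OF that] dY[OF that] by auto
 qed
 moreover have "\<forall>x>0. comm_le (%f z. X f z + Y f z) x"
 proof (rule comm_le_scale)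
  show "2 powr p * 2 > (0::real)" by simp
  fix x :: real assume e: "x > 0"
  obtain d where d: "d > 0"
   "!!J h f. slow d J h ==> f \<in> LP ==> (\<Sum>j\<in>J. pw (comm X (h j) f)) <= ennreal (x * nrm f powr p)"
   "!!J h f. slow d J h ==> f \<in> LP ==> (\<Sum>j\<in>J. pw (comm Y (h j) f)) <= ennreal (x * nrm f powr p)"
   by (rule comm_le_joint[of X x Y x]) (use X Y e in \<open>auto simp: local_op_def\<close>)
  show "comm_le (%f z. X f z + Y f z) (2 powr p * 2 * x)" unfolding comm_le_def
  proof (intro exI[of _ d] conjI d(1) allI impI ballI)
   fix J h f assume s: "slow d J h" and f: "f \<in> LP"
   define A where "A j = (comm X (h j) f)" for j
   define B where "B j = (comm Y (h j) f)" for j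
   have A: "A j \<in> LP" and B: "B j \<in> LP" if "j \<in> J" for j
    unfolding A_def B_def using slow_commutator_LP[OF bX s that f] slow_commutator_LP[OF bY s that f] by auto
   have "(\<Sum>j\<in>J. pw (%z. X (mul (h j) f) z + Y (mul (h j) f) z - of_real (h j z) * (X f z + Y f z)))
     <= (\<Sum>j\<in>J. ennreal (2 powr p) * (pw (A j) + pw (B j)))"
   proof (rule sum_mono)
    fix j assume j: "j \<in> J"
    have eq: "(%z. X (mul (h j) f) z + Y (mul (h j) f) z - of_real (h j z) * (X f z + Y f z)) = (%z. A j z + B j z)"
     by (simp add: A_def B_def distrib_left fun_eq_iff)
    show "pw (%z. X (mul (h j) f) z + Y (mul (h j) f) z - of_real (h j z) * (X f z + Y f z)) <= ennreal (2 powr p) * (pw (A j) + pw (B j))"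
     unfolding eq by (rule pw_add[OF LP_measurable[OF A[OF j]] LP_measurable[OF B[OF j]]])
   qed
   also have "... = ennreal (2 powr p) * ((\<Sum>j\<in>J. pw (A j)) + (\<Sum>j\<in>J. pw (B j)))"
    by (simp add: sum_distrib_left sum.distrib distrib_left)
   also have "... <= ennreal (2 powr p) * (ennreal (x * nrm f powr p) + ennreal (x * nrm f powr p))"
    unfolding A_def B_def by (intro mult_left_mono add_mono d(2)[OF s f] d(3)[OF s f]) auto
   also have "... = ennreal (2 powr p * 2 * x * nrm f powr p)"
    using e by (simp add: ennreal_mult[symmetric] ennreal_plus[symmetric] mult_ac del: ennreal_plus)
   finally show "(\<Sum>j\<in>J. pw (%z. X (mul (h j) f) z + Y (mul (h j) f) z - of_real (h j z) * (X f z + Y f z)))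
     <= ennreal (2 powr p * 2 * x * nrm f powr p)" .
  qed
 qed
 ultimately show ?thesis by (simp add: local_op_def)
qed

text \<open>With \<open>Z = X - Y\<close>, the commutator of \<open>X\<close> consists of that of
  \<open>Y\<close> and the two terms \<open>Z (\<phi> f)\<close> and \<open>\<phi> (Z f)\<close>.
  Over a slow family both have total \<open>p\<close>-th power at most that of the norm of
  \<open>Z\<close> times that of \<open>f\<close>, whatever the number of members.\<close>

lemma local_limit:
 assumes bX: "bddL X" and lim: "!!\<eta>. \<eta> > 0 ==> \<exists>Y. local_op Y & (\<forall>f\<in>LP. nrm (%z. X f z - Y f z) <= \<eta> * nrm f)"
 shows "local_op X"
proof -
 have "\<forall>x>0. comm_le X x"
 proof (rule comm_le_scale)
  show "2 powr p * (1 + 2 powr p * 2) > (0::real)" by (simp add: add_pos_pos)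
  fix x :: real assume e: "x > 0"
  define \<eta> where "\<eta> = x powr (1 / p)"
  have \<eta>: "\<eta> > 0" "\<eta> powr p = x" using e p by (auto simp: \<eta>_def powr_powr)
  obtain Y where Y: "local_op Y" "!!f. f \<in> LP ==> nrm (%z. X f z - Y f z) <= \<eta> * nrm f" using lim[OF \<eta>(1)] by blast
  have bY: "bddL Y" using Y by (auto simp: local_op_def)
  have mem: "f \<in> LP ==> X f \<in> LP" "f \<in> LP ==> Y f \<in> LP" for f using bX bY by (auto simp: bddL_def)
  obtain d where d: "d > 0"
   "!!J g f. slow d J g ==> f \<in> LP ==> (\<Sum>j\<in>J. pw (comm Y (g j) f)) <= ennreal (x * nrm f powr p)"
   by (rule comm_le_joint[of Y x Y x]) (use Y e in \<open>auto simp: local_op_def\<close>)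
  define Z where "Z f = (%z. X f z - Y f z)" for f
  have Z: "Z f \<in> LP" "pw (Z f) <= ennreal x * pw f" if "f \<in> LP" for f
  proof -
   show "Z f \<in> LP" unfolding Z_def by (rule LP_diff(1)[OF mem(1)[OF that] mem(2)[OF that]])
   have "pw (Z f) <= ennreal ((\<eta> * nrm f) powr p)"
    by (rule pw_le_nrm[OF `Z f \<in> LP`]) (use Y(2)[OF that] in \<open>simp add: Z_def\<close>)
   thus "pw (Z f) <= ennreal x * pw f" using \<eta> e by (simp add: pw_LP[OF that] powr_mult ennreal_mult)
  qed
  show "comm_le X (2 powr p * (1 + 2 powr p * 2) * x)" unfolding comm_le_def
  proof (intro exI[of _ d] conjI d(1) allI impI ballI)
   fix J g f assume s: "slow d J g" and f: "f \<in> LP"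
   define A where "A j = (comm Y (g j) f)" for j
   define B where "B j = Z (mul (g j) f)" for j
   define C where "C j = (%z. of_real (g j z) * Z f z)" for j
   have A: "A j \<in> LP" and B: "B j \<in> LP" and C: "C j \<in> LP" if "j \<in> J" for j unfolding A_def B_def C_def
    using slow_commutator_LP[OF bY s that f] Z(1) slow_mult_LP(1)[OF s that f] slow_mult_LP(1)[OF s that Z(1)[OF f]] by auto
   have "(\<Sum>j\<in>J. pw (comm X (g j) f)) <= (\<Sum>j\<in>J. ennreal (2 powr p) * (pw (A j) + ennreal (2 powr p) * (pw (B j) + pw (C j))))"
   proof (rule sum_mono)
    fix j assume j: "j \<in> J"
    have mC: "(%z. - C j z) \<in> bmM" using LP_measurable[OF C[OF j]] by measurable
    have eq: "(comm X (g j) f) = (%z. A j z + (B j z + - C j z))" by (simp add: A_def B_def C_def Z_def right_diff_distrib fun_eq_iff)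
    have "pw (%z. - C j z) = pw (C j)" by (simp add: pw_def)
    hence "pw (%z. B j z + - C j z) <= ennreal (2 powr p) * (pw (B j) + pw (C j))" using pw_add[OF LP_measurable[OF B[OF j]] mC] by simp
    moreover have "(%z. B j z + - C j z) \<in> bmM" using LP_measurable[OF B[OF j]] mC by measurable
    hence "pw (%z. A j z + (B j z + - C j z)) <= ennreal (2 powr p) * (pw (A j) + pw (%z. B j z + - C j z))"
     by (rule pw_add[OF LP_measurable[OF A[OF j]]])
    ultimately show "pw (comm X (g j) f) <= ennreal (2 powr p) * (pw (A j) + ennreal (2 powr p) * (pw (B j) + pw (C j)))"
     unfolding eq by (meson add_left_mono mult_left_mono order_trans zero_le)
   qed
   also have "... = ennreal (2 powr p) * ((\<Sum>j\<in>J. pw (A j)) + ennreal (2 powr p) * ((\<Sum>j\<in>J. pw (B j)) + (\<Sum>j\<in>J. pw (C j))))"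
    by (simp add: sum_distrib_left sum.distrib distrib_left)
   also have "... <= ennreal (2 powr p) * (ennreal (x * nrm f powr p) + ennreal (2 powr p) * (ennreal x * pw f + ennreal x * pw f))"
   proof (intro mult_left_mono add_mono)
    show "(\<Sum>j\<in>J. pw (A j)) <= ennreal (x * nrm f powr p)" unfolding A_def by (rule d(2)[OF s f])
    have "(\<Sum>j\<in>J. pw (B j)) <= (\<Sum>j\<in>J. ennreal x * pw (mul (g j) f))"
     unfolding B_def by (intro sum_mono Z(2) slow_mult_LP(1)[OF s _ f])
    also have "... <= ennreal x * pw f" unfolding sum_distrib_left[symmetric] by (intro mult_left_mono slow_sum_pw[OF s LP_measurable[OF f]]) simp
    finally show "(\<Sum>j\<in>J. pw (B j)) <= ennreal x * pw f" .
    show "(\<Sum>j\<in>J. pw (C j)) <= ennreal x * pw f"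
     unfolding C_def using slow_sum_pw[OF s LP_measurable[OF Z(1)[OF f]]] Z(2)[OF f] by (rule order_trans)
   qed auto
   also have "... = ennreal (2 powr p * (1 + 2 powr p * 2) * x * nrm f powr p)"
    using e by (simp add: pw_LP[OF f] ennreal_mult[symmetric] ennreal_plus[symmetric] distrib_left distrib_right mult_ac del: ennreal_plus)
   finally show "(\<Sum>j\<in>J. pw (comm X (g j) f)) <= ennreal (2 powr p * (1 + 2 powr p * 2) * x * nrm f powr p)" .
  qed
 qed
 thus ?thesis using bX by (simp add: local_op_def)
qed

text \<open>The essential bound refers to \<open>ball_measure\<close>; it passes to \<open>M\<close>
  because the latter has a density with respect to it.\<close>

lemma Linfty_D:
 assumes "a \<in> (Linfty :: (complex ^ 'n => complex) set)"
 obtains C where "C > 0" "a \<in> bmM" "AE z in M. norm (a z) <= C"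
proof -
 have m: "a \<in> borel_measurable ball_measure" using assms by (simp add: Linfty_def)
 obtain C where C: "AE z in ball_measure. norm (a z) <= C" using assms by (auto simp: Linfty_def)
 have am: "a \<in> bmM" using m measurable_cong_sets[OF sets_weighted_measure_eq_ball_measure refl, of \<alpha>] unfolding M_def by blast
 have g: "(%z :: complex ^ 'n. ennreal (weight_const CARD('n) \<alpha> * (1 - (norm z)\<^sup>2) powr \<alpha>)) \<in> borel_measurable ball_measure"
  unfolding measurable_cong_sets[OF sets_weighted_measure_eq_ball_measure[of \<alpha>, symmetric] refl]
  by (rule borel_measurable_weighted_measure) measurable
 have "AE z in M. norm (a z) <= C" unfolding M_def weighted_measure_def by (subst AE_density[OF g]) (use C in eventually_elim, simp)
 hence "AE z in M. norm (a z) <= max C 1" by eventually_elim auto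
 thus ?thesis using am by (intro that[of "max C 1"]) auto
qed

lemma mult_LP:
 assumes a: "a \<in> bmM" "AE z in M. norm (a z) <= C" "C > 0" and f: "f \<in> LP"
 shows "(%z. a z * f z) \<in> LP" "nrm (%z. a z * f z) <= C * nrm f"
proof -
 have fm: "f \<in> bmM" using f by (rule LP_measurable)
 have m: "(%z. a z * f z) \<in> bmM" using a(1) fm by measurable
 have "pw (%z. a z * f z) <= (NN z. norm (of_real C * f z) powr p)" unfolding pw_def
 proof (rule nn_integral_mono_AE)
  show "AE z in M. ennreal (norm (a z * f z) powr p) <= ennreal (norm (of_real C * f z) powr p)" using a(2)
  proof eventually_elim
   case (elim z)
   thus ?case using a(3) p by (intro ennreal_leI powr_mono2) (auto simp: norm_mult mult_right_mono)
  qed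
 qed
 also have "... = ennreal ((C * nrm f) powr p)"
  using pw_LP[OF LP_cmult(1)[OF f, of "of_real C"]] LP_cmult(2)[OF f, of "of_real C"] a(3) by (simp add: pw_def)
 finally have le: "pw (%z. a z * f z) <= ennreal ((C * nrm f) powr p)" .
 show "(%z. a z * f z) \<in> LP" "nrm (%z. a z * f z) <= C * nrm f" using LP_I[OF m _ le] a(3) by auto
qed

lemma local_mult:
 assumes "a \<in> bmM" "AE z in M. norm (a z) <= C" "C > 0"
 shows "local_op (%f z. a z * f z)"
proof -
 have "bddL (%f z. a z * f z)"
 proof (rule bddL_I)
  show "(%z. a z * f z) \<in> LP" "nrm (%z. a z * f z) <= C * nrm f" if "f \<in> LP" for f using mult_LP[OF assms that] by auto
  show "(%z. a z * (f z - g z)) = (%z. a z * f z - a z * g z)" for f g by (simp add: right_diff_distrib)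
 qed fact
 moreover have "comm_le (%f z. a z * f z) e" if "e > 0" for e
 proof -
  have "(%z. a z * (of_real (h z) * f z) - of_real (h z) * (a z * f z)) = (%z. 0)" for h :: "complex ^ 'n => real" and f
   by (rule ext) (simp only: mult.left_commute[of "a _"] diff_self)
  moreover have "pw (%z. 0) = 0" using p by (simp add: pw_def)
  ultimately show ?thesis unfolding comm_le_def by (intro exI[of _ 1]) simp
 qed
 ultimately show ?thesis by (simp add: local_op_def)
qed

lemma local_const: "local_op (%f z. c * f z)" by (rule local_mult[of "%_. c" "norm c + 1"]) (auto simp: add_nonneg_pos)

lemma BO_D:
 assumes S: "S \<in> BO"
 shows "S f \<in> AP" "f \<notin> AP ==> S f = (%z. 0)"
  "f \<in> AP ==> g \<in> AP ==> S (%z. f z + g z) = (%z. S f z + S g z)"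
  "f \<in> AP ==> S (%z. c * f z) = (%z. c * S f z)"
proof -
 show out: "f \<notin> AP ==> S f = (%z. 0)" for f using S unfolding bounded_operators_def mem_Collect_eq by blast
 have "f \<in> AP ==> S f \<in> AP" using S unfolding bounded_operators_def mem_Collect_eq by blast
 thus "S f \<in> AP" using out[of f] AP_zero by metis
 show "f \<in> AP ==> g \<in> AP ==> S (%z. f z + g z) = (%z. S f z + S g z)"
  using S unfolding bounded_operators_def mem_Collect_eq by blast
 show "f \<in> AP ==> S (%z. c * f z) = (%z. c * S f z)" using S unfolding bounded_operators_def mem_Collect_eq by blast
qed

lemma BO_diff_arg:
 assumes S: "S \<in> BO" and "f \<in> AP" "g \<in> AP"
 shows "S (%z. f z - g z) = (%z. S f z - S g z)"
 using BO_D(3)[OF S assms(2) AP_cmult[OF assms(3), of "-1"]] BO_D(4)[OF S assms(3), of "-1"] by simp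

lemma BO_zero_arg: "S \<in> BO ==> S (%z. 0) = (%z. 0)" using BO_D(4)[of S "%z. 0" 0] AP_zero by simp

lemma BO_sum_arg:
 assumes S: "S \<in> BO" and "finite J" "!!j. j \<in> J ==> f j \<in> AP"
 shows "S (%z. \<Sum>j\<in>J. c j * f j z) = (%z. \<Sum>j\<in>J. c j * S (f j) z)" using assms(2,3)
proof (induction J rule: finite_induct)
 case empty thus ?case by (simp add: BO_zero_arg[OF S])
next
 case (insert x F)
 have "(%z. c x * f x z) \<in> AP" "(%z. \<Sum>j\<in>F. c j * f j z) \<in> AP" using insert by (auto intro!: AP_cmult AP_sum)
 from BO_D(3)[OF S this] show ?case using insert BO_D(4)[OF S, of "f x" "c x"] by simp
qed

lemma BO_bound:
 assumes S: "S \<in> BO"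
 obtains C where "C > 0" "!!f. f \<in> AP ==> nrm (S f) <= C * nrm f"
proof -
 obtain C where C: "!!f. f \<in> AP ==> nrm (S f) <= C * nrm f" using S unfolding bounded_operators_def mem_Collect_eq by blast
 show ?thesis
 proof (rule that[of "max C 1"])
  show "nrm (S f) <= max C 1 * nrm f" if "f \<in> AP" for f using order_trans[OF C[OF that] mult_right_mono[of C "max C 1" "nrm f"]] by simp
 qed simp
qed

lemma BO_I:
 assumes "!!f. f \<notin> AP ==> S f = (%z. 0)" "!!f. f \<in> AP ==> S f \<in> AP"
  "!!f g. f \<in> AP ==> g \<in> AP ==> S (%z. f z + g z) = (%z. S f z + S g z)"
  "!!c f. f \<in> AP ==> S (%z. c * f z) = (%z. c * S f z)"
  "!!f. f \<in> AP ==> nrm (S f) <= C * nrm f"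
 shows "S \<in> BO" using assms unfolding bounded_operators_def by blast

lemma op_norm_bdd: "S \<in> BO ==> bdd_above ((%f. nrm (S f)) ` {f \<in> AP. nrm f <= 1})"
proof -
 assume S: "S \<in> BO"
 obtain C where C: "C > 0" "!!f. f \<in> AP ==> nrm (S f) <= C * nrm f" using BO_bound[OF S] by blast
 show ?thesis
 proof (rule bdd_aboveI2)
  fix f assume "f \<in> {f \<in> AP. nrm f <= 1}"
  hence f: "f \<in> AP" "nrm f <= 1" by auto
  show "nrm (S f) <= C" by (rule order_trans[OF C(2)[OF f(1)] mult_left_le[OF f(2)]]) (use C(1) in simp)
 qed
qed

lemma op_norm_nonneg: "S \<in> BO ==> 0 <= op_norm p \<alpha> S" unfolding op_norm_def
 by (rule cSUP_upper2[OF op_norm_bdd, of _ "%z. 0"]) (use p in \<open>auto simp: AP_zero Lp_norm_def\<close>)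

lemma op_norm_le:
 assumes "!!f. f \<in> AP ==> nrm (S f) <= c * nrm f" "c >= 0"
 shows "op_norm p \<alpha> S <= c" unfolding op_norm_def
proof (rule cSUP_least)
 show "{f \<in> AP. nrm f <= 1} ~= {}" using AP_zero by auto
 fix f assume "f \<in> {f \<in> AP. nrm f <= 1}"
 hence f: "f \<in> AP" "nrm f <= 1" by auto
 show "nrm (S f) <= c" by (rule order_trans[OF assms(1)[OF f(1)] mult_left_le[OF f(2) assms(2)]])
qed

lemma op_norm_bound:
 assumes S: "S \<in> BO" and f: "f \<in> AP"
 shows "nrm (S f) <= op_norm p \<alpha> S * nrm f"
proof (cases "nrm f = 0")
 case True
 obtain C where C: "C > 0" "!!f. f \<in> AP ==> nrm (S f) <= C * nrm f" using BO_bound[OF S] by blast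
 show ?thesis using C(2)[OF f] True by simp
next
 case False
 hence pos: "nrm f > 0" using nrm_nonneg[of f] by linarith
 define c where "c = complex_of_real (1 / nrm f)"
 have c: "norm c = 1 / nrm f" using pos by (simp add: c_def norm_divide)
 have g: "(%z. c * f z) \<in> AP" "nrm (%z. c * f z) = 1"
  using AP_cmult[OF f, of c] LP_cmult(2)[OF AP_D(1)[OF f], of c] pos unfolding c by auto
 have "nrm (S (%z. c * f z)) <= op_norm p \<alpha> S" unfolding op_norm_def by (rule cSUP_upper[OF _ op_norm_bdd[OF S]]) (use g in auto)
 moreover have "nrm (S (%z. c * f z)) = nrm (S f) / nrm f" unfolding BO_D(4)[OF S f] LP_cmult(2)[OF AP_D(1)[OF BO_D(1)[OF S]]] c by simp
 ultimately show ?thesis using pos by (simp add: divide_le_eq)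
qed

lemma BO_zero: "(%f z. 0) \<in> BO" by (rule BO_I[of _ 0]) (auto simp: AP_zero)

lemma BO_add: assumes "R \<in> BO" "S \<in> BO" shows "(%f z. R f z + S f z) \<in> BO"
proof (rule BO_I)
 show "nrm (%z. R f z + S f z) <= (op_norm p \<alpha> R + op_norm p \<alpha> S) * nrm f" if "f \<in> AP" for f
  using LP_add(2)[OF AP_D(1)[OF BO_D(1)[OF assms(1)]] AP_D(1)[OF BO_D(1)[OF assms(2)]], of f f]
   op_norm_bound[OF assms(1) that] op_norm_bound[OF assms(2) that] by (simp add: distrib_right)
qed (use assms in \<open>auto simp: BO_D distrib_left fun_eq_iff intro!: AP_add\<close>)

lemma BO_cmult: assumes "R \<in> BO" shows "(%f z. c * R f z) \<in> BO"
proof (rule BO_I)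
 show "nrm (%z. c * R f z) <= (norm c * op_norm p \<alpha> R) * nrm f" if "f \<in> AP" for f
  using LP_cmult(2)[OF AP_D(1)[OF BO_D(1)[OF assms]], of c f] mult_left_mono[OF op_norm_bound[OF assms that] norm_ge_zero[of c]]
  by (simp add: mult.assoc)
qed (use assms in \<open>auto simp: BO_D distrib_left fun_eq_iff intro!: AP_cmult\<close>)

lemma BO_diff: assumes "R \<in> BO" "S \<in> BO" shows "(%f z. R f z - S f z) \<in> BO"
 using BO_add[OF assms(1) BO_cmult[OF assms(2), of "-1"]] by simp

lemma BO_comp: assumes "R \<in> BO" "S \<in> BO" shows "R \<circ> S \<in> BO"
proof (rule BO_I)
 show "nrm ((R \<circ> S) f) <= (op_norm p \<alpha> R * op_norm p \<alpha> S) * nrm f" if "f \<in> AP" for f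
 proof -
  have "nrm (R (S f)) <= op_norm p \<alpha> R * nrm (S f)" by (rule op_norm_bound[OF assms(1) BO_D(1)[OF assms(2)]])
  also have "... <= op_norm p \<alpha> R * (op_norm p \<alpha> S * nrm f)" by (intro mult_left_mono op_norm_bound assms that op_norm_nonneg)
  finally show ?thesis by (simp add: mult.assoc)
 qed
qed (use assms BO_zero_arg[OF assms(1)] in \<open>auto simp: BO_D\<close>)

lemma toeplitz_BO:
 assumes "a \<in> Linfty" shows "toeplitz p \<alpha> a \<in> BO"
proof -
 obtain C where C: "C > 0" "a \<in> bmM" "AE z in M. norm (a z) <= C" using Linfty_D[OF assms] by blast
 note m = mult_LP[OF C(2,3,1) AP_D(1)]
 show ?thesis
 proof (rule BO_I)
  show "nrm (toeplitz p \<alpha> a f) <= (CP * C) * nrm f" if "f \<in> AP" for f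
  proof -
   have "nrm (toeplitz p \<alpha> a f) <= CP * nrm (%z. a z * f z)" using CP(2)[OF m(1)[OF that]] that by (simp add: toeplitz_def)
   also have "... <= CP * (C * nrm f)" using CP(1) by (intro mult_left_mono m(2)[OF that]) simp
   finally show ?thesis by (simp add: mult.assoc)
  qed
  show "toeplitz p \<alpha> a (%z. f z + g z) = (%z. toeplitz p \<alpha> a f z + toeplitz p \<alpha> a g z)" if "f \<in> AP" "g \<in> AP" for f g
   using proj_add[OF m(1)[OF that(1)] m(1)[OF that(2)]] that AP_add[OF that] by (simp add: toeplitz_def distrib_left)
  show "toeplitz p \<alpha> a (%z. c * f z) = (%z. c * toeplitz p \<alpha> a f z)" if "f \<in> AP" for c f
   using proj_cmult[of c "%z. a z * f z"] AP_cmult[OF that, of c] that by (simp add: toeplitz_def mult.left_commute)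
  show "toeplitz p \<alpha> a f \<in> AP" if "f \<in> AP" for f using proj_AP[OF m(1)[OF that]] that by (simp add: toeplitz_def)
 qed (simp add: toeplitz_def)
qed

lemma TA_induct:
 assumes "closed_subalgebra p \<alpha> A" "!!a. a \<in> Linfty ==> toeplitz p \<alpha> a \<in> A" "S \<in> TA"
 shows "S \<in> A" using assms unfolding toeplitz_algebra_def hull_def by blast

lemma closed_subalgebra_BO: "closed_subalgebra p \<alpha> BO" unfolding closed_subalgebra_def using BO_zero BO_add BO_cmult BO_comp by auto

lemma TA_BO: "S \<in> TA ==> S \<in> BO" by (rule TA_induct[OF closed_subalgebra_BO toeplitz_BO])

lemma TA_intros:
 shows TA_toeplitz: "a \<in> Linfty ==> toeplitz p \<alpha> a \<in> TA"
  and TA_zero: "(%f z. 0) \<in> TA"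
  and TA_add: "R \<in> TA ==> S \<in> TA ==> (%f z. R f z + S f z) \<in> TA"
  and TA_cmult: "R \<in> TA ==> (%f z. c * R f z) \<in> TA"
  and TA_comp: "R \<in> TA ==> S \<in> TA ==> R \<circ> S \<in> TA" unfolding toeplitz_algebra_def hull_def closed_subalgebra_def by blast+

lemma TA_lim:
 assumes "!!k. Rk k \<in> TA" "S \<in> BO" "(%k. op_norm p \<alpha> (%f z. Rk k f z - S f z)) ----> 0"
 shows "S \<in> TA" unfolding toeplitz_algebra_def hull_def
proof (rule InterI, clarify)
 fix A :: "'n operator set" assume A: "closed_subalgebra p \<alpha> A" "toeplitz p \<alpha> ` Linfty \<subseteq> A"
 have "Rk k \<in> A" for k by (rule TA_induct[OF A(1) _ assms(1)]) (use A(2) in auto)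
 thus "S \<in> A" using A(1) assms(2,3) unfolding closed_subalgebra_def by blast
qed

lemma TA_closed:
 assumes S: "S \<in> BO" and "!!e. e > 0 ==> \<exists>R\<in>TA. \<forall>f\<in>AP. nrm (%z. R f z - S f z) <= e * nrm f"
 shows "S \<in> TA"
proof -
 have "\<forall>k. \<exists>R\<in>TA. \<forall>f\<in>AP. nrm (%z. R f z - S f z) <= inverse (real (Suc k)) * nrm f" using assms(2) by simp
 then obtain Rk where R: "!!k. Rk k \<in> TA" "!!k f. f \<in> AP ==> nrm (%z. Rk k f z - S f z) <= inverse (real (Suc k)) * nrm f" by metis
 show ?thesis
 proof (rule TA_lim[of Rk, OF R(1) S])
  show "(%k. op_norm p \<alpha> (%f z. Rk k f z - S f z)) ----> 0"
  proof (rule Lim_null_comparison[OF _ LIMSEQ_inverse_real_of_nat])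
   show "\<forall>\<^sub>F k in sequentially. norm (op_norm p \<alpha> (%f z. Rk k f z - S f z)) <= inverse (real (Suc k))"
   proof (intro always_eventually allI)
    fix k
    have "op_norm p \<alpha> (%f z. Rk k f z - S f z) <= inverse (real (Suc k))" by (rule op_norm_le[OF R(2)]) auto
    thus "norm (op_norm p \<alpha> (%f z. Rk k f z - S f z)) <= inverse (real (Suc k))"
     using op_norm_nonneg[OF BO_diff[OF TA_BO[OF R(1)[of k]] S]] by simp
   qed
  qed
 qed
qed

lemma BO_proj_bddL: assumes S: "S \<in> BO" shows "bddL (%f. S (proj f))"
proof -
 obtain C where C: "C > 0" "!!f. f \<in> AP ==> nrm (S f) <= C * nrm f" using BO_bound[OF S] by blast
 show ?thesis
 proof (rule bddL_I)
  show "C * CP > 0" using C CP(1) by simp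
  show "nrm (S (proj f)) <= C * CP * nrm f" if "f \<in> LP" for f
   using order_trans[OF C(2)[OF proj_AP[OF that]] mult_left_mono[OF CP(2)[OF that], of C]] C(1) by (simp add: mult.assoc)
  show "S (proj (%z. f z - g z)) = (%z. S (proj f) z - S (proj g) z)" if "f \<in> LP" "g \<in> LP" for f g
   unfolding proj_diff[OF that] by (rule BO_diff_arg[OF S proj_AP[OF that(1)] proj_AP[OF that(2)]])
 qed (rule AP_D(1)[OF BO_D(1)[OF S]])
qed

text \<open>The operators \<open>S\<close> for which \<open>S\<close> after \<open>proj\<close> is
  local form a closed subalgebra that contains the Toeplitz operators, since a Toeplitz operator is
  built from the projection and a multiplication, and multiplications commute exactly.\<close>

theorem TA_local:
 assumes "S \<in> TA" shows "local_op (%f. S (proj f))"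
proof -
 let ?A = "{S \<in> BO. local_op (%f. S (proj f))}"
 have "S \<in> ?A"
 proof (rule TA_induct[OF _ _ assms])
  show "toeplitz p \<alpha> a \<in> ?A" if aL: "a \<in> Linfty" for a
  proof -
   obtain C where C: "C > 0" "a \<in> bmM" "AE z in M. norm (a z) <= C" by (rule Linfty_D[OF aL]) (rule that)
   have L: "local_op (%f. proj (%z. a z * proj f z))"
    by (rule local_comp[OF local_projection local_comp[OF local_mult[OF C(2,3,1)] local_projection]])
   have T: "toeplitz p \<alpha> a (proj f) = proj (%z. a z * proj f z)" if "f \<in> LP" for f
    unfolding toeplitz_def using proj_AP[OF that] by (simp only: if_True)
   \<comment> \<open>The two expressions agree for arguments in \<open>LP\<close> only, so locality
     is transferred by the limit lemma with difference zero.\<close>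
   have "local_op (%f. toeplitz p \<alpha> a (proj f))"
   proof (rule local_limit[OF BO_proj_bddL[OF toeplitz_BO[OF aL]]])
    fix h :: real assume "h > 0"
    hence "0 <= h * nrm f" for f using nrm_nonneg[of f] by simp
    moreover have "nrm (%z. 0) = 0" using p by (simp add: Lp_norm_def)
    ultimately have "nrm (%z. toeplitz p \<alpha> a (proj f) z - proj (%z. a z * proj f z) z) <= h * nrm f" if "f \<in> LP" for f
     unfolding T[OF that] diff_self by metis
    thus "\<exists>Y. local_op Y & (\<forall>f\<in>LP. nrm (%z. toeplitz p \<alpha> a (proj f) z - Y f z) <= h * nrm f)"
     by (intro exI[of _ "%f. proj (%z. a z * proj f z)"] conjI ballI L)
   qed
   thus ?thesis using toeplitz_BO[OF aL] by simp
  qed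
  show "closed_subalgebra p \<alpha> ?A" unfolding closed_subalgebra_def
  proof (intro conjI ballI allI impI; (elim conjE)?)
   show "?A \<subseteq> BO" by auto
   show "(%f z. 0) \<in> ?A" using BO_zero local_const[of 0] by simp
   show "(%f z. R f z + S f z) \<in> ?A" if "R \<in> ?A" "S \<in> ?A" for R S
    using that BO_add local_add[of "%f. R (proj f)" "%f. S (proj f)"] by simp
   show "(%f z. c * R f z) \<in> ?A" if "R \<in> ?A" for c R
    using that BO_cmult local_comp[OF local_const[of c], of "%f. R (proj f)"] by simp
   show "R \<circ> S \<in> ?A" if "R \<in> ?A" "S \<in> ?A" for R S
   proof -
    \<comment> \<open>The projection may be inserted between the two operators, which writes the
      composition as one of two local operators.\<close>
    have "proj (S f) = S f" for f using that by (intro proj_AP_eq BO_D(1)) auto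
    thus ?thesis using that BO_comp local_comp[of "%f. R (proj f)" "%f. S (proj f)"] by simp
   qed
   fix R S assume S: "S \<in> BO" and R: "\<forall>k::nat. R k \<in> ?A" and lim: "(%k. op_norm p \<alpha> (%f z. R k f z - S f z)) ----> 0"
   have "local_op (%f. S (proj f))"
   proof (rule local_limit[OF BO_proj_bddL[OF S]])
    fix h :: real assume "h > 0"
    hence "h / CP > 0" using CP(1) by simp
    from order_tendstoD(2)[OF lim this] obtain k where k: "op_norm p \<alpha> (%f z. R k f z - S f z) < h / CP"
     by (auto simp: eventually_sequentially)
    have D: "(%f z. R k f z - S f z) \<in> BO" using R S by (intro BO_diff) auto
    have "nrm (%z. S (proj f) z - R k (proj f) z) <= h * nrm f" if f: "f \<in> LP" for f
    proof -
     have "nrm (%z. R k (proj f) z - S (proj f) z) <= op_norm p \<alpha> (%f z. R k f z - S f z) * nrm (proj f)"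
      by (rule op_norm_bound[OF D proj_AP[OF f]])
     also have "... <= h / CP * (CP * nrm f)" using k CP(1) `h > 0` by (intro mult_mono CP(2)[OF f]) auto
     also have "... = h * nrm f" using CP(1) by simp
     finally show ?thesis unfolding nrm_minus_commute[of "S (proj f)"] .
    qed
    thus "\<exists>Y. local_op Y & (\<forall>f\<in>LP. nrm (%z. S (proj f) z - Y f z) <= h * nrm f)"
     using R by (intro exI[of _ "%f. R k (proj f)"]) auto
   qed
   thus "S \<in> ?A" using S by simp
  qed
 qed
 thus ?thesis by simp
qed

end

section \<open>Riemann sums and rank one operators in the Toeplitz algebra\<close>

text \<open>Total boundedness of the closed ball, made disjoint. These cells are the partitions for
  all Riemann sums, and they also cut the layers in the construction of slow families.\<close>

lemma finite_cells:
 fixes e :: real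
 assumes e: "e > 0"
 obtains m :: nat and E :: "nat => (complex ^ 'n) set"
 where "!!i. E i \<in> sets borel" "!!i. E i \<subseteq> UB" "disjoint_family E" "(\<Union>i<m. E i) = UB"
  "!!i x y. x \<in> E i ==> y \<in> E i ==> norm (x - y) < e"
proof -
 have "compact (cball 0 1 :: (complex ^ 'n) set)" by simp
 then obtain K :: "(complex ^ 'n) set" where K: "finite K" "cball 0 1 \<subseteq> (\<Union>x\<in>K. ball x (e / 2))"
  using e unfolding compact_eq_totally_bounded by (meson half_gt_zero)
 obtain xs where xs: "set xs = K" using finite_list[OF K(1)] by blast
 define A where "A i = (if i < length xs then UB \<inter> ball (xs ! i) (e / 2) else {})" for i
 have sub: "disjointed A i \<subseteq> A i" for i by (rule disjointed_subset)
 show ?thesis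
 proof (rule that[of "disjointed A" "length xs"])
  show "disjointed A i \<in> sets borel" for i unfolding disjointed_def by (intro sets.Diff sets.finite_UN) (auto simp: A_def)
  show "disjointed A i \<subseteq> UB" for i using sub[of i] by (auto simp: A_def split: if_splits)
  show "disjoint_family (disjointed A)" by (rule disjoint_family_disjointed)
  show "(\<Union>i<length xs. disjointed A i) = UB"
  proof -
   have "(\<Union>i<length xs. disjointed A i) = (\<Union>i<length xs. A i)"
    using finite_UN_disjointed_eq[of A "length xs"] by (simp only: lessThan_atLeast0)
   also have "... = UB"
   proof
    show "UB \<subseteq> (\<Union>i<length xs. A i)"
    proof
     fix x :: "complex ^ 'n" assume x: "x \<in> UB"
     then obtain y where "y \<in> K" "x \<in> ball y (e / 2)" using K(2) by force
     then obtain i where "i < length xs" "xs ! i = y" using xs by (auto simp: in_set_conv_nth)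
     thus "x \<in> (\<Union>i<length xs. A i)" using x `x \<in> ball y (e / 2)` by (auto simp: A_def)
    qed
   qed (auto simp: A_def)
   finally show ?thesis .
  qed
  show "norm (x - y) < e" if "x \<in> disjointed A i" "y \<in> disjointed A i" for i x y
  proof -
   have "dist (xs ! i) x < e / 2" "dist (xs ! i) y < e / 2" using sub[of i] that by (auto simp: A_def split: if_splits)
   hence "dist x y < e" by (rule dist_triangle_half_r)
   thus ?thesis by (simp add: dist_norm)
  qed
 qed
qed

lemma sum_indicator_cells:
 assumes "disjoint_family E" "(\<Union>i<m :: nat. E i) = UB" "z \<in> UB"
 shows "(\<Sum>i<m. indicator (E i) z) = (1 :: 'a :: semiring_1)"
proof -
 obtain i where i: "i < m" "z \<in> E i" using assms(2,3) by blast
 have "z \<notin> E j" if "j ~= i" for j using disjoint_family_onD[OF assms(1) _ _ that] i(2) by auto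
 hence "indicator (E j) z = (if j = i then 1 else 0 :: 'a)" for j using i(2) by (simp add: indicator_def)
 thus ?thesis using i(1) by simp
qed

context bergman_space begin

lemma LP_integral_mult_le:
 assumes f: "f \<in> LP" and g: "g \<in> bmM" and b: "!!z. z \<in> UB ==> norm (g z) <= c" and c: "c >= 0"
 shows "integrable M (%z. f z * g z)" "norm (LINT z|M. f z * g z) <= c * nrm f"
proof -
 have e: "(%z. f z * g z) = (%z. g z * f z)" by (simp add: mult.commute)
 have L: "(%z. f z * g z) \<in> LP" "nrm (%z. f z * g z) <= c * nrm f" unfolding e by (rule LP_bounded_mult[OF f g b c]; assumption)+
 show "integrable M (%z. f z * g z)" by (rule LP_integrable[OF L(1)])
 have "norm (LINT z|M. f z * g z) <= (LINT z|M. norm (f z * g z))" by (rule integral_norm_bound)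
 also have "... <= nrm (%z. f z * g z)" by (rule LP_integral_norm_le[OF L(1)])
 also note L(2)
 finally show "norm (LINT z|M. f z * g z) <= c * nrm f" .
qed

lemma ker_lipschitz:
 assumes r: "r < 1"
 obtains C where "C > 0"
  "!!z w u. z \<in> UB ==> norm w <= r ==> norm u <= r ==> norm (ker z w - ker z u) <= C * norm (w - u)"
  "!!z w. z \<in> UB ==> norm w <= r ==> norm (ker z w) <= C"
proof -
 obtain C where C: "C >= 0" "!!x y. norm x <= r ==> norm y <= r ==> norm (phi y - phi x) <= C * norm (y - x)"
  "!!x. norm x <= r ==> norm (phi x) <= C" by (rule phi_Taylor[OF r]) (rule that)
 have h: "norm (herm z w) <= norm w" if "z \<in> UB" for z w :: "complex ^ 'n"
  using norm_herm_le[of z w] mult_right_mono[of "norm z" 1 "norm w"] that by simp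
 show ?thesis
 proof (rule that[of "C + 1"])
  show "norm (ker z w - ker z u) <= (C + 1) * norm (w - u)" if "z \<in> UB" "norm w <= r" "norm u <= r" for z w u
  proof -
   have "norm (ker z w - ker z u) <= C * norm (herm z w - herm z u)" unfolding ker_phi using that h[of z w] h[of z u] by (intro C(2)) auto
   also have "... <= C * norm (w - u)" unfolding herm_diff_right[symmetric] using C(1) by (intro mult_left_mono h that)
   also have "... <= (C + 1) * norm (w - u)" by (simp add: mult_right_mono)
   finally show ?thesis .
  qed
  show "norm (ker z w) <= C + 1" if "z \<in> UB" "norm w <= r" for z w using C(3)[of "herm z w"] h[of z w] that unfolding ker_phi by simp
 qed (use C(1) in simp)
qed

lemma ker_section_measurable [measurable]: "(%w. ker z w) \<in> bmM" by (rule borel_measurable_M) measurable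

lemma AP_lipschitz:
 assumes r: "r < 1"
 obtains C where "C > 0"
  "!!f w u. f \<in> AP ==> norm w <= r ==> norm u <= r ==> norm (f w - f u) <= C * norm (w - u) * nrm f"
  "!!f w. f \<in> AP ==> norm w <= r ==> norm (f w) <= C * nrm f"
proof -
 obtain C where C: "C > 0"
  "!!z w u. z \<in> UB ==> norm w <= r ==> norm u <= r ==> norm (ker z w - ker z u) <= C * norm (w - u)"
  "!!z w. z \<in> UB ==> norm w <= r ==> norm (ker z w) <= C" by (rule ker_lipschitz[OF r]) (rule that)
 have eq: "f w = (LINT v|M. f v * ker w v)" if "f \<in> AP" "norm w <= r" for f w
  using reproducing[OF AP_D(2)[OF that(1)] LP_integrable[OF AP_D(1)[OF that(1)]], of w] that r by simp
 show ?thesis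
 proof (rule that[OF C(1)])
  fix f and w u :: "complex ^ 'n" assume f: "f \<in> AP" and w: "norm w <= r"
  have bd: "norm (ker w v) <= C" if "v \<in> UB" for v using C(3)[OF that w] by (simp add: norm_ker_commute[of w])
  note I = LP_integral_mult_le[OF AP_D(1)[OF f] ker_section_measurable bd]
  show "norm (f w) <= C * nrm f" unfolding eq[OF f w] by (rule I(2)) (use C(1) in auto)
  assume u: "norm u <= r"
  have "f w - f u = (LINT v|M. f v * (ker w v - ker u v))" unfolding eq[OF f w] eq[OF f u] right_diff_distrib
   by (rule Bochner_Integration.integral_diff[symmetric];
     rule integrable_mult_ker[OF LP_integrable[OF AP_D(1)[OF f]]]; use w u r in simp)
  moreover have "norm (ker w v - ker u v) <= C * norm (w - u)" if "v \<in> UB" for v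
  proof -
   have "w \<in> UB" "u \<in> UB" using w u r by auto
   hence "ker w v - ker u v = cnj (ker v w - ker v u)" using that by (simp add: ker_cnj)
   hence "norm (ker w v - ker u v) = norm (ker v w - ker v u)" by (simp only: complex_mod_cnj)
   thus ?thesis using C(2)[OF that w u] by simp
  qed
  hence "norm (LINT v|M. f v * (ker w v - ker u v)) <= (C * norm (w - u)) * nrm f" using C(1) by (intro LP_integral_mult_le(2) AP_D(1)[OF f]) auto
  ultimately show "norm (f w - f u) <= C * norm (w - u) * nrm f" by simp
 qed
qed

lemma sets_M: "E \<in> sets borel ==> E \<subseteq> UB ==> E \<in> sets M"
 unfolding M_def using sets_weighted_measureI[of E \<alpha>] by (simp add: Int_absorb2)

lemma indicator_M [measurable]: "E \<in> sets borel ==> (%w. indicator E w :: complex) \<in> bmM"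
 by (rule borel_measurable_M) (rule borel_measurable_indicator)

lemma indicator_LP:
 assumes "E \<in> sets borel" "f \<in> LP"
 shows "(%w. indicator E w * f w) \<in> LP" "nrm (%w. indicator E w * f w) <= nrm f"
proof -
 have "norm (indicator E z :: complex) <= 1" for z by (simp add: indicator_def)
 from LP_bounded_mult[OF assms(2) indicator_M[OF assms(1)] this]
 show "(%w. indicator E w * f w) \<in> LP" "nrm (%w. indicator E w * f w) <= nrm f" by simp_all
qed

lemma indicator_Linfty: "E \<in> sets borel ==> (%w :: complex ^ 'n. c * indicator E w) \<in> Linfty"
proof -
 assume E: "E \<in> sets borel"
 have "(%w. c * indicator E w) \<in> bmM" using indicator_M[OF E] by measurable
 hence "(%w. c * indicator E w) \<in> borel_measurable ball_measure"
  unfolding M_def measurable_cong_sets[OF sets_weighted_measure_eq_ball_measure[of \<alpha>] refl] .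
 thus ?thesis unfolding Linfty_def mem_Collect_eq by (intro conjI exI[of _ "norm c"] AE_I2) (auto simp: norm_mult indicator_def)
qed

text \<open>On a small cell around \<open>u\<close> both \<open>f\<close> and the kernel are nearly
  constant. The error carries the factor \<open>measure M E\<close>, so that errors over disjoint
  cells add up to a bound without their number.\<close>

lemma cell_kernel_approx:
 assumes r: "r < 1"
 obtains C where "C > 0"
  "!!E u x f. E \<in> sets borel ==> E \<subseteq> cball 0 r ==> norm u <= r ==> \<forall>w\<in>E. norm (w - u) <= x ==> x >= 0 ==> f \<in> AP ==>
   nrm (%z. proj (%w. indicator E w * f w) z - of_real (measure M E) * (f u * kf u z)) <= C * x * measure M E * nrm f"
proof -
 obtain C where C: "C > 0"
  "!!z w u. z \<in> UB ==> norm w <= r ==> norm u <= r ==> norm (ker z w - ker z u) <= C * norm (w - u)"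
  "!!z w. z \<in> UB ==> norm w <= r ==> norm (ker z w) <= C" by (rule ker_lipschitz[OF r]) (rule that)
 obtain D where D: "D > 0"
  "!!f w u. f \<in> AP ==> norm w <= r ==> norm u <= r ==> norm (f w - f u) <= D * norm (w - u) * nrm f"
  "!!f w. f \<in> AP ==> norm w <= r ==> norm (f w) <= D * nrm f" by (rule AP_lipschitz[OF r]) (rule that)
 show ?thesis
 proof (rule that[of "2 * C * D"])
  fix E :: "(complex ^ 'n) set" and u x f
  assume E: "E \<in> sets borel" "E \<subseteq> cball 0 r" and u: "norm u <= r" and eE: "\<forall>w\<in>E. norm (w - u) <= x" and x0: "x >= 0"
   and f: "f \<in> AP"
  note x = bspec[OF eE] x0
  have fm: "f \<in> bmM" by (rule LP_measurable[OF AP_D(1)[OF f]])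
  have u1: "u \<in> UB" using u r by simp
  have EM: "E \<in> sets M" using E r by (intro sets_M) auto
  have pt: "norm (f w * ker z w - f u * ker z u) <= 2 * C * D * x * nrm f" if "w \<in> E" "z \<in> UB" for w z
  proof -
   have w: "norm w <= r" using that E by auto
   have "f w * ker z w - f u * ker z u = (f w - f u) * ker z w + f u * (ker z w - ker z u)" by (simp add: algebra_simps)
   moreover have "norm ((f w - f u) * ker z w + f u * (ker z w - ker z u)) <= norm (f w - f u) * norm (ker z w) + norm (f u) * norm (ker z w - ker z u)"
    by (rule order_trans[OF norm_triangle_ineq]) (simp add: norm_mult)
   ultimately have "norm (f w * ker z w - f u * ker z u) <= norm (f w - f u) * norm (ker z w) + norm (f u) * norm (ker z w - ker z u)" by (simp only:)
   also have "... <= (D * x * nrm f) * C + (D * nrm f) * (C * x)"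
   proof (intro add_mono mult_mono)
    show "norm (f w - f u) <= D * x * nrm f"
     by (rule order_trans[OF D(2)[OF f w u]]) (use x(1)[OF that(1)] D(1) in \<open>intro mult_right_mono mult_left_mono; simp\<close>)
    show "norm (ker z w - ker z u) <= C * x"
     by (rule order_trans[OF C(2)[OF that(2) w u]]) (use x(1)[OF that(1)] C(1) in \<open>intro mult_left_mono; simp\<close>)
   qed (use C D x(2) f w u that in auto)
   also have "... = 2 * C * D * x * nrm f" by (simp add: algebra_simps)
   finally show ?thesis .
  qed
  have nn: "0 <= 2 * C * D * x * measure M E * nrm f" using C D x(2) by simp
  have b: "norm (proj (%w. indicator E w * f w) z - of_real (measure M E) * (f u * kf u z)) <= 2 * C * D * x * measure M E * nrm f"
   if z: "z \<in> UB" for z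
  proof -
   have i1: "integrable M (%w. indicator E w * f w * ker z w)"
    by (rule integrable_mult_ker[OF LP_integrable[OF indicator_LP(1)[OF E(1) AP_D(1)[OF f]]] z])
   have B: "has_bochner_integral M (%w. indicator E w *\<^sub>R c) (measure M E *\<^sub>R c)" for c :: complex
    by (intro has_bochner_integral_indicator EM) (simp add: emeasure_eq_measure)
   have B': "has_bochner_integral M (%w. indicator E w *\<^sub>R c) (measure M E *\<^sub>R c)" for c :: real
    by (intro has_bochner_integral_indicator EM) (simp add: emeasure_eq_measure)
   note i2 = integrable.intros[OF B[of "f u * ker z u"]]
   have "proj (%w. indicator E w * f w) z - of_real (measure M E) * (f u * kf u z)
    = (LINT w|M. indicator E w * f w * ker z w) - (LINT w|M. indicator E w *\<^sub>R (f u * ker z u))"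
    unfolding has_bochner_integral_integral_eq[OF B] using z by (simp add: projection_eq kf_def scaleR_conv_of_real)
   also have "... = (LINT w|M. indicator E w * f w * ker z w - indicator E w *\<^sub>R (f u * ker z u))"
    by (rule Bochner_Integration.integral_diff[symmetric, OF i1 i2])
   finally have e: "proj (%w. indicator E w * f w) z - of_real (measure M E) * (f u * kf u z) =
     (LINT w|M. indicator E w * f w * ker z w - indicator E w *\<^sub>R (f u * ker z u))" .
   have "norm (LINT w|M. indicator E w * f w * ker z w - indicator E w *\<^sub>R (f u * ker z u))
    <= (LINT w|M. indicator E w *\<^sub>R (2 * C * D * x * nrm f))"
   proof (rule Bochner_Integration.integral_norm_bound_integral[OF Bochner_Integration.integrable_diff[OF i1 i2]])
    show "integrable M (%w. indicator E w *\<^sub>R (2 * C * D * x * nrm f))" by (rule integrable.intros[OF B'])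
    show "norm (indicator E w * f w * ker z w - indicator E w *\<^sub>R (f u * ker z u)) <= indicator E w *\<^sub>R (2 * C * D * x * nrm f)"
     for w using pt[of w z] z by (cases "w \<in> E") auto
   qed
   also have "... = 2 * C * D * x * measure M E * nrm f" unfolding has_bochner_integral_integral_eq[OF B'] by simp
   finally show ?thesis unfolding e .
  qed
  have m: "(%z. proj (%w. indicator E w * f w) z - of_real (measure M E) * (f u * kf u z)) \<in> bmM"
   using LP_measurable[OF proj_LP[OF indicator_LP(1)[OF E(1) AP_D(1)[OF f]]]] LP_measurable[OF kf_LP[OF u1]] by measurable
  show "nrm (%z. proj (%w. indicator E w * f w) z - of_real (measure M E) * (f u * kf u z)) <= (2 * C * D) * x * measure M E * nrm f"
   by (rule LP_bounded(2)[OF m b nn])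
 qed (use C D in simp)
qed

lemma measure_ball_pos:
 assumes "u \<in> UB" "l > 0" shows "measure M (ball u l \<inter> UB) > 0"
proof -
 let ?E = "ball u l \<inter> UB"
 have E: "?E \<in> sets borel" by simp
 have "emeasure M ?E ~= 0"
 proof
  assume "emeasure M ?E = 0"
  hence z: "(\<integral>\<^sup>+w. indicator ?E w \<partial>M) = 0" using sets_M[OF E] by simp
  define c where "c = Gamma (real CARD('n) + \<alpha> + 1) / (Gamma (\<alpha> + 1) * pi ^ CARD('n))"
  have c: "c > 0" unfolding c_def using alpha by (intro divide_pos_pos mult_pos_pos Gamma_real_pos) (auto intro: add_nonneg_pos)
  let ?I = "\<integral>\<^sup>+w. ennreal (indicator UB w * tau w powr \<alpha>) * indicator ?E w \<partial>lborel"
  have i: "(indicator ?E :: complex ^ 'n => ennreal) \<in> borel_measurable borel" by (rule borel_measurable_indicator[OF E])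
  have t: "(%w :: complex ^ 'n. indicator UB w * tau w powr \<alpha> :: real) \<in> borel_measurable borel"
  proof (intro borel_measurable_times borel_measurable_indicator)
   show "(%w :: complex ^ 'n. tau w powr \<alpha>) \<in> borel_measurable borel" by measurable
  qed simp
  have mm: "(%w. ennreal (indicator UB w * tau w powr \<alpha>) * indicator ?E w) \<in> borel_measurable lborel"
  proof (rule borel_measurable_times_ennreal)
   show "(%w :: complex ^ 'n. ennreal (indicator UB w * tau w powr \<alpha>)) \<in> borel_measurable lborel"
    using measurable_compose[OF t measurable_ennreal] by simp
   show "(indicator ?E :: complex ^ 'n => ennreal) \<in> borel_measurable lborel" using i by simp
  qed
  have "(\<integral>\<^sup>+w. indicator ?E w \<partial>M) = ennreal c * ?I" unfolding M_def c_def by (rule nn_integral_weighted_measure[OF alpha i])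
  hence "ennreal c * ?I = 0" unfolding z by simp
  hence "?I = 0" using c by (simp only: mult_eq_0_iff ennreal_eq_0_iff) auto
  from nn_integral_0_iff_AE[OF mm, THEN iffD1, OF this]
  have "AE w in lborel. w \<notin> ?E"
  proof eventually_elim
   case (elim w)
   show ?case
   proof
    assume w: "w \<in> ?E"
    hence "norm w < 1" by simp
    hence "tau w > 0" by (rule tau_pos)
    thus False using elim w by simp
   qed
  qed
  hence "?E \<in> null_sets lborel" by (rule AE_iff_null_sets[THEN iffD2, rotated]) (use E in simp)
  hence "negligible ?E" unfolding negligible_iff_null_sets by (rule null_sets_completionI)
  moreover have "open ?E" by (rule open_Int[OF open_ball open_ball])
  moreover have "u \<in> ?E" using assms by simp
  hence "?E ~= {}" by blast
  ultimately show False using open_not_negligible[of ?E] by metis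
 qed
 hence "measure M ?E ~= 0" unfolding emeasure_eq_measure by simp
 thus ?thesis by (simp add: zero_less_measure_iff)
qed

end

lemma tau_less_near_boundary:
 assumes "h > 0"
 obtains s where "0 < s" "s < 1" "!!z :: complex ^ 'n. s < norm z ==> norm z < 1 ==> tau z < h"
proof (rule that[of "max (1 / 2) (1 - h / 2)"])
 fix z :: "complex ^ 'n" assume z: "max (1 / 2) (1 - h / 2) < norm z" "norm z < 1"
 have "tau z = (1 - norm z) * (1 + norm z)" by (simp add: tau_def power2_eq_square algebra_simps)
 also have "... <= (1 - norm z) * 2" using z by (intro mult_left_mono) auto
 also have "... < h" using z by simp
 finally show "tau z < h" .
qed (use assms in auto)

context bergman_space begin

definition rank1 :: "complex ^ 'n => complex ^ 'n => 'n operator" where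
 "rank1 u w = (%f. if f \<in> AP then (%z. f w * kf u z) else (%z. 0))"

lemma rank1_BO: assumes "u \<in> UB" "w \<in> UB" shows "rank1 u w \<in> BO"
proof (rule BO_I)
 show "nrm (rank1 u w f) <= ((1 - norm w) powr (- N) * nrm (kf u)) * nrm f" if f: "f \<in> AP" for f
 proof -
  have "nrm (rank1 u w f) = norm (f w) * nrm (kf u)" using f LP_cmult(2)[OF kf_LP[OF assms(1)], of "f w"] by (simp add: rank1_def)
  also have "... <= ((1 - norm w) powr (- N) * nrm f) * nrm (kf u)" by (intro mult_right_mono AP_norm_le[OF f assms(2)]) simp
  finally show ?thesis by (simp only: mult_ac)
 qed
 show "rank1 u w f \<in> AP" if "f \<in> AP" for f using that AP_cmult[OF kf_AP[OF assms(1)]] by (simp add: rank1_def)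
qed (auto simp: rank1_def AP_add AP_cmult distrib_right)

lemma rank1_diag_TA: assumes u: "u \<in> UB" shows "rank1 u u \<in> TA"
proof (rule TA_closed[OF rank1_BO[OF u u]])
 fix e :: real assume e: "e > 0"
 define r where "r = (1 + norm u) / 2"
 have r: "r < 1" "norm u <= r" using u by (auto simp: r_def)
 obtain C where C: "C > 0"
  "!!E u e f. E \<in> sets borel ==> E \<subseteq> cball 0 r ==> norm u <= r ==> \<forall>w\<in>E. norm (w - u) <= e ==> e >= 0 ==> f \<in> AP ==>
   nrm (%z. proj (%w. indicator E w * f w) z - of_real (measure M E) * (f u * kf u z)) <= C * e * measure M E * nrm f"
  by (rule cell_kernel_approx[OF r(1)]) (rule that)
 \<comment> \<open>The first entry makes the cell error at most \<open>e\<close>; the second keeps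
   the ball inside \<open>cball 0 r\<close>, where the constant \<open>C\<close> is valid.\<close>
 define \<rho> where "\<rho> = min (e / C) ((1 - norm u) / 2)"
 have \<rho>: "\<rho> > 0" "C * \<rho> <= e" using C(1) e u by (auto simp: \<rho>_def min_def field_simps)
 define E where "E = ball u \<rho> \<inter> UB"
 define m where "m = measure M E"
 have m: "m > 0" unfolding m_def E_def by (rule measure_ball_pos[OF u \<rho>(1)])
 have E: "E \<in> sets borel" by (simp add: E_def)
 have Er: "E \<subseteq> cball 0 r"
 proof
  fix w assume "w \<in> E"
  hence "norm (u - w) < (1 - norm u) / 2" by (auto simp: E_def \<rho>_def dist_norm)
  thus "w \<in> cball 0 r" using norm_triangle_sub[of w u] by (simp add: r_def norm_minus_commute)
 qed
 define R where "R = toeplitz p \<alpha> (%w. of_real (1 / m) * indicator E w)"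
 have "nrm (%z. R f z - rank1 u u f z) <= e * nrm f" if f: "f \<in> AP" for f
 proof -
  let ?h = "%z. proj (%w. indicator E w * f w) z - of_real m * (f u * kf u z)"
  have hLP: "?h \<in> LP" by (intro LP_diff(1) proj_LP indicator_LP(1)[OF E] LP_cmult kf_LP[OF u] AP_D(1)[OF f])
  have "R f = (%z. of_real (1 / m) * proj (%w. indicator E w * f w) z)"
   unfolding R_def toeplitz_def using f by (simp only: if_True mult.assoc proj_cmult)
  hence eq: "(%z. R f z - rank1 u u f z) = (%z. of_real (1 / m) * ?h z)" using m f by (simp add: rank1_def right_diff_distrib)
  have "norm (complex_of_real (1 / m)) = 1 / m" using m by (simp add: norm_divide)
  hence "nrm (%z. R f z - rank1 u u f z) = (1 / m) * nrm ?h" unfolding eq LP_cmult(2)[OF hLP] by (simp only:)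
  also have "... <= (1 / m) * (C * \<rho> * m * nrm f)"
  proof (intro mult_left_mono)
   show "nrm ?h <= C * \<rho> * m * nrm f" unfolding m_def
    by (rule C(2)[OF E Er r(2) _ _ f]) (use \<rho>(1) in \<open>auto simp: E_def dist_norm norm_minus_commute\<close>)
  qed (use m in simp)
  also have "... = C * \<rho> * nrm f" using m by simp
  also have "... <= e * nrm f" by (intro mult_right_mono \<rho>(2)) simp
  finally show ?thesis .
 qed
 moreover have "R \<in> TA" unfolding R_def by (intro TA_toeplitz indicator_Linfty E)
 ultimately show "\<exists>R\<in>TA. \<forall>f\<in>AP. nrm (%z. R f z - rank1 u u f z) <= e * nrm f" by blast
qed

lemma ker_nonzero: "z \<in> UB ==> w \<in> UB ==> ker z w ~= 0" using norm_ker[of z w] norm_one_minus_herm_pos[of z w] by auto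

text \<open>Composing the diagonal operators at \<open>u\<close> and \<open>w\<close> gives the
  mixed one times \<open>ker u w\<close>, which is not zero and can be divided out.\<close>

lemma rank1_TA: assumes u: "u \<in> UB" and w: "w \<in> UB" shows "rank1 u w \<in> TA"
proof -
 have "rank1 u w = (%f z. (1 / ker u w) * (rank1 u u \<circ> rank1 w w) f z)"
 proof (intro ext)
  fix f z
  have "(%z. f w * kf w z) \<in> AP" by (rule AP_cmult[OF kf_AP[OF w]])
  thus "rank1 u w f z = (1 / ker u w) * (rank1 u u \<circ> rank1 w w) f z" using ker_nonzero[OF u w] u AP_zero by (simp add: rank1_def kf_def)
 qed
 also have "... \<in> TA" by (intro TA_cmult TA_comp rank1_diag_TA u w)
 finally show ?thesis .
qed

lemma proj_cong: "(!!w. w \<in> UB ==> f w = g w) ==> proj f = proj g" for f g :: "complex ^ 'n => complex"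
 by (rule ext) (auto simp: projection_eq intro!: Bochner_Integration.integral_cong)

lemma proj_zero: "proj (%w. 0) = (%w :: complex ^ 'n. 0)" by (rule ext) (simp add: projection_eq)

lemma proj_sum:
 assumes "finite J" "!!j. j \<in> J ==> f j \<in> LP"
 shows "proj (%w. \<Sum>j\<in>J. f j w) = (%z. \<Sum>j\<in>J. proj (f j) z)" using assms
proof (induction J rule: finite_induct)
 case empty show ?case by (simp add: proj_zero)
next
 case (insert x F)
 have "(%w. \<Sum>j\<in>F. f j w) \<in> LP" using LP_sum[of F f] insert by auto
 from proj_add[OF _ this, of "f x"] show ?case using insert by simp
qed

text \<open>The projection of the truncated function is an integral of \<open>f w\<close> times
  kernel functions, and the sum is a Riemann sum for it. The cells have total measure at most one,
  so mesh \<open>\<epsilon> / C\<close> suffices.\<close>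

lemma trunc_approx:
 assumes r: "0 <= r" "r < 1" and \<epsilon>: "\<epsilon> > 0"
 obtains m :: nat and c u where "!!i. u i \<in> UB"
  "!!f. f \<in> AP ==> nrm (%z. proj (msk (cball 0 r) f) z - (\<Sum>i<m. c i * (f (u i) * kf (u i) z))) <= \<epsilon> * nrm f"
proof -
 obtain C where C: "C > 0"
  "!!E u \<epsilon> f. E \<in> sets borel ==> E \<subseteq> cball 0 r ==> norm u <= r ==> \<forall>w\<in>E. norm (w - u) <= \<epsilon> ==> \<epsilon> >= 0 ==> f \<in> AP ==>
   nrm (%z. proj (%w. indicator E w * f w) z - of_real (measure M E) * (f u * kf u z)) <= C * \<epsilon> * measure M E * nrm f"
  by (rule cell_kernel_approx[OF r(2)]) (rule that)
 define e where "e = \<epsilon> / C"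
 have e: "e > 0" "C * e = \<epsilon>" using C(1) \<epsilon> by (auto simp: e_def)
 obtain m :: nat and E :: "nat => (complex ^ 'n) set"
 where E: "!!i. E i \<in> sets borel" "!!i. E i \<subseteq> UB" "disjoint_family E" "(\<Union>i<m. E i) = UB"
  "!!i x y. x \<in> E i ==> y \<in> E i ==> norm (x - y) < e" by (rule finite_cells[OF e(1)]) (rule that)
 define G where "G i = E i \<inter> cball 0 r" for i
 \<comment> \<open>The node lies in its cell; an empty piece receives the default node 0.\<close>
 have "\<exists>u. norm u <= r & (\<forall>w\<in>G i. norm (w - u) <= e)" for i
 proof (cases "G i = {}")
  case True thus ?thesis using r by (intro exI[of _ 0]) simp
 next
  case False
  then obtain u where "u \<in> G i" by blast
  hence "norm u <= r" "u \<in> E i" by (auto simp: G_def)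
  moreover have "norm (w - u) <= e" if "w \<in> G i" for w using E(5)[of w i u] that `u \<in> E i` unfolding G_def by fastforce
  ultimately show ?thesis by blast
 qed
 then obtain u where u: "!!i. norm (u i) <= r" "!!i w. w \<in> G i ==> norm (w - u i) <= e" by metis
 have ub: "u i \<in> UB" for i using u(1)[of i] r by simp
 have Gb: "G i \<in> sets borel" for i using E(1) by (simp add: G_def)
 have GM: "G i \<in> sets M" for i using E(2)[of i] by (intro sets_M[OF Gb]) (auto simp: G_def)
 have "disjoint_family_on G {..<m}" using E(3) by (auto simp: disjoint_family_on_def G_def)
 hence "(\<Sum>i<m. measure M (G i)) = measure M (\<Union>i<m. G i)" using GM by (intro finite_measure_finite_Union[symmetric]) auto
 hence tot: "(\<Sum>i<m. measure M (G i)) <= 1" by simp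
 have bound: "nrm (%z. proj (msk (cball 0 r) f) z - (\<Sum>i<m. of_real (measure M (G i)) * (f (u i) * kf (u i) z))) <= \<epsilon> * nrm f"
  if f: "f \<in> AP" for f
 proof -
  define h where "h i z = proj (%w. indicator (G i) w * f w) z - of_real (measure M (G i)) * (f (u i) * kf (u i) z)" for i z
  have L: "(%w. indicator (G i) w * f w) \<in> LP" for i by (intro indicator_LP(1) Gb AP_D(1)[OF f])
  have hLP: "h i \<in> LP" for i unfolding h_def by (intro LP_diff(1) proj_LP L LP_cmult kf_LP ub)
  have "proj (msk (cball 0 r) f) = proj (%w. \<Sum>i<m. indicator (G i) w * f w)"
  proof (rule proj_cong)
   fix w :: "complex ^ 'n" assume w: "w \<in> UB"
   have "(\<Sum>i<m. indicator (G i) w * f w) = (\<Sum>i<m. indicator (E i) w) * (indicator (cball 0 r) w * f w)"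
    unfolding sum_distrib_right G_def by (simp add: indicator_inter_arith mult.assoc)
   thus "indicator (cball 0 r) w * f w = (\<Sum>i<m. indicator (G i) w * f w)"
    unfolding sum_indicator_cells[OF E(3,4) w] by (simp only: mult_1_left)
  qed
  also have "... = (%z. \<Sum>i<m. proj (%w. indicator (G i) w * f w) z)" by (intro proj_sum L) simp
  finally have "(%z. proj (msk (cball 0 r) f) z - (\<Sum>i<m. of_real (measure M (G i)) * (f (u i) * kf (u i) z)))
   = (%z. \<Sum>i<m. h i z)" by (simp add: h_def sum_subtractf)
  hence "nrm (%z. proj (msk (cball 0 r) f) z - (\<Sum>i<m. of_real (measure M (G i)) * (f (u i) * kf (u i) z)))
   <= (\<Sum>i<m. nrm (h i))" using LP_sum[of "{..<m}" h] hLP by simp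
  also have "... <= (\<Sum>i<m. C * e * measure M (G i) * nrm f)"
  proof (rule sum_mono)
   fix i
   show "nrm (h i) <= C * e * measure M (G i) * nrm f" unfolding h_def
   proof (rule C(2)[OF Gb _ u(1) _ _ f])
    show "G i \<subseteq> cball 0 r" "\<forall>w\<in>G i. norm (w - u i) <= e" "0 <= e" using u(2) e(1) by (auto simp: G_def)
   qed
  qed
  also have "... = (\<Sum>i<m. measure M (G i)) * (\<epsilon> * nrm f)" unfolding e(2) sum_distrib_right by (simp add: mult_ac)
  also have "... <= 1 * (\<epsilon> * nrm f)" using \<epsilon> by (intro mult_right_mono tot) simp
  finally show ?thesis by simp
 qed
 show ?thesis by (rule that[OF ub bound])
qed

section \<open>Vanishing of the Berezin transform at the sphere\<close>

text \<open>The right-hand side of the theorem in a form suited to estimates: by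
  \<open>berezin_eq\<close> the expression \<open>tau z powr N * norm (R (kf z) z)\<close> is the
  modulus of the Berezin transform.\<close>

definition bzero :: "'n operator => bool" where
 "bzero R \<longleftrightarrow> R \<in> TA & (\<forall>\<epsilon>>0. \<exists>\<eta>>0. \<forall>z\<in>UB. tau z < \<eta> --> tau z powr N * norm (R (kf z) z) <= \<epsilon>)"

text \<open>At \<open>kf z\<close> the operator takes at \<open>z\<close> the value
  \<open>ker w z * ker z u\<close>, which stays bounded for fixed \<open>u\<close> and
  \<open>w\<close>, while the factor \<open>tau z powr N\<close> tends to 0.\<close>

lemma bzero_rank1: assumes u: "u \<in> UB" and w: "w \<in> UB" shows "bzero (rank1 u w)" unfolding bzero_def
proof (intro conjI allI impI)
 show "rank1 u w \<in> TA" by (rule rank1_TA[OF u w])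
 fix e :: real assume e: "e > 0"
 define K where "K = (1 - norm w) powr (- N) * (1 - norm u) powr (- N)"
 have K: "K > 0" using u w by (simp add: K_def)
 define \<eta> where "\<eta> = (e / K) powr (1 / N)"
 have \<eta>: "\<eta> > 0" "\<eta> powr N = e / K" using K e N_pos by (auto simp: \<eta>_def powr_powr)
 have "tau z powr N * norm (rank1 u w (kf z) z) <= e" if z: "z \<in> UB" "tau z < \<eta>" for z
 proof -
  have "norm (ker w z) <= (1 - norm w) powr (- N)" using norm_ker_le[of w z] z w by simp
  moreover have "norm (ker z u) <= (1 - norm u) powr (- N)" using norm_ker_le[of u z] z u by (simp add: norm_ker_commute[of z])
  ultimately have "norm (rank1 u w (kf z) z) <= K" using z w u kf_AP[OF z(1)] unfolding K_def by (simp add: rank1_def kf_def norm_mult mult_mono)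
  hence "tau z powr N * norm (rank1 u w (kf z) z) <= \<eta> powr N * K" using z N_pos by (intro mult_mono powr_mono2) (auto intro: less_imp_le)
  also have "... = e" using \<eta> K by simp
  finally show ?thesis .
 qed
 thus "\<exists>\<eta>>0. \<forall>z\<in>UB. tau z < \<eta> --> tau z powr N * norm (rank1 u w (kf z) z) <= e" using \<eta>(1) by blast
qed

lemma bzero_zero: "bzero (%f z. 0)" unfolding bzero_def using TA_zero by (auto intro!: exI[of _ 1])

lemma bzero_add_cmult: assumes R: "bzero R" and S: "bzero S" shows "bzero (%f z. R f z + c * S f z)" unfolding bzero_def
proof (intro conjI allI impI)
 show "(%f z. R f z + c * S f z) \<in> TA" using R S by (intro TA_add TA_cmult) (auto simp: bzero_def)
 fix e :: real assume e: "e > 0"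
 define d where "d = e / (1 + norm c)"
 have c: "1 + norm c > 0" using norm_ge_zero[of c] by linarith
 have "(1 + norm c) * d = e" using c by (simp add: d_def)
 hence d2: "d + norm c * d = e" by (simp only: distrib_right mult_1_left)
 have "d > 0" using e c unfolding d_def by (rule divide_pos_pos)
 note d = this d2
 obtain a where a: "a > 0" "!!z. z \<in> UB ==> tau z < a ==> tau z powr N * norm (R (kf z) z) <= d" using R d(1) unfolding bzero_def by meson
 obtain b where b: "b > 0" "!!z. z \<in> UB ==> tau z < b ==> tau z powr N * norm (S (kf z) z) <= d" using S d(1) unfolding bzero_def by meson
 have "tau z powr N * norm (R (kf z) z + c * S (kf z) z) <= e" if z: "z \<in> UB" "tau z < min a b" for z
 proof -
  have "tau z powr N * norm (R (kf z) z + c * S (kf z) z) <= tau z powr N * (norm (R (kf z) z) + norm c * norm (S (kf z) z))"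
   by (intro mult_left_mono) (auto intro: order_trans[OF norm_triangle_ineq] simp: norm_mult)
  also have "... = tau z powr N * norm (R (kf z) z) + norm c * (tau z powr N * norm (S (kf z) z))" by (simp add: algebra_simps)
  also have "... <= d + norm c * d" using z by (intro add_mono mult_left_mono a(2) b(2)) auto
  finally show ?thesis unfolding d(2) .
 qed
 thus "\<exists>h>0. \<forall>z\<in>UB. tau z < h --> tau z powr N * norm (R (kf z) z + c * S (kf z) z) <= e"
  using a(1) b(1) by (intro exI[of _ "min a b"]) auto
qed

lemma bzero_sum: assumes "finite J" "!!j. j \<in> J ==> bzero (R j)" shows "bzero (%f z. \<Sum>j\<in>J. c j * R j f z)" using assms
proof (induction J rule: finite_induct)
 case (insert x F)
 hence "bzero (%f z. (\<Sum>j\<in>F. c j * R j f z) + c x * R x f z)" by (intro bzero_add_cmult) auto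
 thus ?case using insert by (simp add: add.commute)
qed (simp add: bzero_zero)

text \<open>Only the value of \<open>T\<close> at one kernel function enters, so the bound applies
  to differences of operators with \<open>c\<close> the size of the difference.\<close>

lemma operator_kernel_bound:
 obtains K where "K > 0"
  "!!T w z c. T (kf w) \<in> AP ==> nrm (T (kf w)) <= c * nrm (kf w) ==> c >= 0 ==> w \<in> UB ==> z \<in> UB ==>
    norm (T (kf w) z) <= K * c * (tau z powr (- N / p) * tau w powr (- N / q))"
proof -
 obtain A where A: "A > 0" "!!f z. f \<in> AP ==> z \<in> UB ==> norm (f z) <= A * tau z powr (- N / p) * nrm f" by (rule AP_growth) (rule that)
 obtain B where B: "B > 0" "!!w. w \<in> UB ==> nrm (kf w) <= B * tau w powr (- N / q)" by (rule nrm_kf_le) (rule that)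
 show ?thesis
 proof (rule that[of "A * B"])
  fix T :: "'n operator" and w z :: "complex ^ 'n" and c :: real assume T: "T (kf w) \<in> AP" "nrm (T (kf w)) <= c * nrm (kf w)" "c >= 0" and w: "w \<in> UB" and z: "z \<in> UB"
  have "norm (T (kf w) z) <= A * tau z powr (- N / p) * nrm (T (kf w))" by (rule A(2)[OF T(1) z])
  also have "... <= A * tau z powr (- N / p) * (c * (B * tau w powr (- N / q)))"
   using A(1) T(3) by (intro mult_left_mono order_trans[OF T(2)] B(2)[OF w]) auto
  finally show "norm (T (kf w) z) <= A * B * c * (tau z powr (- N / p) * tau w powr (- N / q))" by (simp only: mult_ac)
 qed (use A B in simp)
qed

lemma tau_powr_conjugate: assumes "z \<in> UB" shows "tau z powr (- N / p) * tau z powr (- N / q) = tau z powr (- N)"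
proof -
 have "- N / p + - N / q = - N * (1 / p + 1 / q)" by (simp add: field_simps)
 thus ?thesis unfolding powr_add[symmetric] using pq by simp
qed

text \<open>The Berezin transform is bounded by a constant times the operator norm, because the
  exponents of the kernel bound add up to \<open>- N\<close> on the diagonal. Norm limits therefore
  give uniform limits of Berezin transforms.\<close>

lemma bzero_limit:
 assumes S: "S \<in> BO" and lim: "!!e. e > 0 ==> \<exists>R. bzero R & (\<forall>f\<in>AP. nrm (%z. R f z - S f z) <= e * nrm f)"
 shows "bzero S" unfolding bzero_def
proof (intro conjI allI impI)
 show "S \<in> TA" by (rule TA_closed[OF S]) (use lim in \<open>unfold bzero_def, blast\<close>)
 fix e :: real assume e: "e > 0"
 obtain K where K: "K > 0"
  "!!T w z c. T (kf w) \<in> AP ==> nrm (T (kf w)) <= c * nrm (kf w) ==> c >= 0 ==> w \<in> UB ==> z \<in> UB ==>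
    norm (T (kf w) z) <= K * c * (tau z powr (- N / p) * tau w powr (- N / q))" by (rule operator_kernel_bound) (rule that)
 define c where "c = e / (2 * K)"
 have c: "c > 0" "K * c = e / 2" using K(1) e by (auto simp: c_def)
 obtain R where "bzero R & (\<forall>f\<in>AP. nrm (%z. R f z - S f z) <= c * nrm f)" using lim[OF c(1)] ..
 hence R: "bzero R" "!!f. f \<in> AP ==> nrm (%z. R f z - S f z) <= c * nrm f" by auto
 obtain h where h: "h > 0" "!!z. z \<in> UB ==> tau z < h ==> tau z powr N * norm (R (kf z) z) <= e / 2"
  using R(1) half_gt_zero[OF e] unfolding bzero_def by meson
 have RB: "R \<in> BO" using R(1) TA_BO by (simp add: bzero_def)
 have "tau z powr N * norm (S (kf z) z) <= e" if z: "z \<in> UB" "tau z < h" for z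
 proof -
  have t: "tau z > 0" by (rule tau_pos'[OF z(1)])
  have "norm (R (kf z) z - S (kf z) z) <= K * c * (tau z powr (- N / p) * tau z powr (- N / q))"
   by (rule K(2)[of "%f z. R f z - S f z" z c z, OF AP_diff[OF BO_D(1)[OF RB] BO_D(1)[OF S]] R(2)[OF kf_AP[OF z(1)]] _ z(1) z(1)])
    (use c in simp)
  also have "... = e / 2 * tau z powr (- N)" unfolding tau_powr_conjugate[OF z(1)] c(2) ..
  finally have "tau z powr N * norm (R (kf z) z - S (kf z) z) <= tau z powr N * (e / 2 * tau z powr (- N))" by (rule mult_left_mono) simp
  also have "... = e / 2" using t by (simp add: powr_minus field_simps)
  finally have 1: "tau z powr N * norm (R (kf z) z - S (kf z) z) <= e / 2" .
  have "norm (S (kf z) z) <= norm (R (kf z) z) + norm (R (kf z) z - S (kf z) z)"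
   using norm_triangle_ineq4[of "R (kf z) z" "R (kf z) z - S (kf z) z"] by simp
  hence "tau z powr N * norm (S (kf z) z) <= tau z powr N * (norm (R (kf z) z) + norm (R (kf z) z - S (kf z) z))" by (rule mult_left_mono) simp
  thus ?thesis using 1 h(2)[OF z] by (simp add: distrib_left)
 qed
 thus "\<exists>h>0. \<forall>z\<in>UB. tau z < h --> tau z powr N * norm (S (kf z) z) <= e" using h(1) by blast
qed

section \<open>From compact operators to small tails, and to the Berezin transform\<close>

lemma LP_tail:
 assumes h: "h \<in> LP" and e: "e > 0"
 obtains r where "0 <= r" "r < 1" "nrm (ct r h) <= e"
proof -
 define s where "s k = 1 - inverse (real (Suc k))" for k
 have s: "0 <= s k" "s k < 1" for k by (auto simp: s_def inverse_le_1_iff)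
 have sl: "s ----> 1" unfolding s_def using tendsto_diff[OF tendsto_const[of 1] LIMSEQ_inverse_real_of_nat] by simp
 have hm [measurable]: "h \<in> bmM" by (rule LP_measurable[OF h])
 have ih: "integrable M (%w. norm (h w) powr p)" using h by (simp add: Lp_def M_def)
 have L: "(ct (s k) h) \<in> LP" for k by (rule indicator_LP(1)[OF _ h]) simp
 have lim: "(%k. \<integral>w. norm (indicator (- cball 0 (s k)) w * h w) powr p \<partial>M) ----> (LINT w|M. (0 :: real))"
 proof (rule integral_dominated_convergence[OF _ _ ih])
  show "(%w. norm (indicator (- cball 0 (s k)) w * h w) powr p) \<in> bmM" for k using LP_measurable[OF L[of k]] by measurable
  show "AE w in M. (%k. norm (indicator (- cball 0 (s k)) w * h w) powr p) ----> 0"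
  proof (rule AE_I2)
   fix w assume "w \<in> space M"
   hence "norm w < 1" by simp
   from order_tendstoD(1)[OF sl this] have "\<forall>\<^sub>F k in sequentially. norm (indicator (- cball 0 (s k)) w * h w) powr p = 0"
    by eventually_elim (use p in simp)
   thus "(%k. norm (indicator (- cball 0 (s k)) w * h w) powr p) ----> 0" by (rule tendsto_eventually)
  qed
  show "AE w in M. norm (norm (indicator (- cball 0 (s k)) w * h w) powr p) <= norm (h w) powr p" for k
   using p by (intro AE_I2) (auto simp: indicator_def)
 qed simp
 have "(%k. nrm (ct (s k) h)) ----> 0 powr (1 / p)" unfolding Lp_norm_def M_def[symmetric]
 proof (rule tendsto_powr')
  show "(%k. \<integral>w. norm (indicator (- cball 0 (s k)) w * h w) powr p \<partial>M) ----> 0" using lim by simp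
 qed (use p in auto)
 hence "(%k. nrm (ct (s k) h)) ----> 0" using p by simp
 from order_tendstoD(2)[OF this e] obtain k where "nrm (ct (s k) h) < e" by (auto simp: eventually_sequentially)
 thus ?thesis using s[of k] by (intro that[of "s k"]) auto
qed

text \<open>Otherwise summing \<open>m\<close> functions of norm one with disjoint supports gives a function of
 norm \<open>m powr (1 / p)\<close> on which the functional is at least a multiple of \<open>m\<close>.\<close>

lemma functional_tail:
 assumes lin: "!!f g. f \<in> LP ==> g \<in> LP ==> l (%z. f z + g z) = l f + l g"
  "!!c f. f \<in> LP ==> l (%z. c * f z) = c * l f"
  and K: "!!f. f \<in> LP ==> norm (l f :: complex) <= K * nrm f" "K > 0" and e: "e > 0"
 shows "\<exists>r. 0 <= r & r < 1 & (\<forall>g\<in>LP. norm (l (ct r g)) <= e * nrm g)"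
proof (rule ccontr)
 assume neg: "\<not> ?thesis"
 \<comment> \<open>A failure at every radius produces, beyond any given radius, a function of norm
   at most one supported in a shell. The outer cut costs at most half of the lower bound, whence
   \<open>e / 2\<close>.\<close>
 have step: "\<exists>r' f c. 0 <= r' & r' < 1 & f \<in> LP & (\<forall>w. norm w <= r \<or> r' < norm w --> f w = 0) & nrm f <= 1 & l f = of_real c & e / 2 <= c"
  if r: "0 <= r" "r < 1" for r
 proof -
  obtain g where g: "g \<in> LP" "norm (l (ct r g)) > e * nrm g" using neg r by (meson not_le)
  define h where "h = (ct r g)"
  have h: "h \<in> LP" "nrm h <= nrm g" unfolding h_def using indicator_LP[OF _ g(1), of "- cball 0 r"] by auto
  have gp: "nrm g > 0"
  proof (rule ccontr)
   assume "\<not> nrm g > 0"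
   hence "nrm h = 0" using h(2) nrm_nonneg[of h] nrm_nonneg[of g] by linarith
   thus False using K(1)[OF h(1)] g(2) e nrm_nonneg[of g] unfolding h_def by (metis mult_zero_right norm_le_zero_iff norm_zero not_le mult_nonneg_nonneg less_imp_le)
  qed
  obtain r' where r': "0 <= r'" "r' < 1" "nrm (ct r' h) <= e / 2 * nrm g / K"
  proof (rule LP_tail[OF h(1), of "e / 2 * nrm g / K"])
   show "0 < e / 2 * nrm g / K" using e gp K(2) by simp
  qed (rule that)
  define f0 where "f0 = (msk (cball 0 r') h)"
  have f0: "f0 \<in> LP" "nrm f0 <= nrm h" unfolding f0_def using indicator_LP[OF _ h(1), of "cball 0 r'"] by auto
  have t: "(ct r' h) \<in> LP" by (rule indicator_LP(1)[OF _ h(1)]) simp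
  have "h = (%w. f0 w + indicator (- cball 0 r') w * h w)" by (rule ext) (simp add: f0_def indicator_def)
  hence "l h = l f0 + l (ct r' h)" using lin(1)[OF f0(1) t] by simp
  moreover have "norm (l (ct r' h)) <= e / 2 * nrm g"
  proof -
   have "norm (l (ct r' h)) <= K * (e / 2 * nrm g / K)" by (rule order_trans[OF K(1)[OF t]]) (intro mult_left_mono r'(3), use K(2) in simp)
   thus ?thesis using K(2) by simp
  qed
  ultimately have lf0: "norm (l f0) >= e / 2 * nrm g" using g(2) norm_triangle_ineq[of "l f0" "l (ct r' h)"] unfolding h_def[symmetric] by simp
  hence nz: "l f0 ~= 0" using e gp by (auto simp: mult_le_0_iff)
  \<comment> \<open>This factor rotates the value of the functional to the positive reals, so that
    values of different pieces add without cancellation, and scales the norm to at most one.\<close>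
  define c where "c = cnj (l f0) / (of_real (norm (l f0)) * of_real (nrm g))"
  have nc: "norm c = 1 / nrm g" using nz gp by (simp add: c_def norm_divide norm_mult)
  have "cnj (l f0) * l f0 = of_real (norm (l f0)) * of_real (norm (l f0))"
   using complex_norm_square[of "l f0"] by (simp add: power2_eq_square mult.commute)
  hence "c * l f0 = of_real (norm (l f0) / nrm g)" using nz by (simp add: c_def)
  hence lc: "l (%w. c * f0 w) = of_real (norm (l f0) / nrm g)" using lin(2)[OF f0(1)] by simp
  have "nrm (%w. c * f0 w) <= 1" unfolding LP_cmult(2)[OF f0(1)] nc using f0(2) h(2) gp by simp
  moreover have "e / 2 <= norm (l f0) / nrm g" using lf0 gp by (simp add: pos_le_divide_eq)
  moreover have "c * f0 w = 0" if "norm w <= r \<or> r' < norm w" for w using that by (auto simp: f0_def h_def)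
  ultimately show ?thesis using r' LP_cmult(1)[OF f0(1), of c] lc
   by (intro exI[of _ r'] exI[of _ "%w. c * f0 w"] exI[of _ "norm (l f0) / nrm g"]) auto
 qed
 have main: "\<exists>r F c. 0 <= r & r < 1 & F \<in> LP & (\<forall>w. r < norm w --> F w = 0) & pw F <= of_nat m & l F = of_real c & real m * (e / 2) <= c" for m
 proof (induction m)
  case 0
  have "l (%w. 0) = 0" using lin(2)[of "%w. 0" 0] by simp
  thus ?case using p by (intro exI[of _ 0] exI[of _ "%w. 0"]) (simp add: pw_def)
 next
  case (Suc m)
  then obtain r F c where F: "0 <= r" "r < 1" "F \<in> LP" "!!w. r < norm w ==> F w = 0" "pw F <= of_nat m" "l F = of_real c" "real m * (e / 2) <= c"
   by blast
  from step[OF F(1,2)] obtain r' f c' where f: "0 <= r'" "r' < 1" "f \<in> LP" "!!w. norm w <= r \<or> r' < norm w ==> f w = 0" "nrm f <= 1" "l f = of_real c'" "e / 2 <= c'"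
   by blast
  note [measurable] = LP_measurable[OF F(3)] LP_measurable[OF f(3)]
  have "pw (%w. F w + f w) = (\<integral>\<^sup>+w. ennreal (norm (F w) powr p) + ennreal (norm (f w) powr p) \<partial>M)" unfolding pw_def
  proof (rule nn_integral_cong)
   fix w
   have "F w = 0 \<or> f w = 0" using F(4)[of w] f(4)[of w] by linarith
   thus "ennreal (norm (F w + f w) powr p) = ennreal (norm (F w) powr p) + ennreal (norm (f w) powr p)" using p by auto
  qed
  also have "... = pw F + pw f" unfolding pw_def by (rule nn_integral_add) measurable
  also have "... <= of_nat m + 1" using F(5) pw_le_nrm[OF f(3,5)] by (intro add_mono) auto
  finally have "pw (%w. F w + f w) <= of_nat (Suc m)" by (simp add: add.commute)
  moreover have "l (%w. F w + f w) = of_real (c + c')" using lin(1)[OF F(3) f(3)] F(6) f(6) by simp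
  moreover have "real (Suc m) * (e / 2) <= c + c'" using F(7) f(7) by (simp add: distrib_right)
  moreover have "F w + f w = 0" if "max r r' < norm w" for w using that F(4)[of w] f(4)[of w] by simp
  moreover have "0 <= max r r'" "max r r' < 1" using F f by auto
  ultimately show ?case using LP_add(1)[OF F(3) f(3)] by blast
 qed
 \<comment> \<open>For such \<open>m\<close> the number \<open>m * (e / 2)\<close> exceeds
   \<open>K\<close> times \<open>m powr (1 / p)\<close>, as
   \<open>1 - 1 / p = 1 / q\<close>.\<close>
 obtain m :: nat where m: "real m > (2 * K / e) powr q" using reals_Archimedean2 by blast
 obtain F c where F: "F \<in> LP" "pw F <= of_nat m" "l F = of_real c" "real m * (e / 2) <= c" using main[of m] by blast
 have m0: "real m > 0" using m powr_ge_zero[of "2 * K / e" q] by linarith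
 have "pw F <= ennreal ((real m powr (1 / p)) powr p)" using F(2) p m0 by (simp add: powr_powr ennreal_of_nat_eq_real_of_nat)
 from LP_I(2)[OF LP_measurable[OF F(1)] _ this] have nF: "nrm F <= real m powr (1 / p)" by simp
 have "2 * K / e = ((2 * K / e) powr q) powr (1 / q)" using K(2) e q by (simp add: powr_powr)
 also have "... < real m powr (1 / q)" using m q by (intro powr_less_mono2) auto
 finally have "K < real m powr (1 / q) * (e / 2)" using e by (simp add: field_simps)
 hence "K * real m powr (1 / p) < (real m powr (1 / q) * (e / 2)) * real m powr (1 / p)" using m0 by (intro mult_strict_right_mono) auto
 also have "... = (real m powr (1 / p) * real m powr (1 / q)) * (e / 2)" by simp
 also have "... = real m * (e / 2)" unfolding powr_add[symmetric] using pq m0 by simp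
 also have "... <= c" by fact
 also have "... <= norm (l F)" using F(3) by simp
 also have "... <= K * nrm F" by (rule K(1)[OF F(1)])
 also have "... <= K * real m powr (1 / p)" using K(2) by (intro mult_left_mono nF) simp
 finally show False by simp
qed

text \<open>Definiteness comes from the bound on point evaluations together with the normalisation
  outside the ball.\<close>

lemma Metric_AP: "Metric_space AP (%f g. nrm (%z. f z - g z))"
proof
 show "0 <= nrm (%z. f z - g z)" for f g by simp
 show "nrm (%z. f z - g z) = nrm (%z. g z - f z)" for f g by (rule nrm_minus_commute)
 show "nrm (%z. f z - g z) = 0 \<longleftrightarrow> f = g" if fg: "f \<in> AP" "g \<in> AP" for f g
 proof
  assume z: "nrm (%z. f z - g z) = 0"
  show "f = g"
  proof
   fix z show "f z = g z"
   proof (cases "z \<in> UB")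
    case True
    from AP_norm_le[OF AP_diff[OF fg] this] show ?thesis unfolding z by simp
   next
    case False
    thus ?thesis using AP_D(3)[OF fg(1) False] AP_D(3)[OF fg(2) False] by simp
   qed
  qed
 qed simp
 show "nrm (%z. f z - h z) <= nrm (%z. f z - g z) + nrm (%z. g z - h z)" if "f \<in> AP" "g \<in> AP" "h \<in> AP" for f g h
  using LP_add(2)[OF AP_D(1)[OF AP_diff[OF that(1,2)]] AP_D(1)[OF AP_diff[OF that(2,3)]]] by simp
qed

interpretation AP: Metric_space AP "%f g. nrm (%z. f z - g z)" by (rule Metric_AP)

text \<open>The image of the unit ball has a finite net. Each of its members has a small tail from
  some radius on, and the largest of these radii serves the whole image; homogeneity extends the
  bound to all \<open>f\<close>.\<close>

lemma compact_tail:
 assumes S: "compact_operator p \<alpha> S" and e: "e > 0"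
 obtains r where "0 <= r" "r < 1" "!!f. f \<in> AP ==> nrm (ct r (S f)) <= e * nrm f"
proof -
 have SB: "S \<in> BO" using S by (simp add: compact_operator_def)
 let ?B = "S ` {f \<in> AP. nrm f <= 1}"
 have "compactin AP.mtopology (AP.mtopology closure_of ?B)" using S by (simp add: compact_operator_def Ap_topology_def)
 hence tb: "AP.mtotally_bounded (AP.mtopology closure_of ?B)" by (rule AP.compactin_imp_mtotally_bounded)
 have sub: "?B \<subseteq> AP" using BO_D(1)[OF SB] by auto
 have "?B \<subseteq> AP.mtopology closure_of ?B" by (rule closure_of_subset) (simp add: sub)
 from AP.mtotally_bounded_subset[OF tb this] have "AP.mtotally_bounded ?B" .
 from this[unfolded AP.mtotally_bounded_def, rule_format, OF half_gt_zero[OF e]]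
 obtain F where F: "finite F" "F \<subseteq> ?B" "?B \<subseteq> (\<Union>h\<in>F. AP.mball h (e / 2))" by (elim exE conjE)
 have "\<forall>h\<in>F. \<exists>r. 0 <= r & r < 1 & nrm (ct r h) <= e / 2"
 proof
  fix h assume "h \<in> F"
  hence "h \<in> LP" using F(2) sub AP_D(1) by blast
  from LP_tail[OF this half_gt_zero[OF e]] show "\<exists>r. 0 <= r & r < 1 & nrm (ct r h) <= e / 2" by metis
 qed
 then obtain t where t: "!!h. h \<in> F ==> 0 <= t h & t h < 1 & nrm (ct (t h) h) <= e / 2" by metis
 define r where "r = Max (insert 0 (t ` F))"
 have r: "0 <= r" "r < 1" "!!h. h \<in> F ==> t h <= r" unfolding r_def using F(1) t by auto
 have unit: "nrm (ct r (S f)) <= e" if f: "f \<in> AP" "nrm f <= 1" for f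
 proof -
  obtain h where h: "h \<in> F" "S f \<in> AP.mball h (e / 2)" using F(3) f by blast
  have hA: "h \<in> AP" using h F(2) sub by blast
  have SA: "S f \<in> AP" by (rule BO_D(1)[OF SB])
  have d: "nrm (%z. S f z - h z) <= e / 2" using h(2) by (simp add: nrm_minus_commute[of h])
  have b: "- cball 0 r \<in> sets borel" for r :: real by simp
  have "(ct r (S f)) = (%w. indicator (- cball 0 r) w * (S f w - h w) + indicator (- cball 0 r) w * h w)" by (simp add: right_diff_distrib)
  hence "nrm (ct r (S f)) <= nrm (%w. indicator (- cball 0 r) w * (S f w - h w)) + nrm (ct r h)"
   using LP_add(2)[OF indicator_LP(1)[OF b AP_D(1)[OF AP_diff[OF SA hA]]] indicator_LP(1)[OF b AP_D(1)[OF hA]], of r r] by simp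
  also have "... <= nrm (%z. S f z - h z) + nrm (ct (t h) h)"
  proof (intro add_mono)
   show "nrm (%w. indicator (- cball 0 r) w * (S f w - h w)) <= nrm (%z. S f z - h z)"
    by (rule indicator_LP(2)[OF b AP_D(1)[OF AP_diff[OF SA hA]]])
   show "nrm (ct r h) <= nrm (ct (t h) h)" using r(3)[OF h(1)]
    by (intro LP_mono(2)[OF indicator_LP(1)[OF b AP_D(1)[OF hA]] LP_measurable[OF indicator_LP(1)[OF b AP_D(1)[OF hA]]]])
      (auto simp: indicator_def)
  qed
  also have "... <= e" using d t[OF h(1)] by simp
  finally show ?thesis .
 qed
 have "nrm (ct r (S f)) <= e * nrm f" if f: "f \<in> AP" for f
 proof (cases "nrm f = 0")
  case True
  hence "nrm (S f) = 0" using op_norm_bound[OF SB f] nrm_nonneg[of "S f"] by simp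
  hence "nrm (ct r (S f)) <= 0" using indicator_LP(2)[OF _ AP_D(1)[OF BO_D(1)[OF SB]], of "- cball 0 r" f] by simp
  thus ?thesis using True by simp
 next
  case False
  hence pos: "nrm f > 0" using nrm_nonneg[of f] by linarith
  define c where "c = complex_of_real (1 / nrm f)"
  have c: "norm c = 1 / nrm f" using pos by (simp add: c_def norm_divide)
  have "nrm (%w. indicator (- cball 0 r) w * S (%z. c * f z) w) <= e"
   by (rule unit[OF AP_cmult[OF f]]) (use LP_cmult(2)[OF AP_D(1)[OF f], of c] pos c in simp)
  moreover have "(%w. indicator (- cball 0 r) w * S (%z. c * f z) w) = (%w. c * (indicator (- cball 0 r) w * S f w))"
   unfolding BO_D(4)[OF SB f] by (simp only: mult.left_commute)
  ultimately show ?thesis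
   using LP_cmult(2)[OF indicator_LP(1)[OF _ AP_D(1)[OF BO_D(1)[OF SB]], of "- cball 0 r" f], of c] c pos by (simp add: divide_le_eq)
 qed
 thus ?thesis by (rule that[OF r(1,2)])
qed

end

lemma eventually_to_boundary:
 "eventually P (to_boundary :: (complex ^ 'n) filter) \<longleftrightarrow> (\<exists>h>0. \<forall>z\<in>UB. tau z < h --> P z)"
proof
 assume "eventually P (to_boundary :: (complex ^ 'n) filter)"
 then obtain Q where Q: "eventually Q (at_left (1 :: real))" "!!z :: complex ^ 'n. Q (norm z) ==> P z"
  unfolding to_boundary_def eventually_filtercomap by blast
 from Q(1) obtain b where b: "b < 1" "!!x. b < x ==> x < 1 ==> Q x" unfolding eventually_at_left_field by auto
 define s where "s = max b 0"
 have s: "0 <= s" "s < 1" "b <= s" using b by (auto simp: s_def)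
 have "P z" if z: "z \<in> UB" "tau z < 1 - s\<^sup>2" for z
 proof -
  have "s\<^sup>2 < (norm z)\<^sup>2" using z by (simp add: tau_def)
  hence "s < norm z" by (rule power_less_imp_less_base) simp
  thus ?thesis using z s by (intro Q(2) b(2)) auto
 qed
 moreover have "1 - s\<^sup>2 > 0" using s by (simp add: power_less_one_iff)
 ultimately show "\<exists>h>0. \<forall>z\<in>UB. tau z < h --> P z" by blast
next
 assume "\<exists>h>0. \<forall>z\<in>UB. tau z < h --> P z"
 then obtain h where h: "h > 0" "!!z. z \<in> UB ==> tau z < h ==> P z" by blast
 obtain s where s: "0 < s" "s < 1" "!!z :: complex ^ 'n. s < norm z ==> norm z < 1 ==> tau z < h"
  by (rule tau_less_near_boundary[OF h(1)]) (rule that)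
 have "eventually (%x. s < x & x < 1) (at_left (1 :: real))" unfolding eventually_at_left_field using s(2) by blast
 thus "eventually P (to_boundary :: (complex ^ 'n) filter)"
  unfolding to_boundary_def eventually_filtercomap using h(2) s(3) by (intro exI[of _ "%x. s < x & x < 1"]) auto
qed

context bergman_space begin

lemma normalized_kernel_eq:
 "normalized_kernel r \<alpha> y = (%z. of_real (tau y powr (N / conj_exponent r)) * kf y z)" for y :: "complex ^ 'n"
 unfolding normalized_kernel_def N_def[symmetric] tau_def[symmetric] kf_def ker_def by (rule ext) simp

text \<open>The two normalising powers \<open>N / q\<close> and \<open>N / p\<close> of
  \<open>tau z\<close> multiply to the power \<open>N\<close>, and integrating against the conjugate
  kernel reproduces the value at \<open>z\<close>.\<close>

lemma berezin_eq:
 assumes S: "S \<in> BO" and z: "z \<in> UB"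
 shows "berezin p \<alpha> S z = of_real (tau z powr N) * S (kf z) z"
proof -
 let ?a = "complex_of_real (tau z powr (N / q))" and ?b = "complex_of_real (tau z powr (N / p))"
 have SA: "S (kf z) \<in> AP" by (rule BO_D(1)[OF S])
 have "berezin p \<alpha> S z = (LINT v|M. ?a * S (kf z) v * cnj (?b * kf z v))"
  unfolding berezin_def pairing_def normalized_kernel_eq q_def[symmetric] conj_exponent_q BO_D(4)[OF S kf_AP[OF z]] M_def ..
 also have "... = (LINT v|M. ?a * ?b * (S (kf z) v * ker z v))"
 proof (rule Bochner_Integration.integral_cong)
  fix v assume "v \<in> space M"
  hence v: "v \<in> UB" by simp
  hence "cnj (kf z v) = ker z v" using z by (simp add: kf_def ker_cnj)
  hence "cnj (?b * kf z v) = ?b * ker z v" by simp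
  thus "?a * S (kf z) v * cnj (?b * kf z v) = ?a * ?b * (S (kf z) v * ker z v)" by (simp only: mult_ac)
 qed simp
 also have "... = ?a * ?b * (LINT v|M. S (kf z) v * ker z v)" by (rule integral_mult_right_zero)
 also have "(LINT v|M. S (kf z) v * ker z v) = S (kf z) z" using fun_cong[OF proj_AP_eq[OF SA], of z] z by (simp only: projection_eq if_True)
 also have "?a * ?b = of_real (tau z powr (N / q + N / p))" by (simp add: powr_add)
 also have "N / q + N / p = N * (1 / p + 1 / q)" by (simp add: field_simps)
 finally show ?thesis using pq by simp
qed

lemma bzero_iff:
 assumes S: "S \<in> BO"
 shows "bzero S \<longleftrightarrow> S \<in> TA & (berezin p \<alpha> S \<longlongrightarrow> 0) to_boundary"
proof -
 have nb: "norm (berezin p \<alpha> S z) = tau z powr N * norm (S (kf z) z)" if "z \<in> UB" for z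
  unfolding berezin_eq[OF S that] by (simp add: norm_mult)
 have "(berezin p \<alpha> S \<longlongrightarrow> 0) to_boundary \<longleftrightarrow>
  (\<forall>e>0. \<exists>h>0. \<forall>z\<in>UB. tau z < h --> tau z powr N * norm (S (kf z) z) < e)"
  unfolding tendsto_iff eventually_to_boundary dist_0_norm dist_commute[of _ 0] using nb by (metis (no_types, lifting))
 also have "... \<longleftrightarrow> (\<forall>e>0. \<exists>h>0. \<forall>z\<in>UB. tau z < h --> tau z powr N * norm (S (kf z) z) <= e)"
  (is "?l \<longleftrightarrow> ?r")
 proof
  assume ?l thus ?r by (meson less_imp_le)
 next
  assume r: ?r
  show ?l
  proof (intro allI impI)
   fix e :: real assume "e > 0"
   hence "e / 2 > 0" "e / 2 < e" by auto
   thus "\<exists>h>0. \<forall>z\<in>UB. tau z < h --> tau z powr N * norm (S (kf z) z) < e" using r by (meson le_less_trans)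
  qed
 qed
 finally show ?thesis unfolding bzero_def by simp
qed

text \<open>The functional \<open>f\<close> \<mapsto> \<open>S f u\<close> is negligible on
  functions near the sphere, by \<open>functional_tail\<close>. On the remaining part it is a
  Riemann sum of point evaluations, so the operator is a norm limit of finite sums of
  \<open>rank1\<close>.\<close>

lemma bzero_point:
 assumes S: "S \<in> BO" and u: "u \<in> UB"
 shows "bzero (%f. if f \<in> AP then (%z. S f u * kf u z) else (%z. 0))" (is "bzero ?T")
proof -
 obtain C where C: "C > 0" "!!f. f \<in> AP ==> nrm (S f) <= C * nrm f" by (rule BO_bound[OF S]) (rule that)
 define A where "A = (1 - norm u) powr (- N) * C"
 have A: "A > 0" using u C by (simp add: A_def)
 have Su: "norm (S f u) <= A * nrm f" if "f \<in> AP" for f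
 proof -
  have "norm (S f u) <= (1 - norm u) powr (- N) * nrm (S f)" by (rule AP_norm_le[OF BO_D(1)[OF S] u])
  also have "... <= (1 - norm u) powr (- N) * (C * nrm f)" by (intro mult_left_mono C(2)[OF that]) simp
  finally show ?thesis by (simp add: A_def mult.assoc)
 qed
 have "?T \<in> BO"
 proof (rule BO_I)
  show "?T f \<in> AP" if "f \<in> AP" for f using that AP_cmult[OF kf_AP[OF u]] by simp
  show "nrm (?T f) <= (A * nrm (kf u)) * nrm f" if "f \<in> AP" for f
  proof -
   have "nrm (?T f) = norm (S f u) * nrm (kf u)" using that LP_cmult(2)[OF kf_LP[OF u], of "S f u"] by simp
   also have "... <= (A * nrm f) * nrm (kf u)" by (intro mult_right_mono Su[OF that]) simp
   finally show ?thesis by (simp only: mult_ac)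
  qed
 qed (use AP_add AP_cmult in \<open>auto simp: BO_D[OF S] distrib_right\<close>)
 thus ?thesis
 proof (rule bzero_limit)
  fix e :: real assume e: "e > 0"
  define D where "D = nrm (kf u) + 1"
  have D: "D > 0" "nrm (kf u) <= D" using nrm_nonneg[of "kf u"] unfolding D_def by linarith+
  \<comment> \<open>The error budget: \<open>D\<close> bounds the norm of \<open>kf u\<close> and
    \<open>A\<close> that of the functional, so the tail and the Riemann sum each cost
    \<open>e / 2\<close> in the end.\<close>
  have e1: "e / (2 * D) > 0" and e2: "e / (2 * D * A) > 0" using e D A by auto
  have "\<exists>r. 0 <= r & r < 1 & (\<forall>g\<in>LP. norm (S (proj (ct r g)) u) <= e / (2 * D) * nrm g)"
  proof (rule functional_tail[of "%g. S (proj g) u" "A * CP", OF _ _ _ _ e1])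
   show "S (proj (%z. f z + g z)) u = S (proj f) u + S (proj g) u" if "f \<in> LP" "g \<in> LP" for f g
    unfolding proj_add[OF that] BO_D(3)[OF S proj_AP[OF that(1)] proj_AP[OF that(2)]] ..
   show "S (proj (%z. c * f z)) u = c * S (proj f) u" if "f \<in> LP" for c f unfolding proj_cmult BO_D(4)[OF S proj_AP[OF that]] ..
   show "norm (S (proj f) u) <= A * CP * nrm f" if "f \<in> LP" for f
    using order_trans[OF Su[OF proj_AP[OF that]] mult_left_mono[OF CP(2)[OF that], of A]] A by (simp add: mult.assoc)
   show "A * CP > 0" using A CP(1) by simp
  qed
  then obtain r where r: "0 <= r" "r < 1" "!!g. g \<in> LP ==> norm (S (proj (ct r g)) u) <= e / (2 * D) * nrm g" by blast
  obtain m :: nat and c v where v: "!!i. v i \<in> UB"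
   "!!f. f \<in> AP ==> nrm (%z. proj (msk (cball 0 r) f) z - (\<Sum>i<m. c i * (f (v i) * kf (v i) z))) <= e / (2 * D * A) * nrm f"
   by (rule trunc_approx[OF r(1,2) e2]) (rule that)
  define R where "R = (%f z. \<Sum>i<m. (c i * S (kf (v i)) u) * rank1 u (v i) f z)"
  have "bzero R" unfolding R_def by (intro bzero_sum bzero_rank1 u v) simp
  moreover have "nrm (%z. R f z - ?T f z) <= e * nrm f" if f: "f \<in> AP" for f
  proof -
   note fL = AP_D(1)[OF f]
   define b where "b = (\<Sum>i<m. (c i * f (v i)) * S (kf (v i)) u)"
   define h where "h = (%z. proj (msk (cball 0 r) f) z)"
   define k where "k = (%z. \<Sum>i<m. (c i * f (v i)) * kf (v i) z)"
   have bL: "(msk (cball 0 r) f) \<in> LP" "(ct r f) \<in> LP" by (rule indicator_LP(1)[OF _ fL]; simp)+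
   have hA: "h \<in> AP" unfolding h_def by (rule proj_AP[OF bL(1)])
   have kA: "k \<in> AP" unfolding k_def by (intro AP_sum AP_cmult kf_AP v) simp
   have Sk: "S k u = b" unfolding k_def b_def
    using BO_sum_arg[OF S, of "{..<m}" "%i. kf (v i)" "%i. c i * f (v i)"] kf_AP[OF v(1)] by simp
   have "nrm (%z. h z - k z) <= e / (2 * D * A) * nrm f" using v(2)[OF f] by (simp add: h_def k_def mult.assoc)
   hence "norm (S (%z. h z - k z) u) <= A * (e / (2 * D * A) * nrm f)"
    using Su[OF AP_diff[OF hA kA]] A by (meson mult_left_mono less_imp_le order_trans)
   hence 1: "norm (S h u - b) <= e / (2 * D) * nrm f" unfolding BO_diff_arg[OF S hA kA] Sk using A by simp
   have "f = (%w. indicator (cball 0 r) w * f w + indicator (- cball 0 r) w * f w)" by (rule ext) (simp add: indicator_def)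
   hence "proj f = (%z. h z + proj (ct r f) z)" unfolding h_def proj_add[OF bL, symmetric] by simp
   hence "S f u = S h u + S (proj (ct r f)) u" unfolding proj_AP_eq[OF f] using BO_D(3)[OF S hA proj_AP[OF bL(2)]] by simp
   hence "norm (b - S f u) <= norm (S h u - b) + norm (S (proj (ct r f)) u)"
    using norm_triangle_ineq[of "S h u - b" "S (proj (ct r f)) u"] norm_minus_commute[of b "S f u"] by (simp add: algebra_simps)
   also have "... <= e / (2 * D) * nrm f + e / (2 * D) * nrm f" by (intro add_mono 1 r(3) fL)
   also have "... = e / D * nrm f" using D by (simp add: field_simps)
   finally have bb: "norm (b - S f u) <= e / D * nrm f" .
   have "(%z. R f z - ?T f z) = (%z. (b - S f u) * kf u z)"
    using f unfolding R_def b_def rank1_def left_diff_distrib sum_distrib_right by (simp add: mult_ac)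
   hence "nrm (%z. R f z - ?T f z) = norm (b - S f u) * nrm (kf u)" using LP_cmult(2)[OF kf_LP[OF u], of "b - S f u"] by simp
   also have "... <= (e / D * nrm f) * D" using D e by (intro mult_mono bb) auto
   also have "... = e * nrm f" using D by simp
   finally show ?thesis .
  qed
  ultimately show "\<exists>R. bzero R & (\<forall>f\<in>AP. nrm (%z. R f z - ?T f z) <= e * nrm f)" by blast
 qed
qed

text \<open>As \<open>S f\<close> is fixed by the projection, its tail may be dropped at the cost of
  \<open>CP\<close>, and the projection of the rest is a Riemann sum. Only the tail condition is
  used, so the approximation serves both directions.\<close>

lemma finite_rank_approx:
 assumes S: "S \<in> BO" and e: "e > 0"
  and tail: "!!d. d > 0 ==> \<exists>r. 0 <= r & r < 1 & (\<forall>f\<in>AP. nrm (ct r (S f)) <= d * nrm f)"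
 obtains m :: nat and c v where "!!i. v i \<in> UB"
  "!!f. f \<in> AP ==> nrm (%z. (\<Sum>i<m. c i * (S f (v i) * kf (v i) z)) - S f z) <= e * nrm f"
proof -
 obtain C where C: "C > 0" "!!f. f \<in> AP ==> nrm (S f) <= C * nrm f" by (rule BO_bound[OF S]) (rule that)
 have e1: "e / (2 * CP) > 0" and e2: "e / (2 * C) > 0" using e CP(1) C(1) by auto
 obtain r where r: "0 <= r" "r < 1" "!!f. f \<in> AP ==> nrm (ct r (S f)) <= e / (2 * CP) * nrm f" using tail[OF e1] by blast
 obtain m :: nat and c v where v: "!!i. v i \<in> UB"
  "!!f. f \<in> AP ==> nrm (%z. proj (msk (cball 0 r) f) z - (\<Sum>i<m. c i * (f (v i) * kf (v i) z))) <= e / (2 * C) * nrm f"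
  by (rule trunc_approx[OF r(1,2) e2]) (rule that)
 have "nrm (%z. (\<Sum>i<m. c i * (S f (v i) * kf (v i) z)) - S f z) <= e * nrm f" if f: "f \<in> AP" for f
 proof -
  have SA: "S f \<in> AP" by (rule BO_D(1)[OF S])
  note sL = AP_D(1)[OF SA]
  have bL: "(msk (cball 0 r) (S f)) \<in> LP" "(ct r (S f)) \<in> LP" by (rule indicator_LP(1)[OF _ sL]; simp)+
  define F where "F = (%z. \<Sum>i<m. c i * (S f (v i) * kf (v i) z))"
  define h where "h = proj (msk (cball 0 r) (S f))"
  define k where "k = proj (ct r (S f))"
  have FA: "F \<in> AP" unfolding F_def by (intro AP_sum AP_cmult kf_AP v) simp
  have hA: "h \<in> AP" and kA: "k \<in> AP" unfolding h_def k_def by (intro proj_AP bL)+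
  have "S f = (%w. indicator (cball 0 r) w * S f w + indicator (- cball 0 r) w * S f w)" by (rule ext) (simp add: indicator_def)
  hence "proj (S f) = (%z. h z + k z)" unfolding h_def k_def proj_add[OF bL, symmetric] by simp
  hence "(%z. F z - S f z) = (%z. (F z - h z) - k z)" unfolding proj_AP_eq[OF SA] by (simp add: fun_eq_iff)
  hence "nrm (%z. F z - S f z) <= nrm (%z. F z - h z) + nrm k"
   using LP_diff(2)[OF AP_D(1)[OF AP_diff[OF FA hA]] AP_D(1)[OF kA]] by simp
  also have "... <= e / 2 * nrm f + e / 2 * nrm f"
  proof (rule add_mono)
   have "nrm (%z. F z - h z) = nrm (%z. h z - F z)" by (rule nrm_minus_commute)
   also have "... <= e / (2 * C) * nrm (S f)" unfolding h_def F_def by (rule v(2)[OF SA])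
   also have "... <= e / (2 * C) * (C * nrm f)" using e2 by (intro mult_left_mono C(2)[OF f]) simp
   finally show "nrm (%z. F z - h z) <= e / 2 * nrm f" using C(1) by simp
   have "nrm k <= CP * nrm (ct r (S f))" unfolding k_def by (rule CP(2)[OF bL(2)])
   also have "... <= CP * (e / (2 * CP) * nrm f)" using CP(1) by (intro mult_left_mono r(3)[OF f]) simp
   finally show "nrm k <= e / 2 * nrm f" using CP(1) by simp
  qed
  finally show ?thesis unfolding F_def by simp
 qed
 thus ?thesis by (rule that[OF v(1)])
qed

theorem compact_bzero:
 assumes S: "compact_operator p \<alpha> S" shows "bzero S"
proof -
 have SB: "S \<in> BO" using S by (simp add: compact_operator_def)
 show ?thesis
 proof (rule bzero_limit[OF SB])
  fix e :: real assume e: "e > 0"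
  have tail: "\<exists>r. 0 <= r & r < 1 & (\<forall>f\<in>AP. nrm (ct r (S f)) <= d * nrm f)" if "d > 0" for d
   by (rule compact_tail[OF S that]) blast
  obtain m :: nat and c v where v: "!!i. v i \<in> UB"
   "!!f. f \<in> AP ==> nrm (%z. (\<Sum>i<m. c i * (S f (v i) * kf (v i) z)) - S f z) <= e * nrm f"
   by (rule finite_rank_approx[OF SB e tail]) (assumption, rule that)
  define T where "T u = (%f. if f \<in> AP then (%z. S f u * kf u z) else (%z. 0))" for u
  define R where "R = (%f z. \<Sum>i<m. c i * T (v i) f z)"
  have "bzero R" unfolding R_def T_def by (intro bzero_sum bzero_point SB v) simp
  moreover have "nrm (%z. R f z - S f z) <= e * nrm f" if "f \<in> AP" for f using v(2)[OF that] that by (simp add: R_def T_def)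
  ultimately show "\<exists>R. bzero R & (\<forall>f\<in>AP. nrm (%z. R f z - S f z) <= e * nrm f)" by blast
 qed
qed

end

section \<open>Decay of the kernel of an operator near the diagonal\<close>

text \<open>A quantitative identity theorem by normal families: were there no such \<open>b\<close>,
  Montel's theorem would give a limit that vanishes on a real segment, hence everywhere, against the
  lower bound \<open>c\<close>. What matters is that \<open>b\<close> is the same for all
  \<open>g\<close> with the bound \<open>C\<close>.\<close>

lemma small_on_reals:
 fixes C r r' t c :: real
 assumes "0 < t" "0 < r'" "r < r'" "c > 0"
 obtains b where "b > 0"
  "!!g z. g holomorphic_on ball 0 r' ==> \<forall>z\<in>ball 0 r'. norm (g z) <= C ==>
    \<forall>x::real. \<bar>x\<bar> < t --> \<bar>x\<bar> < r' --> norm (g (of_real x)) <= b ==> norm z <= r ==> norm (g z) <= c"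
proof (rule ccontr)
 assume neg: "\<not> thesis"
 have "\<exists>g z. g holomorphic_on ball 0 r' & (\<forall>z\<in>ball 0 r'. norm (g z) <= C) &
    (\<forall>x::real. \<bar>x\<bar> < t --> \<bar>x\<bar> < r' --> norm (g (of_real x)) <= inverse (real (Suc n))) & norm z <= r & norm (g z) > c" for n
 proof (rule ccontr)
  assume a: "\<not> ?thesis"
  show False by (rule neg[THEN notE], rule that[of "inverse (real (Suc n))"]) (use a not_le in \<open>simp, blast\<close>)
 qed
 then obtain F y where F: "!!n. F n holomorphic_on ball 0 r'" "!!n z. z \<in> ball 0 r' ==> norm (F n z) <= C"
  "!!n x. \<bar>x\<bar> < t ==> \<bar>x\<bar> < r' ==> norm (F n (of_real x)) <= inverse (real (Suc n))"
  "!!n. norm (y n) <= r" "!!n. norm (F n (y n)) > c" by metis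
 obtain g k where g: "g holomorphic_on ball 0 r'" "strict_mono (k :: nat => nat)"
  "!!x. x \<in> ball 0 r' ==> ((%n. F (k n) x) \<longlongrightarrow> g x) sequentially"
  "!!K. compact K ==> K \<subseteq> ball 0 r' ==> uniform_limit K (F \<circ> k) g sequentially"
 proof (rule Montel[of "ball 0 r'" "range F" F])
  show "\<exists>B. \<forall>h\<in>range F. \<forall>z\<in>K. norm (h z) <= B" if "compact K" "K \<subseteq> ball 0 r'" for K using that F(2) by blast
 qed (use F(1) in auto)
 define s where "s = min t r'"
 have s: "s > 0" using assms by (simp add: s_def)
 have real0: "g (of_real x) = 0" if "\<bar>x\<bar> < s" for x :: real
 proof -
  have x: "\<bar>x\<bar> < t" "\<bar>x\<bar> < r'" using that by (auto simp: s_def)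
  have "(%n. F (k n) (of_real x)) ----> 0"
  proof (rule Lim_null_comparison)
   show "\<forall>\<^sub>F n in sequentially. norm (F (k n) (of_real x)) <= inverse (real (Suc (k n)))"
    using F(3)[OF x] by (intro always_eventually allI)
   show "(%n. inverse (real (Suc (k n)))) ----> 0"
    using LIMSEQ_subseq_LIMSEQ[OF LIMSEQ_inverse_real_of_nat g(2)] by (simp add: o_def)
  qed
  moreover have "(%n. F (k n) (of_real x)) ----> g (of_real x)" using x(2) by (intro g(3)) simp
  ultimately show ?thesis using LIMSEQ_unique by blast
 qed
 have g0: "g z = 0" if "z \<in> ball 0 r'" for z
 proof (rule analytic_continuation[OF g(1) open_ball connected_ball, of "complex_of_real ` {-s<..<s}" 0])
  show "complex_of_real ` {-s<..<s} \<subseteq> ball 0 r'" by (auto simp: s_def)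
  show "(0 :: complex) \<in> ball 0 r'" using assms by simp
  show "(0 :: complex) islimpt complex_of_real ` {-s<..<s}" unfolding islimpt_approachable
  proof (intro allI impI)
   fix e :: real assume e: "e > 0"
   have "complex_of_real (min (s / 2) (e / 2)) \<in> complex_of_real ` {-s<..<s}" using s e by (intro imageI) (auto simp: min_def)
   thus "\<exists>x'\<in>complex_of_real ` {-s<..<s}. x' ~= 0 & dist x' 0 < e"
    by (rule bexI[rotated]) (use s e in \<open>simp add: min_def\<close>)
  qed
  show "g z = 0" if "z \<in> complex_of_real ` {-s<..<s}" for z using that real0 by (auto simp: abs_less_iff)
 qed (fact that)
 have "uniform_limit (cball 0 r) (F \<circ> k) g sequentially" using assms by (intro g(4)) auto
 from uniform_limitD[OF this assms(4)] obtain n where "\<forall>m\<ge>n. \<forall>z\<in>cball 0 r. dist ((F \<circ> k) m z) (g z) < c"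
  unfolding eventually_sequentially ..
 hence n: "!!z. z \<in> cball 0 r ==> dist (F (k n) z) (g z) < c" by simp
 have "y (k n) \<in> cball 0 r" "y (k n) \<in> ball 0 r'" using F(4)[of "k n"] assms by auto
 thus False using n[of "y (k n)"] g0[of "y (k n)"] F(5)[of "k n"] by simp
qed

text \<open>For close points \<open>tau z\<close>, \<open>tau w\<close> and
  \<open>norm (1 - herm z w)\<close> are mutually comparable, with constants that depend on
  \<open>\<delta>\<close> alone.\<close>

lemma close_bounds:
 assumes c: "close \<delta> z w" and \<delta>: "\<delta> > 0" and z: "z \<in> UB" and w: "w \<in> UB"
 shows "\<delta> * norm (1 - herm z w) <= 2 * tau z" "\<delta> * norm (1 - herm z w) <= 2 * tau w" "tau z <= 2 * norm (1 - herm z w)"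
  "tau w <= 2 * norm (1 - herm z w)" "\<delta> * tau w <= 4 * tau z" "\<delta> * tau z <= 4 * tau w"
proof -
 define d where "d = norm (1 - herm z w)"
 have d: "d > 0" unfolding d_def using z w by (intro norm_one_minus_herm_pos) auto
 have t: "tau x <= 2 * (1 - norm x)" if "x \<in> UB" for x
 proof -
  have "tau x = (1 + norm x) * (1 - norm x)" by (simp add: tau_def power2_eq_square algebra_simps)
  also have "... <= 2 * (1 - norm x)" using that by (intro mult_right_mono) auto
  finally show ?thesis .
 qed
 have tz: "tau z <= 2 * d" using t[OF z] norm_one_minus_herm_ge[of w z] w unfolding d_def by simp
 have tw: "tau w <= 2 * d" using t[OF w] norm_one_minus_herm_ge[of z w] z unfolding d_def norm_one_minus_herm_commute[of z w] by simp
 have c': "\<delta> * d\<^sup>2 <= tau z * tau w" using c by (simp add: close_def d_def)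
 have "\<delta> * d * d <= 2 * tau z * d"
 proof -
  have "\<delta> * d * d <= tau z * tau w" using c' by (simp add: power2_eq_square mult.assoc)
  also have "... <= tau z * (2 * d)" using z by (intro mult_left_mono tw) (auto intro: less_imp_le)
  finally show ?thesis by simp
 qed
 hence 1: "\<delta> * d <= 2 * tau z" using d by simp
 have "\<delta> * d * d <= 2 * d * tau w"
 proof -
  have "\<delta> * d * d <= tau z * tau w" using c' by (simp add: power2_eq_square mult.assoc)
  also have "... <= (2 * d) * tau w" using w by (intro mult_right_mono tz) (auto intro: less_imp_le)
  finally show ?thesis by simp
 qed
 hence 2: "\<delta> * d <= 2 * tau w" using d by simp
 have "\<delta> * tau w <= \<delta> * (2 * d)" "\<delta> * tau z <= \<delta> * (2 * d)" using \<delta> tz tw by (auto intro: mult_left_mono)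
 thus "\<delta> * tau w <= 4 * tau z" "\<delta> * tau z <= 4 * tau w" using 1 2 by linarith+
 show "\<delta> * norm (1 - herm z w) <= 2 * tau z" "\<delta> * norm (1 - herm z w) <= 2 * tau w" "tau z <= 2 * norm (1 - herm z w)" "tau w <= 2 * norm (1 - herm z w)"
  using 1 2 tz tw unfolding d_def by auto
qed

context bergman_space begin

text \<open>The kernel function depends on its parameter antiholomorphically; the conjugate in front
  of \<open>e\<close> turns this into a complex derivative with values in the Bergman space, to
  which \<open>S\<close> can be applied.\<close>

lemma kernel_derivative:
 assumes w: "c + cnj \<omega> *s e \<in> UB"
 obtains G C r where "G \<in> AP" "C >= 0" "r > 0"
  "!!k. norm k < r ==> c + cnj (\<omega> + k) *s e \<in> UB &
    nrm (%v. kf (c + cnj (\<omega> + k) *s e) v - kf (c + cnj \<omega> *s e) v - k * G v) <= C * (norm k)\<^sup>2"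
proof -
 define w0 where "w0 = c + cnj \<omega> *s e"
 define R where "R = (1 + norm w0) / 2"
 have R: "R < 1" "norm w0 < R" using w by (auto simp: R_def w0_def)
 obtain C where C: "C >= 0" "!!x y. norm x <= R ==> norm y <= R ==> norm (phi y - phi x - dphi x * (y - x)) <= C * (norm (y - x))\<^sup>2"
  "!!x. norm x <= R ==> norm (dphi x) <= C" by (rule phi_Taylor[OF R(1)]) (rule that)
 have h: "norm (herm z w) <= norm w" if "z \<in> UB" for z w :: "complex ^ 'n"
  using norm_herm_le[of z w] mult_right_mono[of "norm z" 1 "norm w"] that by simp
 define g where "g v = dphi (herm v w0) * herm v e" for v
 have gm: "g \<in> bmM" unfolding g_def by (rule borel_measurable_M) measurable
 have gb: "norm (g v) <= C * norm e" if "v \<in> UB" for v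
  unfolding g_def norm_mult using h[OF that, of w0] R by (intro mult_mono C(3) h that) (use C(1) in auto)
 have gL: "g \<in> LP" by (rule LP_bounded(1)[OF gm gb]) (use C in auto)
 define r where "r = (R - norm w0) / (norm e + 1)"
 have ne: "norm e + 1 > 0" using norm_ge_zero[of e] by linarith
 have r: "r > 0" using R ne by (simp add: r_def)
 show ?thesis
 \<comment> \<open>The derivative is taken to be the projection of the pointwise one, which places
   it in the Bergman space; differences of kernel functions are fixed by the projection, and its
   norm costs only the factor \<open>CP\<close>.\<close>
 proof (rule that[OF proj_AP[OF gL] _ r, of "CP * (C * (norm e)\<^sup>2)"])
  show "CP * (C * (norm e)\<^sup>2) >= 0" using CP(1) C(1) by simp
  fix k :: complex assume k: "norm k < r"
  define w1 where "w1 = c + cnj (\<omega> + k) *s e"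
  have w1: "w1 = w0 + cnj k *s e" by (simp add: w1_def w0_def vector_sadd_rdistrib add.assoc)
  have "norm (cnj k *s e) <= norm k * (norm e + 1)" by (simp add: norm_smult mult_left_mono)
  also have "... < r * (norm e + 1)" using k ne by (intro mult_strict_right_mono) auto
  also have "... = R - norm w0" using ne by (simp add: r_def)
  finally have w1R: "norm w1 < R" using norm_triangle_ineq[of w0 "cnj k *s e"] unfolding w1 by linarith
  have b: "w0 \<in> UB" "w1 \<in> UB" using R w1R by auto
  define u where "u v = (kf w1 v - kf w0 v) - k * g v" for v
  have uL: "(%v. kf w1 v - kf w0 v) \<in> LP" "(%v. k * g v) \<in> LP" by (intro LP_diff(1) kf_LP LP_cmult(1) b gL)+
  have ub: "norm (u v) <= C * (norm e)\<^sup>2 * (norm k)\<^sup>2" if v: "v \<in> UB" for v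
  proof -
   have hd: "herm v w1 - herm v w0 = k * herm v e" unfolding w1 by (simp add: herm_add_right herm_smult_right)
   have "u v = phi (herm v w1) - phi (herm v w0) - dphi (herm v w0) * (herm v w1 - herm v w0)" unfolding hd u_def g_def kf_def ker_phi using v by simp
   hence "norm (u v) <= C * (norm (herm v w1 - herm v w0))\<^sup>2" using h[OF v, of w1] h[OF v, of w0] w1R R by (simp add: C(2))
   also have "... <= C * (norm k * norm e)\<^sup>2" unfolding hd norm_mult using C(1) h[OF v, of e] by (intro mult_left_mono power_mono) auto
   finally show ?thesis by (simp add: power_mult_distrib mult_ac)
  qed
  have um: "u \<in> LP" unfolding u_def by (rule LP_diff(1)[OF uL])
  have nu: "nrm u <= C * (norm e)\<^sup>2 * (norm k)\<^sup>2" by (rule LP_bounded(2)[OF LP_measurable[OF um] ub]) (use C in auto)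
  have "proj u = (%v. proj (%v. kf w1 v - kf w0 v) v - k * proj g v)" unfolding u_def proj_diff[OF uL] proj_cmult ..
  hence eq: "proj u = (%v. kf w1 v - kf w0 v - k * proj g v)" unfolding proj_AP_eq[OF AP_diff[OF kf_AP[OF b(2)] kf_AP[OF b(1)]]] .
  have "nrm (proj u) <= CP * (C * (norm e)\<^sup>2 * (norm k)\<^sup>2)"
   by (rule order_trans[OF CP(2)[OF um] mult_left_mono[OF nu]]) (use CP(1) in simp)
  thus "c + cnj (\<omega> + k) *s e \<in> UB &
    nrm (%v. kf (c + cnj (\<omega> + k) *s e) v - kf (c + cnj \<omega> *s e) v - k * proj g v) <= CP * (C * (norm e)\<^sup>2) * (norm k)\<^sup>2"
   using b(2) unfolding eq w1_def[symmetric] w0_def[symmetric] by (simp add: mult.assoc)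
 qed
qed

text \<open>In the first variable the derivative is that of the holomorphic function
  \<open>S (kf w0)\<close>; in the second it comes from applying \<open>S\<close> to the derivative
  of the kernel function. A joint real derivative is shown directly, so that holomorphy along any
  curve of parameters follows by the chain rule.\<close>

lemma joint_derivative:
 assumes S: "S \<in> BO" and w: "c + cnj y *s e \<in> UB" and z: "c + \<zeta> *s e \<in> UB"
 shows "\<exists>A B. ((%x. S (kf (c + cnj (snd x) *s e)) (c + fst x *s e)) has_derivative (%h. A * fst h + B * snd h)) (at (\<zeta>, y))"
proof -
 obtain G C r where G: "G \<in> AP" "C >= 0" "r > 0"
  "!!k. norm k < r ==> c + cnj (y + k) *s e \<in> UB &
    nrm (%v. kf (c + cnj (y + k) *s e) v - kf (c + cnj y *s e) v - k * G v) <= C * (norm k)\<^sup>2"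
  by (rule kernel_derivative[OF w]) (rule that)
 define w0 where "w0 = c + cnj y *s e"
 define z0 where "z0 = c + \<zeta> *s e"
 have wz: "w0 \<in> UB" "z0 \<in> UB" using w z by (auto simp: w0_def z0_def)
 define R where "R = (1 + norm z0) / 2"
 have R: "R < 1" "norm z0 < R" using wz by (auto simp: R_def)
 obtain D where D: "D > 0"
  "!!f w u. f \<in> AP ==> norm w <= R ==> norm u <= R ==> norm (f w - f u) <= D * norm (w - u) * nrm f"
  "!!f w. f \<in> AP ==> norm w <= R ==> norm (f w) <= D * nrm f" by (rule AP_lipschitz[OF R(1)]) (rule that)
 obtain K where K: "K > 0" "!!f. f \<in> AP ==> nrm (S f) <= K * nrm f" by (rule BO_bound[OF S]) (rule that)
 define f where "f = S (kf w0)"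
 have fA: "f \<in> AP" unfolding f_def by (rule BO_D(1)[OF S])
 obtain A where A: "((%c'. f (c + c' *s e)) has_field_derivative A) (at \<zeta>)" using holomorphic_several_line[OF AP_D(2)[OF fA] z] by blast
 have "((%c'. f (c + c' *s e)) \<circ> fst has_derivative (*) A \<circ> fst) (at (\<zeta>, y))"
  by (rule diff_chain_at) (use A in \<open>auto simp: has_field_derivative_def intro!: derivative_intros\<close>)
 hence A': "((%x. f (c + fst x *s e)) has_derivative (%h. A * fst h)) (at (\<zeta>, y))" by (simp add: o_def)
 define B where "B = S G z0"
 define r1 where "r1 = min r ((R - norm z0) / (norm e + 1))"
 have ne: "norm e + 1 > 0" using norm_ge_zero[of e] by linarith
 have r1: "r1 > 0" "r1 <= r" using G(3) R ne by (auto simp: r1_def)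
 have r1': "r1 * (norm e + 1) <= R - norm z0" unfolding pos_le_divide_eq[OF ne, symmetric] r1_def by (rule min.cobounded2)
 \<comment> \<open>The change caused by the second variable alone. Its two errors are the Taylor
   remainder of the kernel function and the variation of \<open>S G\<close> between
   \<open>z0\<close> and \<open>z1\<close>, both quadratic.\<close>
 define F where "F x = S (kf (c + cnj (snd x) *s e)) (c + fst x *s e) - f (c + fst x *s e)" for x
 have B': "(F has_derivative (%h. B * snd h)) (at (\<zeta>, y))"
 proof (rule has_derivative_quadratic[OF _ r1(1)])
  show "bounded_linear (%h :: complex \<times> complex. B * snd h)"
   by (rule bounded_linear_compose[OF bounded_linear_mult_right bounded_linear_snd])
  fix x :: "complex \<times> complex" assume x: "norm x < r1"
  obtain h k where hk: "x = (h, k)" by fastforce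
  have n: "norm h <= norm x" "norm k <= norm x" unfolding hk using norm_fst_le[of h k] norm_snd_le[of k h] by auto
  define w1 where "w1 = c + cnj (y + k) *s e"
  define z1 where "z1 = c + (\<zeta> + h) *s e"
  have z1: "z1 - z0 = h *s e" by (simp add: z1_def z0_def vector_sadd_rdistrib)
  have "norm (h *s e) <= r1 * (norm e + 1)" unfolding norm_smult using n(1) x r1(1) by (intro mult_mono) auto
  hence z1R: "norm z1 <= R" using r1' norm_triangle_sub[of z1 z0] unfolding z1 by linarith
  have kr: "norm k < r" using n(2) x r1(2) by linarith
  have w1: "w1 \<in> UB" and nk: "nrm (%v. kf w1 v - kf w0 v - k * G v) <= C * (norm k)\<^sup>2"
   using G(4)[OF kr] unfolding w1_def w0_def by auto
  have dA: "(%v. kf w1 v - kf w0 v - k * G v) \<in> AP" by (intro AP_diff AP_cmult kf_AP w1 wz G(1))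
  have Sd: "S (%v. kf w1 v - kf w0 v - k * G v) = (%v. S (kf w1) v - S (kf w0) v - k * S G v)"
   unfolding BO_diff_arg[OF S AP_diff[OF kf_AP[OF w1] kf_AP[OF wz(1)]] AP_cmult[OF G(1)]] BO_diff_arg[OF S kf_AP[OF w1] kf_AP[OF wz(1)]] BO_D(4)[OF S G(1)] ..
  have "norm (S (kf w1) z1 - S (kf w0) z1 - k * S G z1) <= D * nrm (S (%v. kf w1 v - kf w0 v - k * G v))"
   using D(3)[OF BO_D(1)[OF S, of "%v. kf w1 v - kf w0 v - k * G v"] z1R] unfolding Sd .
  also have "... <= D * (K * (C * (norm k)\<^sup>2))" using D(1) K(1) by (intro mult_left_mono order_trans[OF K(2)[OF dA]] nk) auto
  also have "... <= D * (K * (C * (norm x)\<^sup>2))" using D(1) K(1) G(2) n(2) by (intro mult_left_mono power_mono) auto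
  finally have 1: "norm (S (kf w1) z1 - S (kf w0) z1 - k * S G z1) <= D * (K * (C * (norm x)\<^sup>2))" .
  have "norm (k * (S G z1 - S G z0)) <= norm k * (D * norm (z1 - z0) * nrm (S G))"
   unfolding norm_mult using R z1R by (intro mult_left_mono D(2) BO_D(1)[OF S]) auto
  also have "... = norm k * (D * (norm h * norm e) * nrm (S G))" unfolding z1 norm_smult ..
  also have "... <= norm x * (D * (norm x * norm e) * nrm (S G))"
   using n D(1) by (intro mult_mono mult_left_mono mult_right_mono mult_nonneg_nonneg) auto
  finally have 2: "norm (k * (S G z1 - S G z0)) <= D * norm e * nrm (S G) * (norm x)\<^sup>2" by (simp add: power2_eq_square mult_ac)
  have e1: "F ((\<zeta>, y) + x) = S (kf w1) z1 - S (kf w0) z1" unfolding F_def hk f_def add_Pair fst_conv snd_conv w1_def z1_def ..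
  have e2: "F (\<zeta>, y) = 0" by (simp add: F_def f_def w0_def)
  have "F ((\<zeta>, y) + x) - F (\<zeta>, y) - B * snd x = (S (kf w1) z1 - S (kf w0) z1 - k * S G z1) + k * (S G z1 - S G z0)"
   unfolding e1 e2 unfolding hk B_def by (simp add: algebra_simps)
  also have "norm ... <= D * (K * (C * (norm x)\<^sup>2)) + D * norm e * nrm (S G) * (norm x)\<^sup>2"
   by (rule order_trans[OF norm_triangle_ineq add_mono[OF 1 2]])
  also have "... = (D * (K * C) + D * norm e * nrm (S G)) * (norm x)\<^sup>2" by (simp add: algebra_simps)
  finally show "norm (F ((\<zeta>, y) + x) - F (\<zeta>, y) - B * snd x) <= (D * (K * C) + D * norm e * nrm (S G)) * (norm x)\<^sup>2" .
 qed
 from has_derivative_add[OF A' B'] show ?thesis unfolding F_def by auto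
qed

lemma joint_holomorphic:
 assumes S: "S \<in> BO" and w: "!!s. s \<in> U ==> c + cnj (v s) *s e \<in> UB" and z: "!!s. s \<in> U ==> c + y s *s e \<in> UB"
  and U: "open U" and hol: "y holomorphic_on U" "v holomorphic_on U"
 shows "(%s. S (kf (c + cnj (v s) *s e)) (c + y s *s e)) holomorphic_on U" unfolding holomorphic_on_open[OF U]
proof
 fix s assume s: "s \<in> U"
 obtain a b where ab: "(y has_field_derivative a) (at s)" "(v has_field_derivative b) (at s)" using hol s unfolding holomorphic_on_open[OF U] by blast
 obtain A B where AB: "((%x. S (kf (c + cnj (snd x) *s e)) (c + fst x *s e)) has_derivative (%h. A * fst h + B * snd h)) (at (y s, v s))"
  using joint_derivative[OF S w[OF s] z[OF s]] by blast
 have "((%s. (y s, v s)) has_derivative (%h. (a * h, b * h))) (at s)"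
  using ab by (intro has_derivative_Pair) (auto simp: has_field_derivative_def)
 from diff_chain_at[OF this AB]
 have "((%s. S (kf (c + cnj (v s) *s e)) (c + y s *s e)) has_derivative (%h. A * (a * h) + B * (b * h))) (at s)" by (simp add: o_def)
 moreover have "(%h. A * (a * h) + B * (b * h)) = (*) (A * a + B * b)" by (rule ext) (simp add: algebra_simps)
 ultimately show "\<exists>f'. ((%s. S (kf (c + cnj (v s) *s e)) (c + y s *s e)) has_field_derivative f') (at s)"
  unfolding has_field_derivative_def by auto
qed

end

lemma unit_direction:
 fixes z w :: "complex ^ 'n"
 obtains e t where "norm e = 1" "w = z + t *s e"
proof -
 have unit: "norm (complex_of_real (1 / norm v) *s v) = 1" if "v ~= 0" for v :: "complex ^ 'n"
  unfolding norm_smult using that by (simp add: norm_divide)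
 show ?thesis
 proof (cases "w = z")
  case True
  have "axis undefined 1 ~= (0 :: complex ^ 'n)" by (simp add: axis_eq_0_iff)
  from that[OF unit[OF this], of 0] show ?thesis using True by simp
 next
  case False
  hence "w - z ~= 0" by simp
  moreover from this have "w = z + complex_of_real (norm (w - z)) *s (complex_of_real (1 / norm (w - z)) *s (w - z))"
   by (simp add: vector_smult_assoc)
  ultimately show ?thesis using that[OF unit] by blast
 qed
qed

lemma herm_line:
 assumes "herm c e = 0"
 shows "herm (c + x *s e) (c + y *s e) = of_real ((norm c)\<^sup>2) + x * cnj y * of_real ((norm e)\<^sup>2)" using assms herm_commute[of c e]
 by (simp add: herm_add_left herm_add_right herm_smult_left herm_smult_right herm_self)

text \<open>A complex line meets the ball in a disc. Its centre \<open>c\<close> is the point of the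
  line nearest to the origin, hence orthogonal to the direction, and
  \<open>R = 1 - (norm c)\<^sup>2\<close> is the square of its radius. After rescaling,
  \<open>1 - herm\<close> is that of the unit disc times \<open>R\<close>.\<close>

lemma disc_through_two_points:
 fixes z w :: "complex ^ 'n"
 assumes z: "z \<in> UB" and w: "w \<in> UB"
 obtains c e a b R where "R > 0" "z = c + a *s e" "w = c + b *s e" "norm a < 1" "norm b < 1"
  "!!x y. 1 - herm (c + x *s e) (c + y *s e) = of_real R * (1 - x * cnj y)"
proof -
 obtain e t where e: "norm e = 1" "w = z + t *s e" by (rule unit_direction)
 define c where "c = z - herm z e *s e"
 have ce: "herm c e = 0" using e(1) by (simp add: c_def herm_diff_left herm_smult_left herm_self)
 define R where "R = 1 - (norm c)\<^sup>2"
 have zc: "z = c + herm z e *s e" and wc: "w = c + (herm z e + t) *s e" by (simp_all add: c_def e(2) vector_sadd_rdistrib)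
 have nz: "(norm (c + x *s e))\<^sup>2 = (norm c)\<^sup>2 + (norm x)\<^sup>2" for x
 proof -
  have "complex_of_real ((norm (c + x *s e))\<^sup>2) = complex_of_real ((norm c)\<^sup>2 + (norm x)\<^sup>2)"
   using herm_self[of "c + x *s e"] herm_line[OF ce, of x x] e(1) unfolding of_real_add complex_norm_square[of x] by simp
  thus ?thesis by (simp only: of_real_eq_iff)
 qed
 have "(norm z)\<^sup>2 < 1" "(norm w)\<^sup>2 < 1" using z w by (simp_all add: power_less_one_iff abs_square_less_1)
 hence ab: "(norm (herm z e))\<^sup>2 < R" "(norm (herm z e + t))\<^sup>2 < R"
  using nz[of "herm z e"] nz[of "herm z e + t"] unfolding zc[symmetric] wc[symmetric] R_def by linarith+
 have R: "R > 0" using ab(1) zero_le_power2[of "norm (herm z e)"] by linarith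
 define s where "s = complex_of_real (sqrt R)"
 have s: "s ~= 0" "norm s = sqrt R" "s * cnj s = of_real R" using R by (simp_all add: s_def flip: of_real_mult)
 show ?thesis
 proof (rule that[OF R])
  show "z = c + (herm z e / s) *s (s *s e)" "w = c + ((herm z e + t) / s) *s (s *s e)" using zc wc s(1) by (simp_all add: vector_smult_assoc)
  have "norm (herm z e) < sqrt R" "norm (herm z e + t) < sqrt R" using ab by (auto intro: real_less_rsqrt)
  thus "norm (herm z e / s) < 1" "norm ((herm z e + t) / s) < 1" using R by (simp_all add: norm_divide s(2))
  fix x y
  have "1 - herm (c + x *s (s *s e)) (c + y *s (s *s e)) = 1 - (of_real ((norm c)\<^sup>2) + (x * s) * cnj (y * s))"
   unfolding vector_smult_assoc herm_line[OF ce] e(1) by simp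
  also have "(x * s) * cnj (y * s) = of_real R * (x * cnj y)" unfolding s(3)[symmetric] by simp
  also have "1 - (of_real ((norm c)\<^sup>2) + of_real R * (x * cnj y)) = of_real R * (1 - x * cnj y)" by (simp add: R_def algebra_simps)
  finally show "1 - herm (c + x *s (s *s e)) (c + y *s (s *s e)) = of_real R * (1 - x * cnj y)" .
 qed
qed

context
 fixes a :: complex
 assumes a: "norm a < 1"
begin

text \<open>The automorphism of the unit disc that takes 0 to \<open>a\<close>.\<close>

definition moeb :: "complex => complex" where "moeb \<xi> = (a + \<xi>) / (1 + cnj a * \<xi>)"

lemma moeb_denominator: "norm \<xi> < 1 ==> 1 + cnj a * \<xi> ~= 0"
proof
 assume "norm \<xi> < 1" "1 + cnj a * \<xi> = 0"
 hence "norm (cnj a * \<xi>) = 1" by (metis add_eq_0_iff norm_minus_cancel norm_one)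
 moreover have "norm (cnj a * \<xi>) < 1" using a `norm \<xi> < 1` norm_mult_less[of "cnj a" 1 \<xi> 1] by simp
 ultimately show False by simp
qed

lemma one_minus_moeb:
 assumes "norm \<xi> < 1" "norm h < 1"
 shows "1 - moeb \<xi> * cnj (moeb h) = of_real (1 - (norm a)\<^sup>2) * (1 - \<xi> * cnj h) / ((1 + cnj a * \<xi>) * cnj (1 + cnj a * h))"
proof -
 have 1: "1 + cnj a * \<xi> ~= 0" and 2: "cnj (1 + cnj a * h) ~= 0" using moeb_denominator assms complex_cnj_zero_iff by metis+
 have "1 - moeb \<xi> * cnj (moeb h) = ((1 + cnj a * \<xi>) * cnj (1 + cnj a * h) - (a + \<xi>) * cnj (a + h)) / ((1 + cnj a * \<xi>) * cnj (1 + cnj a * h))"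
  unfolding moeb_def complex_cnj_divide times_divide_times_eq using 1 2 by (simp add: diff_divide_distrib)
 also have "(1 + cnj a * \<xi>) * cnj (1 + cnj a * h) - (a + \<xi>) * cnj (a + h) = of_real (1 - (norm a)\<^sup>2) * (1 - \<xi> * cnj h)"
  unfolding of_real_diff of_real_power[symmetric] complex_norm_square by (simp add: algebra_simps)
 finally show ?thesis .
qed

lemma moeb_inverse:
 assumes b: "norm b < 1"
 obtains \<eta> where "norm \<eta> < 1" "moeb \<eta> = b" "1 - (norm \<eta>)\<^sup>2 = (1 - (norm a)\<^sup>2) * (1 - (norm b)\<^sup>2) / (norm (1 - a * cnj b))\<^sup>2"
proof -
 define \<eta> where "\<eta> = (b - a) / (1 - cnj a * b)"
 have n: "norm (cnj a * b) < 1" using a b norm_mult_less[of "cnj a" 1 b 1] by simp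
 hence nz: "1 - cnj a * b ~= 0" by auto
 have "1 - cnj a * b = cnj (1 - a * cnj b)" by simp
 hence nn: "norm (1 - cnj a * b) = norm (1 - a * cnj b)" by (simp only: complex_mod_cnj)
 have nz': "1 - a * cnj b ~= 0" using nz nn by (metis norm_eq_zero)
 have "complex_of_real (1 - (norm \<eta>)\<^sup>2) = 1 - \<eta> * cnj \<eta>" unfolding of_real_diff complex_norm_square by simp
 also have "... = ((1 - cnj a * b) * cnj (1 - cnj a * b) - (b - a) * cnj (b - a)) / ((1 - cnj a * b) * cnj (1 - cnj a * b))"
  unfolding \<eta>_def complex_cnj_divide times_divide_times_eq using nz nz' by (simp add: diff_divide_distrib)
 also have "(1 - cnj a * b) * cnj (1 - cnj a * b) - (b - a) * cnj (b - a) = of_real ((1 - (norm a)\<^sup>2) * (1 - (norm b)\<^sup>2))"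
  unfolding of_real_mult of_real_diff of_real_power[symmetric] complex_norm_square by (simp add: algebra_simps)
 also have "(1 - cnj a * b) * cnj (1 - cnj a * b) = of_real ((norm (1 - cnj a * b))\<^sup>2)" by (simp only: complex_norm_square)
 also have "norm (1 - cnj a * b) = norm (1 - a * cnj b)" by (rule nn)
 finally have "complex_of_real (1 - (norm \<eta>)\<^sup>2) = of_real ((1 - (norm a)\<^sup>2) * (1 - (norm b)\<^sup>2) / (norm (1 - a * cnj b))\<^sup>2)"
  by (simp only: of_real_divide)
 hence eq: "1 - (norm \<eta>)\<^sup>2 = (1 - (norm a)\<^sup>2) * (1 - (norm b)\<^sup>2) / (norm (1 - a * cnj b))\<^sup>2" by (simp only: of_real_eq_iff)
 have "(norm a)\<^sup>2 < 1" "(norm b)\<^sup>2 < 1" using a b by (simp_all add: abs_square_less_1)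
 hence "1 - (norm \<eta>)\<^sup>2 > 0" unfolding eq using nz' by simp
 hence "norm \<eta> < 1" by (simp add: abs_square_less_1)
 moreover have "moeb \<eta> = b"
 proof -
  have d: "1 + cnj a * \<eta> ~= 0" by (rule moeb_denominator) fact
  have "a + \<eta> = b * (1 + cnj a * \<eta>)" using nz unfolding \<eta>_def by (simp add: field_simps)
  thus ?thesis using d by (simp add: moeb_def)
 qed
 ultimately show ?thesis using eq by (rule that)
qed

lemma holomorphic_moeb: "moeb holomorphic_on UB" unfolding moeb_def[abs_def] by (intro holomorphic_intros) (use moeb_denominator in auto)

lemma holomorphic_cnj_moeb_cnj: "(%v. cnj (moeb (cnj v))) holomorphic_on UB"
proof -
 have "cnj (moeb (cnj v)) = (cnj a + v) / (1 + a * v)" for v by (simp add: moeb_def)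
 moreover have "1 + a * v ~= 0" if "v \<in> UB" for v
 proof -
  have "1 + cnj a * cnj v ~= 0" using that by (intro moeb_denominator) simp
  thus ?thesis by (metis complex_cnj_cnj complex_cnj_add complex_cnj_mult complex_cnj_one complex_cnj_zero)
 qed
 hence "(%v. (cnj a + v) / (1 + a * v)) holomorphic_on UB" by (intro holomorphic_intros) auto
 ultimately show ?thesis by simp
qed

end

context bergman_space begin

text \<open>For close points both \<open>tau z\<close> and \<open>tau w\<close> are at least a
  multiple of \<open>norm (1 - herm z w)\<close>, and the exponents \<open>- N / p\<close> and
  \<open>- N / q\<close> of the general bound add up to that of the kernel.\<close>

lemma kernel_bound_close:
 assumes S: "S \<in> BO" and \<delta>: "\<delta> > 0"
 obtains C where "C > 0"
  "!!z w. z \<in> UB ==> w \<in> UB ==> close \<delta> z w ==> norm (S (kf w) z) <= C * norm (ker z w)"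
proof -
 obtain c where c: "c > 0" "!!f. f \<in> AP ==> nrm (S f) <= c * nrm f" by (rule BO_bound[OF S]) (rule that)
 obtain K where K: "K > 0"
  "!!T w z c. T (kf w) \<in> AP ==> nrm (T (kf w)) <= c * nrm (kf w) ==> c >= 0 ==> w \<in> UB ==> z \<in> UB ==>
    norm (T (kf w) z) <= K * c * (tau z powr (- N / p) * tau w powr (- N / q))" by (rule operator_kernel_bound) (rule that)
 show ?thesis
 proof (rule that[of "K * c * (\<delta> / 2) powr (- N)"])
  fix z w :: "complex ^ 'n" assume z: "z \<in> UB" and w: "w \<in> UB" and cl: "close \<delta> z w"
  define d where "d = norm (1 - herm z w)"
  have d: "d > 0" unfolding d_def using z w by (intro norm_one_minus_herm_pos) auto
  have t: "\<delta> / 2 * d <= tau z" "\<delta> / 2 * d <= tau w" using close_bounds(1,2)[OF cl \<delta> z w] unfolding d_def by simp_all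
  have np: "- N / p <= 0" "- N / q <= 0" using N_pos p q by (simp_all add: divide_le_0_iff)
  have "norm (S (kf w) z) <= K * c * (tau z powr (- N / p) * tau w powr (- N / q))"
   by (rule K(2)[of S w c z, OF BO_D(1)[OF S] c(2)[OF kf_AP[OF w]] _ w z]) (use c(1) in simp)
  also have "... <= K * c * ((\<delta> / 2 * d) powr (- N / p) * (\<delta> / 2 * d) powr (- N / q))"
   using K(1) c(1) t d \<delta> np by (intro mult_left_mono mult_mono powr_mono2') auto
  also have "(\<delta> / 2 * d) powr (- N / p) * (\<delta> / 2 * d) powr (- N / q) = (\<delta> / 2 * d) powr (- N)"
  proof -
   have "- N / p + - N / q = - N * (1 / p + 1 / q)" by (simp add: field_simps)
   hence "- N / p + - N / q = - N" unfolding pq by simp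
   thus ?thesis unfolding powr_add[symmetric] by (simp only:)
  qed
  also have "... = (\<delta> / 2) powr (- N) * norm (ker z w)" unfolding norm_ker d_def[symmetric] using \<delta> d by (intro powr_mult)
  finally show "norm (S (kf w) z) <= K * c * (\<delta> / 2) powr (- N) * norm (ker z w)" by (simp only: mult.assoc)
 qed (use K c \<delta> in simp)
qed

text \<open>On the disc cut out by a complex line, \<open>E(\<xi>, v) = (S K\<^sub>w)(z) / K\<^sub>w(z)\<close> with \<open>z\<close>, \<open>w\<close> the images of
 \<open>\<xi>\<close> and \<open>cnj v\<close> under a Moebius map is holomorphic, bounded, and small for \<open>v = cnj \<xi>\<close>. In the
 coordinates \<open>\<xi> = s + \<i>t\<close>, \<open>v = s - \<i>t\<close> these points have real \<open>s\<close> and \<open>t\<close>, so smallness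
 spreads first in \<open>s\<close>, then in \<open>t\<close>, and finally along \<open>\<xi> = 0\<close>.\<close>

lemma off_diagonal_decay:
 assumes S: "S \<in> BO"
  and D: "!!\<epsilon>. \<epsilon> > 0 ==> \<exists>\<eta>>0. \<forall>z\<in>UB. tau z < \<eta> --> tau z powr N * norm (S (kf z) z) <= \<epsilon>"
  and d: "0 < d" "d < 1" and \<gamma>: "\<gamma> > 0"
 shows "\<exists>\<eta>>0. \<forall>z\<in>UB. \<forall>w\<in>UB. close d z w --> tau z < \<eta> --> norm (S (kf w) z) <= \<gamma> * norm (ker z w)"
proof -
 \<comment> \<open>The closeness hypothesis bounds the pseudohyperbolic distance by
   \<open>sqrt (1 - d)\<close>. The minimum 1/2 leaves room for the points
   \<open>s + \<i> * t\<close> and \<open>s - \<i> * t\<close> with both parameters below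
   1/4.\<close>
 define r where "r = max (1 / 2) (sqrt (1 - d))"
 have r: "1 / 2 <= r" "sqrt (1 - d) <= r" "r < 1" using d by (auto simp: r_def)
 define r2 where "r2 = (1 + r) / 2"
 have r2: "1 / 2 < r2" "r < r2" "r2 < 1" using r by (auto simp: r2_def)
 \<comment> \<open>Chosen so that any two images of points of modulus below \<open>r2\<close> are
   \<open>d'\<close>-close: the numerator is the worst case of the two \<open>tau\<close> factors,
   and the denominator that of the squared distance.\<close>
 define d' where "d' = (1 - r2\<^sup>2)\<^sup>2 / 4"
 have r21: "r2\<^sup>2 < 1" using r2 by (simp add: abs_square_less_1)
 have d': "d' > 0" using r21 by (simp add: d'_def)
 obtain C where C: "C > 0"
  "!!z w. z \<in> UB ==> w \<in> UB ==> close d' z w ==> norm (S (kf w) z) <= C * norm (ker z w)" by (rule kernel_bound_close[OF S d']) (rule that)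
 \<comment> \<open>The constants are chosen backwards: smallness by \<open>\<beta>1\<close> on the
   diagonal yields \<open>\<beta>2\<close> for complex \<open>s\<close>, this yields
   \<open>\<beta>3\<close> for complex \<open>t\<close>, and this yields \<open>\<gamma>\<close>.
   None depends on the points, which makes the final threshold uniform.\<close>
 obtain \<beta>3 where \<beta>3: "\<beta>3 > 0"
  "!!g z. g holomorphic_on ball 0 r2 ==> \<forall>z\<in>ball 0 r2. norm (g z) <= C ==>
    \<forall>x::real. \<bar>x\<bar> < 1/4 --> \<bar>x\<bar> < r2 --> norm (g (of_real x)) <= \<beta>3 ==> norm z <= r ==> norm (g z) <= \<gamma>"
 proof (rule small_on_reals[of "1/4" r2 r \<gamma> C])
  show "0 < (1/4 :: real)" "0 < r2" "r < r2" "0 < \<gamma>" using r2 \<gamma> by auto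
 qed (rule that)
 obtain \<beta>2 where \<beta>2: "\<beta>2 > 0"
  "!!g z. g holomorphic_on ball 0 (1/4) ==> \<forall>z\<in>ball 0 (1/4). norm (g z) <= C ==>
    \<forall>x::real. \<bar>x\<bar> < 1/8 --> \<bar>x\<bar> < 1/4 --> norm (g (of_real x)) <= \<beta>2 ==> norm z <= 1/8 ==> norm (g z) <= \<beta>3"
 proof (rule small_on_reals[of "1/8" "1/4" "1/8" \<beta>3 C])
  show "0 < (1/8 :: real)" "0 < (1/4 :: real)" "1/8 < (1/4 :: real)" "0 < \<beta>3" using \<beta>3(1) by auto
 qed (rule that)
 obtain \<beta>1 where \<beta>1: "\<beta>1 > 0"
  "!!g z. g holomorphic_on ball 0 (1/4) ==> \<forall>z\<in>ball 0 (1/4). norm (g z) <= C ==>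
    \<forall>x::real. \<bar>x\<bar> < 1/8 --> \<bar>x\<bar> < 1/4 --> norm (g (of_real x)) <= \<beta>1 ==> norm z <= 1/8 ==> norm (g z) <= \<beta>2"
 proof (rule small_on_reals[of "1/8" "1/4" "1/8" \<beta>2 C])
  show "0 < (1/8 :: real)" "0 < (1/4 :: real)" "1/8 < (1/4 :: real)" "0 < \<beta>2" using \<beta>2(1) by auto
 qed (rule that)
 obtain \<eta> where \<eta>: "\<eta> > 0" "!!z. z \<in> UB ==> tau z < \<eta> ==> tau z powr N * norm (S (kf z) z) <= \<beta>1"
  using D[OF \<beta>1(1)] by blast
 \<comment> \<open>All points of the slice within pseudohyperbolic radius \<open>r2\<close> of
   \<open>z0\<close> have \<open>tau\<close> at most \<open>4 / d'\<close> times
   \<open>tau z0\<close>. The assumed bound thus places the entire region below the threshold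
   \<open>\<eta>\<close> where the diagonal is small.\<close>
 have main: "norm (S (kf w0) z0) <= \<gamma> * norm (ker z0 w0)"
  if z0: "z0 \<in> UB" and w0: "w0 \<in> UB" and cl: "close d z0 w0" and t0: "tau z0 < \<eta> * d' / 4" for z0 w0
 proof -
  obtain c e a b R where R: "R > 0" "z0 = c + a *s e" "w0 = c + b *s e" and a: "norm a < 1" and b: "norm b < 1"
   and RH: "!!x y. 1 - herm (c + x *s e) (c + y *s e) = of_real R * (1 - x * cnj y)" by (rule disc_through_two_points[OF z0 w0]) (rule that)
  have tauH: "complex_of_real (tau z) = 1 - herm z z" for z :: "complex ^ 'n" by (simp add: tau_def one_minus_herm_self)
  have tauR: "tau (c + x *s e) = R * (1 - (norm x)\<^sup>2)" for x
  proof -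
   have "complex_of_real (tau (c + x *s e)) = of_real (R * (1 - (norm x)\<^sup>2))"
    unfolding tauH RH of_real_mult of_real_diff complex_norm_square by simp
   thus ?thesis by (simp only: of_real_eq_iff)
  qed
  define Z where "Z \<xi> = c + moeb a \<xi> *s e" for \<xi>
  define P where "P = R * (1 - (norm a)\<^sup>2)"
  define A where "A \<xi> = norm (1 + cnj a * \<xi>)" for \<xi>
  have "(norm a)\<^sup>2 < 1" using a by (simp add: abs_square_less_1)
  hence P: "P > 0" using R(1) by (simp add: P_def)
  have A: "A \<xi> > 0" if "norm \<xi> < 1" for \<xi> using moeb_denominator[OF a that] by (simp add: A_def)
  have H: "1 - herm (Z \<xi>) (Z \<omega>) = of_real P * (1 - \<xi> * cnj \<omega>) / ((1 + cnj a * \<xi>) * cnj (1 + cnj a * \<omega>))"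
   if "norm \<xi> < 1" "norm \<omega> < 1" for \<xi> \<omega> unfolding Z_def RH one_minus_moeb[OF a that] P_def by simp
  have nH: "norm (1 - herm (Z \<xi>) (Z \<omega>)) = P * norm (1 - \<xi> * cnj \<omega>) / (A \<xi> * A \<omega>)" if "norm \<xi> < 1" "norm \<omega> < 1" for \<xi> \<omega>
   unfolding H[OF that] norm_divide norm_mult A_def complex_mod_cnj using P by simp
  have tZ: "tau (Z \<xi>) = P * (1 - (norm \<xi>)\<^sup>2) / (A \<xi>)\<^sup>2" if "norm \<xi> < 1" for \<xi>
  proof -
   have "complex_of_real (tau (Z \<xi>)) = of_real (P * (1 - (norm \<xi>)\<^sup>2) / (A \<xi>)\<^sup>2)"
    unfolding tauH H[OF that that] of_real_divide of_real_mult of_real_diff A_def complex_norm_square by simp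
   thus ?thesis by (simp only: of_real_eq_iff)
  qed
  have Zb: "Z \<xi> \<in> UB" if "norm \<xi> < 1" for \<xi>
  proof -
   have "(norm \<xi>)\<^sup>2 < 1" using that by (simp add: abs_square_less_1)
   hence "tau (Z \<xi>) > 0" unfolding tZ[OF that] using P A[OF that] by simp
   thus ?thesis by (simp add: tau_def abs_square_less_1)
  qed
  have clZ: "close d' (Z \<xi>) (Z \<omega>)" if x: "norm \<xi> < r2" and y: "norm \<omega> < r2" for \<xi> \<omega>
  proof -
   have 1: "norm \<xi> < 1" "norm \<omega> < 1" using x y r2 by auto
   have sq: "(norm \<xi>)\<^sup>2 <= r2\<^sup>2" "(norm \<omega>)\<^sup>2 <= r2\<^sup>2" using x y by (auto intro: power_mono)
   have "norm (\<xi> * cnj \<omega>) <= 1" unfolding norm_mult complex_mod_cnj using 1 by (intro mult_le_one) auto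
   hence "norm (1 - \<xi> * cnj \<omega>) <= 2" using norm_triangle_ineq4[of 1 "\<xi> * cnj \<omega>"] by simp
   hence "(norm (1 - \<xi> * cnj \<omega>))\<^sup>2 <= 2\<^sup>2" by (intro power_mono) auto
   hence "d' * (norm (1 - \<xi> * cnj \<omega>))\<^sup>2 <= d' * 2\<^sup>2" using d' by (intro mult_left_mono) auto
   also have "... = (1 - r2\<^sup>2) * (1 - r2\<^sup>2)" by (simp add: d'_def power2_eq_square)
   also have "... <= (1 - (norm \<xi>)\<^sup>2) * (1 - (norm \<omega>)\<^sup>2)" using sq r21 by (intro mult_mono) auto
   finally have "(P * P / ((A \<xi>)\<^sup>2 * (A \<omega>)\<^sup>2)) * (d' * (norm (1 - \<xi> * cnj \<omega>))\<^sup>2)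
    <= (P * P / ((A \<xi>)\<^sup>2 * (A \<omega>)\<^sup>2)) * ((1 - (norm \<xi>)\<^sup>2) * (1 - (norm \<omega>)\<^sup>2))"
    using P by (intro mult_left_mono) auto
   thus ?thesis unfolding close_def nH[OF 1] tZ[OF 1(1)] tZ[OF 1(2)]
    by (simp add: power_divide power_mult_distrib power2_eq_square[of P] mult_ac)
  qed
  have Z0: "Z 0 = z0" by (simp add: Z_def moeb_def[OF a] R(2))
  obtain \<eta>0 where e0: "norm \<eta>0 < 1" "moeb a \<eta>0 = b" "1 - (norm \<eta>0)\<^sup>2 = (1 - (norm a)\<^sup>2) * (1 - (norm b)\<^sup>2) / (norm (1 - a * cnj b))\<^sup>2"
   by (rule moeb_inverse[OF a b]) (rule that)
  have We: "Z \<eta>0 = w0" by (simp add: Z_def e0(2) R(3))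
  \<comment> \<open>In the coordinate with \<open>z0\<close> at the origin, the modulus of the
    coordinate of \<open>w0\<close> is the pseudohyperbolic distance of the two points.\<close>
  have e0r: "norm \<eta>0 <= r"
  proof -
   have n0: "1 - a * cnj b ~= 0" using norm_one_minus_herm_pos[of z0 w0] z0 w0 unfolding R(2,3) RH by auto
   have "d * (R * norm (1 - a * cnj b))\<^sup>2 <= (R * (1 - (norm a)\<^sup>2)) * (R * (1 - (norm b)\<^sup>2))"
    using cl R(1) unfolding close_def R(2,3) RH tauR by (simp add: norm_mult)
   hence "R\<^sup>2 * (d * (norm (1 - a * cnj b))\<^sup>2) <= R\<^sup>2 * ((1 - (norm a)\<^sup>2) * (1 - (norm b)\<^sup>2))"
    by (simp add: power_mult_distrib power2_eq_square[of R] mult_ac)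
   hence "d * (norm (1 - a * cnj b))\<^sup>2 <= (1 - (norm a)\<^sup>2) * (1 - (norm b)\<^sup>2)" using R(1) by simp
   hence "d <= 1 - (norm \<eta>0)\<^sup>2" unfolding e0(3) using n0 by (simp add: pos_le_divide_eq)
   hence "norm \<eta>0 <= sqrt (1 - d)" by (intro real_le_rsqrt) simp
   thus ?thesis using r by linarith
  qed
  define E where "E \<xi> \<omega> = S (kf (Z (cnj \<omega>))) (Z \<xi>) * (1 - herm (Z \<xi>) (Z (cnj \<omega>))) powr (of_real N)" for \<xi> \<omega>
  have nE: "norm (E \<xi> \<omega>) * norm (ker (Z \<xi>) (Z (cnj \<omega>))) = norm (S (kf (Z (cnj \<omega>))) (Z \<xi>))" if "norm \<xi> < 1" "norm \<omega> < 1" for \<xi> \<omega>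
  proof -
   have "norm (cnj \<omega>) < 1" using that by simp
   hence "ker (Z \<xi>) (Z (cnj \<omega>)) ~= 0" using that by (intro ker_nonzero Zb)
   thus ?thesis unfolding E_def ker_def norm_mult norm_divide by (auto simp: field_simps)
  qed
  have Ebound: "norm (E \<xi> \<omega>) <= X \<longleftrightarrow> norm (S (kf (Z (cnj \<omega>))) (Z \<xi>)) <= X * norm (ker (Z \<xi>) (Z (cnj \<omega>)))" if "norm \<xi> < 1" "norm \<omega> < 1" for \<xi> \<omega> X
  proof -
   have "norm (cnj \<omega>) < 1" using that by simp
   hence "norm (ker (Z \<xi>) (Z (cnj \<omega>))) > 0" using that ker_nonzero[OF Zb Zb] by (simp add: zero_less_norm_iff)
   thus ?thesis unfolding nE[OF that, symmetric] by simp
  qed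
  have EC: "norm (E \<xi> \<omega>) <= C" if "norm \<xi> < r2" "norm \<omega> < r2" for \<xi> \<omega>
  proof -
   have 1: "norm \<xi> < 1" "norm \<omega> < 1" "norm (cnj \<omega>) < 1" using that r2 by auto
   show ?thesis unfolding Ebound[OF 1(1,2)] by (rule C(2)[OF Zb[OF 1(1)] Zb[OF 1(3)] clZ]) (use that in auto)
  qed
  have Ediag: "norm (E \<xi> (cnj \<xi>)) <= \<beta>1" if "norm \<xi> < r2" for \<xi>
  proof -
   have 1: "norm \<xi> < 1" "norm (cnj \<xi>) < 1" using that r2 by auto
   have "norm (0 :: complex) < r2" using r2 by simp
   hence "d' * tau (Z \<xi>) <= 4 * tau z0" using close_bounds(6)[OF clZ[OF that, of 0] d' Zb[OF 1(1)] Zb[of 0]] unfolding Z0 by simp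
   also have "... < d' * \<eta>" using t0 by (simp add: mult.commute)
   finally have "tau (Z \<xi>) < \<eta>" using d' by simp
   from \<eta>(2)[OF Zb[OF 1(1)] this] have "tau (Z \<xi>) powr N * norm (S (kf (Z \<xi>)) (Z \<xi>)) <= \<beta>1" .
   moreover have tp: "tau (Z \<xi>) > 0" by (rule tau_pos'[OF Zb[OF 1(1)]])
   moreover have k: "norm (ker (Z \<xi>) (Z \<xi>)) = 1 / tau (Z \<xi>) powr N" unfolding norm_ker tauH[symmetric] using tp by (simp add: powr_minus_divide)
   ultimately show ?thesis unfolding Ebound[OF 1] complex_cnj_cnj k by (simp add: pos_le_divide_eq mult.commute)
  qed
  have hol: "(%s. E (\<zeta> s) (\<omega> s)) holomorphic_on U"
   if U: "open U" and h: "\<zeta> holomorphic_on U" "\<omega> holomorphic_on U" and sm: "!!s. s \<in> U ==> norm (\<zeta> s) < 1" "!!s. s \<in> U ==> norm (\<omega> s) < 1" for U \<zeta> \<omega>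
  proof -
   have im: "\<zeta> ` U \<subseteq> UB" "\<omega> ` U \<subseteq> UB" using sm by auto
   have h1: "(%s. moeb a (\<zeta> s)) holomorphic_on U"
    using holomorphic_on_compose_gen[OF h(1) holomorphic_moeb[OF a] im(1)] by (simp add: o_def)
   have h2: "(%s. cnj (moeb a (cnj (\<omega> s)))) holomorphic_on U"
    using holomorphic_on_compose_gen[OF h(2) holomorphic_cnj_moeb_cnj[OF a] im(2)] by (simp add: o_def)
   have b1: "c + cnj (cnj (moeb a (cnj (\<omega> s)))) *s e \<in> UB" if "s \<in> U" for s
    using Zb[of "cnj (\<omega> s)"] sm(2)[OF that] by (simp add: Z_def)
   have b2: "c + moeb a (\<zeta> s) *s e \<in> UB" if "s \<in> U" for s using Zb[of "\<zeta> s"] sm(1)[OF that] by (simp add: Z_def)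
   have "(%s. S (kf (c + cnj (cnj (moeb a (cnj (\<omega> s)))) *s e)) (c + moeb a (\<zeta> s) *s e)) holomorphic_on U"
    by (rule joint_holomorphic[OF S b1 b2 U h1 h2])
   hence J: "(%s. S (kf (Z (cnj (\<omega> s)))) (Z (\<zeta> s))) holomorphic_on U" by (simp add: Z_def)
   have Q: "(%s. 1 - herm (Z (\<zeta> s)) (Z (cnj (\<omega> s)))) holomorphic_on U" unfolding Z_def RH by (intro holomorphic_intros h1 h2)
   have "1 - herm (Z (\<zeta> s)) (Z (cnj (\<omega> s))) \<notin> \<real>\<^sub>\<le>\<^sub>0" if "s \<in> U" for s
   proof -
    have "norm (Z (\<zeta> s)) < 1" "norm (Z (cnj (\<omega> s))) < 1" using b1[OF that] b2[OF that] by (simp_all add: Z_def)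
    hence "0 < Re (1 - herm (Z (\<zeta> s)) (Z (cnj (\<omega> s))))" by (intro Re_one_minus_herm_pos) auto
    thus ?thesis by (auto simp: complex_nonpos_Reals_iff)
   qed
   hence "(%s. (1 - herm (Z (\<zeta> s)) (Z (cnj (\<omega> s)))) powr (of_real N)) holomorphic_on U"
    by (intro holomorphic_on_powr Q holomorphic_on_const) auto
   with J show ?thesis unfolding E_def by (intro holomorphic_on_mult)
  qed
  have st: "norm (s + \<i> * t) < 1 / 2" "norm (s - \<i> * t) < 1 / 2" if "norm s < 1/4" "norm t < 1/4" for s t
   using norm_triangle_ineq[of s "\<i> * t"] norm_triangle_ineq4[of s "\<i> * t"] that by (auto simp: norm_mult)
  have st2: "norm (s + \<i> * t) < r2" "norm (s - \<i> * t) < r2" "norm (s + \<i> * t) < 1" "norm (s - \<i> * t) < 1" if "norm s < 1/4" "norm t < 1/4" for s t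
   using st[OF that] r2 by linarith+
  have step1: "norm (E (s + \<i> * of_real t) (s - \<i> * of_real t)) <= \<beta>2" if t: "\<bar>t\<bar> < 1/8" and s: "norm s <= 1/8" for t :: real and s
  proof (rule \<beta>1(2)[of "%s. E (s + \<i> * of_real t) (s - \<i> * of_real t)" s, OF _ _ _ s])
   have t4: "norm (complex_of_real t) < 1/4" using t by simp
   show "(%s. E (s + \<i> * of_real t) (s - \<i> * of_real t)) holomorphic_on ball 0 (1/4)"
    by (rule hol) (use st2[OF _ t4] in \<open>auto intro!: holomorphic_intros\<close>)
   show "\<forall>z\<in>ball 0 (1/4). norm (E (z + \<i> * of_real t) (z - \<i> * of_real t)) <= C" using EC[OF st2(1,2)[OF _ t4]] by auto
   show "\<forall>x::real. \<bar>x\<bar> < 1/8 --> \<bar>x\<bar> < 1/4 --> norm (E (of_real x + \<i> * of_real t) (of_real x - \<i> * of_real t)) <= \<beta>1"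
   proof (intro allI impI)
    fix x :: real assume "\<bar>x\<bar> < 1/4"
    hence x4: "norm (complex_of_real x) < 1/4" by simp
    have "complex_of_real x - \<i> * of_real t = cnj (of_real x + \<i> * of_real t)" by simp
    thus "norm (E (of_real x + \<i> * of_real t) (of_real x - \<i> * of_real t)) <= \<beta>1" using Ediag[OF st2(1)[OF x4 t4]] by simp
   qed
  qed
  have step2: "norm (E (s + \<i> * t) (s - \<i> * t)) <= \<beta>3" if s: "norm s <= 1/8" and t: "norm t <= 1/8" for s t
  proof (rule \<beta>2(2)[of "%t. E (s + \<i> * t) (s - \<i> * t)" t, OF _ _ _ t])
   have s4: "norm s < 1/4" using s by simp
   show "(%t. E (s + \<i> * t) (s - \<i> * t)) holomorphic_on ball 0 (1/4)"
    by (rule hol) (use st2[OF s4] in \<open>auto intro!: holomorphic_intros\<close>)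
   show "\<forall>t\<in>ball 0 (1/4). norm (E (s + \<i> * t) (s - \<i> * t)) <= C" using EC[OF st2(1,2)[OF s4]] by auto
   show "\<forall>x::real. \<bar>x\<bar> < 1/8 --> \<bar>x\<bar> < 1/4 --> norm (E (s + \<i> * of_real x) (s - \<i> * of_real x)) <= \<beta>2"
    using step1[OF _ s] by blast
  qed
  have step3: "norm (E 0 \<omega>) <= \<gamma>" if "norm \<omega> <= r" for \<omega>
  proof (rule \<beta>3(2)[of "E 0" \<omega>, OF _ _ _ that])
   show "E 0 holomorphic_on ball 0 r2" using hol[of "ball 0 r2" "%_. 0" "%\<omega>. \<omega>"] r2 by (auto intro: holomorphic_intros)
   show "\<forall>\<omega>\<in>ball 0 r2. norm (E 0 \<omega>) <= C" using EC[of 0] r2 by auto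
   show "\<forall>x::real. \<bar>x\<bar> < 1/4 --> \<bar>x\<bar> < r2 --> norm (E 0 (of_real x)) <= \<beta>3"
   proof (intro allI impI)
    fix x :: real assume x: "\<bar>x\<bar> < 1/4"
    \<comment> \<open>With \<open>s = y\<close> and \<open>t = \<i> * y\<close> the first coordinate
      vanishes and the second is \<open>x\<close>. Such a \<open>t\<close> is not real, which is why
      smallness had to be extended in \<open>t\<close> as well.\<close>
    define y where "y = complex_of_real x / 2"
    have "norm y <= 1/8" "norm (\<i> * y) <= 1/8" using x by (simp_all add: y_def norm_mult)
    from step2[OF this] have "norm (E (y + \<i> * (\<i> * y)) (y - \<i> * (\<i> * y))) <= \<beta>3" .
    moreover have "y + \<i> * (\<i> * y) = 0" "y - \<i> * (\<i> * y) = of_real x" by (simp_all add: y_def flip: mult.assoc)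
    ultimately show "norm (E 0 (of_real x)) <= \<beta>3" by simp
   qed
  qed
  have "norm (E 0 (cnj \<eta>0)) <= \<gamma>" by (rule step3) (use e0r in simp)
  thus ?thesis using Ebound[of 0 "cnj \<eta>0" \<gamma>] e0(1) by (simp add: Z0 We)
 qed
 show ?thesis by (rule exI[of _ "\<eta> * d' / 4"]) (use \<eta>(1) d' main in auto)
qed

end

section \<open>Densities of normalised kernels and the construction of slow families\<close>

text \<open>Expanding at \<open>u\<close> leaves the mixed term \<open>herm (z - u) (u - w)\<close>.
  It is at most the product of two Euclidean distances, whose squares are controlled by
  \<open>norm_diff_sqr_le\<close>.\<close>

lemma quasi_triangle:
 assumes z: "norm z <= 1" and u: "norm u <= 1" and w: "norm w <= 1"
 shows "norm (1 - herm z w) <= 2 * norm (1 - herm z u) + 4 * norm (1 - herm u w)"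
proof -
 have "herm z u - herm z w = herm (z - u) (u - w) + (herm u u - herm u w)" by (simp add: herm_diff_left herm_diff_right)
 hence eq: "1 - herm z w = (1 - herm z u) + (herm (z - u) (u - w) + ((1 - herm u w) - (1 - herm u u)))" by (simp add: algebra_simps)
 have "norm (1 - herm z w) <= norm (1 - herm z u) + (norm (herm (z - u) (u - w)) + (norm (1 - herm u w) + norm (1 - herm u u)))"
  unfolding eq by (intro norm_triangle_mono order_refl norm_triangle_ineq4)
 moreover have "norm (herm (z - u) (u - w)) <= norm (1 - herm z u) + norm (1 - herm u w)"
 proof -
  have "norm (herm (z - u) (u - w)) <= norm (z - u) * norm (u - w)" by (rule norm_herm_le)
  also have "... <= ((norm (z - u))\<^sup>2 + (norm (u - w))\<^sup>2) / 2" using sum_squares_bound[of "norm (z - u)" "norm (u - w)"] by simp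
  also have "... <= norm (1 - herm z u) + norm (1 - herm u w)" using norm_diff_sqr_le[of z u] norm_diff_sqr_le[of u w] z u w by simp
  finally show ?thesis .
 qed
 moreover have "norm (1 - herm u u) <= 2 * norm (1 - herm u w)"
 proof -
  have "norm (1 - herm u u) = 1 - (norm u)\<^sup>2" unfolding one_minus_herm_self norm_of_real using power_le_one[OF norm_ge_zero u, of 2] by simp
  also have "... = (1 - norm u) * (1 + norm u)" by (simp add: power2_eq_square algebra_simps)
  also have "... <= (1 - norm u) * 2" using u by (intro mult_left_mono) auto
  also have "... <= norm (1 - herm u w) * 2" using norm_one_minus_herm_ge[OF w, of u] by (intro mult_right_mono) auto
  finally show ?thesis by simp
 qed
 ultimately show ?thesis by linarith
qed

context bergman_space begin

definition kk :: "complex ^ 'n => complex ^ 'n => complex" where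
 "kk v u = of_real (tau v powr (N / 2)) * ker v u"

text \<open>The squared modulus of the kernel normalised in the square-integrable sense: a
  probability density that concentrates around \<open>v\<close> at scale \<open>tau v\<close>, known
  as the Berezin kernel.\<close>

definition dens :: "complex ^ 'n => complex ^ 'n => real" where
 "dens v u = (norm (kk v u))\<^sup>2"

lemma kk_measurable [measurable]: "kk v \<in> bmM" unfolding kk_def by measurable

lemma dens_measurable [measurable]: "dens v \<in> bmM" unfolding dens_def by measurable

lemma dens_nonneg [simp]: "0 <= dens v u" by (simp add: dens_def)

lemma kk_integral:
 assumes v: "v \<in> UB" and v': "v' \<in> UB"
 shows "integrable M (%u. kk v u * cnj (kk v' u))"
  "(LINT u|M. kk v u * cnj (kk v' u)) = of_real (tau v powr (N / 2) * tau v' powr (N / 2)) * ker v v'"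
proof -
 let ?c = "complex_of_real (tau v powr (N / 2) * tau v' powr (N / 2))"
 have i: "integrable M (%u. kf v' u * ker v u)" by (rule integrable_mult_ker[OF LP_integrable[OF kf_LP[OF v']] v])
 have eq: "kk v u * cnj (kk v' u) = ?c * (kf v' u * ker v u)" if "u \<in> space M" for u
  using that v' ker_cnj[of v' u] by (simp add: kk_def kf_def mult_ac)
 show "integrable M (%u. kk v u * cnj (kk v' u))"
  by (rule Bochner_Integration.integrable_cong[OF refl eq, THEN iffD2]) (assumption, rule integrable_mult_right[OF i])
 have "(LINT u|M. kk v u * cnj (kk v' u)) = (LINT u|M. ?c * (kf v' u * ker v u))" by (rule Bochner_Integration.integral_cong[OF refl eq])
 also have "... = ?c * (LINT u|M. kf v' u * ker v u)" by (rule integral_mult_right_zero)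
 also have "(LINT u|M. kf v' u * ker v u) = ker v v'" using fun_cong[OF proj_AP_eq[OF kf_AP[OF v']], of v] v by (simp add: projection_eq kf_def)
 finally show "(LINT u|M. kk v u * cnj (kk v' u)) = ?c * ker v v'" .
qed

lemma dens_integral:
 assumes v: "v \<in> UB"
 shows "integrable M (dens v)" "(LINT u|M. dens v u) = 1"
proof -
 have e: "complex_of_real (dens v u) = kk v u * cnj (kk v u)" for u unfolding dens_def by (rule complex_norm_square)
 have "integrable M (%u. complex_of_real (dens v u))" unfolding e by (rule kk_integral(1)[OF v v])
 thus "integrable M (dens v)" by (simp only: complex_of_real_integrable_eq)
 have "complex_of_real (LINT u|M. dens v u) = (LINT u|M. complex_of_real (dens v u))" by simp
 also have "... = of_real (tau v powr (N / 2) * tau v powr (N / 2)) * ker v v" unfolding e by (rule kk_integral(2)[OF v v])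
 also have "tau v powr (N / 2) * tau v powr (N / 2) = tau v powr N" by (simp flip: powr_add)
 also have "ker v v = of_real (tau v powr (- N))"
 proof -
  have "ker v v = 1 / complex_of_real (tau v) powr of_real N" by (simp add: ker_def tau_def one_minus_herm_self)
  also have "complex_of_real (tau v) powr of_real N = of_real (tau v powr N)" using tau_pos'[OF v] by (simp add: powr_of_real)
  finally show ?thesis using tau_pos'[OF v] by (simp add: powr_minus field_simps)
 qed
 also have "complex_of_real (tau v powr N) * of_real (tau v powr (- N)) = 1" using tau_pos'[OF v] by (simp add: powr_minus flip: of_real_mult)
 finally show "(LINT u|M. dens v u) = 1" by (simp only: of_real_eq_1_iff)
qed

text \<open>For unit vectors the distance of the squared moduli in mean is governed by the distance
  of the vectors after the best change of phase, and this equals \<open>2 - 2 * norm I\<close> in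
  square with \<open>I\<close> the inner product, which the reproducing property evaluates. The
  parameter \<open>h\<close> replaces the Cauchy-Schwarz inequality by a weighted arithmetic
  mean.\<close>

lemma dens_distance:
 assumes v: "v \<in> UB" and v': "v' \<in> UB" and h: "h > 0"
 shows "(LINT u|M. \<bar>dens v u - dens v' u\<bar>) <= (1 - (tau v * tau v') powr (N / 2) * norm (1 - herm v v') powr (- N)) / h + 2 * h"
proof -
 define I where "I = (LINT u|M. kk v u * cnj (kk v' u))"
 have nI: "norm I = (tau v * tau v') powr (N / 2) * norm (1 - herm v v') powr (- N)"
 proof -
  have "norm (complex_of_real (tau v powr (N / 2) * tau v' powr (N / 2))) = tau v powr (N / 2) * tau v' powr (N / 2)"
   unfolding norm_of_real by (rule abs_of_nonneg) simp
  also have "... = (tau v * tau v') powr (N / 2)" using tau_pos'[OF v] tau_pos'[OF v'] by (intro powr_mult[symmetric])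
  finally show ?thesis unfolding I_def kk_integral(2)[OF v v'] norm_mult[of "complex_of_real _"] norm_ker by (simp only:)
 qed
 \<comment> \<open>The phase that makes the inner product real and nonnegative; 1 is the default if
   it vanishes.\<close>
 define c where "c = (if I = 0 then 1 else I / of_real (norm I))"
 have c: "norm c = 1" "cnj c * I = of_real (norm I)"
  using complex_norm_square[of I, symmetric] by (auto simp: c_def norm_divide power2_eq_square mult.commute[of "cnj I"])
 have i: "integrable M (dens v)" "integrable M (dens v')" "integrable M (%u. kk v u * cnj (kk v' u))"
  using dens_integral(1)[OF v] dens_integral(1)[OF v'] kk_integral(1)[OF v v'] by auto
 let ?D = "%u. (norm (kk v u - c * kk v' u))\<^sup>2"
 have exp: "?D u = dens v u + dens v' u - 2 * Re (cnj c * (kk v u * cnj (kk v' u)))" for u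
 proof -
  have "complex_of_real (?D u) = (kk v u - c * kk v' u) * cnj (kk v u - c * kk v' u)" by (rule complex_norm_square)
  also have "... = kk v u * cnj (kk v u) + (c * cnj c) * (kk v' u * cnj (kk v' u)) - (cnj c * (kk v u * cnj (kk v' u)) + cnj (cnj c * (kk v u * cnj (kk v' u))))"
   by (simp add: algebra_simps)
  also have "c * cnj c = 1" using complex_norm_square[of c] c(1) by simp
  also have "cnj c * (kk v u * cnj (kk v' u)) + cnj (cnj c * (kk v u * cnj (kk v' u))) = of_real (2 * Re (cnj c * (kk v u * cnj (kk v' u))))"
   by (rule complex_add_cnj)
  finally have "complex_of_real (?D u) = of_real (dens v u + dens v' u - 2 * Re (cnj c * (kk v u * cnj (kk v' u))))"
   unfolding of_real_diff of_real_add dens_def complex_norm_square by simp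
  thus ?thesis by (simp only: of_real_eq_iff)
 qed
 have i4: "integrable M (%u. 2 * Re (cnj c * (kk v u * cnj (kk v' u))))" by (intro integrable_mult_right integrable_Re i(3))
 have iD: "integrable M ?D" unfolding exp by (intro Bochner_Integration.integrable_diff Bochner_Integration.integrable_add i i4)
 have D: "(LINT u|M. ?D u) = 2 - 2 * norm I"
 proof -
  have "(LINT u|M. ?D u) = (LINT u|M. dens v u + dens v' u) - (LINT u|M. 2 * Re (cnj c * (kk v u * cnj (kk v' u))))"
   unfolding exp by (rule Bochner_Integration.integral_diff) (intro Bochner_Integration.integrable_add i i4)+
  also have "(LINT u|M. dens v u + dens v' u) = 2" using i dens_integral(2)[OF v] dens_integral(2)[OF v'] by simp
  also have "(LINT u|M. 2 * Re (cnj c * (kk v u * cnj (kk v' u)))) = 2 * Re (LINT u|M. cnj c * (kk v u * cnj (kk v' u)))"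
   by (simp only: integral_mult_right_zero integral_Re[OF integrable_mult_right[OF i(3)]])
  also have "(LINT u|M. cnj c * (kk v u * cnj (kk v' u))) = of_real (norm I)" using c(2) unfolding I_def by (simp only: integral_mult_right_zero)
  finally show ?thesis by simp
 qed
 have "(LINT u|M. \<bar>dens v u - dens v' u\<bar>) <= (LINT u|M. ?D u / (2 * h) + h * (dens v u + dens v' u))"
 proof (rule integral_mono)
  show "integrable M (%u. \<bar>dens v u - dens v' u\<bar>)" "integrable M (%u. ?D u / (2 * h) + h * (dens v u + dens v' u))"
   using i iD by simp_all
  fix u
  define x y d where "x = norm (kk v u)" and "y = norm (kk v' u)" and "d = norm (kk v u - c * kk v' u)"
  have xy: "0 <= x" "0 <= y" "0 <= d" by (auto simp: x_def y_def d_def)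
  have "\<bar>x - y\<bar> <= d" using norm_triangle_ineq3[of "kk v u" "c * kk v' u"] c(1) by (simp add: x_def y_def d_def norm_mult)
  moreover have "\<bar>x\<^sup>2 - y\<^sup>2\<bar> = \<bar>x - y\<bar> * (x + y)" using xy by (simp add: power2_eq_square square_diff_square_factored abs_mult mult.commute)
  ultimately have "\<bar>x\<^sup>2 - y\<^sup>2\<bar> <= d * (x + y)" using xy by (simp add: mult_right_mono)
  also have "... <= d\<^sup>2 / (2 * h) + h * (x\<^sup>2 + y\<^sup>2)"
  proof -
   have "0 <= (d - h * (x + y))\<^sup>2 + h\<^sup>2 * (x - y)\<^sup>2" by simp
   also have "... = d\<^sup>2 + 2 * h\<^sup>2 * (x\<^sup>2 + y\<^sup>2) - 2 * h * (d * (x + y))" by (simp add: power2_eq_square algebra_simps)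
   finally have "2 * h * (d * (x + y)) <= d\<^sup>2 + 2 * h\<^sup>2 * (x\<^sup>2 + y\<^sup>2)" by simp
   also have "... = 2 * h * (d\<^sup>2 / (2 * h) + h * (x\<^sup>2 + y\<^sup>2))" using h by (simp add: power2_eq_square field_simps)
   finally show ?thesis using h by simp
  qed
  finally show "\<bar>dens v u - dens v' u\<bar> <= ?D u / (2 * h) + h * (dens v u + dens v' u)" by (simp add: dens_def x_def y_def d_def)
 qed
 also have "... = (2 - 2 * norm I) / (2 * h) + h * 2" using i iD D dens_integral(2)[OF v] dens_integral(2)[OF v'] by simp
 also have "... = (1 - norm I) / h + 2 * h" using h by (simp add: field_simps)
 finally show ?thesis unfolding nI .
qed

text \<open>Outside the region of radius \<open>X\<close> a power \<open>N / 2\<close> of the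
  distance is given up against \<open>X\<close>. The exponent \<open>3 * N / 2\<close> that remains
  is still large enough for the Forelli-Rudin estimate.\<close>

lemma dens_tail:
 obtains C where "C > 0"
  "!!v X. v \<in> UB ==> X > 0 ==> (LINT u|M. (if norm (1 - herm v u) <= X then 0 else dens v u)) <= C * (tau v / X) powr (N / 2)"
proof -
 have h: "\<alpha> + 0 > -1" "N / 2 > 0" "0 + N / 2 = 3 * N / 2 - N" using alpha N_pos by auto
 obtain C where C: "C > 0"
  "!!z. z \<in> UB ==> (NN w. tau w powr 0 * norm (1 - herm z w) powr (- (3 * N / 2))) <= ennreal (C * tau z powr (- (N / 2)))"
  by (rule FR_ker[OF h]) (rule that)
 show ?thesis
 proof (rule that[OF C(1)])
  fix v :: "complex ^ 'n" and X :: real assume v: "v \<in> UB" and X: "X > 0"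
  have t: "tau v > 0" by (rule tau_pos'[OF v])
  let ?f = "%u. if norm (1 - herm v u) <= X then 0 else dens v u"
  have "(NN u. ?f u) <= (\<integral>\<^sup>+u. ennreal (tau v powr N * X powr (- (N / 2))) * ennreal (tau u powr 0 * norm (1 - herm v u) powr (- (3 * N / 2))) \<partial>M)"
  proof (rule nn_integral_mono)
   fix u assume "u \<in> space M"
   hence u: "u \<in> UB" by simp
   define d where "d = norm (1 - herm v u)"
   have "?f u <= (tau v powr N * X powr (- (N / 2))) * (tau u powr 0 * d powr (- (3 * N / 2)))"
   proof (cases "d <= X")
    case False
    hence d: "d > X" "d > 0" using X by auto
    have "dens v u = (tau v powr (N / 2))\<^sup>2 * (d powr (- N))\<^sup>2" by (simp add: dens_def kk_def norm_mult norm_ker power_mult_distrib d_def)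
    also have "(tau v powr (N / 2))\<^sup>2 = tau v powr N" by (simp add: power2_eq_square flip: powr_add)
    also have "(d powr (- N))\<^sup>2 = d powr (- (N / 2)) * d powr (- (3 * N / 2))" by (simp add: power2_eq_square flip: powr_add)
    also have "tau v powr N * (d powr (- (N / 2)) * d powr (- (3 * N / 2))) <= tau v powr N * (X powr (- (N / 2)) * d powr (- (3 * N / 2)))"
     using d X N_pos by (intro mult_left_mono mult_right_mono powr_mono2') auto
    finally show ?thesis using False tau_pos'[OF u] by (simp add: d_def)
   qed (simp add: d_def)
   thus "ennreal (?f u) <= ennreal (tau v powr N * X powr (- (N / 2))) * ennreal (tau u powr 0 * norm (1 - herm v u) powr (- (3 * N / 2)))"
    unfolding d_def by (subst ennreal_mult[symmetric]) (auto intro!: ennreal_leI)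
  qed
  also have "... = ennreal (tau v powr N * X powr (- (N / 2))) * (NN u. tau u powr 0 * norm (1 - herm v u) powr (- (3 * N / 2)))"
   by (rule nn_integral_cmult) (rule borel_measurable_M, measurable)
  also have "... <= ennreal (tau v powr N * X powr (- (N / 2))) * ennreal (C * tau v powr (- (N / 2)))" by (intro mult_left_mono C(2)[OF v]) simp
  also have "... = ennreal (C * (tau v / X) powr (N / 2))"
  proof -
   have e: "tau v powr N * tau v powr (- (N / 2)) = tau v powr (N / 2)" by (simp flip: powr_add)
   have "(tau v / X) powr (N / 2) = tau v powr (N / 2) * X powr (- (N / 2))" using t X by (simp add: powr_divide powr_minus_divide)
   hence "(tau v powr N * X powr (- (N / 2))) * (C * tau v powr (- (N / 2))) = C * (tau v / X) powr (N / 2)"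
    unfolding e[symmetric] by (simp only: mult_ac)
   thus ?thesis using C(1) by (simp flip: ennreal_mult)
  qed
  finally have nn: "(NN u. ?f u) <= ennreal (C * (tau v / X) powr (N / 2))" .
  have m: "?f \<in> bmM"
  proof -
   have [measurable]: "(%u. norm (1 - herm v u)) \<in> bmM" by (rule borel_measurable_M) measurable
   show ?thesis by measurable
  qed
  show "(LINT u|M. ?f u) <= C * (tau v / X) powr (N / 2)" by (rule integral_real_bounded) (use nn C(1) in auto)
 qed
qed

end

lemma powr_superadditive:
 fixes x y :: real
 assumes "1 < p" "0 <= x" "0 <= y"
 shows "x powr p + y powr p <= (x + y) powr p"
proof (cases "x = 0 \<or> y = 0")
 case False
 hence xy: "x > 0" "y > 0" using assms by auto
 have e: "z powr p = z * z powr (p - 1)" if "z > 0" for z :: real using that by (simp add: powr_mult_base)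
 have "x powr p + y powr p <= x * (x + y) powr (p - 1) + y * (x + y) powr (p - 1)"
  unfolding e[OF xy(1)] e[OF xy(2)] using assms xy by (intro add_mono mult_left_mono powr_mono2) auto
 also have "... = (x + y) powr p" using e[of "x + y"] xy by (simp add: distrib_right)
 finally show ?thesis .
qed (use assms in auto)

text \<open>Superadditivity of the \<open>p\<close>-th power. It lets slow families be built as
  \<open>p\<close>-th roots of functions for which only sums of absolute differences have to be
  estimated.\<close>

lemma powr_root_diff:
 fixes a b :: real
 assumes p: "1 < p" and ab: "0 <= a" "0 <= b"
 shows "\<bar>a powr (1 / p) - b powr (1 / p)\<bar> powr p <= \<bar>a - b\<bar>"
proof -
 have le: "(a powr (1 / p) - b powr (1 / p)) powr p <= a - b" if "0 <= b" "b <= a" for a b :: real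
 proof -
  define x y where "x = b powr (1 / p)" and "y = a powr (1 / p) - b powr (1 / p)"
  have "0 <= x" "0 <= y" unfolding x_def y_def using that p by (auto intro: powr_mono2)
  from powr_superadditive[OF p this] have "x powr p + y powr p <= (a powr (1 / p)) powr p" by (simp add: x_def y_def)
  thus ?thesis using p that by (simp add: x_def y_def powr_powr)
 qed
 show ?thesis
 proof (cases "b <= a")
  case True
  moreover have "b powr (1 / p) <= a powr (1 / p)" using True ab p by (intro powr_mono2) auto
  ultimately show ?thesis using le[of b a] ab by simp
 next
  case False
  moreover have "a powr (1 / p) <= b powr (1 / p)" using False ab p by (intro powr_mono2) auto
  ultimately show ?thesis using le[of a b] ab by (simp add: abs_minus_commute)
 qed
qed

definition tent :: "real => real" where "tent t = max 0 (1 - \<bar>t\<bar>)"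

lemma tent_bounds: "0 <= tent t" "\<bar>tent s - tent t\<bar> <= \<bar>s - t\<bar>" by (auto simp: tent_def max_def abs_if)

text \<open>The tents at the naturals form a partition of unity in which only the integer part of
  \<open>t\<close> and its successor contribute.\<close>

lemma tent_nat:
 assumes t: "0 <= t"
 shows "tent (t - real k) = (if k = nat \<lfloor>t\<rfloor> then 1 - frac t else 0) + (if k = Suc (nat \<lfloor>t\<rfloor>) then frac t else 0)"
proof -
 define n where "n = nat \<lfloor>t\<rfloor>"
 have n: "t = real n + frac t" using t by (simp add: n_def frac_def)
 have f: "0 <= frac t" "frac t < 1" by (auto simp: frac_lt_1)
 consider "k < n" | "k = n" | "k = Suc n" | "k > Suc n" by linarith
 hence "tent (t - real k) = (if k = n then 1 - frac t else 0) + (if k = Suc n then frac t else 0)"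
 proof cases
  case 1
  hence "real k + 1 <= real n" by linarith
  hence "\<bar>t - real k\<bar> >= 1" using n f by linarith
  thus ?thesis using 1 by (simp add: tent_def)
 next
  case 2
  have "\<bar>t - real k\<bar> = frac t" using n f 2 by linarith
  thus ?thesis using 2 f by (simp add: tent_def)
 next
  case 3
  have "\<bar>t - real k\<bar> = 1 - frac t" using n f 3 by linarith
  thus ?thesis using 3 f by (simp add: tent_def)
 next
  case 4
  hence "real k >= real n + 2" by linarith
  hence "\<bar>t - real k\<bar> >= 1" using n f by linarith
  thus ?thesis using 4 by (simp add: tent_def)
 qed
 thus ?thesis unfolding n_def .
qed

lemma tent_sum_le:
 assumes t: "0 <= t" and K: "finite K"
 shows "(\<Sum>k\<in>K. tent (t - real k)) <= 1" unfolding tent_nat[OF t] sum.distrib using K frac_lt_1[of t] by (auto simp: sum.delta)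

lemma tent_sum_eq:
 assumes t: "real k0 <= t" "t <= real k1"
 shows "(\<Sum>k=k0..k1. tent (t - real k)) = 1"
proof -
 have t0: "0 <= t" using t by linarith
 have "nat \<lfloor>t\<rfloor> \<in> {k0..k1}" using t t0 by (auto simp: le_nat_floor nat_le_iff floor_le_iff)
 moreover have "Suc (nat \<lfloor>t\<rfloor>) \<in> {k0..k1} \<or> frac t = 0"
 proof (cases "t = real k1")
  case True thus ?thesis by (simp add: frac_def)
 next
  case False
  hence "\<lfloor>t\<rfloor> < int k1" using t by (simp add: floor_less_iff)
  hence "Suc (nat \<lfloor>t\<rfloor>) <= k1" using t0 by linarith
  thus ?thesis using `nat \<lfloor>t\<rfloor> \<in> {k0..k1}` by auto
 qed
 ultimately show ?thesis unfolding tent_nat[OF t0] sum.distrib by (auto simp: sum.delta)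
qed

text \<open>Tents are Lipschitz with constant one, and at most four indices are active at
  \<open>s\<close> or \<open>t\<close>; hence the factor 4, whatever the size of
  \<open>K\<close>.\<close>

lemma tent_sum_diff:
 assumes s: "0 <= s" and t: "0 <= t" and K: "finite K"
 shows "(\<Sum>k\<in>K. \<bar>tent (s - real k) - tent (t - real k)\<bar>) <= 4 * \<bar>s - t\<bar>"
proof -
 define A where "A = {nat \<lfloor>s\<rfloor>, Suc (nat \<lfloor>s\<rfloor>), nat \<lfloor>t\<rfloor>, Suc (nat \<lfloor>t\<rfloor>)}"
 have "(\<Sum>k\<in>K. \<bar>tent (s - real k) - tent (t - real k)\<bar>) = (\<Sum>k\<in>K \<inter> A. \<bar>tent (s - real k) - tent (t - real k)\<bar>)"
  using K by (intro sum.mono_neutral_right) (auto simp: A_def tent_nat s t)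
 also have "... <= (\<Sum>k\<in>K \<inter> A. \<bar>s - t\<bar>)" by (intro sum_mono order_trans[OF tent_bounds(2)]) simp
 also have "... = real (card (K \<inter> A)) * \<bar>s - t\<bar>" by simp
 also have "... <= 4 * \<bar>s - t\<bar>"
 proof (intro mult_right_mono)
  have "card (K \<inter> A) <= card A" by (intro card_mono) (auto simp: A_def)
  also have "... <= 4" unfolding A_def
   using card_length[of "[nat \<lfloor>s\<rfloor>, Suc (nat \<lfloor>s\<rfloor>), nat \<lfloor>t\<rfloor>, Suc (nat \<lfloor>t\<rfloor>)]"] by simp
  finally show "real (card (K \<inter> A)) <= 4" by simp
 qed simp
 finally show ?thesis .
qed

context bergman_space begin

text \<open>The density of the point contracted by \<open>sqrt (1 - \<kappa>)\<close>, cut off at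
  distance \<open>R * \<kappa>\<close>. The contraction imposes the scale \<open>\<kappa>\<close>
  even if \<open>z\<close> is much nearer to the sphere; the cutoff gives the blurred position
  bounded extent.\<close>

definition blur :: "real => real => complex ^ 'n => complex ^ 'n => real" where
 "blur R \<kappa> z u = (if norm (1 - herm (sqrt (1 - \<kappa>) *\<^sub>R z) u) <= R * \<kappa> then dens (sqrt (1 - \<kappa>) *\<^sub>R z) u else 0)"

lemma blur_nonneg [simp]: "0 <= blur R k z u" by (simp add: blur_def)

lemma blur_measurable_pair: "(%(z, u). blur R k z u) \<in> bmMM"
proof -
 have [measurable]: "fst \<in> bmMM" "snd \<in> bmMM"
  using measurable_compose[OF measurable_fst measurable_M_id] measurable_compose[OF measurable_snd measurable_M_id] by auto
 have v [measurable]: "(%x. sqrt (1 - k) *\<^sub>R fst x) \<in> bmMM" by measurable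
 have [measurable]: "(%x. ker (sqrt (1 - k) *\<^sub>R fst x) (snd x)) \<in> bmMM"
  "(%x. herm (sqrt (1 - k) *\<^sub>R fst x) (snd x)) \<in> bmMM" by (rule ker_measurable borel_measurable_herm; measurable)+
 have [measurable]: "(%x. tau (sqrt (1 - k) *\<^sub>R fst x)) \<in> bmMM" by (rule measurable_compose[OF v borel_measurable_tau])
 show ?thesis unfolding blur_def dens_def kk_def case_prod_beta by measurable
qed

lemma blur_measurable [measurable]: assumes "z \<in> UB" shows "blur R k z \<in> bmM"
 using measurable_Pair2[OF blur_measurable_pair, of z] assms by simp

lemma contraction:
 assumes k: "0 < k" "k < 1" and z: "z \<in> UB"
 shows "sqrt (1 - k) *\<^sub>R z \<in> UB" "k <= tau (sqrt (1 - k) *\<^sub>R z)" "tau (sqrt (1 - k) *\<^sub>R z) <= tau z + k"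
proof -
 have n: "(norm (sqrt (1 - k) *\<^sub>R z))\<^sup>2 = (1 - k) * (norm z)\<^sup>2" using k by (simp add: power_mult_distrib)
 have z2: "(norm z)\<^sup>2 < 1" using z by (simp add: abs_square_less_1)
 have t: "tau (sqrt (1 - k) *\<^sub>R z) = tau z + k * (norm z)\<^sup>2" unfolding tau_def n by (simp add: algebra_simps)
 have "(1 - k) * (norm z)\<^sup>2 <= (1 - k) * 1" using z2 k by (intro mult_left_mono) auto
 thus l: "k <= tau (sqrt (1 - k) *\<^sub>R z)" unfolding tau_def n by simp
 have "k * (norm z)\<^sup>2 <= k * 1" using z2 k by (intro mult_left_mono) auto
 thus "tau (sqrt (1 - k) *\<^sub>R z) <= tau z + k" unfolding t by simp
 have "tau (sqrt (1 - k) *\<^sub>R z) > 0" using l k by linarith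
 thus "sqrt (1 - k) *\<^sub>R z \<in> UB" by (simp add: tau_def abs_square_less_1 power_less_one_iff del: norm_scaleR)
qed

lemma blur_integrable:
 assumes k: "0 < k" "k < 1" and z: "z \<in> UB"
 shows "integrable M (blur R k z)" "(LINT u|M. blur R k z u) <= 1"
proof -
 note v = contraction(1)[OF k z]
 note d = dens_integral[OF v]
 show i: "integrable M (blur R k z)" by (rule Bochner_Integration.integrable_bound[OF d(1) blur_measurable[OF z]]) (auto simp: blur_def)
 have "(LINT u|M. blur R k z u) <= (LINT u|M. dens (sqrt (1 - k) *\<^sub>R z) u)" by (rule integral_mono[OF i d(1)]) (simp add: blur_def)
 thus "(LINT u|M. blur R k z u) <= 1" unfolding d(2) .
qed

text \<open>For points with \<open>tau\<close> at most the scale, the contracted points have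
  \<open>tau\<close> between one and two times the scale, so both the loss of mass by the cutoff and
  the mean distance of the densities are estimated by constants free of the scale.\<close>

lemma blur_slow:
 assumes e: "0 < e"
 obtains R m where "R > 0" "0 < m" "m < 1"
  "!!k z. 0 < k ==> k < 1 ==> z \<in> UB ==> tau z <= k ==> 1 - e <= (LINT u|M. blur R k z u)"
  "!!k z w. 0 < k ==> k < 1 ==> z \<in> UB ==> w \<in> UB ==> tau z <= k ==> tau w <= k ==> norm (1 - herm z w) <= m * k ==>
   (LINT u|M. \<bar>blur R k z u - blur R k w u\<bar>) <= e"
proof -
 obtain C where C: "C > 0"
  "!!v X. v \<in> UB ==> X > 0 ==> (LINT u|M. (if norm (1 - herm v u) <= X then 0 else dens v u)) <= C * (tau v / X) powr (N / 2)"
  by (rule dens_tail) (rule that)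
 \<comment> \<open>Solves \<open>C * (2 / R) powr (N / 2) = e / 4\<close>, the mass that the cutoff
   may lose.\<close>
 define R where "R = 2 / (e / (4 * C)) powr (2 / N)"
 have R: "R > 0" "(2 / R) powr (N / 2) = e / (4 * C)" using C(1) e N_pos by (auto simp: R_def powr_powr)
 \<comment> \<open>Makes the inner product of the normalised kernels at least
   \<open>1 - e\<^sup>2 / 32\<close>. With \<open>h = e / 8\<close> in \<open>dens_distance\<close>
   both terms of the bound are then at most \<open>e / 4\<close>.\<close>
 define m where "m = min (1 / 2) (e\<^sup>2 / (32 * N))"
 have m: "0 < m" "m < 1" "N * m <= e\<^sup>2 / 32" using e N_pos by (auto simp: m_def min_def field_simps)
 define tail where "tail k z u = dens (sqrt (1 - k) *\<^sub>R z) u - blur R k z u" for k z u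
 have tail: "integrable M (tail k z)" "0 <= tail k z u" "(LINT u|M. tail k z u) <= e / 4"
  if k: "0 < k" "k < 1" and z: "z \<in> UB" and t: "tau z <= k" for k z u
 proof -
  let ?v = "sqrt (1 - k) *\<^sub>R z"
  note v = contraction[OF k z]
  show "integrable M (tail k z)" unfolding tail_def by (intro Bochner_Integration.integrable_diff dens_integral(1)[OF v(1)] blur_integrable(1)[OF k z])
  show "0 <= tail k z u" by (simp add: tail_def blur_def)
  have "tail k z = (%u. if norm (1 - herm ?v u) <= R * k then 0 else dens ?v u)" by (rule ext) (simp add: tail_def blur_def)
  hence "(LINT u|M. tail k z u) <= C * (tau ?v / (R * k)) powr (N / 2)" using C(2)[OF v(1), of "R * k"] R(1) k by simp
  also have "tau ?v / (R * k) <= 2 / R" using v(3) t R(1) k by (simp add: field_simps)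
  hence "C * (tau ?v / (R * k)) powr (N / 2) <= C * (2 / R) powr (N / 2)" using C(1) R(1) k N_pos v(2) by (intro mult_left_mono powr_mono2) auto
  also have "... = e / 4" unfolding R(2) using C(1) by simp
  finally show "(LINT u|M. tail k z u) <= e / 4" .
 qed
 show ?thesis
 proof (rule that[OF R(1) m(1,2)])
  fix k :: real and z :: "complex ^ 'n" assume k: "0 < k" "k < 1" and z: "z \<in> UB" and t: "tau z <= k"
  have "(LINT u|M. tail k z u) = 1 - (LINT u|M. blur R k z u)"
   unfolding tail_def using dens_integral[OF contraction(1)[OF k z]] blur_integrable(1)[OF k z] by simp
  thus "1 - e <= (LINT u|M. blur R k z u)" using tail(3)[OF k z t] e by simp
  fix w :: "complex ^ 'n" assume w: "w \<in> UB" and tw: "tau w <= k" and d: "norm (1 - herm z w) <= m * k"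
  let ?v = "sqrt (1 - k) *\<^sub>R z" and ?v' = "sqrt (1 - k) *\<^sub>R w"
  note v = contraction[OF k z] and v' = contraction[OF k w]
  have "1 - herm ?v ?v' = of_real k + of_real (1 - k) * (1 - herm z w)"
  proof -
   have "complex_of_real (sqrt (1 - k)) * complex_of_real (sqrt (1 - k)) = of_real (1 - k)" using k by (simp flip: of_real_mult)
   hence "herm ?v ?v' = of_real (1 - k) * herm z w" by (simp add: herm_scaleR_left herm_scaleR_right flip: mult.assoc)
   thus ?thesis by (simp add: algebra_simps)
  qed
  hence "norm (1 - herm ?v ?v') <= norm (complex_of_real k) + norm (complex_of_real (1 - k) * (1 - herm z w))" by (simp only: norm_triangle_ineq)
  also have "norm (complex_of_real (1 - k) * (1 - herm z w)) <= 1 * norm (1 - herm z w)"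
   unfolding norm_mult norm_of_real using k by (intro mult_right_mono) auto
  finally have nd: "norm (1 - herm ?v ?v') <= (1 + m) * k" using d k by (simp add: algebra_simps)
  have pos: "norm (1 - herm ?v ?v') > 0" using v(1) v'(1) by (intro norm_one_minus_herm_pos) auto
  have "1 - N * m <= 1 - N * ln (1 + m)" using ln_add_one_self_le_self[of m] m(1) N_pos by simp
  also have "... <= exp (- N * ln (1 + m))" using exp_ge_add_one_self[of "- N * ln (1 + m)"] by simp
  also have "... = (1 + m) powr (- N)" using m(1) by (simp add: powr_def)
  also have "... = (k * k) powr (N / 2) * ((1 + m) * k) powr (- N)"
  proof -
   have "(k * k) powr (N / 2) = k powr N" using k by (simp add: powr_mult flip: powr_add)
   thus ?thesis using k m(1) by (simp add: powr_mult powr_minus)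
  qed
  also have "... <= (tau ?v * tau ?v') powr (N / 2) * norm (1 - herm ?v ?v') powr (- N)"
   using v(2) v'(2) k N_pos nd pos by (intro mult_mono powr_mono2 powr_mono2' mult_nonneg_nonneg) auto
  finally have "1 - (tau ?v * tau ?v') powr (N / 2) * norm (1 - herm ?v ?v') powr (- N) <= e\<^sup>2 / 32" using m(3) by linarith
  hence "(1 - (tau ?v * tau ?v') powr (N / 2) * norm (1 - herm ?v ?v') powr (- N)) / (e / 8) <= (e\<^sup>2 / 32) / (e / 8)"
   using e by (intro divide_right_mono) auto
  also have "... = e / 4" using e by (simp add: power2_eq_square)
  finally have d1: "(1 - (tau ?v * tau ?v') powr (N / 2) * norm (1 - herm ?v ?v') powr (- N)) / (e / 8) <= e / 4" .
  have "e / 8 > 0" using e by simp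
  from dens_distance[OF v(1) v'(1) this] d1 have dd: "(LINT u|M. \<bar>dens ?v u - dens ?v' u\<bar>) <= e / 2" by linarith
  have id: "integrable M (%u. \<bar>dens ?v u - dens ?v' u\<bar>)" using dens_integral(1)[OF v(1)] dens_integral(1)[OF v'(1)] by simp
  have "(LINT u|M. \<bar>blur R k z u - blur R k w u\<bar>) <= (LINT u|M. \<bar>dens ?v u - dens ?v' u\<bar> + (tail k z u + tail k w u))"
  proof (rule integral_mono)
   show "integrable M (%u. \<bar>blur R k z u - blur R k w u\<bar>)" using blur_integrable(1)[OF k z] blur_integrable(1)[OF k w] by simp
   show "integrable M (%u. \<bar>dens ?v u - dens ?v' u\<bar> + (tail k z u + tail k w u))"
    by (intro Bochner_Integration.integrable_add id tail(1)[OF k z t] tail(1)[OF k w tw])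
   show "\<bar>blur R k z u - blur R k w u\<bar> <= \<bar>dens ?v u - dens ?v' u\<bar> + (tail k z u + tail k w u)" for u
    using tail(2)[OF k z t, of u] tail(2)[OF k w tw, of u] unfolding tail_def by linarith
  qed
  also have "... = (LINT u|M. \<bar>dens ?v u - dens ?v' u\<bar>) + ((LINT u|M. tail k z u) + (LINT u|M. tail k w u))"
   using id tail(1)[OF k z t] tail(1)[OF k w tw] by simp
  also have "... <= e / 2 + (e / 4 + e / 4)" by (intro add_mono dd tail(3) k z w t tw)
  finally show "(LINT u|M. \<bar>blur R k z u - blur R k w u\<bar>) <= e" by simp
 qed
qed

lemma cell_integrals:
 fixes f g :: "complex ^ 'n => real"
 assumes E: "!!i. E i \<in> sets borel" "disjoint_family E" "(\<Union>i<n :: nat. E i) = UB" and f: "integrable M f"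
 shows "!!i. integrable M (%u. indicator (E i) u * f u)"
  "(\<Sum>i<n. (LINT u|M. indicator (E i) u * f u)) = (LINT u|M. f u)"
  "integrable M g ==> (\<Sum>i<n. \<bar>(LINT u|M. indicator (E i) u * f u) - (LINT u|M. indicator (E i) u * g u)\<bar>) <= (LINT u|M. \<bar>f u - g u\<bar>)"
proof -
 have I: "integrable M (%u. indicator (E i) u * h u)" if h: "integrable M h" for h :: "complex ^ 'n => real" and i
 proof (rule Bochner_Integration.integrable_bound[OF h])
  have "(indicator (E i) :: complex ^ 'n => real) \<in> bmM" by (rule borel_measurable_M) (rule borel_measurable_indicator[OF E(1)])
  moreover have "h \<in> bmM" using h by simp
  ultimately show "(%u. indicator (E i) u * h u) \<in> bmM" by measurable
 qed (auto simp: indicator_def)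
 show If: "!!i. integrable M (%u. indicator (E i) u * f u)" by (rule I[OF f])
 have S: "(\<Sum>i<n. (LINT u|M. indicator (E i) u * h u)) = (LINT u|M. h u)" if h: "integrable M h" for h :: "complex ^ 'n => real"
 proof -
  have "(\<Sum>i<n. (LINT u|M. indicator (E i) u * h u)) = (LINT u|M. (\<Sum>i<n. indicator (E i) u * h u))"
   by (rule Bochner_Integration.integral_sum[symmetric]) (rule I[OF h])
  also have "... = (LINT u|M. h u)"
  proof (rule Bochner_Integration.integral_cong[OF refl])
   fix u assume "u \<in> space M"
   hence "u \<in> UB" by simp
   from sum_indicator_cells[OF E(2,3) this, where 'a = real] show "(\<Sum>i<n. indicator (E i) u * h u) = h u" by (simp flip: sum_distrib_right)
  qed
  finally show ?thesis .
 qed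
 show "(\<Sum>i<n. (LINT u|M. indicator (E i) u * f u)) = (LINT u|M. f u)" by (rule S[OF f])
 assume g: "integrable M g"
 have fg: "integrable M (%u. \<bar>f u - g u\<bar>)" using f g by simp
 have "(\<Sum>i<n. \<bar>(LINT u|M. indicator (E i) u * f u) - (LINT u|M. indicator (E i) u * g u)\<bar>) <= (\<Sum>i<n. (LINT u|M. indicator (E i) u * \<bar>f u - g u\<bar>))"
 proof (rule sum_mono)
  fix i
  have "(LINT u|M. indicator (E i) u * f u) - (LINT u|M. indicator (E i) u * g u) = (LINT u|M. indicator (E i) u * f u - indicator (E i) u * g u)"
   by (rule Bochner_Integration.integral_diff[symmetric, OF I[OF f] I[OF g]])
  also have "\<bar>...\<bar> <= (LINT u|M. \<bar>indicator (E i) u * f u - indicator (E i) u * g u\<bar>)" by (rule integral_abs_bound)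
  also have "... = (LINT u|M. indicator (E i) u * \<bar>f u - g u\<bar>)"
   by (rule Bochner_Integration.integral_cong[OF refl]) (auto simp: indicator_def)
  finally show "\<bar>(LINT u|M. indicator (E i) u * f u) - (LINT u|M. indicator (E i) u * g u)\<bar> <= (LINT u|M. indicator (E i) u * \<bar>f u - g u\<bar>)" .
 qed
 also have "... = (LINT u|M. \<bar>f u - g u\<bar>)" by (rule S[OF fg])
 finally show "(\<Sum>i<n. \<bar>(LINT u|M. indicator (E i) u * f u) - (LINT u|M. indicator (E i) u * g u)\<bar>) <= (LINT u|M. \<bar>f u - g u\<bar>)" .
qed

text \<open>The family covers the shell from \<open>t0\<close> to \<open>s\<close> with
  \<open>p\<close>-th powers that sum to at least 1/2, lives where \<open>tau\<close> lies between
  some \<open>t1\<close> and \<open>h\<close>, and has pieces of bounded pseudohyperbolic diameter.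
  Families are finite, so a positive inner limit \<open>t0\<close> is required; it is to be chosen
  last, with \<open>s\<close> independent of it.\<close>

definition layered :: "real => real => real => real => real => bool" where
 "layered d d1 h s t0 \<longleftrightarrow> (\<exists>J g t1. t1 > 0 & slow d J g &
  (\<forall>z\<in>UB. t0 <= tau z --> tau z <= s --> 1 / 2 <= (\<Sum>j\<in>J. g j z powr p)) &
  (\<forall>j\<in>J. \<forall>z\<in>UB. g j z ~= 0 --> t1 <= tau z & tau z < h) &
  (\<forall>j\<in>J. \<forall>z\<in>UB. \<forall>w\<in>UB. g j z ~= 0 --> g j w ~= 0 --> close d1 z w))"

text \<open>Layers \<open>tau z \<approx> exp (- k L)\<close> are cut further according to the position of \<open>z\<close> blurred at the
 scale \<open>l k = Q exp (- k L)\<close>. As \<open>Q\<close> is large, the blurred position hardly changes between close points, while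
 the pieces still have bounded diameter.\<close>

lemma slow_family:
 assumes d: "0 < d" "d <= 1"
 obtains d1 where "0 < d1" "d1 < 1"
  "!!\<eta>. \<eta> > 0 ==> \<exists>s>0. \<forall>t0>0. layered d d1 \<eta> s t0"
proof -
 have d2: "0 < d / 2" using d by simp
 obtain R m where R: "R > 0" and m: "0 < m" "m < 1"
  and mass: "!!\<kappa> z. 0 < \<kappa> ==> \<kappa> < 1 ==> z \<in> UB ==> tau z <= \<kappa> ==> 1 - d / 2 <= (LINT u|M. blur R \<kappa> z u)"
  and diff: "!!\<kappa> z w. 0 < \<kappa> ==> \<kappa> < 1 ==> z \<in> UB ==> w \<in> UB ==> tau z <= \<kappa> ==> tau w <= \<kappa> ==> norm (1 - herm z w) <= m * \<kappa> ==>
   (LINT u|M. \<bar>blur R \<kappa> z u - blur R \<kappa> w u\<bar>) <= d / 2" by (rule blur_slow[OF d2]) (rule that)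
 \<comment> \<open>Points that are \<open>d\<close>-close have \<open>tau\<close> within a factor
   \<open>4 / d\<close> of each other, so \<open>- ln tau\<close> differs by at most
   \<open>B\<close>.\<close>
 define B where "B = ln (4 / d)"
 have B: "B >= 0" using d by (simp add: B_def)
 \<comment> \<open>The thickness of the logarithmic layers: the layer functions then change by at
   most \<open>4 * B / L\<close>, which is at most \<open>d / 2\<close>.\<close>
 define L where "L = 8 * B / d + 1"
 have L: "L >= 1" "8 * B <= d * L" using B d by (auto simp: L_def distrib_left)
 have L0: "L > 0" using L(1) by simp
 \<comment> \<open>Relates the blurring scale to the layer: on a layer, \<open>d\<close>-close
   points are then within \<open>m\<close> times the scale of each other, as
   \<open>blur_slow\<close> demands.\<close>
 define Q where "Q = 4 / d * exp L / m"
 have Q: "Q > 0" "4 / d * exp L = m * Q" using d m by (auto simp: Q_def)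
 have Qe: "4 / d * exp L <= Q" using Q m by (simp add: mult_le_cancel_right1)
 have Qe': "exp L <= Q"
 proof -
  have "1 * exp L <= 4 / d * exp L" using d by (intro mult_right_mono) auto
  thus ?thesis using Qe by simp
 qed
 define \<kappa> where "\<kappa> k = Q * exp (- real k * L)" for k :: nat
 have \<kappa>0: "\<kappa> k > 0" for k using Q by (simp add: \<kappa>_def)
 have \<kappa>mono: "\<kappa> l <= \<kappa> k" if "k <= l" for k l using that Q L0 by (simp add: \<kappa>_def)
 \<comment> \<open>The quasi-triangle inequality contributes 6. Each of its two legs is at most
   \<open>R + 2\<close> times the scale: \<open>R\<close> for the cutoff, one for the contraction,
   and one as an allowance for the diameter of a cell.\<close>
 define D where "D = 6 * (R + 2) * Q"
 have "exp L >= 1" using L0 by simp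
 hence "Q >= 1" using Qe' by linarith
 hence "6 * (R + 2) * Q >= 12 * 1" using R by (intro mult_mono) auto
 hence D: "D > 1" by (simp add: D_def)
 define d1 where "d1 = exp (- 2 * L) / D\<^sup>2"
 have d1: "0 < d1" "d1 < 1"
 proof -
  show "0 < d1" using D by (simp add: d1_def)
  have "exp (- 2 * L) <= 1" using L0 by simp
  moreover have "1 < D\<^sup>2" using D by (simp add: one_less_power)
  ultimately have lt: "exp (- 2 * L) < D\<^sup>2" by linarith
  have "0 < D\<^sup>2" using D by simp
  thus "d1 < 1" unfolding d1_def using lt by (simp only: divide_less_eq_1_pos)
 qed
 define x where "x z = - ln (tau z)" for z :: "complex ^ 'n"
 have ex: "tau z = exp (- x z)" if "z \<in> UB" for z using tau_pos'[OF that] by (simp add: x_def)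
 have x0: "0 <= x z" if "z \<in> UB" for z using tau_pos'[OF that] tau_le_1[of z] by (simp add: x_def ln_le_zero_iff)
 define f where "f k z = tent (x z / L - real k)" for k :: nat and z
 have f0: "0 <= f k z" for k z by (simp add: f_def tent_bounds)
 have fpos: "exp (- real k * L) <= exp L * tau z" "tau z <= exp L * exp (- real k * L)" if "f k z ~= 0" "z \<in> UB" for k z
 proof -
  have "\<bar>x z / L - real k\<bar> < 1" using that(1) by (auto simp: f_def tent_def max_def split: if_splits)
  hence "x z / L < real k + 1" "real k - 1 < x z / L" by linarith+
  hence "x z < (real k + 1) * L" "(real k - 1) * L < x z" using L0 by (auto simp: field_simps)
  hence "- real k * L <= L - x z" "- x z <= L - real k * L" by (auto simp: algebra_simps)
  thus "exp (- real k * L) <= exp L * tau z" "tau z <= exp L * exp (- real k * L)" unfolding ex[OF that(2)] by (simp_all flip: exp_add)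
 qed
 have "\<exists>s>0. \<forall>t0>0. layered d d1 \<eta> s t0"
  if \<eta>: "\<eta> > 0" for \<eta>
 proof -
  have lim: "(%k. C * exp (- real k * L)) ----> C * 0" for C using L0 by (intro tendsto_mult tendsto_const) real_asymp
  have ev: "\<forall>\<^sub>F k in sequentially. Q * exp (- real k * L) < 1 & exp L * exp (- real k * L) < \<eta>"
   by (intro eventually_conj order_tendstoD(2)[OF lim]) (use \<eta> in simp_all)
  \<comment> \<open>From this layer on the scale is below 1, so that blurring makes sense, and the
    supports lie where \<open>tau\<close> is below \<open>\<eta>\<close>.\<close>
  then obtain k0 where k0: "!!k. k >= k0 ==> \<kappa> k < 1" "!!k. k >= k0 ==> exp L * exp (- real k * L) < \<eta>"
   unfolding eventually_sequentially \<kappa>_def by blast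
  show ?thesis
  proof (intro exI[of _ "exp (- real k0 * L)"] conjI allI impI)
   show "exp (- real k0 * L) > 0" by simp
   fix t0 :: real assume t0: "t0 > 0"
   have "\<forall>\<^sub>F k in sequentially. 1 * exp (- real k * L) < t0" by (rule order_tendstoD(2)[OF lim]) (use t0 in simp)
   then obtain k1' where "!!k. k >= k1' ==> exp (- real k * L) < t0" unfolding eventually_sequentially by auto
   then obtain k1 where k1: "k0 <= k1" "exp (- real k1 * L) < t0" by (meson max.cobounded1 max.cobounded2)
   \<comment> \<open>One partition serves all layers; its mesh is the finest scale that
     occurs.\<close>
   obtain n :: nat and E :: "nat => (complex ^ 'n) set"
   where E: "!!i. E i \<in> sets borel" "!!i. E i \<subseteq> UB" "disjoint_family E" "(\<Union>i<n. E i) = UB"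
    "!!i x y. x \<in> E i ==> y \<in> E i ==> norm (x - y) < \<kappa> k1" by (rule finite_cells[OF \<kappa>0]) (rule that)
   define I where "I k i z = (LINT u|M. indicator (E i) u * blur R (\<kappa> k) z u)" for k i z
   have I0: "0 <= I k i z" for k i z unfolding I_def by (intro Bochner_Integration.integral_nonneg) simp
   define A where "A = {k0..k1} \<times> {..<n}"
   have fA: "finite A" by (simp add: A_def)
   obtain h where h: "bij_betw h {0..<card A} A" using ex_bij_betw_nat_finite[OF fA] ..
   define J where "J = {0..<card A}"
   have hA: "k0 <= fst (h j)" "fst (h j) <= k1" if "j \<in> J" for j using bij_betwE[OF h] that unfolding J_def A_def by (auto simp: mem_Times_iff)
   define \<psi> where "\<psi> j z = f (fst (h j)) z * I (fst (h j)) (snd (h j)) z" for j z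
   define g where "g j z = \<psi> j z powr (1 / p)" for j z
   have \<psi>0: "0 <= \<psi> j z" for j z unfolding \<psi>_def by (intro mult_nonneg_nonneg f0 I0)
   have gp: "g j z powr p = \<psi> j z" for j z using \<psi>0 p by (simp add: g_def powr_powr)
   have sumJ: "(\<Sum>j\<in>J. G (fst (h j)) (snd (h j))) = (\<Sum>k=k0..k1. \<Sum>i<n. G k i)" for G :: "nat => nat => real"
   proof -
    have "(\<Sum>j\<in>J. G (fst (h j)) (snd (h j))) = (\<Sum>a\<in>A. G (fst a) (snd a))"
     unfolding J_def using sum.reindex_bij_betw[OF h, of "%a. G (fst a) (snd a)"] by simp
    also have "... = (\<Sum>k=k0..k1. \<Sum>i<n. G k i)" unfolding A_def sum.cartesian_product by (simp add: case_prod_beta)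
    finally show ?thesis .
   qed
   note bI = blur_integrable[OF \<kappa>0]
   have k1': "\<kappa> k < 1" if "k \<in> {k0..k1}" for k using k0(1) that by simp
   have sI: "(\<Sum>i<n. I k i z) = (LINT u|M. blur R (\<kappa> k) z u)" if "k \<in> {k0..k1}" "z \<in> UB" for k z
    unfolding I_def by (rule cell_integrals(2)[OF E(1,3,4) bI(1)[OF k1'[OF that(1)] that(2)]])
   have \<psi>sum: "(\<Sum>j\<in>J. \<psi> j z) = (\<Sum>k=k0..k1. f k z * (LINT u|M. blur R (\<kappa> k) z u))" if "z \<in> UB" for z
    unfolding \<psi>_def sumJ[of "%k i. f k z * I k i z"] using sI[OF _ that] by (simp flip: sum_distrib_left)
   have xL: "0 <= x z / L" if "z \<in> UB" for z using x0[OF that] L0 by simp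
   have "slow d J g" unfolding slow_def
   proof (intro conjI ballI impI allI)
    show "finite J" by (simp add: J_def)
    show "0 <= g j z" for j z by (simp add: g_def)
    show "g j \<in> bmM" for j
    proof -
     have "(%(z, u). indicator (E i) u * blur R \<kappa>' z u) \<in> bmMM" for i \<kappa>'
     proof -
      have [measurable]: "snd \<in> bmMM" using measurable_compose[OF measurable_snd measurable_M_id] by auto
      have [measurable]: "(%q. indicator (E i) (snd q) :: real) \<in> bmMM"
       by (rule measurable_compose[OF _ borel_measurable_indicator[OF E(1)]]) measurable
      have [measurable]: "(%q. blur R \<kappa>' (fst q) (snd q)) \<in> bmMM"
       using blur_measurable_pair[of R \<kappa>'] by (simp add: case_prod_beta')
      show ?thesis unfolding case_prod_beta' by measurable
     qed
     hence [measurable]: "I k i \<in> bmM" for k i unfolding I_def by (rule borel_measurable_lebesgue_integral)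
     have [measurable]: "f k \<in> bmM" for k unfolding f_def x_def tent_def by (rule borel_measurable_M) measurable
     show ?thesis unfolding g_def \<psi>_def by measurable
    qed
    fix z :: "complex ^ 'n" assume z: "z \<in> UB"
    have "(\<Sum>j\<in>J. g j z powr p) <= (\<Sum>k=k0..k1. f k z * 1)"
     unfolding gp \<psi>sum[OF z] by (intro sum_mono mult_left_mono f0 bI(2)[OF k1' z])
    also have "... <= 1" unfolding f_def using tent_sum_le[OF xL[OF z], of "{k0..k1}"] by simp
    finally show "(\<Sum>j\<in>J. g j z powr p) <= 1" .
    fix w :: "complex ^ 'n" assume w: "w \<in> UB" and cl: "close d z w"
    note cb = close_bounds[OF cl d(1) z w]
    have "(\<Sum>j\<in>J. \<bar>g j z - g j w\<bar> powr p) <= (\<Sum>j\<in>J. \<bar>\<psi> j z - \<psi> j w\<bar>)"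
     unfolding g_def by (intro sum_mono powr_root_diff p \<psi>0)
    also have "... = (\<Sum>k=k0..k1. \<Sum>i<n. \<bar>f k z * I k i z - f k w * I k i w\<bar>)" unfolding \<psi>_def by (rule sumJ)
    also have "... <= (\<Sum>k=k0..k1. \<bar>f k z - f k w\<bar> + f k w * (d / 2))"
    proof (rule sum_mono)
     fix k assume k: "k \<in> {k0..k1}"
     have "(\<Sum>i<n. \<bar>f k z * I k i z - f k w * I k i w\<bar>) <= (\<Sum>i<n. \<bar>f k z - f k w\<bar> * I k i z + f k w * \<bar>I k i z - I k i w\<bar>)"
     proof (rule sum_mono)
      fix i
      have "f k z * I k i z - f k w * I k i w = (f k z - f k w) * I k i z + f k w * (I k i z - I k i w)" by (simp add: algebra_simps)
      also have "\<bar>...\<bar> <= \<bar>(f k z - f k w) * I k i z\<bar> + \<bar>f k w * (I k i z - I k i w)\<bar>" by (rule abs_triangle_ineq)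
      finally show "\<bar>f k z * I k i z - f k w * I k i w\<bar> <= \<bar>f k z - f k w\<bar> * I k i z + f k w * \<bar>I k i z - I k i w\<bar>"
       using f0[of k w] I0[of k i z] by (simp add: abs_mult)
     qed
     also have "... = \<bar>f k z - f k w\<bar> * (\<Sum>i<n. I k i z) + f k w * (\<Sum>i<n. \<bar>I k i z - I k i w\<bar>)"
      by (simp add: sum.distrib sum_distrib_left)
     also have "... <= \<bar>f k z - f k w\<bar> * 1 + f k w * (d / 2)"
     proof (intro add_mono)
      show "\<bar>f k z - f k w\<bar> * (\<Sum>i<n. I k i z) <= \<bar>f k z - f k w\<bar> * 1"
       unfolding sI[OF k z] by (intro mult_left_mono bI(2)[OF k1'[OF k] z]) simp
      show "f k w * (\<Sum>i<n. \<bar>I k i z - I k i w\<bar>) <= f k w * (d / 2)"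
      proof (cases "f k w = 0")
       case False
       \<comment> \<open>On the support of the layer, \<open>w\<close> and hence the close point
         \<open>z\<close> have \<open>tau\<close> at most the scale, and their distance is at most
         \<open>m\<close> times the scale. These are the hypotheses of the mean difference
         bound.\<close>
       have tw: "tau w <= exp L * exp (- real k * L)" by (rule fpos(2)[OF False w])
       have e: "(4 / d * exp L) * exp (- real k * L) = m * \<kappa> k" unfolding Q(2) \<kappa>_def by simp
       have m\<kappa>: "m * \<kappa> k <= \<kappa> k" using m \<kappa>0[of k] by (simp add: mult_le_cancel_right1)
       have t4: "4 / d * tau w <= m * \<kappa> k" unfolding e[symmetric] using mult_left_mono[OF tw, of "4 / d"] d by (simp add: mult.assoc)
       have "tau z <= 4 / d * tau w" using cb(6) d by (simp add: field_simps)
       hence tz: "tau z <= \<kappa> k" using t4 m\<kappa> by linarith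
       have "tau w <= 4 / d * tau w" using mult_right_mono[of 1 "4 / d" "tau w"] tau_pos'[OF w] d by simp
       hence tw': "tau w <= \<kappa> k" using t4 m\<kappa> by linarith
       have "norm (1 - herm z w) <= 2 / d * tau w" using cb(2) d by (simp add: field_simps)
       also have "... <= 4 / d * tau w" using tau_pos'[OF w] d by (intro mult_right_mono divide_right_mono) auto
       finally have dd: "norm (1 - herm z w) <= m * \<kappa> k" using t4 by linarith
       have "(\<Sum>i<n. \<bar>I k i z - I k i w\<bar>) <= (LINT u|M. \<bar>blur R (\<kappa> k) z u - blur R (\<kappa> k) w u\<bar>)"
        unfolding I_def by (rule cell_integrals(3)[OF E(1,3,4) bI(1)[OF k1'[OF k] z] bI(1)[OF k1'[OF k] w]])
       also have "... <= d / 2" by (rule diff[OF \<kappa>0 k1'[OF k] z w tz tw' dd])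
       finally show ?thesis by (intro mult_left_mono f0)
      qed simp
     qed
     finally show "(\<Sum>i<n. \<bar>f k z * I k i z - f k w * I k i w\<bar>) <= \<bar>f k z - f k w\<bar> + f k w * (d / 2)" by simp
    qed
    also have "... = (\<Sum>k=k0..k1. \<bar>f k z - f k w\<bar>) + (\<Sum>k=k0..k1. f k w) * (d / 2)" by (simp add: sum.distrib sum_distrib_right)
    also have "... <= d / 2 + 1 * (d / 2)"
    proof (intro add_mono mult_right_mono)
     show "(\<Sum>k=k0..k1. f k w) <= 1" unfolding f_def by (rule tent_sum_le[OF xL[OF w]]) simp
     have "x z - x w = ln (tau w / tau z)" "x w - x z = ln (tau z / tau w)" using tau_pos'[OF z] tau_pos'[OF w] by (simp_all add: x_def ln_div)
     moreover have "tau w / tau z <= 4 / d" "tau z / tau w <= 4 / d" using cb(5,6) tau_pos'[OF z] tau_pos'[OF w] d by (simp_all add: field_simps)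
     hence "ln (tau w / tau z) <= B" "ln (tau z / tau w) <= B" unfolding B_def using tau_pos'[OF z] tau_pos'[OF w] by (auto intro!: ln_mono)
     ultimately have "\<bar>x z - x w\<bar> <= B" by linarith
     have "(\<Sum>k=k0..k1. \<bar>f k z - f k w\<bar>) <= 4 * \<bar>x z / L - x w / L\<bar>"
      unfolding f_def by (rule tent_sum_diff[OF xL[OF z] xL[OF w]]) simp
     also have "... = 4 * (\<bar>x z - x w\<bar> / L)" using L0 by (simp flip: diff_divide_distrib)
     also have "... <= 4 * (B / L)" using `\<bar>x z - x w\<bar> <= B` L0 by (intro mult_left_mono divide_right_mono) auto
     also have "... <= d / 2" using L(2) L0 by (simp add: field_simps)
     finally show "(\<Sum>k=k0..k1. \<bar>f k z - f k w\<bar>) <= d / 2" .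
    qed (use d in simp)
    finally show "(\<Sum>j\<in>J. \<bar>g j z - g j w\<bar> powr p) <= d" by simp
   qed
   moreover have "1 / 2 <= (\<Sum>j\<in>J. g j z powr p)" if z: "z \<in> UB" and t: "t0 <= tau z" "tau z <= exp (- real k0 * L)" for z
   proof -
    have "exp (- real k1 * L) <= exp (- x z)" "exp (- x z) <= exp (- real k0 * L)" using k1(2) t unfolding ex[OF z] by linarith+
    hence "real k0 <= x z / L" "x z / L <= real k1" using L0 by (simp_all add: field_simps)
    hence 1: "(\<Sum>k=k0..k1. f k z) = 1" unfolding f_def by (rule tent_sum_eq)
    have "1 / 2 <= (\<Sum>k=k0..k1. f k z) * (1 - d / 2)" unfolding 1 using d by simp
    also have "... <= (\<Sum>j\<in>J. g j z powr p)" unfolding gp \<psi>sum[OF z] sum_distrib_right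
    proof (rule sum_mono)
     fix k assume k: "k \<in> {k0..k1}"
     show "f k z * (1 - d / 2) <= f k z * (LINT u|M. blur R (\<kappa> k) z u)"
     proof (cases "f k z = 0")
      case False
      have "tau z <= exp L * exp (- real k * L)" by (rule fpos(2)[OF False z])
      also have "... <= \<kappa> k" unfolding \<kappa>_def using Qe' by (intro mult_right_mono) auto
      finally show ?thesis by (intro mult_left_mono mass[OF \<kappa>0 k1'[OF k] z] f0)
     qed simp
    qed
    finally show ?thesis .
   qed
   moreover have "exp (- real k1 * L) / exp L <= tau z & tau z < \<eta>" if j: "j \<in> J" and z: "z \<in> UB" and nz: "g j z ~= 0" for j z
   proof -
    have nz': "f (fst (h j)) z ~= 0" using nz by (auto simp: g_def \<psi>_def)
    have "exp (- real k1 * L) <= exp (- real (fst (h j)) * L)" using hA[OF j] L0 by simp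
    also note fpos(1)[OF nz' z]
    finally have "exp (- real k1 * L) / exp L <= tau z" by (simp add: divide_le_eq mult.commute)
    thus ?thesis using fpos(2)[OF nz' z] k0(2)[OF hA(1)[OF j]] by linarith
   qed
   moreover have "close d1 z w" if j: "j \<in> J" and z: "z \<in> UB" and w: "w \<in> UB" and nz: "g j z ~= 0" "g j w ~= 0" for j z w
   proof -
    define k i where "k = fst (h j)" and "i = snd (h j)"
    have k: "k \<in> {k0..k1}" using hA[OF j] by (simp add: k_def)
    have fz: "f k z ~= 0" "f k w ~= 0" and Iz: "I k i z ~= 0" "I k i w ~= 0" using nz by (auto simp: g_def \<psi>_def k_def i_def)
    \<comment> \<open>If the blurred mass in a cell is not zero, the cell contains a point near
      \<open>v\<close>. Undoing the contraction costs at most one more multiple of the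
      scale.\<close>
    have pt: "\<exists>u\<in>E i. norm (1 - herm u v) <= (R + 1) * \<kappa> k" if v: "v \<in> UB" and nI: "I k i v ~= 0" for v
    proof -
     have "\<exists>u. indicator (E i) u * blur R (\<kappa> k) v u ~= 0"
     proof (rule ccontr)
      assume "\<not> ?thesis"
      hence "I k i v = (LINT u|M. 0)" unfolding I_def by (intro Bochner_Integration.integral_cong) auto
      thus False using nI by simp
     qed
     then obtain u where "indicator (E i) u * blur R (\<kappa> k) v u ~= 0" by blast
     hence u: "u \<in> E i" and b: "norm (1 - herm (sqrt (1 - \<kappa> k) *\<^sub>R v) u) <= R * \<kappa> k"
      by (auto simp: blur_def indicator_def split: if_splits)
     have ub: "u \<in> UB" using E(2) u by blast
     define r where "r = sqrt (1 - \<kappa> k)"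
     have r: "1 - \<kappa> k <= r" "r <= 1"
     proof -
      have "(1 - \<kappa> k)\<^sup>2 <= 1 - \<kappa> k" using \<kappa>0[of k] k1'[OF k] by (simp add: power2_eq_square mult_left_le)
      thus "1 - \<kappa> k <= r" unfolding r_def by (rule real_le_rsqrt)
      show "r <= 1" unfolding r_def using \<kappa>0[of k] by simp
     qed
     have hb: "norm (herm v u) <= 1" using norm_herm_less_1[of v u] v ub by simp
     have "1 - herm v u = (1 - herm (r *\<^sub>R v) u) - of_real (1 - r) * herm v u" by (simp add: herm_scaleR_left algebra_simps)
     hence "norm (1 - herm v u) <= norm (1 - herm (r *\<^sub>R v) u) + norm (of_real (1 - r) * herm v u)" by (simp only: norm_triangle_ineq4)
     also have "norm (complex_of_real (1 - r) * herm v u) <= (1 - r) * 1" unfolding norm_mult norm_of_real using r(2) hb by (intro mult_mono) auto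
     finally have "norm (1 - herm v u) <= (R + 1) * \<kappa> k" using b r(1) unfolding r_def[symmetric] by (simp add: distrib_right)
     thus ?thesis using u unfolding norm_one_minus_herm_commute[of v u] by blast
    qed
    obtain u where u: "u \<in> E i" "norm (1 - herm u z) <= (R + 1) * \<kappa> k" using pt[OF z Iz(1)] by blast
    obtain u' where u': "u' \<in> E i" "norm (1 - herm u' w) <= (R + 1) * \<kappa> k" using pt[OF w Iz(2)] by blast
    have ub: "u \<in> UB" using E(2) u by blast
    have "1 - herm u w = (1 - herm u' w) - herm (u - u') w" by (simp add: herm_diff_left)
    hence "norm (1 - herm u w) <= norm (1 - herm u' w) + norm (herm (u - u') w)" by (simp only: norm_triangle_ineq4)
    also have "norm (herm (u - u') w) <= norm (u - u') * 1" by (rule order_trans[OF norm_herm_le mult_left_mono]) (use w in auto)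
    also have "norm (u - u') * 1 <= \<kappa> k" using E(5)[OF u(1) u'(1)] \<kappa>mono[of k k1] k by simp
    finally have uw: "norm (1 - herm u w) <= (R + 2) * \<kappa> k" using u'(2) by (simp add: distrib_right)
    have zu: "norm (1 - herm z u) <= (R + 2) * \<kappa> k" using u(2) \<kappa>0[of k] unfolding norm_one_minus_herm_commute[of z u] by (simp add: distrib_right)
    have "norm (1 - herm z w) <= 2 * norm (1 - herm z u) + 4 * norm (1 - herm u w)" using z w ub by (intro quasi_triangle) auto
    also have "... <= 6 * ((R + 2) * \<kappa> k)" using zu uw by linarith
    also have "... = D * exp (- real k * L)" by (simp add: D_def \<kappa>_def)
    finally have "(norm (1 - herm z w))\<^sup>2 <= (D * exp (- real k * L))\<^sup>2" by (intro power_mono) auto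
    hence "d1 * (norm (1 - herm z w))\<^sup>2 <= d1 * (D * exp (- real k * L))\<^sup>2" using d1(1) by (intro mult_left_mono) auto
    also have "... = (exp (- L) * exp (- real k * L)) * (exp (- L) * exp (- real k * L))"
    proof -
     have "exp (- 2 * L) = exp (- L) * exp (- L)" by (simp flip: exp_add)
     thus ?thesis using D by (simp add: d1_def power_mult_distrib power2_eq_square)
    qed
    also have "... <= tau z * tau w"
    proof (intro mult_mono)
     show "exp (- L) * exp (- real k * L) <= tau z" using fpos(1)[OF fz(1) z] by (simp add: exp_minus field_simps)
     show "exp (- L) * exp (- real k * L) <= tau w" using fpos(1)[OF fz(2) w] by (simp add: exp_minus field_simps)
    qed (use tau_pos'[OF z] in auto)
    finally show ?thesis by (simp add: close_def)
   qed
   moreover have "exp (- real k1 * L) / exp L > 0" by simp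
   ultimately show "layered d d1 \<eta> (exp (- real k0 * L)) t0"
    unfolding layered_def by (intro exI[of _ J] exI[of _ g] exI[of _ "exp (- real k1 * L) / exp L"] conjI ballI impI) blast+
  qed
 qed
 thus ?thesis by (rule that[OF d1])
qed

section \<open>Operators as integrals, and the tail estimate from the Berezin transform\<close>

text \<open>The function \<open>H\<close> is kept general because the same nodes and weights are
  used twice: with the kernel, and with the kernel after \<open>S\<close>.\<close>

lemma riemann_sum:
 fixes H :: "complex ^ 'n => complex"
 assumes r: "0 <= r" "r < 1" and g: "g \<in> LP" "!!w. w \<in> UB ==> r < norm w ==> g w = 0"
  and H: "!!w u. norm w <= r ==> norm u <= r ==> norm (H w - H u) <= K * norm (w - u)" and K: "K >= 0"
  and E: "!!i. E i \<in> sets borel" "disjoint_family E" "(\<Union>i<n :: nat. E i) = UB"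
  and u: "!!i. norm (u i) <= r" "!!i w. w \<in> E i ==> norm w <= r ==> norm (w - u i) <= e" and e: "e >= 0"
 shows "norm ((LINT w|M. g w * H w) - (\<Sum>i<n. (LINT w|M. indicator (E i) w * g w) * H (u i))) <= K * e * nrm g"
proof -
 define H' where "H' w = indicator (cball 0 r) w *\<^sub>R H w" for w
 have "continuous_on (cball 0 r) H"
 proof (rule continuous_on_iff[THEN iffD2], intro ballI allI impI)
  fix x :: "complex ^ 'n" and d :: real assume x: "x \<in> cball 0 r" and d: "d > 0"
  have K1: "K + 1 > 0" using K by simp
  show "\<exists>t>0. \<forall>y\<in>cball 0 r. dist y x < t --> dist (H y) (H x) < d"
  proof (intro exI[of _ "d / (K + 1)"] conjI ballI impI)
   fix y assume y: "y \<in> cball 0 r" "dist y x < d / (K + 1)"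
   have "dist (H y) (H x) <= K * norm (y - x)" unfolding dist_norm using H[of y x] x y by simp
   also have "... <= (K + 1) * norm (y - x)" by (simp add: mult_right_mono)
   also have "... < d" using y(2) K1 by (simp add: dist_norm pos_less_divide_eq mult.commute)
   finally show "dist (H y) (H x) < d" .
  qed (use d K1 in simp)
 qed
 hence H'm: "H' \<in> bmM" unfolding H'_def by (intro borel_measurable_M borel_measurable_continuous_on_indicator) auto
 have H'b: "norm (H' w) <= norm (H 0) + K" if "w \<in> UB" for w
 proof (cases "norm w <= r")
  case True
  have "norm (H w - H 0) <= K * 1" using order_trans[OF H[OF True, of 0]] r K that by (simp add: mult_left_le)
  thus ?thesis using True norm_triangle_sub[of "H w" "H 0"] by (simp add: H'_def)
 qed (use K in \<open>simp add: H'_def\<close>)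
 define D where "D w = H' w - (\<Sum>i<n. indicator (E i) w * (indicator (cball 0 r) w * H (u i)))" for w
 have Dm: "D \<in> bmM"
 proof -
  have "(%w. indicator (E i) w * (indicator (cball 0 r) w * H (u i))) \<in> bmM" for i
   by (intro borel_measurable_times borel_measurable_const indicator_M E(1)) simp
  thus ?thesis unfolding D_def by (intro borel_measurable_diff H'm borel_measurable_sum)
 qed
 have Db: "norm (D w) <= K * e" if w: "w \<in> UB" for w
 proof (cases "norm w <= r")
  case True
  obtain i where i: "i < n" "w \<in> E i" using E(3) w by blast
  have "w \<notin> E j" if "j ~= i" for j using disjoint_family_onD[OF E(2) _ _ that] i(2) by auto
  hence "indicator (E j) w * (indicator (cball 0 r) w * H (u j)) = (if j = i then H (u i) else 0)" for j
   using i True by (auto simp: indicator_def)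
  hence "D w = H w - H (u i)" unfolding D_def H'_def using i(1) True by simp
  hence "norm (D w) <= K * norm (w - u i)" using H[OF True u(1)] by simp
  also have "... <= K * e" using u(2)[OF i(2) True] K by (intro mult_left_mono)
  finally show ?thesis .
 qed (use K e in \<open>simp add: D_def H'_def\<close>)
 have gH: "(LINT w|M. g w * H w) = (LINT w|M. g w * H' w)"
  by (rule Bochner_Integration.integral_cong[OF refl]) (use g(2) in \<open>auto simp: H'_def indicator_def not_le\<close>)
 have ig: "integrable M (%w. indicator (E i) w * g w)" for i by (rule LP_integrable[OF indicator_LP(1)[OF E(1) g(1)]])
 have iH: "integrable M (%w. g w * H' w)"
  by (rule LP_integral_mult_le(1)[OF g(1) H'm H'b]) (use K in \<open>auto simp: add_nonneg_nonneg\<close>)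
 have "(\<Sum>i<n. (LINT w|M. indicator (E i) w * g w) * H (u i)) = (\<Sum>i<n. (LINT w|M. (indicator (E i) w * g w) * H (u i)))"
  by (simp only: integral_mult_left_zero)
 also have "... = (LINT w|M. (\<Sum>i<n. (indicator (E i) w * g w) * H (u i)))"
  by (rule Bochner_Integration.integral_sum[symmetric]) (intro integrable_mult_left ig)
 finally have "(LINT w|M. g w * H w) - (\<Sum>i<n. (LINT w|M. indicator (E i) w * g w) * H (u i))
   = (LINT w|M. g w * H' w - (\<Sum>i<n. (indicator (E i) w * g w) * H (u i)))"
  unfolding gH by (simp only:) (rule Bochner_Integration.integral_diff[symmetric, OF iH];
   intro Bochner_Integration.integrable_sum integrable_mult_left ig)
 also have "... = (LINT w|M. g w * D w)"
 proof (rule Bochner_Integration.integral_cong[OF refl])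
  fix w assume "w \<in> space M"
  hence "indicator (cball 0 r) w * g w = g w" using g(2)[of w] by (auto simp: indicator_def not_le)
  hence q: "indicator (E i) w * g w * H (u i) = g w * (indicator (E i) w * (indicator (cball 0 r) w * H (u i)))" for i
   by (metis mult.assoc mult.commute)
  show "g w * H' w - (\<Sum>i<n. (indicator (E i) w * g w) * H (u i)) = g w * D w" unfolding D_def right_diff_distrib sum_distrib_left q ..
 qed
 finally show ?thesis using LP_integral_mult_le(2)[OF g(1) Dm Db] K e by simp
qed

text \<open>Away from the sphere the kernel functions are uniformly Lipschitz in their parameter.
  The projection of \<open>g\<close> and the integral on the right are then approximated by Riemann
  sums with the same nodes and weights, which \<open>S\<close> followed by evaluation at
  \<open>z\<close> carries into each other.\<close>

lemma operator_integral:
 assumes S: "S \<in> BO" and z: "z \<in> UB" and r: "0 <= r" "r < 1"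
  and g: "g \<in> LP" "!!w. w \<in> UB ==> r < norm w ==> g w = 0"
 shows "S (proj g) z = (LINT w|M. g w * S (kf w) z)"
proof -
 obtain C where C: "C > 0"
  "!!z w u. z \<in> UB ==> norm w <= r ==> norm u <= r ==> norm (ker z w - ker z u) <= C * norm (w - u)"
  "!!z w. z \<in> UB ==> norm w <= r ==> norm (ker z w) <= C" by (rule ker_lipschitz[OF r(2)]) (rule that)
 obtain c where c: "c > 0" "!!f. f \<in> AP ==> nrm (S f) <= c * nrm f" by (rule BO_bound[OF S]) (rule that)
 define A where "A = (1 - norm z) powr (- N) * c"
 have A: "A > 0" using z c by (simp add: A_def)
 have Sz: "norm (S f z) <= A * nrm f" if "f \<in> AP" for f
 proof -
  have "norm (S f z) <= (1 - norm z) powr (- N) * nrm (S f)" by (rule AP_norm_le[OF BO_D(1)[OF S] z])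
  also have "... <= (1 - norm z) powr (- N) * (c * nrm f)" by (intro mult_left_mono c(2)[OF that]) simp
  finally show ?thesis by (simp add: A_def mult.assoc)
 qed
 have rb: "norm w <= r ==> w \<in> UB" for w :: "complex ^ 'n" using r by simp
 have lip: "norm (S (kf w) z - S (kf u) z) <= A * C * norm (w - u)" if w: "norm w <= r" and u: "norm u <= r" for w u
 proof -
  note d = AP_diff[OF kf_AP[OF rb[OF w]] kf_AP[OF rb[OF u]]]
  have "nrm (%v. kf w v - kf u v) <= C * norm (w - u)"
  proof (rule LP_bounded(2)[OF LP_measurable[OF AP_D(1)[OF d]]])
   show "norm (kf w v - kf u v) <= C * norm (w - u)" if "v \<in> UB" for v using C(2)[OF that w u] that by (simp add: kf_def)
  qed (use C(1) in simp)
  hence "norm (S (%v. kf w v - kf u v) z) <= A * (C * norm (w - u))"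
   using order_trans[OF Sz[OF d] mult_left_mono] A by (meson less_imp_le)
  thus ?thesis unfolding BO_diff_arg[OF S kf_AP[OF rb[OF w]] kf_AP[OF rb[OF u]]] by (simp add: mult.assoc)
 qed
 have small: "norm ((LINT w|M. g w * S (kf w) z) - S (proj g) z) <= e * (2 * A * C * nrm g)" if e: "e > 0" for e
 proof -
  obtain n :: nat and E :: "nat => (complex ^ 'n) set"
  where E: "!!i. E i \<in> sets borel" "!!i. E i \<subseteq> UB" "disjoint_family E" "(\<Union>i<n. E i) = UB"
   "!!i x y. x \<in> E i ==> y \<in> E i ==> norm (x - y) < e" by (rule finite_cells[OF e]) (rule that)
  have "\<exists>u. norm u <= r & (\<forall>w\<in>E i. norm w <= r --> norm (w - u) <= e)" for i
  proof (cases "\<exists>u\<in>E i. norm u <= r")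
   case True thus ?thesis using E(5) less_imp_le by meson
  next
   case False thus ?thesis using r by (intro exI[of _ 0]) auto
  qed
  then obtain u where u: "!!i. norm (u i) <= r" "!!i w. w \<in> E i ==> norm w <= r ==> norm (w - u i) <= e" by metis
  define b where "b i = (LINT w|M. indicator (E i) w * g w)" for i
  define k where "k = (%v. \<Sum>i<n. b i * kf (u i) v)"
  note ub = rb[OF u(1)]
  have kA: "k \<in> AP" unfolding k_def by (intro AP_sum AP_cmult kf_AP ub) simp
  have Sk: "S k z = (\<Sum>i<n. b i * S (kf (u i)) z)"
   unfolding k_def using BO_sum_arg[OF S, of "{..<n}" "%i. kf (u i)" b] kf_AP[OF ub] by simp
  have e0: "e >= 0" using e by simp
  note gA = proj_AP[OF g(1)]
  have "norm (proj g v - k v) <= C * e * nrm g" if v: "v \<in> UB" for v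
  proof -
   have "proj g v - k v = (LINT w|M. g w * ker v w) - (\<Sum>i<n. (LINT w|M. indicator (E i) w * g w) * ker v (u i))"
    using v by (simp add: projection_eq k_def kf_def b_def)
   also have "norm ... <= C * e * nrm g" by (rule riemann_sum[OF r g C(2)[OF v] less_imp_le[OF C(1)] E(1,3,4) u e0])
   finally show ?thesis .
  qed
  hence "nrm (%v. proj g v - k v) <= C * e * nrm g"
   by (intro LP_bounded(2)[OF LP_measurable[OF AP_D(1)[OF AP_diff[OF gA kA]]]]) (use C e in auto)
  hence "norm (S (%v. proj g v - k v) z) <= A * (C * e * nrm g)"
   using order_trans[OF Sz[OF AP_diff[OF gA kA]] mult_left_mono] A by (meson less_imp_le)
  hence 1: "norm (S (proj g) z - S k z) <= A * C * e * nrm g" unfolding BO_diff_arg[OF S gA kA] by (simp add: mult.assoc)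
  have AC: "A * C >= 0" using A C(1) by simp
  have 2: "norm ((LINT w|M. g w * S (kf w) z) - S k z) <= A * C * e * nrm g" unfolding Sk b_def by (rule riemann_sum[OF r g lip AC E(1,3,4) u e0])
  have "norm ((LINT w|M. g w * S (kf w) z) - S (proj g) z) <= norm ((LINT w|M. g w * S (kf w) z) - S k z) + norm (S (proj g) z - S k z)"
   using norm_triangle_ineq4[of "(LINT w|M. g w * S (kf w) z) - S k z" "S (proj g) z - S k z"] by simp
  also have "... <= e * (2 * A * C * nrm g)" using 1 2 by (simp add: mult_ac)
  finally show ?thesis .
 qed
 have "norm ((LINT w|M. g w * S (kf w) z) - S (proj g) z) <= 0 + d" if d: "d > 0" for d
 proof -
  define P where "P = 2 * A * C * nrm g + 1"
  have P: "P > 0" "2 * A * C * nrm g <= P" unfolding P_def using A C(1) by (auto intro: add_nonneg_pos)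
  have "norm ((LINT w|M. g w * S (kf w) z) - S (proj g) z) <= d / P * (2 * A * C * nrm g)" by (rule small) (use d P in simp)
  also have "... <= d / P * P" using d P by (intro mult_left_mono) auto
  finally show ?thesis using P by simp
 qed
 hence "norm ((LINT w|M. g w * S (kf w) z) - S (proj g) z) <= 0" by (rule field_le_epsilon)
 thus ?thesis by simp
qed

lemma bzero_tail:
 assumes S: "bzero S" and d: "d > 0"
 shows "\<exists>r. 0 <= r & r < 1 & (\<forall>f\<in>AP. nrm (ct r (S f)) <= d * nrm f)"
proof -
 have ST: "S \<in> TA" and SD: "!!\<epsilon>. \<epsilon> > 0 ==> \<exists>h>0. \<forall>z\<in>UB. tau z < h --> tau z powr N * norm (S (kf z) z) <= \<epsilon>"
  using S by (auto simp: bzero_def)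
 have SB: "S \<in> BO" by (rule TA_BO[OF ST])
 obtain B where B: "B > 0"
  "!!f u. f \<in> LP ==> u \<in> bmM ==>
   \<forall>z\<in>UB. ennreal (norm (u z)) <= (NN w. norm (ker z w) * norm (f w)) ==> pw u <= ennreal (B powr p) * pw f"
  using kernel_domination by blast
 \<comment> \<open>The factors are lost as follows: 2 because the family covers only one half,
   \<open>2 powr p\<close> by splitting into two parts, and one \<open>\<epsilon>\<close> for each
   part.\<close>
 define \<epsilon> where "\<epsilon> = (d / 2) powr p / (4 * 2 powr p)"
 have \<epsilon>: "\<epsilon> > 0" "2 * (2 powr p * (\<epsilon> + \<epsilon>)) = (d / 2) powr p" using d by (auto simp: \<epsilon>_def)
 \<comment> \<open>The near-diagonal part is bounded through \<open>kernel_domination\<close> with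
   constant \<open>\<gamma> * B\<close>, whose \<open>p\<close>-th power is to be
   \<open>\<epsilon>\<close>.\<close>
 define \<gamma> where "\<gamma> = \<epsilon> powr (1 / p) / B"
 have \<gamma>: "\<gamma> > 0" "(\<gamma> * B) powr p = \<epsilon>" using \<epsilon>(1) B(1) p by (auto simp: \<gamma>_def powr_powr)
 have "comm_le (%f. S (proj f)) \<epsilon>" using TA_local[OF ST] \<epsilon>(1) by (simp add: local_op_def)
 then obtain \<delta>0 where \<delta>0: "\<delta>0 > 0" "!!J \<phi> f. slow \<delta>0 J \<phi> ==> f \<in> LP ==>
  (\<Sum>j\<in>J. pw (%z. S (proj (mul (\<phi> j) f)) z - of_real (\<phi> j z) * S (proj f) z)) <= ennreal (\<epsilon> * nrm f powr p)"
  unfolding comm_le_def by blast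
 define \<delta> where "\<delta> = min \<delta>0 1"
 have \<delta>: "0 < \<delta>" "\<delta> <= 1" "\<delta> <= \<delta>0" using \<delta>0(1) by (auto simp: \<delta>_def)
 obtain \<delta>1 where \<delta>1: "0 < \<delta>1" "\<delta>1 < 1"
  "!!h. h > 0 ==> \<exists>s>0. \<forall>t0>0. layered \<delta> \<delta>1 h s t0" by (rule slow_family[OF \<delta>(1,2)]) (rule that)
 obtain h where h: "h > 0" "!!z w. z \<in> UB ==> w \<in> UB ==> close \<delta>1 z w ==> tau z < h ==> norm (S (kf w) z) <= \<gamma> * norm (ker z w)"
  using off_diagonal_decay[OF SB SD \<delta>1(1,2) \<gamma>(1)] by blast
 obtain s where s: "s > 0" "!!t0. t0 > 0 ==> layered \<delta> \<delta>1 h s t0" using \<delta>1(3)[OF h(1)] by blast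
 obtain r where r: "0 < r" "r < 1" "!!z :: complex ^ 'n. r < norm z ==> norm z < 1 ==> tau z < s"
  by (rule tau_less_near_boundary[OF s(1)]) (rule that)
 \<comment> \<open>The bound does not depend on the outer radius \<open>r'\<close>, although the
   family does. This is why \<open>r'\<close> can be sent to the sphere for each \<open>f\<close>
   separately.\<close>
 have shell: "nrm (msk (cball 0 r' - cball 0 r) (S f)) <= d / 2 * nrm f" if f: "f \<in> AP" and r': "0 <= r'" "r' < 1" for f r'
 proof -
  note fL = AP_D(1)[OF f]
  have hL: "S f \<in> LP" by (rule AP_D(1)[OF BO_D(1)[OF SB]])
  have [measurable]: "S f \<in> bmM" by (rule LP_measurable[OF hL])
  define t0 where "t0 = 1 - r'\<^sup>2"
  have t0: "t0 > 0" using r' by (simp add: t0_def abs_square_less_1)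
  obtain J \<phi> t1 where t1: "t1 > 0" and sl: "slow \<delta> J \<phi>"
   and cover: "!!z. z \<in> UB ==> t0 <= tau z ==> tau z <= s ==> 1 / 2 <= (\<Sum>j\<in>J. \<phi> j z powr p)"
   and supp: "!!j z. j \<in> J ==> z \<in> UB ==> \<phi> j z ~= 0 ==> t1 <= tau z & tau z < h"
   and cl: "!!j z w. j \<in> J ==> z \<in> UB ==> w \<in> UB ==> \<phi> j z ~= 0 ==> \<phi> j w ~= 0 ==> close \<delta>1 z w"
   using s(2)[OF t0] unfolding layered_def by blast
  have \<phi>m: "\<phi> j \<in> bmM" and \<phi>0: "0 <= \<phi> j z" if "j \<in> J" for j z using sl that by (auto simp: slow_def)
  define r1 where "r1 = sqrt (max 0 (1 - t1))"
  have r1: "0 <= r1" "r1 < 1" using t1 by (auto simp: r1_def max_def)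
  have \<phi>supp: "\<phi> j w = 0" if "j \<in> J" "w \<in> UB" "r1 < norm w" for j w
  proof (rule ccontr)
   assume "\<phi> j w ~= 0"
   hence "(norm w)\<^sup>2 <= max 0 (1 - t1)" using supp[OF that(1,2)] by (auto simp: tau_def le_max_iff_disj)
   hence "norm w <= r1" unfolding r1_def by (rule real_le_rsqrt)
   thus False using that by simp
  qed
  define F where "F j = (mul (\<phi> j) f)" for j
  have FL: "F j \<in> LP" if "j \<in> J" for j unfolding F_def by (rule slow_mult_LP(1)[OF sl that fL])
  \<comment> \<open>The part that sees only the kernel between two points of one piece; the
    complementary part \<open>V\<close> is the commutator. Both are cut to the support of
    \<open>\<phi> j\<close>, so that off-diagonal decay applies to every pair that
    contributes.\<close>
  define U where "U j z = (if \<phi> j z = 0 then 0 else S (proj (F j)) z)" for j z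
  define V where "V j z = (if \<phi> j z = 0 then 0 else of_real (\<phi> j z) * S f z - S (proj (F j)) z)" for j z
  have XL: "S (proj (F j)) \<in> LP" for j by (rule AP_D(1)[OF BO_D(1)[OF SB]])
  have Um: "U j \<in> bmM" and Vm: "V j \<in> bmM" if j: "j \<in> J" for j
  proof -
   have [measurable]: "\<phi> j \<in> bmM" "S (proj (F j)) \<in> bmM" using \<phi>m[OF j] LP_measurable[OF XL] by auto
   show "U j \<in> bmM" "V j \<in> bmM" unfolding U_def V_def by measurable
  qed
  have pU: "pw (U j) <= ennreal \<epsilon> * pw (F j)" if j: "j \<in> J" for j
  proof -
   have "ennreal (norm (of_real (1 / \<gamma>) * U j z)) <= (NN w. norm (ker z w) * norm (F j w))" if z: "z \<in> UB" for z
   proof (cases "\<phi> j z = 0")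
    case False
    have "ennreal (norm (S (proj (F j)) z)) <= (NN w. norm (F j w * S (kf w) z))"
    proof -
     have eq: "S (proj (F j)) z = (LINT w|M. F j w * S (kf w) z)" by (rule operator_integral[OF SB z r1 FL[OF j]]) (simp add: F_def \<phi>supp[OF j])
     show ?thesis
     proof (cases "integrable M (%w. F j w * S (kf w) z)")
      case True
      show ?thesis unfolding eq by (rule integral_norm_bound_ennreal[OF True])
     next
      \<comment> \<open>The integral is then 0 by convention, and the bound is trivial.\<close>
      case False
      show ?thesis unfolding eq not_integrable_integral_eq[OF False] by simp
     qed
    qed
    also have "... <= (\<integral>\<^sup>+w. ennreal \<gamma> * ennreal (norm (ker z w) * norm (F j w)) \<partial>M)"
    proof (rule nn_integral_mono)
     fix w assume "w \<in> space M"
     hence w: "w \<in> UB" by simp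
     have "norm (F j w * S (kf w) z) <= \<gamma> * (norm (ker z w) * norm (F j w))"
     proof (cases "\<phi> j w = 0")
      case wn: False
      have "norm (S (kf w) z) <= \<gamma> * norm (ker z w)" using supp[OF j z False] by (intro h(2)[OF z w cl[OF j z w False wn]]) simp
      hence "norm (F j w) * norm (S (kf w) z) <= norm (F j w) * (\<gamma> * norm (ker z w))" by (rule mult_left_mono) simp
      thus ?thesis by (simp add: norm_mult mult_ac)
     qed (simp add: F_def)
     thus "ennreal (norm (F j w * S (kf w) z)) <= ennreal \<gamma> * ennreal (norm (ker z w) * norm (F j w))"
      using \<gamma>(1) by (simp add: ennreal_leI flip: ennreal_mult)
    qed
    also have "... = ennreal \<gamma> * (NN w. norm (ker z w) * norm (F j w))"
    proof (rule nn_integral_cmult)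
     have [measurable]: "F j \<in> bmM" by (rule LP_measurable[OF FL[OF j]])
     show "(%w. ennreal (norm (ker z w) * norm (F j w))) \<in> bmM" by measurable
    qed
    finally have le: "ennreal (norm (S (proj (F j)) z)) <= ennreal \<gamma> * (NN w. norm (ker z w) * norm (F j w))" .
    have "ennreal (norm (of_real (1 / \<gamma>) * U j z)) = ennreal (1 / \<gamma>) * ennreal (norm (S (proj (F j)) z))"
     using False \<gamma>(1) by (simp add: U_def norm_mult norm_divide flip: ennreal_mult)
    also have "... <= ennreal (1 / \<gamma>) * (ennreal \<gamma> * (NN w. norm (ker z w) * norm (F j w)))" by (intro mult_left_mono le) simp
    also have "... = (NN w. norm (ker z w) * norm (F j w))" using \<gamma>(1) by (simp flip: mult.assoc ennreal_mult)
    finally show ?thesis .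
   qed (simp add: U_def)
   hence "pw (%z. of_real (1 / \<gamma>) * U j z) <= ennreal (B powr p) * pw (F j)" using Um[OF j] by (intro B(2)[OF FL[OF j]]) auto
   hence "ennreal ((1 / \<gamma>) powr p) * pw (U j) <= ennreal (B powr p) * pw (F j)"
    unfolding pw_cmult[OF Um[OF j]] using \<gamma>(1) by (simp add: norm_divide)
   hence "ennreal (\<gamma> powr p) * (ennreal ((1 / \<gamma>) powr p) * pw (U j)) <= ennreal (\<gamma> powr p) * (ennreal (B powr p) * pw (F j))" by (rule mult_left_mono) simp
   moreover have "\<gamma> powr p * (1 / \<gamma>) powr p = 1" "\<gamma> powr p * B powr p = \<epsilon>"
    using \<gamma> B(1) by (simp_all add: powr_divide powr_mult)
   ultimately show ?thesis by (simp flip: mult.assoc ennreal_mult)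
  qed
  have pV: "pw (V j) <= pw (%z. S (proj (F j)) z - of_real (\<phi> j z) * S (proj f) z)" for j
   unfolding proj_AP_eq[OF f] by (rule pw_mono) (simp add: V_def norm_minus_commute)
  have "pw (msk (cball 0 r' - cball 0 r) (S f)) <= (\<integral>\<^sup>+z. ennreal 2 * (\<Sum>j\<in>J. ennreal (norm (of_real (\<phi> j z) * S f z) powr p)) \<partial>M)"
   unfolding pw_def
  proof (rule nn_integral_mono)
   fix z assume "z \<in> space M"
   hence z: "z \<in> UB" by simp
   show "ennreal (norm (indicator (cball 0 r' - cball 0 r) z * S f z) powr p) <= ennreal 2 * (\<Sum>j\<in>J. ennreal (norm (of_real (\<phi> j z) * S f z) powr p))"
   proof (cases "z \<in> cball 0 r' - cball 0 r")
    case True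
    hence "(norm z)\<^sup>2 <= r'\<^sup>2" by (intro power_mono) auto
    hence "t0 <= tau z" by (simp add: t0_def tau_def)
    moreover have "tau z <= s" using r(3)[of z] True z by auto
    ultimately have c: "1 <= 2 * (\<Sum>j\<in>J. \<phi> j z powr p)" using cover[OF z] by simp
    have "1 * norm (S f z) powr p <= (2 * (\<Sum>j\<in>J. \<phi> j z powr p)) * norm (S f z) powr p" by (rule mult_right_mono[OF c]) simp
    also have "... = 2 * (\<Sum>j\<in>J. norm (of_real (\<phi> j z) * S f z) powr p)"
     unfolding mult.assoc sum_distrib_right using \<phi>0 by (simp add: norm_mult powr_mult)
    finally have "ennreal (norm (S f z) powr p) <= ennreal (2 * (\<Sum>j\<in>J. norm (of_real (\<phi> j z) * S f z) powr p))" by (simp add: ennreal_leI)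
    thus ?thesis using True by (simp add: ennreal_mult sum_nonneg sum_ennreal)
   qed (use p in simp)
  qed
  also have "... = ennreal 2 * (\<Sum>j\<in>J. pw (%z. of_real (\<phi> j z) * S f z))"
  proof -
   have m: "(%z. ennreal (norm (of_real (\<phi> j z) * S f z) powr p)) \<in> bmM" if "j \<in> J" for j
   proof -
    have [measurable]: "\<phi> j \<in> bmM" by (rule \<phi>m[OF that])
    show ?thesis by measurable
   qed
   hence mm: "(%z. \<Sum>j\<in>J. ennreal (norm (of_real (\<phi> j z) * S f z) powr p)) \<in> bmM" by (rule borel_measurable_sum)
   have "(\<integral>\<^sup>+z. (\<Sum>j\<in>J. ennreal (norm (of_real (\<phi> j z) * S f z) powr p)) \<partial>M)
    = (\<Sum>j\<in>J. \<integral>\<^sup>+z. ennreal (norm (of_real (\<phi> j z) * S f z) powr p) \<partial>M)" by (rule nn_integral_sum) (rule m)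
   thus ?thesis unfolding pw_def nn_integral_cmult[OF mm] by (simp only:)
  qed
  also have "... <= ennreal 2 * (\<Sum>j\<in>J. ennreal (2 powr p) * (pw (U j) + pw (V j)))"
  proof (intro mult_left_mono sum_mono)
   fix j assume j: "j \<in> J"
   have "(%z. of_real (\<phi> j z) * S f z) = (%z. U j z + V j z)" by (rule ext) (simp add: U_def V_def)
   thus "pw (%z. of_real (\<phi> j z) * S f z) <= ennreal (2 powr p) * (pw (U j) + pw (V j))" using pw_add[OF Um[OF j] Vm[OF j]] by simp
  qed simp
  also have "... = ennreal 2 * (ennreal (2 powr p) * ((\<Sum>j\<in>J. pw (U j)) + (\<Sum>j\<in>J. pw (V j))))"
   by (simp add: sum.distrib flip: sum_distrib_left)
  also have "... <= ennreal 2 * (ennreal (2 powr p) * (ennreal (\<epsilon> * nrm f powr p) + ennreal (\<epsilon> * nrm f powr p)))"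
  proof (intro mult_left_mono add_mono)
   have "(\<Sum>j\<in>J. pw (U j)) <= ennreal \<epsilon> * (\<Sum>j\<in>J. pw (F j))" unfolding sum_distrib_left by (rule sum_mono[OF pU])
   also have "... <= ennreal \<epsilon> * pw f" unfolding F_def by (intro mult_left_mono slow_sum_pw[OF sl LP_measurable[OF fL]]) simp
   also have "... = ennreal (\<epsilon> * nrm f powr p)" unfolding pw_LP[OF fL] using \<epsilon>(1) by (simp add: ennreal_mult)
   finally show "(\<Sum>j\<in>J. pw (U j)) <= ennreal (\<epsilon> * nrm f powr p)" .
   have "(\<Sum>j\<in>J. pw (V j)) <= (\<Sum>j\<in>J. pw (%z. S (proj (F j)) z - of_real (\<phi> j z) * S (proj f) z))" by (rule sum_mono[OF pV])
   also have "... <= ennreal (\<epsilon> * nrm f powr p)" unfolding F_def by (rule \<delta>0(2)[OF slow_mono[OF sl \<delta>(3)] fL])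
   finally show "(\<Sum>j\<in>J. pw (V j)) <= ennreal (\<epsilon> * nrm f powr p)" .
  qed auto
  also have "... = ennreal ((d / 2 * nrm f) powr p)"
  proof -
   have e0: "0 <= \<epsilon> * nrm f powr p" using \<epsilon>(1) by simp
   have "2 * (2 powr p * (\<epsilon> * nrm f powr p + \<epsilon> * nrm f powr p)) = (2 * (2 powr p * (\<epsilon> + \<epsilon>))) * nrm f powr p" by (simp add: algebra_simps)
   also have "... = (d / 2 * nrm f) powr p" unfolding \<epsilon>(2) by (rule powr_mult[symmetric])
   finally have "ennreal (2 * (2 powr p * (\<epsilon> * nrm f powr p + \<epsilon> * nrm f powr p))) = ennreal ((d / 2 * nrm f) powr p)" by (simp only:)
   thus ?thesis unfolding ennreal_plus[OF e0 e0, symmetric] by (subst ennreal_mult'[symmetric], simp, subst ennreal_mult'[symmetric], simp)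
  qed
  finally have le: "pw (msk (cball 0 r' - cball 0 r) (S f)) <= ennreal ((d / 2 * nrm f) powr p)" .
  show ?thesis by (rule LP_I(2)[OF LP_measurable[OF indicator_LP(1)[OF _ hL]] _ le]) (use d in auto)
 qed
 show ?thesis
 proof (intro exI[of _ r] conjI ballI)
  fix f assume f: "f \<in> AP"
  have hL: "S f \<in> LP" by (rule AP_D(1)[OF BO_D(1)[OF SB]])
  have "nrm (ct r (S f)) <= d / 2 * nrm f + e" if e: "e > 0" for e
  proof -
   obtain r' where r': "0 <= r'" "r' < 1" "nrm (ct r' (S f)) <= e" by (rule LP_tail[OF hL e]) (rule that)
   let ?g = "%w. indicator (cball 0 r' - cball 0 r) w * S f w + indicator (- cball 0 r') w * S f w"
   have L: "(msk (cball 0 r' - cball 0 r) (S f)) \<in> LP" "(ct r' (S f)) \<in> LP"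
    "(ct r (S f)) \<in> LP" by (rule indicator_LP(1)[OF _ hL]; simp)+
   have "nrm (ct r (S f)) <= nrm ?g" by (rule LP_mono(2)[OF LP_add(1)[OF L(1,2)] LP_measurable[OF L(3)]]) (auto simp: indicator_def)
   also have "... <= nrm (msk (cball 0 r' - cball 0 r) (S f)) + nrm (ct r' (S f))" by (rule LP_add(2)[OF L(1,2)])
   also have "... <= d / 2 * nrm f + e" by (intro add_mono shell[OF f r'(1,2)] r'(3))
   finally show ?thesis .
  qed
  hence "nrm (ct r (S f)) <= d / 2 * nrm f" by (rule field_le_epsilon)
  also have "... <= d * nrm f" using d by (intro mult_right_mono) auto
  finally show "nrm (ct r (S f)) <= d * nrm f" .
 qed (use r in auto)
qed

section \<open>Completeness of the Bergman space and compactness from small tails\<close>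

interpretation AP: Metric_space AP "%f g. nrm (%z. f z - g z)" by (rule Metric_AP)

text \<open>Point evaluations give a pointwise limit on the ball, and Fatou's lemma gives
  convergence in norm. That limit is arbitrary outside the ball and not known to be holomorphic, so
  its projection is taken as the limit; the sequence itself is fixed by the projection.\<close>

lemma AP_complete: "AP.mcomplete" unfolding AP.mcomplete_def
proof (intro allI impI)
 fix s assume "AP.MCauchy s"
 hence s: "!!n. s n \<in> AP" "!!x. x > 0 ==> \<exists>K. \<forall>n n'. K <= n --> K <= n' --> nrm (%z. s n z - s n' z) < x"
  unfolding AP.MCauchy_def by auto
 have "Cauchy (%n. s n z)" if z: "z \<in> UB" for z
 proof (rule metric_CauchyI)
  fix e :: real assume e: "e > 0"
  define c where "c = (1 - norm z) powr (- N)"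
  have c: "c > 0" using z by (simp add: c_def)
  obtain K where K: "!!n n'. K <= n ==> K <= n' ==> nrm (%z. s n z - s n' z) < e / c" using s(2)[of "e / c"] e c by auto
  have "dist (s n z) (s n' z) < e" if "K <= n" "K <= n'" for n n'
  proof -
   have "dist (s n z) (s n' z) <= c * nrm (%z. s n z - s n' z)" unfolding dist_norm c_def by (rule AP_norm_le[OF AP_diff[OF s(1) s(1)] z])
   also have "... < c * (e / c)" using c by (intro mult_strict_left_mono K that)
   finally show ?thesis using c by simp
  qed
  thus "\<exists>M. \<forall>m\<ge>M. \<forall>n\<ge>M. dist (s m z) (s n z) < e" by blast
 qed
 hence "\<forall>z\<in>UB. \<exists>l. (%n. s n z) ----> l" by (auto simp: Cauchy_convergent_iff convergent_def)
 then obtain f where f: "!!z. z \<in> UB ==> (%n. s n z) ----> f z" by metis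
 have fm: "f \<in> bmM" by (rule borel_measurable_LIMSEQ_metric[OF LP_measurable[OF AP_D(1)[OF s(1)]]]) (use f in simp)
 have close: "\<exists>K. \<forall>n\<ge>K. (%z. f z - s n z) \<in> LP & nrm (%z. f z - s n z) <= x" if x: "x > 0" for x
 proof -
  obtain K where K: "!!n n'. K <= n ==> K <= n' ==> nrm (%z. s n z - s n' z) < x" using s(2)[OF x] by blast
  have "(%z. f z - s n z) \<in> LP & nrm (%z. f z - s n z) <= x" if n: "K <= n" for n
  proof -
   have m: "(%z. f z - s n z) \<in> bmM" using fm LP_measurable[OF AP_D(1)[OF s(1)]] by measurable
   have dm: "(%z. s i z - s n z) \<in> bmM" for i by (rule LP_measurable[OF AP_D(1)[OF AP_diff[OF s(1) s(1)]]])
   have "pw (%z. f z - s n z) = (\<integral>\<^sup>+z. liminf (%i. ennreal (norm (s i z - s n z) powr p)) \<partial>M)"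
    unfolding pw_def
   proof (rule nn_integral_cong)
    fix z assume "z \<in> space M"
    hence "(%i. s i z) ----> f z" by (intro f) simp
    hence "(%i. ennreal (norm (s i z - s n z) powr p)) ----> ennreal (norm (f z - s n z) powr p)"
     by (intro tendsto_ennrealI tendsto_powr' tendsto_intros) (use p in auto)
    thus "ennreal (norm (f z - s n z) powr p) = liminf (%i. ennreal (norm (s i z - s n z) powr p))"
     by (intro lim_imp_Liminf[symmetric]) auto
   qed
   also have "... <= liminf (%i. pw (%z. s i z - s n z))" unfolding pw_def by (rule nn_integral_liminf) (use dm in measurable)
   also have "... <= liminf (%i. ennreal (x powr p))"
   proof (rule Liminf_mono)
    show "\<forall>\<^sub>F i in sequentially. pw (%z. s i z - s n z) <= ennreal (x powr p)" unfolding eventually_sequentially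
     using pw_le_nrm[OF AP_D(1)[OF AP_diff[OF s(1) s(1)]] less_imp_le[OF K[OF _ n]]] by blast
   qed
   also have "... = ennreal (x powr p)" by (simp add: Liminf_const)
   finally show ?thesis using LP_I[OF m less_imp_le[OF x]] by blast
  qed
  thus ?thesis by blast
 qed
 obtain n where n: "(%z. f z - s n z) \<in> LP" using close[of 1] by auto
 have fL: "f \<in> LP" using LP_add(1)[OF n AP_D(1)[OF s(1)[of n]]] by simp
 have "limitin AP.mtopology s (proj f) sequentially" unfolding AP.limit_metric_sequentially
 proof (intro conjI allI impI)
  show "proj f \<in> AP" by (rule proj_AP[OF fL])
  fix x :: real assume x: "x > 0"
  hence "x / (2 * CP) > 0" using CP(1) by simp
  from close[OF this] obtain K where K: "!!n. K <= n ==> (%z. f z - s n z) \<in> LP" "!!n. K <= n ==> nrm (%z. f z - s n z) <= x / (2 * CP)" by blast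
  have "nrm (%z. s n z - proj f z) < x" if "K <= n" for n
  proof -
   have "nrm (%z. s n z - proj f z) = nrm (%z. proj f z - proj (s n) z)" unfolding proj_AP_eq[OF s(1)] by (rule nrm_minus_commute)
   also have "... = nrm (proj (%z. f z - s n z))" unfolding proj_diff[OF fL AP_D(1)[OF s(1)]] ..
   also have "... <= CP * (x / (2 * CP))" by (rule order_trans[OF CP(2)[OF K(1)[OF that]] mult_left_mono[OF K(2)[OF that]]]) (use CP(1) in simp)
   also have "... < x" using CP(1) x by simp
   finally show ?thesis .
  qed
  thus "\<exists>K. \<forall>n\<ge>K. s n \<in> AP & nrm (%z. s n z - proj f z) < x" using s(1) by blast
 qed
 thus "\<exists>l. limitin AP.mtopology s l sequentially" by blast
qed

text \<open>The finite rank approximation is determined by finitely many values of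
  \<open>S f\<close>, which stay in a fixed disc as \<open>f\<close> runs through the unit ball. A
  finite net of this disc gives a finite net of the image, and completeness turns total boundedness
  into compactness of the closure.\<close>

lemma compact_of_tail:
 assumes S: "S \<in> BO"
  and tail: "!!d. d > 0 ==> \<exists>r. 0 <= r & r < 1 & (\<forall>f\<in>AP. nrm (ct r (S f)) <= d * nrm f)"
 shows "compact_operator p \<alpha> S"
proof -
 let ?B = "{f \<in> AP. nrm f <= 1}"
 have "AP.mtotally_bounded (S ` ?B)" unfolding AP.mtotally_bounded_def
 proof (intro allI impI)
  fix e :: real assume e: "e > 0"
  hence e8: "e / 8 > 0" by simp
  obtain m :: nat and c v where v: "!!i. v i \<in> UB"
   "!!f. f \<in> AP ==> nrm (%z. (\<Sum>i<m. c i * (S f (v i) * kf (v i) z)) - S f z) <= e / 8 * nrm f"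
   by (rule finite_rank_approx[OF S e8 tail]) (assumption, rule that)
  obtain C where C: "C > 0" "!!f. f \<in> AP ==> nrm (S f) <= C * nrm f" by (rule BO_bound[OF S]) (rule that)
  define A where "A = (\<Sum>i<m. (1 - norm (v i)) powr (- N) * C)"
  have Sv: "norm (S f (v i)) <= A" if f: "f \<in> ?B" and i: "i < m" for f i
  proof -
   have "norm (S f (v i)) <= (1 - norm (v i)) powr (- N) * nrm (S f)" by (rule AP_norm_le[OF BO_D(1)[OF S] v(1)])
   also have "... <= (1 - norm (v i)) powr (- N) * C" using order_trans[OF C(2) mult_left_le[of "nrm f" C]] f C(1) by (intro mult_left_mono) auto
   also have "... <= A" unfolding A_def using i C(1) by (intro member_le_sum) auto
   finally show ?thesis .
  qed
  define W where "W = (\<Sum>i<m. norm (c i) * nrm (kf (v i))) + 1"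
  have W: "W > 0" "(\<Sum>i<m. norm (c i) * nrm (kf (v i))) <= W" unfolding W_def by (auto intro!: add_nonneg_pos sum_nonneg)
  have "e / (8 * W) > 0" using e W by simp
  moreover have "compact (cball 0 A :: complex set)" by simp
  ultimately obtain \<Lambda> :: "complex set" where \<Lambda>: "finite \<Lambda>" "cball 0 A \<subseteq> (\<Union>x\<in>\<Lambda>. ball x (e / (8 * W)))"
   unfolding compact_eq_totally_bounded by meson
  define F where "F l = (%z. \<Sum>i<m. c i * (l i * kf (v i) z))" for l :: "nat => complex"
  have FA: "F l \<in> AP" for l unfolding F_def by (intro AP_sum AP_cmult kf_AP v) simp
  have near: "\<exists>l\<in>PiE {..<m} (%_. \<Lambda>). nrm (%z. F l z - S f z) <= e / 4" if f: "f \<in> ?B" for f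
  proof -
   have ex: "\<forall>i. \<exists>x. i < m --> x \<in> \<Lambda> & norm (x - S f (v i)) <= e / (8 * W)"
   proof
    fix i
    show "\<exists>x. i < m --> x \<in> \<Lambda> & norm (x - S f (v i)) <= e / (8 * W)"
    proof (cases "i < m")
     case True
     have "S f (v i) \<in> cball 0 A" using Sv[OF f True] by simp
     from subsetD[OF \<Lambda>(2) this] show ?thesis by (auto simp: dist_norm intro: less_imp_le)
    qed blast
   qed
   obtain x where "\<forall>i. i < m --> x i \<in> \<Lambda> & norm (x i - S f (v i)) <= e / (8 * W)" using choice[OF ex] ..
   hence x: "!!i. i < m ==> x i \<in> \<Lambda>" "!!i. i < m ==> norm (x i - S f (v i)) <= e / (8 * W)" by auto
   define l where "l = restrict x {..<m}"
   have l: "l \<in> PiE {..<m} (%_. \<Lambda>)" using x(1) by (auto simp: l_def)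
   have "(%z. F l z - F (%i. S f (v i)) z) = (%z. \<Sum>i<m. (c i * (x i - S f (v i))) * kf (v i) z)"
    unfolding F_def sum_subtractf[symmetric] by (rule ext, rule sum.cong) (auto simp: l_def algebra_simps)
   hence "nrm (%z. F l z - F (%i. S f (v i)) z) <= (\<Sum>i<m. nrm (%z. (c i * (x i - S f (v i))) * kf (v i) z))"
    using LP_sum[of "{..<m}" "%i z. (c i * (x i - S f (v i))) * kf (v i) z"] LP_cmult(1)[OF kf_LP[OF v(1)]] by simp
   also have "... <= (\<Sum>i<m. (norm (c i) * nrm (kf (v i))) * (e / (8 * W)))"
   proof (rule sum_mono)
    fix i assume "i \<in> {..<m}"
    hence "norm (c i) * norm (x i - S f (v i)) * nrm (kf (v i)) <= norm (c i) * (e / (8 * W)) * nrm (kf (v i))"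
     using x(2) by (intro mult_right_mono mult_left_mono) auto
    thus "nrm (%z. (c i * (x i - S f (v i))) * kf (v i) z) <= (norm (c i) * nrm (kf (v i))) * (e / (8 * W))"
     unfolding LP_cmult(2)[OF kf_LP[OF v(1)]] norm_mult by (simp only: mult_ac)
   qed
   also have "... <= W * (e / (8 * W))" unfolding sum_distrib_right[symmetric] using W e by (intro mult_right_mono) auto
   also have "... = e / 8" using W by simp
   finally have 1: "nrm (%z. F l z - F (%i. S f (v i)) z) <= e / 8" .
   have "nrm (%z. F (%i. S f (v i)) z - S f z) <= e / 8 * nrm f" unfolding F_def using v(2) f by simp
   also have "... <= e / 8" using f e by (intro mult_left_le) auto
   finally have 2: "nrm (%z. F (%i. S f (v i)) z - S f z) <= e / 8" .
   have "nrm (%z. F l z - S f z) <= nrm (%z. F l z - F (%i. S f (v i)) z) + nrm (%z. F (%i. S f (v i)) z - S f z)"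
    by (rule AP.triangle[OF FA FA BO_D(1)[OF S]])
   hence "nrm (%z. F l z - S f z) <= e / 4" using 1 2 by linarith
   thus ?thesis by (rule bexI[OF _ l])
  qed
  \<comment> \<open>Total boundedness asks for centres inside the image. Only those coefficient
    vectors are kept that come near to some \<open>S f\<close>, and each is replaced by such an
    \<open>S f\<close>, which doubles the error \<open>e / 4\<close>.\<close>
  define P where "P = {l \<in> PiE {..<m} (%_. \<Lambda>). \<exists>f\<in>?B. nrm (%z. F l z - S f z) <= e / 4}"
  have fP: "finite P" unfolding P_def by (rule finite_subset[of _ "PiE {..<m} (%_. \<Lambda>)"]) (auto intro: finite_PiE \<Lambda>)
  have exP: "\<forall>l\<in>P. \<exists>f. f \<in> ?B & nrm (%z. F l z - S f z) <= e / 4" unfolding P_def by blast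
  obtain g where G: "\<forall>l\<in>P. g l \<in> ?B & nrm (%z. F l z - S (g l) z) <= e / 4" using bchoice[OF exP] ..
  note g = conjunct1[OF bspec[OF G]] conjunct2[OF bspec[OF G]]
  show "\<exists>K. finite K & K \<subseteq> S ` ?B & S ` ?B \<subseteq> (\<Union>x\<in>K. AP.mball x e)"
  proof (intro exI[of _ "(%l. S (g l)) ` P"] conjI)
   show "finite ((%l. S (g l)) ` P)" using fP by simp
   show "(%l. S (g l)) ` P \<subseteq> S ` ?B" using g(1) by blast
   show "S ` ?B \<subseteq> (\<Union>x\<in>(%l. S (g l)) ` P. AP.mball x e)"
   proof
    fix h assume "h \<in> S ` ?B"
    then obtain f where f: "f \<in> ?B" "h = S f" by blast
    obtain l where l: "l \<in> PiE {..<m} (%_. \<Lambda>)" "nrm (%z. F l z - S f z) <= e / 4" using near[OF f(1)] by blast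
    have lP: "l \<in> P" unfolding P_def mem_Collect_eq
    proof (intro conjI l(1))
     show "\<exists>f\<in>?B. nrm (%z. F l z - S f z) <= e / 4" by (rule bexI[where x = f]) (rule l(2), rule f(1))
    qed
    have "nrm (%z. S (g l) z - S f z) <= nrm (%z. S (g l) z - F l z) + nrm (%z. F l z - S f z)"
     by (rule AP.triangle[OF BO_D(1)[OF S] FA BO_D(1)[OF S]])
    also have "... <= e / 4 + e / 4" using g(2)[OF lP] l(2) nrm_minus_commute[of "F l" "S (g l)"] by simp
    also have "... < e" using e by simp
    finally have "h \<in> AP.mball (S (g l)) e" unfolding f(2) AP.in_mball using BO_D(1)[OF S] by simp
    thus "h \<in> (\<Union>x\<in>(%l. S (g l)) ` P. AP.mball x e)" by (rule UN_I[OF imageI[OF lP, of "%l. S (g l)"]])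
   qed
  qed
 qed
 hence "compactin AP.mtopology (AP.mtopology closure_of (S ` ?B))"
  by (rule AP.mtotally_bounded_eq_compact_closure_of[OF AP_complete, THEN iffD1, THEN conjunct2])
 thus ?thesis using S by (simp add: compact_operator_def Ap_topology_def)
qed

theorem compact_iff:
 assumes S: "S \<in> BO"
 shows "compact_operator p \<alpha> S \<longleftrightarrow> S \<in> TA & (berezin p \<alpha> S \<longlongrightarrow> 0) to_boundary"
 unfolding bzero_iff[OF S, symmetric]
proof
 show "bzero S" if "compact_operator p \<alpha> S" by (rule compact_bzero[OF that])
 show "compact_operator p \<alpha> S" if "bzero S" by (rule compact_of_tail[OF S bzero_tail[OF that]])
qed

end

theorem theorem1p1:
  fixes p \<alpha> :: real and S :: "'n::finite operator"
  assumes "1 < p" and "\<alpha> > -1" and "S \<in> bounded_operators p \<alpha>"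
  shows "compact_operator p \<alpha> S \<longleftrightarrow>
           S \<in> toeplitz_algebra p \<alpha> \<and> (berezin p \<alpha> S \<longlongrightarrow> 0) to_boundary"
proof -
 interpret bergman_space \<alpha> "weighted_measure \<alpha> :: (complex ^ 'n) measure" "real CARD('n) + 1 + \<alpha>" p "conj_exponent p"
  by unfold_locales (use assms in auto)
 show ?thesis by (rule compact_iff[OF assms(3)])
qed

end
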